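(* Uniformly for $t\geqslant1$ and $y\geqslant 2e^t$, $$\Phi(t,y)=\frac{E(\kappa,y)}{\kappa\sqrt{2\pi\sigma_2}\,(e^\gamma t)^{2\kappa}}\Big\{1+O\Big(\frac{t}{e^t}\Big)\Big\},$$ where $\kappa=\kappa(t,y)$ and $\sigma_2=\phi_2(\kappa,y)$.
   Context: $\gamma$ is Euler's constant. Let $(\vartheta_p)_p$ (primes $p$) be independent random variables on $[0,\pi]$, each with density $(2/\pi)\sin^2\theta$. For $y\geqslant2$ put $L(1,g^\natural;y)=\prod_{p\leqslant y}(1-2p^{-1}\cos\vartheta_p+p^{-2})^{-1}$, $\Phi(t,y)={\rm Prob}\big(L(1,g^\natural;y)\geqslant(e^\gamma t)^2\big)$, $E(s,y)=\mathbb E\big(L(1,g^\natural;y)^s\big)$ for $s\in\mathbb C$; equivalently $E(s,y)=\prod_{p\leqslant y}E_p(s)$ with $E_p(s)=\frac2\pi\int_0^\pi D_p(\theta)^s\sin^2\theta\,d\theta$, $D_p(\theta)=(1-2p^{-1}\cos\theta+p^{-2})^{-1}$. Let $\phi(s,y)=\log E(s,y)$ and $\phi_n(s,y)=\partial^n\phi/\partial s^n(s,y)$. $\kappa(t,y)$ denotes the unique positive solution $\sigma$ of $\phi_1(\sigma,y)=2(\log t+\gamma)$. *)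

theory Defs
  imports "HOL-Probability.Probability" "HOL-Computational_Algebra.Primes"
begin

definition sato_tate_density :: "real \<Rightarrow> real" where
  "sato_tate_density x = 2 / pi * (sin x)\<^sup>2 * indicator {0..pi} x"

definition D :: "nat \<Rightarrow> real \<Rightarrow> real" where
  "D p x = inverse (1 - 2 * cos x / real p + 1 / (real p)\<^sup>2)"

definition L :: "(nat \<Rightarrow> 'a \<Rightarrow> real) \<Rightarrow> real \<Rightarrow> 'a \<Rightarrow> real" where
  "L \<theta> y \<omega> = (\<Prod>p | prime p \<and> real p \<le> y. D p (\<theta> p \<omega>))"

definition Phi :: "'a measure \<Rightarrow> (nat \<Rightarrow> 'a \<Rightarrow> real) \<Rightarrow> real \<Rightarrow> real \<Rightarrow> real" where
  "Phi M \<theta> t y = \<P>(\<omega> in M. L \<theta> y \<omega> \<ge> (exp euler_mascheroni * t)\<^sup>2)"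

definition E :: "'a measure \<Rightarrow> (nat \<Rightarrow> 'a \<Rightarrow> real) \<Rightarrow> complex \<Rightarrow> real \<Rightarrow> complex" where
  "E M \<theta> s y = (LINT \<omega>|M. complex_of_real (L \<theta> y \<omega>) powr s)"

text \<open>
  The logarithm is the principal branch. As E is positive on the real axis,
  this branch is holomorphic near every real point, and the derivatives below are only
  evaluated at such points.
\<close>

definition phi :: "'a measure \<Rightarrow> (nat \<Rightarrow> 'a \<Rightarrow> real) \<Rightarrow> complex \<Rightarrow> real \<Rightarrow> complex" where
  "phi M \<theta> s y = Ln (E M \<theta> s y)"

definition phi_deriv ::
    "nat \<Rightarrow> 'a measure \<Rightarrow> (nat \<Rightarrow> 'a \<Rightarrow> real) \<Rightarrow> complex \<Rightarrow> real \<Rightarrow> complex" where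
  "phi_deriv n M \<theta> s y = (deriv ^^ n) (\<lambda>z. phi M \<theta> z y) s"

definition kappa :: "'a measure \<Rightarrow> (nat \<Rightarrow> 'a \<Rightarrow> real) \<Rightarrow> real \<Rightarrow> real \<Rightarrow> real" where
  "kappa M \<theta> t y =
    (THE \<sigma>. \<sigma> > 0 \<and>
       phi_deriv 1 M \<theta> (complex_of_real \<sigma>) y = complex_of_real (2 * (ln t + euler_mascheroni)))"

end

theory Submission imports Defs "HOL-Probability.Probability" "HOL-Number_Theory.Prime_Powers" "HOL-Real_Asymp.Real_Asymp" "HOL-Complex_Analysis.Complex_Analysis"
begin

text \<open>
  With \<open>X = log L(1, g\<^sup>\<natural>; y)\<close>, a sum of independent bounded variables, and \<open>\<kappa>\<close> the saddle point,
  tilting the law by \<open>e\<^sup>\<kappa>\<^sup>X\<close> gives \<open>\<Phi> = E(\<kappa>) (e\<^sup>\<gamma> t)\<^sup>-\<^sup>2\<^sup>\<kappa> E(e\<^sup>-\<^sup>Z; Z \<ge> 0)\<close>, where \<open>Z\<close> is the centred tilted variable times \<open>\<kappa>\<close>,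
  of variance \<open>\<kappa>\<^sup>2 \<sigma>\<^sub>2\<close>. Each prime \<open>p \<le> \<kappa>\<close> contributes to \<open>Z\<close> a factor with moments bounded above and
  below and with a characteristic function bounded away from 1, uniformly in \<open>p\<close> and \<open>\<kappa>\<close>; the primes \<open>p > \<kappa>\<close>
  are negligible. So the last expectation is \<open>(2 \<pi> \<kappa>\<^sup>2 \<sigma>\<^sub>2)\<^sup>-\<^sup>1\<^sup>/\<^sup>2 (1 + O(1 / n))\<close> with \<open>n\<close> the number of primes up
  to \<open>min \<kappa> y\<close>. Mertens' theorem with error term gives \<open>\<kappa> \<ge> c e\<^sup>t\<close>, hence \<open>1 / n = O(t / e\<^sup>t)\<close>. For bounded \<open>t\<close> the
  saddle point may fail to exist; then \<open>X\<close> is almost surely below the threshold, \<open>\<Phi> = 0\<close>, and \<open>\<delta> = -1\<close> is admissible.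
\<close>


text \<open>The factor 2 in \<open>y >= 2 * exp t\<close> decides how sharp Mertens' theorem must
  be. The supremum of X is twice the Mertens sum up to y, and the saddle point exists once this
  exceeds 2 (log t + gamma). At y = 2 e^t the room between log log y and log t = log (log y - log 2)
  is about log 2 / log y, so an unspecified O(1 / log y) does not help: its coefficient must stay
  below log 2. Elementary bounds suffice without the prime number theorem: the sum of Lambda(n) / n
  is at least log N - 1 and gamma > 19/33, a loss of 14/33 against 2/3 <= log 2. For the size of
  kappa any O(1 / log) does. Uniformity in p and kappa is reached without asymptotics for the single
  factors. On the scale where the tilted density of the angle lives, the law of the rescaled
  variable contains a fixed multiple of Lebesgue measure on an interval of length between 1/(2 pi)
  and 1. This one fact gives both the lower bound for the variance and the decay of the
  characteristic function. Upper bounds for moments come from comparing the tilts at s and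
  s/2.\<close>

section \<open>Chebyshev's bounds for primes\<close>

definition chebyshev_psi :: "nat \<Rightarrow> real" where
  "chebyshev_psi N = (\<Sum>d=1..N. mangoldt d)"

definition mangoldt_mean :: "nat \<Rightarrow> real" where
  "mangoldt_mean N = (\<Sum>d=1..N. mangoldt d / real d)"

lemma mangoldt_nonneg': "mangoldt n \<ge> (0::real)"
proof (cases "primepow n")
  case True
  hence "aprimedivisor n > 0" using primepow_gt_Suc_0 aprimedivisor_pos_nat by auto
  thus ?thesis by (auto simp: mangoldt_def Suc_le_eq intro!: ln_ge_zero)
qed (simp add: mangoldt_def)

lemma chebyshev_psi_mono: "m \<le> n \<Longrightarrow> chebyshev_psi m \<le> chebyshev_psi n"
  unfolding chebyshev_psi_def by (rule sum_mono2) (auto simp: mangoldt_nonneg')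

lemma chebyshev_psi_nonneg: "chebyshev_psi n \<ge> 0"
  unfolding chebyshev_psi_def by (rule sum_nonneg) (auto simp: mangoldt_nonneg')

text \<open>Legendre's formula. In the induction \<open>N div d\<close> jumps by one exactly at the
  divisors d of \<open>Suc N\<close>, and Lambda summed over these is log (N + 1).\<close>

lemma ln_fact_mangoldt: "ln (fact N) = (\<Sum>d=1..N. mangoldt d * real (N div d))"
proof (induction N)
  case (Suc N)
  have "(\<Sum>d=1..Suc N. mangoldt d * real (Suc N div d))
      = (\<Sum>d=1..Suc N. mangoldt d * real (N div d) + (if d dvd Suc N then mangoldt d else (0::real)))"
    by (rule sum.cong) (auto simp: div_Suc dvd_eq_mod_eq_0 algebra_simps)
  also have "\<dots> = (\<Sum>d=1..Suc N. mangoldt d * real (N div d)) + (\<Sum>d=1..Suc N. if d dvd Suc N then mangoldt d else 0)"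
    by (rule sum.distrib)
  also have "(\<Sum>d=1..Suc N. mangoldt d * real (N div d)) = ln (fact N)"
    using Suc by simp
  also have "(\<Sum>d=1..Suc N. if d dvd Suc N then mangoldt d else 0) = (\<Sum>d | d dvd Suc N. mangoldt d :: real)"
  proof -
    have "{d. d dvd Suc N} = {d \<in> {1..Suc N}. d dvd Suc N}"
      by (auto dest: dvd_imp_le intro: Nat.gr0I simp: Suc_le_eq)
    moreover have "(\<Sum>d\<in>{d \<in> {1..Suc N}. d dvd Suc N}. mangoldt d) 
        = (\<Sum>d\<in>{1..Suc N}. if d dvd Suc N then mangoldt d else (0::real))"
      by (rule sum.inter_filter) simp
    ultimately show ?thesis by metis
  qed
  also have "\<dots> = ln (real (Suc N))"
    using mangoldt_sum[of "Suc N", where 'a = real] by simp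
  finally show ?case
    by (simp add: ln_mult algebra_simps del: of_nat_Suc)
qed simp

text \<open>In Legendre's formula for the binomial coefficient every d has a nonnegative
  coefficient, and it equals 1 for a < d <= a + b: there a + b < 2 d because b <= a, while a and b
  are both below d.\<close>

lemma chebyshev_psi_binomial:
  assumes "b \<le> a"
  shows "chebyshev_psi (a + b) - chebyshev_psi a \<le> ln (real ((a + b) choose a))"
proof -
  have ext: "ln (fact c) = (\<Sum>d=1..a+b. mangoldt d * real (c div d))" if "c \<le> a + b" for c
    unfolding ln_fact_mangoldt
    by (rule sum.mono_neutral_left) (use that in auto)
  have "ln (real ((a + b) choose a)) = ln (fact (a + b)) - ln (fact a) - ln (fact b)"
    by (simp add: binomial_fact ln_div ln_mult)
  also have "\<dots> = (\<Sum>d=1..a+b. mangoldt d * (real ((a + b) div d) - real (a div d) - real (b div d)))"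
    unfolding ext[of a, simplified] ext[of b, simplified] ext[of "a + b", simplified] sum_subtractf[symmetric]
    by (rule sum.cong) (simp_all add: right_diff_distrib)
  also have "\<dots> \<ge> (\<Sum>d=a+1..a+b. mangoldt d * (real ((a + b) div d) - real (a div d) - real (b div d)))"
  proof (rule sum_mono2)
    fix d assume "d \<in> {1..a+b} - {a+1..a+b}"
    have "a div d + b div d \<le> (a + b) div d" by (subst div_add1_eq) (rule le_add1)
    hence "real (a div d) + real (b div d) \<le> real ((a + b) div d)" by linarith
    thus "0 \<le> mangoldt d * (real ((a + b) div d) - real (a div d) - real (b div d))"
      by (intro mult_nonneg_nonneg mangoldt_nonneg') auto
  qed auto
  also have "(\<Sum>d=a+1..a+b. mangoldt d * (real ((a + b) div d) - real (a div d) - real (b div d)))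
     = (\<Sum>d=a+1..a+b. mangoldt d)"
  proof (rule sum.cong)
    fix d assume d: "d \<in> {a+1..a+b}"
    hence "(a + b) div d = 1" using assms by (intro div_nat_eqI) auto
    thus "mangoldt d * (real ((a + b) div d) - real (a div d) - real (b div d)) = mangoldt d"
      using d assms by simp
  qed simp
  also have "\<dots> = chebyshev_psi (a + b) - chebyshev_psi a"
    unfolding chebyshev_psi_def
    using sum.ub_add_nat[of 1 a "mangoldt :: nat \<Rightarrow> real" b] by simp
  finally show ?thesis by simp
qed

text \<open>Halving: psi(N) exceeds psi(a) by at most N log 2, where a = N - N div 2. The constant 3
  closes the induction because the inequality left over is a <= 2 b, and a <= b + 1 with b >=
  1.\<close>

lemma chebyshev_psi_le_aux: "N \<ge> 1 \<Longrightarrow> chebyshev_psi N \<le> 3 * ln 2 * (real N - 1)"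
proof (induction N rule: less_induct)
  case (less N)
  show ?case
  proof (cases "N = 1")
    case True
    thus ?thesis by (simp add: chebyshev_psi_def)
  next
    case False
    define b where "b = N div 2"
    define a where "a = N - b"
    have ab: "a + b = N" "b \<le> a" "a < N" "a \<ge> 1" "a \<le> b + 1" "b \<ge> 1"
      using False less.prems unfolding a_def b_def by auto
    have "chebyshev_psi N \<le> chebyshev_psi a + ln (real (N choose a))"
      using chebyshev_psi_binomial[OF ab(2)] ab by simp
    also have "real (N choose a) \<le> 2 ^ N"
      using binomial_le_pow2[of N a] by (metis of_nat_le_iff of_nat_numeral of_nat_power)
    hence "ln (real (N choose a)) \<le> ln (2 ^ N)"
      using ab by (subst ln_le_cancel_iff) auto
    also have "ln (2 ^ N :: real) = real N * ln 2" by (simp add: ln_realpow)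
    also have "chebyshev_psi a \<le> 3 * ln 2 * (real a - 1)" using less.IH ab by auto
    also have "3 * ln 2 * (real a - 1) + real N * ln 2 \<le> 3 * ln 2 * (real N - 1)"
    proof -
      have "real a + real b = real N" "real a \<le> real b + 1" "real b \<ge> 1"
        using ab by linarith+
      hence "3 * (real a - 1) + real N \<le> 3 * (real N - 1)" by argo
      hence "ln 2 * (3 * (real a - 1) + real N) \<le> ln 2 * (3 * (real N - 1))"
        by (intro mult_left_mono) auto
      thus ?thesis by (simp add: algebra_simps)
    qed
    finally show ?thesis by simp
  qed
qed

lemma chebyshev_psi_le: "chebyshev_psi N \<le> 3 * real N"
proof (cases "N = 0")
  case False
  have "chebyshev_psi N \<le> 3 * (ln 2 * (real N - 1))"
    using chebyshev_psi_le_aux[of N] False unfolding mult.assoc by linarith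
  also have "ln 2 * (real N - 1) \<le> 1 * real N"
    using False ln2_le_25_over_36 by (intro mult_mono) auto
  finally show ?thesis by simp
qed (simp add: chebyshev_psi_def)

lemma ln_fact_ge: "N \<ge> 1 \<Longrightarrow> ln (fact N) \<ge> real N * ln (real N) - real N"
proof (induction N rule: dec_induct)
  case (step N)
  have N: "real N > 0" using step by simp
  have "ln (real (Suc N)) - ln (real N) = ln (1 + 1 / real N)"
    using N ln_div[of "1 + real N" "real N"] by (simp add: add_divide_distrib add.commute)
  also have "\<dots> \<le> 1 / real N" by (rule ln_add_one_self_le_self) simp
  finally have "real N * (ln (real (Suc N)) - ln (real N)) \<le> real N * (1 / real N)"
    using N by (intro mult_left_mono) auto
  hence 1: "real N * ln (real (Suc N)) - real N * ln (real N) \<le> 1" using N by (simp add: right_diff_distrib)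
  have 2: "real (Suc N) * ln (real (Suc N)) = real N * ln (real (Suc N)) + ln (real (Suc N))"
    by (simp add: algebra_simps)
  have 3: "ln (fact (Suc N) :: real) = ln (real (Suc N)) + ln (fact N)"
    by (simp add: ln_mult del: of_nat_Suc)
  show ?case unfolding 2 3 using 1 step by simp
qed simp

lemma ln_fact_le: "N \<ge> 1 \<Longrightarrow> ln (fact N) \<le> real N * ln (real N)"
proof -
  assume "N \<ge> 1"
  have "ln (fact N :: real) \<le> ln (real N ^ N)"
    using fact_le_power[of N, where 'a=real] \<open>N \<ge> 1\<close> by (subst ln_le_cancel_iff) auto
  thus ?thesis using \<open>N \<ge> 1\<close> by (simp add: ln_realpow)
qed

text \<open>Mertens' first theorem, from replacing N / d by \<open>N div d\<close> in Legendre's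
  formula. Rounding down costs nothing in the lower bound, so its constant -1 is just the one in log
  N! >= N log N - N; this value is used later. The 3 in the upper bound is Chebyshev's.\<close>

lemma mangoldt_mean_bounds:
  assumes "N \<ge> 1"
  shows "mangoldt_mean N \<ge> ln (real N) - 1" "mangoldt_mean N \<le> ln (real N) + 3"
proof -
  have m: "real N * mangoldt_mean N = (\<Sum>d=1..N. mangoldt d * (real N / real d))"
    unfolding mangoldt_mean_def by (simp add: sum_distrib_left field_simps)
  have "ln (fact N) \<le> real N * mangoldt_mean N"
    unfolding m ln_fact_mangoldt
    by (intro sum_mono mult_left_mono mangoldt_nonneg' ) (auto simp: of_nat_div_le_of_nat)
  hence "real N * (ln (real N) - 1) \<le> real N * mangoldt_mean N"
    using ln_fact_ge[OF assms] by (simp add: algebra_simps)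
  thus "mangoldt_mean N \<ge> ln (real N) - 1" using assms by simp
  have "real N * mangoldt_mean N \<le> (\<Sum>d=1..N. mangoldt d * (real (N div d) + 1))"
    unfolding m
  proof (intro sum_mono mult_left_mono mangoldt_nonneg')
    fix d show "real N / real d \<le> real (N div d) + 1"
      using real_of_int_div3[of "int N" "int d"] by (simp add: zdiv_int[symmetric])
  qed
  also have "\<dots> = ln (fact N) + chebyshev_psi N"
    unfolding ln_fact_mangoldt chebyshev_psi_def by (simp add: algebra_simps sum.distrib)
  also have "\<dots> \<le> real N * (ln (real N) + 3)"
    using ln_fact_le[OF assms] chebyshev_psi_le[of N] by (simp add: algebra_simps)
  finally show "mangoldt_mean N \<le> ln (real N) + 3" using assms by simp
qed

lemma primes_le_nat: "{p::nat. prime p \<and> real p \<le> y} = {p. prime p \<and> p \<le> nat \<lfloor>y\<rfloor>}"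
proof -
  have "real p \<le> y \<longleftrightarrow> p \<le> nat \<lfloor>y\<rfloor>" if "prime p" for p :: nat
  proof -
    have "p > 0" using that by (rule prime_gt_0_nat)
    thus ?thesis by linarith
  qed
  thus ?thesis by auto
qed

lemma finite_primes_le [simp]: "finite {p::nat. prime p \<and> real p \<le> y}"
  unfolding primes_le_nat by simp

text \<open>Prime powers are written with exponent \<open>Suc j\<close>, so that j = 0 is the prime
  itself and a sum over j matches the logarithm series of the Euler factor.\<close>

lemma mangoldt_sum_primes:
  fixes f :: "nat \<Rightarrow> real"
  shows "(\<Sum>n=1..N. mangoldt n * f n)
       = (\<Sum>p | prime p \<and> p \<le> N. \<Sum>j | p ^ Suc j \<le> N. ln (real p) * f (p ^ Suc j))"
proof -
  have fin: "finite {j. p ^ Suc j \<le> N}" if "prime p" for p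
  proof (rule finite_subset)
    show "{j. p ^ Suc j \<le> N} \<subseteq> {..N}"
    proof safe
      fix j assume "p ^ Suc j \<le> N"
      moreover have "Suc j < p ^ Suc j" using prime_gt_Suc_0_nat[OF that] by (rule power_gt_expt)
      ultimately show "j \<le> N" by linarith
    qed
  qed simp
  let ?A = "SIGMA p:{p. prime p \<and> p \<le> N}. {j. p ^ Suc j \<le> N}"
  have "(\<Sum>n=1..N. mangoldt n * f n) = (\<Sum>n | primepow n \<and> n \<le> N. mangoldt n * f n)"
    by (rule sum.mono_neutral_right) (auto simp: mangoldt_def Suc_le_eq primepow_gt_0_nat)
  also have "\<dots> = (\<Sum>(p,j)\<in>?A. mangoldt (p ^ Suc j) * f (p ^ Suc j))"
  proof -
    have 1: "bij_betw (\<lambda>(p,k). p ^ Suc k :: nat) ?A ((\<lambda>(p,k). p ^ Suc k :: nat) ` ?A)"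
      by (rule bij_betw_subset[OF bij_betw_primepows]) auto
    have 2: "(\<lambda>(p,k). p ^ Suc k :: nat) ` ?A = {n. primepow n \<and> n \<le> N}"
    proof (intro equalityI subsetI)
      fix n assume "n \<in> {n. primepow n \<and> n \<le> N}"
      then obtain p k where pk: "prime p" "k > 0" "n = p ^ k" "n \<le> N" by (auto simp: primepow_def)
      then obtain j where j: "k = Suc j" by (cases k) auto
      have "p ^ 1 \<le> p ^ k" using pk prime_gt_0_nat[of p] by (intro power_increasing) auto
      hence "p \<le> N" using pk by simp
      hence "(p, j) \<in> ?A" using pk j by auto
      thus "n \<in> (\<lambda>(p,k). p ^ Suc k :: nat) ` ?A" using pk j by force
    next
      fix n assume "n \<in> (\<lambda>(p,k). p ^ Suc k :: nat) ` ?A"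
      then obtain p j where "prime p" "p ^ Suc j \<le> N" "n = p ^ Suc j" by force
      thus "n \<in> {n. primepow n \<and> n \<le> N}" by (simp del: power_Suc)
    qed
    show ?thesis
      using sum.reindex_bij_betw[OF 1[unfolded 2], of "\<lambda>n. mangoldt n * f n"]
      by (simp only: case_prod_unfold)
  qed
  also have "\<dots> = (\<Sum>p | prime p \<and> p \<le> N. \<Sum>j | p ^ Suc j \<le> N. mangoldt (p ^ Suc j) * f (p ^ Suc j))"
    by (rule sum.Sigma[symmetric]) (use fin in auto)
  also have "\<dots> = (\<Sum>p | prime p \<and> p \<le> N. \<Sum>j | p ^ Suc j \<le> N. ln (real p) * f (p ^ Suc j))"
    by (intro sum.cong refl) (simp add: mangoldt_primepow del: power_Suc)
  finally show ?thesis .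
qed

text \<open>A prime p has at most log N / log p powers up to N, so its total weight in psi(N) is at
  most log N.\<close>

lemma chebyshev_psi_le_primes: 
  assumes "N \<ge> 1"
  shows "chebyshev_psi N \<le> real (card {p. prime p \<and> p \<le> N}) * ln (real N)"
proof -
  have "chebyshev_psi N = (\<Sum>p | prime p \<and> p \<le> N. \<Sum>j | p ^ Suc j \<le> N. ln (real p) * 1)"
    unfolding chebyshev_psi_def using mangoldt_sum_primes[where N = N and f = "\<lambda>_. 1"] by simp
  also have "\<dots> \<le> (\<Sum>p | prime p \<and> p \<le> N. ln (real N))"
  proof (rule sum_mono)
    fix p assume "p \<in> {p. prime p \<and> p \<le> N}"
    hence p: "prime p" "p \<le> N" "p > 1" using prime_gt_1_nat by auto
    define m where "m = nat \<lfloor>ln (real N) / ln (real p)\<rfloor>"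
    have lp: "ln (real p) > 0" using p by auto
    have "{j. p ^ Suc j \<le> N} \<subseteq> {..<m}"
    proof safe
      fix j assume "p ^ Suc j \<le> N"
      hence "real p ^ Suc j \<le> real N" by (metis of_nat_le_iff of_nat_power)
      hence "ln (real p ^ Suc j) \<le> ln (real N)" using p assms by (subst ln_le_cancel_iff) auto
      hence "real (Suc j) \<le> ln (real N) / ln (real p)"
        using p lp by (subst (asm) ln_realpow) (auto simp: field_simps)
      thus "j < m" unfolding m_def by linarith
    qed
    hence "card {j. p ^ Suc j \<le> N} \<le> m" using card_mono[of "{..<m}"] by auto
    hence "real (card {j. p ^ Suc j \<le> N}) \<le> real m" by simp
    also have "real m \<le> ln (real N) / ln (real p)"
      unfolding m_def using lp assms by (simp add: field_simps)
    finally show "(\<Sum>j | p ^ Suc j \<le> N. ln (real p) * 1) \<le> ln (real N)"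
      using lp by (simp add: field_simps)
  qed
  finally show ?thesis by simp
qed



lemma chebyshev_psi_lower: "\<exists>c>0. \<forall>N\<ge>2. chebyshev_psi N \<ge> c * real N"
proof -
  \<comment> \<open>Any K with log K >= 5 works: the bounds for \<open>mangoldt_mean\<close> differ
    by the constants 1 and 3, so the means at K m and m differ by at least log K - 4 >= 1. Since
    terms beyond m carry a factor 1/d < 1/m, psi gains at least m there.\<close>
  define K :: nat where "K = 3 ^ 5"
  have K: "K > 0" "ln (real K) \<ge> 5"
  proof -
    have "exp 5 \<le> (3::real) ^ 5" using power_mono[OF exp_le, of 5] by (simp add: exp_of_nat_mult[symmetric])
    hence "5 \<le> ln ((3::real) ^ 5)" by (subst ln_ge_iff) auto
    thus "ln (real K) \<ge> 5" by (simp add: K_def)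
  qed (simp add: K_def)
  have psi: "chebyshev_psi N \<ge> real (N div K)" if "N \<ge> K" for N
  proof -
    define m where "m = N div K"
    have m: "m \<ge> 1" "K * m \<le> N" using that K by (auto simp: m_def div_greater_zero_iff Suc_le_eq)
    have Km: "m \<le> K * m" "K * m \<ge> 1" using K m by auto
    have "1 \<le> mangoldt_mean (K * m) - mangoldt_mean m"
      using mangoldt_mean_bounds(1)[OF Km(2)] mangoldt_mean_bounds(2)[OF m(1)] K m
      by (simp add: ln_mult)
    also have "\<dots> = (\<Sum>d=m+1..K*m. mangoldt d / real d)"
      unfolding mangoldt_mean_def
      using sum.ub_add_nat[of 1 m "\<lambda>d. mangoldt d / real d :: real" "K * m - m"] Km by simp
    also have "\<dots> \<le> (\<Sum>d=m+1..K*m. mangoldt d / real m)"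
      using m by (intro sum_mono divide_left_mono mangoldt_nonneg') auto
    also have "\<dots> = (\<Sum>d=m+1..K*m. mangoldt d) / real m" by (simp add: sum_divide_distrib)
    also have "\<dots> \<le> chebyshev_psi N / real m"
      unfolding chebyshev_psi_def using m
      by (intro divide_right_mono sum_mono2) (auto simp: mangoldt_nonneg')
    finally show ?thesis using m by (simp add: m_def field_simps)
  qed
  \<comment> \<open>The factor log 2 = psi(2) covers the finitely many N < K, where only psi(N) >=
    psi(2) is used.\<close>
  define c where "c = ln 2 / (2 * real K)"
  have "chebyshev_psi N \<ge> c * real N" if N: "N \<ge> 2" for N
  proof (cases "N \<ge> K")
    case True
    have "N < K * (N div K + 1)" using K dividend_less_div_times[of K N] by (simp add: algebra_simps)
    also have "\<dots> \<le> K * (2 * (N div K))"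
      using True K by (intro mult_left_mono) (auto simp: div_greater_zero_iff Suc_le_eq)
    finally have "real N \<le> 2 * real K * real (N div K)" by (metis less_imp_le mult.assoc mult.left_commute of_nat_le_iff of_nat_mult of_nat_numeral)
    hence "real N / (2 * real K) \<le> real (N div K)" using K by (simp add: field_simps)
    moreover have "c * real N \<le> 1 * (real N / (2 * real K))"
    proof -
      have "ln 2 * (real N / (2 * real K)) \<le> 1 * (real N / (2 * real K))"
        using ln2_le_25_over_36 by (intro mult_right_mono) auto
      thus ?thesis by (simp add: c_def)
    qed
    ultimately show ?thesis using psi[OF True] by linarith
  next
    case False
    have "c * real N \<le> c * (2 * real K)"
      using False K unfolding c_def by (intro mult_left_mono) auto
    also have "\<dots> = ln 2" using K by (simp add: c_def)
    also have "\<dots> = chebyshev_psi 2"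
      by (simp add: chebyshev_psi_def numeral_2_eq_2 mangoldt_def two_is_prime_nat[unfolded numeral_2_eq_2]
            primepow_prime aprimedivisor_of_prime)
    also have "\<dots> \<le> chebyshev_psi N" using N by (rule chebyshev_psi_mono)
    finally show ?thesis .
  qed
  moreover have "c > 0" using K by (simp add: c_def)
  ultimately show ?thesis by blast
qed

lemma prime_count_lower:
  "\<exists>c>0. \<forall>x\<ge>2. real (card {p::nat. prime p \<and> real p \<le> x}) \<ge> c * x / ln x"
proof -
  obtain c where c: "c > 0" "\<And>N. N \<ge> 2 \<Longrightarrow> chebyshev_psi N \<ge> c * real N"
    using chebyshev_psi_lower by blast
  have "real (card {p::nat. prime p \<and> real p \<le> x}) \<ge> (c / 2) * x / ln x" if x: "x \<ge> 2" for x
  proof -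
    define N where "N = nat \<lfloor>x\<rfloor>"
    have N: "N \<ge> 2" "real N \<le> x" "x \<le> 2 * real N" using x unfolding N_def by linarith+
    let ?c = "real (card {p::nat. prime p \<and> real p \<le> x})"
    have "c * (x / 2) \<le> c * real N" using c N by (intro mult_left_mono) auto
    also have "\<dots> \<le> chebyshev_psi N" using c N by blast
    also have "\<dots> \<le> ?c * ln (real N)"
      unfolding primes_le_nat using chebyshev_psi_le_primes[of N] N by (simp add: N_def)
    also have "\<dots> \<le> ?c * ln x" using N x by (intro mult_left_mono) auto
    finally show ?thesis using x by (simp add: field_simps)
  qed
  thus ?thesis using c(1) by (intro exI[of _ "c / 2"]) auto
qed

text \<open>Partial summation arranged as an induction: psi(M) / M^2 is the boundary term, and its
  change from M to M + 1 is paid by 3 M (1/M^2 - 1/(M+1)^2) <= 6 (1/M - 1/(M+1)).\<close>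

lemma mangoldt_sq_tail_aux:
  assumes "m \<ge> 1" "m \<le> M"
  shows "(\<Sum>n=m+1..M. mangoldt n / (real n)\<^sup>2) \<le> chebyshev_psi M / (real M)\<^sup>2 + 6 * (1 / real m - 1 / real M)"
  using assms(2)
proof (induction M rule: dec_induct)
  case base
  thus ?case by (simp add: chebyshev_psi_nonneg)
next
  case (step M)
  have M: "real M > 0" using step assms by simp
  have "chebyshev_psi M * (1 / (real M)\<^sup>2 - 1 / (real (Suc M))\<^sup>2) \<le> (3 * real M) * (1 / (real M)\<^sup>2 - 1 / (real (Suc M))\<^sup>2)"
    using M by (intro mult_right_mono chebyshev_psi_le) (auto intro!: divide_left_mono power_mono simp del: of_nat_Suc)
  also have "\<dots> \<le> 6 * (1 / real M - 1 / real (Suc M))"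
    using M by (simp add: divide_simps) (auto simp: algebra_simps power2_eq_square)
  finally have 1: "chebyshev_psi M / (real M)\<^sup>2 - chebyshev_psi M / (real (Suc M))\<^sup>2 \<le> 6 * (1 / real M - 1 / real (Suc M))"
    by (simp add: right_diff_distrib)
  have 2: "chebyshev_psi (Suc M) = chebyshev_psi M + mangoldt (Suc M)" by (simp add: chebyshev_psi_def)
  show ?case using step.IH step.hyps 1 unfolding 2 by (simp add: add_divide_distrib right_diff_distrib del: of_nat_Suc)
qed

lemma mangoldt_sq_tail:
  assumes "m \<ge> 1"
  shows "(\<Sum>n=m+1..M. mangoldt n / (real n)\<^sup>2) \<le> 9 / real m"
proof (cases "m \<le> M")
  case True
  have "chebyshev_psi M / (real M)\<^sup>2 \<le> 3 * real M / (real M)\<^sup>2"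
    by (intro divide_right_mono chebyshev_psi_le) auto
  also have "\<dots> = 3 * (1 / real M)" using True assms by (simp add: power2_eq_square)
  also have "\<dots> \<le> 3 * (1 / real m)" using True assms by (intro mult_left_mono divide_left_mono) auto
  finally have "chebyshev_psi M / (real M)\<^sup>2 \<le> 3 * (1 / real m)" .
  moreover have "1 / real M \<ge> 0" by simp
  ultimately show ?thesis using mangoldt_sq_tail_aux[OF assms True] by argo
qed (use assms in simp)

text \<open>The saving of log s over the sum over all integers comes from Lambda(p) >= log s. It is
  what makes s^2 times this tail comparable with the number of primes up to s. The set A is
  arbitrary so that any truncation at y is covered.\<close>

lemma prime_sq_tail:
  "\<exists>C>0. \<forall>s\<ge>2. \<forall>A. finite A \<longrightarrow> A \<subseteq> {p::nat. prime p \<and> real p > s} \<longrightarrow>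
     (\<Sum>p\<in>A. 1 / (real p)\<^sup>2) \<le> C / (s * ln s)"
proof (intro exI[of _ 18] conjI allI impI)
  fix s :: real and A :: "nat set"
  assume s: "s \<ge> 2" and A: "finite A" "A \<subseteq> {p::nat. prime p \<and> real p > s}"
  define m where "m = nat \<lfloor>s\<rfloor>"
  have m: "m \<ge> 1" "real m \<le> s" "s \<le> 2 * real m" using s unfolding m_def by linarith+
  have "\<exists>M. \<forall>p\<in>A. p \<le> M" using A(1) finite_nat_set_iff_bounded_le by auto
  then obtain M where M: "\<And>p. p \<in> A \<Longrightarrow> p \<le> M" by blast
  have "(\<Sum>p\<in>A. 1 / (real p)\<^sup>2) \<le> (\<Sum>p\<in>A. mangoldt p / (real p)\<^sup>2 / ln s)"
  proof (rule sum_mono)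
    fix p assume "p \<in> A"
    hence p: "prime p" "real p > s" using A by auto
    have "ln s \<le> mangoldt p" using p s by (simp add: mangoldt_def)
    thus "1 / (real p)\<^sup>2 \<le> mangoldt p / (real p)\<^sup>2 / ln s" using p s by (simp add: field_simps)
  qed
  also have "\<dots> = (\<Sum>p\<in>A. mangoldt p / (real p)\<^sup>2) / ln s" by (simp add: sum_divide_distrib)
  also have "\<dots> \<le> (\<Sum>n=m+1..M. mangoldt n / (real n)\<^sup>2) / ln s"
  proof (intro divide_right_mono sum_mono2)
    show "A \<subseteq> {m+1..M}"
    proof
      fix p assume p: "p \<in> A"
      hence "real p > real m" using A m by force
      thus "p \<in> {m+1..M}" using M[OF p] by simp
    qed
  qed (use s in \<open>auto simp: mangoldt_nonneg'\<close>)
  also have "\<dots> \<le> (9 / real m) / ln s" using s m by (intro divide_right_mono mangoldt_sq_tail) auto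
  also have "\<dots> \<le> (18 / s) / ln s" using s m by (intro divide_right_mono) (auto simp: field_simps)
  finally show "(\<Sum>p\<in>A. 1 / (real p)\<^sup>2) \<le> 18 / (s * ln s)" by simp
qed simp

section \<open>The Mertens sum against the sum of Lambda(n) / (n log n)\<close>

definition mertens_sum :: "nat \<Rightarrow> real" where
  "mertens_sum N = (\<Sum>p | prime p \<and> p \<le> N. - ln (1 - 1 / real p))"

definition mangoldt_log_sum :: "nat \<Rightarrow> real" where
  "mangoldt_log_sum N = (\<Sum>n=1..N. mangoldt n / (real n * ln (real n)))"

lemma minus_ln_one_minus_sums:
  fixes x :: real
  assumes "0 \<le> x" "x < 1"
  shows "(\<lambda>j. x ^ Suc j / real (Suc j)) sums (- ln (1 - x))"
proof -
  have "(\<lambda>n. - ((- (- x)) ^ n) / of_nat n) sums ln (1 + - x)" using assms by (intro ln_series') auto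
  hence "(\<lambda>n. x ^ n / real n) sums (- ln (1 - x))" by (drule_tac sums_minus) simp
  thus ?thesis by (subst sums_Suc_iff) simp
qed

text \<open>The two sums differ by the powers p^k > N of primes p <= N, of weight 1 / (k p^k). For
  these k log p > log N, so 1/k may be replaced by log p / log N and a geometric series
  remains.\<close>

lemma mertens_sum_bounds:
  assumes N: "N \<ge> 2"
  shows "mangoldt_log_sum N \<le> mertens_sum N" "mertens_sum N \<le> mangoldt_log_sum N + 18 / ln (real N)"
proof -
  have lN: "ln (real N) > 0" using N by simp
  have G: "mangoldt_log_sum N = (\<Sum>p | prime p \<and> p \<le> N. \<Sum>j | p ^ Suc j \<le> N. (1 / real p) ^ Suc j / real (Suc j))"
  proof -
    have "mangoldt_log_sum N = (\<Sum>n=1..N. mangoldt n * (1 / (real n * ln (real n))))"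
      by (simp add: mangoldt_log_sum_def)
    also have "\<dots> = (\<Sum>p | prime p \<and> p \<le> N. \<Sum>j | p ^ Suc j \<le> N. ln (real p) * (1 / (real (p ^ Suc j) * ln (real (p ^ Suc j)))))"
      by (rule mangoldt_sum_primes)
    also have "\<dots> = (\<Sum>p | prime p \<and> p \<le> N. \<Sum>j | p ^ Suc j \<le> N. (1 / real p) ^ Suc j / real (Suc j))"
    proof (intro sum.cong refl)
      fix p j assume "p \<in> {p. prime p \<and> p \<le> N}"
      hence "p > 1" using prime_gt_1_nat by auto
      moreover have "ln (real (p ^ Suc j)) = real (Suc j) * ln (real p)"
        using ln_realpow[of "real p" "Suc j"] by (simp del: power_Suc of_nat_Suc)
      ultimately show "ln (real p) * (1 / (real (p ^ Suc j) * ln (real (p ^ Suc j)))) = (1 / real p) ^ Suc j / real (Suc j)"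
        by (simp add: power_one_over field_simps del: power_Suc of_nat_Suc)
    qed
    finally show ?thesis .
  qed
  have *: "(\<Sum>j | p ^ Suc j \<le> N. (1 / real p) ^ Suc j / real (Suc j)) \<le> - ln (1 - 1 / real p) \<and>
     - ln (1 - 1 / real p) \<le> (\<Sum>j | p ^ Suc j \<le> N. (1 / real p) ^ Suc j / real (Suc j)) 
        + 2 * (mangoldt p / (real p)\<^sup>2) / ln (real N)"
    if "p \<in> {p. prime p \<and> p \<le> N}" for p
  proof -
    have p: "prime p" "p > 1" "p \<le> N" using that prime_gt_1_nat by auto
    define x where "x = 1 / real p"
    have x: "0 \<le> x" "x \<le> 1 / 2" using p by (auto simp: x_def field_simps)
    let ?J = "{j. p ^ Suc j \<le> N}"
    let ?f = "\<lambda>j. x ^ Suc j / real (Suc j)"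
    have fin: "finite ?J"
    proof (rule finite_subset)
      show "?J \<subseteq> {..N}"
      proof safe
        fix j assume "p ^ Suc j \<le> N"
        moreover have "Suc j < p ^ Suc j" using prime_gt_Suc_0_nat[OF p(1)] by (rule power_gt_expt)
        ultimately show "j \<le> N" by linarith
      qed
    qed simp
    have s: "?f sums (- ln (1 - x))" using x by (intro minus_ln_one_minus_sums) auto
    have 1: "(\<Sum>j\<in>?J. ?f j) \<le> - ln (1 - x)"
      using sum_le_suminf[of ?f ?J] s fin x by (auto simp: sums_iff simp del: power_Suc of_nat_Suc)
    let ?r = "ln (real p) / ln (real N)"
    have "(\<lambda>j. ?r * x\<^sup>2 * x ^ j) sums (?r * x\<^sup>2 * (1 / (1 - x)))"
      using x by (intro sums_mult geometric_sums) auto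
    \<comment> \<open>The exponent index j = 0 gets no majorant because p <= N always places it in
      \<open>?J\<close>; the series therefore starts with p^2.\<close>
    hence geo: "(\<lambda>j. case j of 0 \<Rightarrow> 0 | Suc i \<Rightarrow> ?r * x\<^sup>2 * x ^ i) sums (?r * x\<^sup>2 * (1 / (1 - x)))"
      using sums_Suc[of "\<lambda>j. case j of 0 \<Rightarrow> 0 | Suc i \<Rightarrow> ?r * x\<^sup>2 * x ^ i"] by simp
    have "(\<lambda>j. (if j \<in> ?J then ?f j else 0) + (case j of 0 \<Rightarrow> 0 | Suc i \<Rightarrow> ?r * x\<^sup>2 * x ^ i)) sums
            ((\<Sum>j\<in>?J. ?f j) + ?r * x\<^sup>2 * (1 / (1 - x)))"
      by (intro sums_add geo sums_If_finite_set fin)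
    moreover have "?f j \<le> (if j \<in> ?J then ?f j else 0) + (case j of 0 \<Rightarrow> 0 | Suc i \<Rightarrow> ?r * x\<^sup>2 * x ^ i)" for j
    proof (cases "j \<in> ?J")
      case True
      have "0 \<le> (case j of 0 \<Rightarrow> 0 | Suc i \<Rightarrow> ?r * x\<^sup>2 * x ^ i)"
        using x lN p by (auto split: nat.split)
      thus ?thesis using True by simp
    next
      case False
      hence "j \<noteq> 0" using p by (intro notI) auto
      then obtain i where i: "j = Suc i" by (cases j) auto
      have "N < p ^ Suc j" using False by simp
      hence "real N < real p ^ Suc j" by (metis of_nat_less_iff of_nat_power)
      hence "ln (real N) < ln (real p ^ Suc j)" using N p by (subst ln_less_cancel_iff) auto
      also have "\<dots> = real (Suc j) * ln (real p)" using p ln_realpow[of "real p" "Suc j"] by (simp del: power_Suc)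
      finally have "1 / real (Suc j) \<le> ?r" using lN by (simp add: field_simps)
      hence "x ^ Suc j * (1 / real (Suc j)) \<le> x ^ Suc j * ?r" using x by (intro mult_left_mono) auto
      also have "\<dots> = ?r * x\<^sup>2 * x ^ i" by (simp add: i power2_eq_square)
      finally show ?thesis using False i by simp
    qed
    ultimately have "- ln (1 - x) \<le> (\<Sum>j\<in>?J. ?f j) + ?r * x\<^sup>2 * (1 / (1 - x))"
      by (intro sums_le[OF _ s]) auto
    also have "?r * x\<^sup>2 * (1 / (1 - x)) \<le> ?r * x\<^sup>2 * 2"
      using x lN p by (intro mult_left_mono) (auto simp: field_simps)
    also have "\<dots> = 2 * (mangoldt p / (real p)\<^sup>2) / ln (real N)"
      using p by (simp add: x_def mangoldt_def power_divide mult.commute)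
    finally show ?thesis using 1 unfolding x_def by simp
  qed
  show "mangoldt_log_sum N \<le> mertens_sum N"
    unfolding G mertens_sum_def by (rule sum_mono) (use * in blast)
  have "mertens_sum N \<le> (\<Sum>p | prime p \<and> p \<le> N. (\<Sum>j | p ^ Suc j \<le> N. (1 / real p) ^ Suc j / real (Suc j)) 
        + 2 * (mangoldt p / (real p)\<^sup>2) / ln (real N))"
    unfolding mertens_sum_def by (rule sum_mono) (use * in blast)
  also have "\<dots> = mangoldt_log_sum N + 2 * (\<Sum>p | prime p \<and> p \<le> N. mangoldt p / (real p)\<^sup>2) / ln (real N)"
    unfolding G by (simp add: sum.distrib sum_distrib_left sum_divide_distrib del: power_Suc of_nat_Suc)
  also have "(\<Sum>p | prime p \<and> p \<le> N. mangoldt p / (real p)\<^sup>2) \<le> (\<Sum>n=1+1..N. mangoldt n / (real n)\<^sup>2)"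
    by (intro sum_mono2) (auto simp: mangoldt_nonneg' dest: prime_ge_2_nat)
  also have "\<dots> \<le> 9 / real 1" by (rule mangoldt_sq_tail) simp
  finally show "mertens_sum N \<le> mangoldt_log_sum N + 18 / ln (real N)"
    using lN by (simp add: divide_right_mono)
qed



section \<open>Logarithmic averages of Lambda(n) / n up to a bounded error\<close>

definition mangoldt_log_mean :: "nat \<Rightarrow> real" where
  "mangoldt_log_mean N = (\<Sum>d=1..N. mangoldt d / real d * (ln (real N) - ln (real d)))"

text \<open>The convolution identity log = Lambda * 1 with every term divided by n, proved by the
  same jump argument as Legendre's formula.\<close>

lemma sum_ln_over_n_mangoldt:
  "(\<Sum>n=1..N. ln (real n) / real n) = (\<Sum>d=1..N. mangoldt d / real d * harm (N div d))"
proof (induction N)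
  case (Suc N)
  have "(\<Sum>d=1..Suc N. mangoldt d / real d * harm (Suc N div d))
      = (\<Sum>d=1..Suc N. mangoldt d / real d * harm (N div d) + (if d dvd Suc N then mangoldt d / real (Suc N) else (0::real)))"
  proof (rule sum.cong)
    fix d assume d: "d \<in> {1..Suc N}"
    show "mangoldt d / real d * harm (Suc N div d) =
          mangoldt d / real d * harm (N div d) + (if d dvd Suc N then mangoldt d / real (Suc N) else (0::real))"
    proof (cases "d dvd Suc N")
      case True
      hence "Suc N div d = Suc (N div d)" by (simp add: div_Suc dvd_eq_mod_eq_0)
      moreover from this have "real (Suc N) = real d * real (Suc (N div d))"
        using True by (metis dvd_mult_div_cancel of_nat_mult)
      ultimately show ?thesis using True d
        by (simp add: harm_Suc distrib_left inverse_eq_divide del: of_nat_Suc)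
    next
      case False
      hence "Suc N div d = N div d" by (simp add: div_Suc dvd_eq_mod_eq_0)
      thus ?thesis using False by simp
    qed
  qed simp
  also have "\<dots> = (\<Sum>d=1..Suc N. mangoldt d / real d * harm (N div d)) 
      + (\<Sum>d=1..Suc N. if d dvd Suc N then mangoldt d / real (Suc N) else 0)"
    by (rule sum.distrib)
  also have "(\<Sum>d=1..Suc N. mangoldt d / real d * harm (N div d)) = (\<Sum>d=1..N. mangoldt d / real d * harm (N div d))"
    by (simp add: harm_def)
  also have "(\<Sum>d=1..Suc N. if d dvd Suc N then mangoldt d / real (Suc N) else 0) 
      = (\<Sum>d | d dvd Suc N. mangoldt d / real (Suc N))"
  proof -
    have "{d. d dvd Suc N} = {d \<in> {1..Suc N}. d dvd Suc N}"
      by (auto dest: dvd_imp_le intro: Nat.gr0I simp: Suc_le_eq)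
    moreover have "(\<Sum>d\<in>{d \<in> {1..Suc N}. d dvd Suc N}. mangoldt d / real (Suc N)) 
        = (\<Sum>d\<in>{1..Suc N}. if d dvd Suc N then mangoldt d / real (Suc N) else (0::real))"
      by (rule sum.inter_filter) simp
    ultimately show ?thesis by metis
  qed
  also have "\<dots> = (\<Sum>d | d dvd Suc N. mangoldt d) / real (Suc N)" by (rule sum_divide_distrib[symmetric])
  also have "\<dots> = ln (real (Suc N)) / real (Suc N)"
    using mangoldt_sum[of "Suc N", where 'a = real] by simp
  finally show ?case using Suc by (simp del: of_nat_Suc)
qed simp

text \<open>The error is of relative size d / N, so that its sum against Lambda(d) / d is 2 psi(N) /
  N = O(1). Two losses are collected: the harmonic number against the logarithm, and N / d against
  its integer part.\<close>

lemma harm_div_approx: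
  assumes "1 \<le> d" "d \<le> N"
  shows "\<bar>harm (N div d) - (ln (real N) - ln (real d)) - euler_mascheroni\<bar> \<le> 2 * real d / real N"
proof -
  define m where "m = N div d"
  have m: "m \<ge> 1" using assms by (simp add: m_def div_greater_zero_iff Suc_le_eq)
  have "m * d \<le> N" "N < (m + 1) * d"
    using assms by (simp_all add: m_def dividend_less_times_div mult.commute)
  hence md: "real m * real d \<le> real N" "real N \<le> (real m + 1) * real d"
    by (metis of_nat_le_iff of_nat_mult) (metis Suc_eq_plus1 \<open>N < (m + 1) * d\<close> less_imp_le of_nat_Suc of_nat_le_iff of_nat_mult add.commute)
  have d0: "real d > 0" "real N > 0" "real m > 0" using assms m by auto
  have "ln (real m * real d) \<le> ln (real N)" using md d0 by (subst ln_le_cancel_iff) auto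
  hence l1: "ln (real m) \<le> ln (real N) - ln (real d)" using d0 by (simp add: ln_mult)
  have "ln (real N) \<le> ln ((real m + 1) * real d)" using md d0 by (subst ln_le_cancel_iff) auto
  hence l2: "ln (real N) - ln (real d) \<le> ln (real m + 1)" using d0 by (simp add: ln_mult)
  have "ln (real m + 1) - ln (real m) = ln (1 + 1 / real m)"
    using d0 ln_div[of "real m + 1" "real m"] by (simp add: add_divide_distrib add.commute)
  also have "\<dots> \<le> 1 / real m" using d0 by (intro ln_add_one_self_le_self) auto
  finally have l3: "ln (real m + 1) - ln (real m) \<le> 1 / real m" .
  have "inverse (real (2 * m)) \<le> 1 / real m" using d0 by (simp add: field_simps)
  moreover have "inverse (real (2 * (m + 1))) \<ge> 0" by simp
  ultimately have e: "harm m - euler_mascheroni \<le> ln (real m + 1)" "harm m - euler_mascheroni \<ge> ln (real m + 1) - 1 / real m"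
    using euler_mascheroni_bounds[OF m] unfolding atLeastAtMost_iff of_nat_Suc add.commute[of 1]
    by (linarith, linarith)
  have "\<bar>harm m - (ln (real N) - ln (real d)) - euler_mascheroni\<bar> \<le> 1 / real m"
    using e l1 l2 l3 by linarith
  also have "1 / real m \<le> 2 * real d / real N"
  proof -
    have "(real m + 1) * real d \<le> (2 * real m) * real d" using m by (intro mult_right_mono) auto
    hence "real N \<le> (2 * real m) * real d" using md by linarith
    thus ?thesis using d0 by (simp add: field_simps)
  qed
  finally show ?thesis by (simp add: m_def)
qed

text \<open>From 3 > e on log x / x decreases. Hence the difference to (log N)^2 / 2 is decreasing
  in N, and becomes increasing after subtracting log N / N; both monotonicities together bound
  it.\<close>

lemma sum_ln_over_n: "\<exists>C. \<forall>N\<ge>3. \<bar>(\<Sum>n=1..N. ln (real n) / real n) - (ln (real N))\<^sup>2 / 2\<bar> \<le> C"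
proof -
  define t where "t N = (\<Sum>n=1..N. ln (real n) / real n) - (ln (real N))\<^sup>2 / 2" for N :: nat
  have step: "ln (real (Suc N)) / real (Suc N) \<le> (ln (real (Suc N)))\<^sup>2 / 2 - (ln (real N))\<^sup>2 / 2
      \<and> (ln (real (Suc N)))\<^sup>2 / 2 - (ln (real N))\<^sup>2 / 2 \<le> ln (real N) / real N" if N: "N \<ge> 3" for N
  proof -
    have e3: "exp 1 \<le> real N" using N exp_le by linarith
    have dec: "ln y / y \<le> ln x / x" if "exp 1 \<le> x" "x \<le> y" for x y :: real
    proof (rule DERIV_nonpos_imp_nonincreasing[OF that(2)])
      fix z assume z: "x \<le> z" "z \<le> y"
      have z0: "exp 1 \<le> z" using that z by simp
      hence "z > 0" by (metis exp_gt_zero less_le_trans)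
      have "1 \<le> ln z" using z0 \<open>z > 0\<close> by (subst ln_ge_iff) auto
      hence "(1 - ln z) / z\<^sup>2 \<le> 0" using \<open>z > 0\<close> by (simp add: divide_le_0_iff)
      moreover have "((\<lambda>z. ln z / z) has_real_derivative (1 - ln z) / z\<^sup>2) (at z)"
        using \<open>z > 0\<close> by (auto intro!: derivative_eq_intros simp: power2_eq_square field_simps)
      ultimately show "\<exists>D. ((\<lambda>z. ln z / z) has_real_derivative D) (at z) \<and> D \<le> 0" by blast
    qed
    have "\<exists>z>real N. z < real (Suc N) \<and> (ln (real (Suc N)))\<^sup>2 / 2 - (ln (real N))\<^sup>2 / 2 = (real (Suc N) - real N) * (ln z / z)"
    proof (rule MVT2[of "real N" "real (Suc N)" "\<lambda>z. (ln z)\<^sup>2 / 2" "\<lambda>z. ln z / z"])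
      fix z assume "real N \<le> z"
      hence "z > 0" using N by linarith
      thus "((\<lambda>z. (ln z)\<^sup>2 / 2) has_real_derivative ln z / z) (at z)"
        by (auto intro!: derivative_eq_intros)
    qed simp
    then obtain z where z: "real N < z" "z < real (Suc N)"
      "(ln (real (Suc N)))\<^sup>2 / 2 - (ln (real N))\<^sup>2 / 2 = ln z / z" by auto
    show ?thesis unfolding z(3) using z e3 by (auto intro!: dec)
  qed
  have "t N \<le> t 3 \<and> t N - ln (real N) / real N \<ge> t 3 - ln (real 3) / real 3" if "N \<ge> 3" for N
    using that
  proof (induction N rule: dec_induct)
    case (step N)
    have 1: "t (Suc N) = t N + ln (real (Suc N)) / real (Suc N) - ((ln (real (Suc N)))\<^sup>2 / 2 - (ln (real N))\<^sup>2 / 2)"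
      by (simp add: t_def)
    show ?case using step.IH \<open>\<And>N. N \<ge> 3 \<Longrightarrow> _\<close>[OF step.hyps(1)] 1 by linarith
  qed simp
  note 2 = this
  have 3: "ln (real N) / real N \<ge> 0" if "N \<ge> 3" for N using that by simp
  have "\<bar>t N\<bar> \<le> \<bar>t 3\<bar> + ln (real 3) / real 3" if "N \<ge> 3" for N
    using 2[OF that] 3[OF that] 3[of 3] by linarith
  thus ?thesis unfolding t_def by blast
qed

text \<open>With \<open>harm (N div d)\<close> replaced by log (N / d) + gamma, the convolution
  identity reads (log N)^2 / 2 = \<open>mangoldt_log_mean N\<close> + gamma
  \<open>mangoldt_mean N\<close> + O(1). This is where gamma first enters.\<close>

lemma mangoldt_log_mean_asymp:
  "\<exists>C. \<forall>N\<ge>1. \<bar>mangoldt_log_mean N - ((ln (real N))\<^sup>2 / 2 - euler_mascheroni * ln (real N))\<bar> \<le> C"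
proof -
  obtain C where C: "\<And>N. N \<ge> 3 \<Longrightarrow> \<bar>(\<Sum>n=1..N. ln (real n) / real n) - (ln (real N))\<^sup>2 / 2\<bar> \<le> C"
    using sum_ln_over_n by blast
  let ?g = "euler_mascheroni :: real"
  let ?e = "\<lambda>N. \<bar>mangoldt_log_mean N - ((ln (real N))\<^sup>2 / 2 - ?g * ln (real N))\<bar>"
  have "?e N \<le> C + 9" if N: "N \<ge> 3" for N
  proof -
    have "\<bar>(\<Sum>d=1..N. mangoldt d / real d * harm (N div d)) - mangoldt_log_mean N - ?g * mangoldt_mean N\<bar>
      = \<bar>\<Sum>d=1..N. mangoldt d / real d * (harm (N div d) - (ln (real N) - ln (real d)) - ?g)\<bar>"
      unfolding mangoldt_log_mean_def mangoldt_mean_def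
      by (simp add: sum_distrib_left sum_subtractf[symmetric] algebra_simps add_divide_distrib)
    also have "\<dots> \<le> (\<Sum>d=1..N. mangoldt d / real d * (2 * real d / real N))"
    proof (rule order_trans[OF sum_abs sum_mono])
      fix d assume d: "d \<in> {1..N}"
      thus "\<bar>mangoldt d / real d * (harm (N div d) - (ln (real N) - ln (real d)) - ?g)\<bar> \<le> mangoldt d / real d * (2 * real d / real N)"
        unfolding abs_mult using harm_div_approx[of d N]
        by (intro mult_mono) (auto simp: mangoldt_nonneg')
    qed
    also have "\<dots> = 2 * chebyshev_psi N / real N"
      unfolding chebyshev_psi_def sum_distrib_left sum_divide_distrib by (rule sum.cong) auto
    also have "\<dots> \<le> 6" using chebyshev_psi_le[of N] N by (simp add: field_simps)
    finally have 1: "\<bar>(\<Sum>n=1..N. ln (real n) / real n) - mangoldt_log_mean N - ?g * mangoldt_mean N\<bar> \<le> 6"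
      unfolding sum_ln_over_n_mangoldt .
    have g: "0 \<le> ?g" "?g \<le> 1" using euler_mascheroni_gt_19_over_33 euler_mascheroni_less_13_over_22 by auto
    have "\<bar>mangoldt_mean N - ln (real N)\<bar> \<le> 3"
      using mangoldt_mean_bounds[of N] N by auto
    hence "?g * \<bar>mangoldt_mean N - ln (real N)\<bar> \<le> 1 * 3" using g by (intro mult_mono) auto
    hence 2: "\<bar>?g * mangoldt_mean N - ?g * ln (real N)\<bar> \<le> 3"
      using g by (simp add: right_diff_distrib[symmetric] abs_mult)
    show ?thesis using 1 2 C[OF N] by linarith
  qed
  hence "?e N \<le> max (C + 9) (max (?e 1) (?e 2))" if N1: "N \<ge> 1" for N
  proof -
    consider "N = 1" | "N = 2" | "N \<ge> 3" using N1 by linarith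
    thus ?thesis by cases (use \<open>\<And>N. N \<ge> 3 \<Longrightarrow> ?e N \<le> C + 9\<close>[of N] in auto)
  qed
  thus ?thesis by blast
qed

text \<open>The average with a real parameter v in place of log N. Terms with log d > v vanish, so N
  only has to be large enough and the sum can be treated as a function of v.\<close>

definition mangoldt_log_trunc :: "real \<Rightarrow> nat \<Rightarrow> real" where
  "mangoldt_log_trunc v N = (\<Sum>d=1..N. mangoldt d / real d * max 0 (v - ln (real d)))"

lemma mangoldt_log_trunc_asymp:
  "\<exists>C>0. \<forall>v\<ge>0. \<forall>N. v \<le> ln (real N) \<longrightarrow> N \<ge> 1 \<longrightarrow>
     \<bar>mangoldt_log_trunc v N - (v\<^sup>2 / 2 - euler_mascheroni * v)\<bar> \<le> C"
proof -
  obtain C where C: "\<And>N. N \<ge> 1 \<Longrightarrow> \<bar>mangoldt_log_mean N - ((ln (real N))\<^sup>2 / 2 - euler_mascheroni * ln (real N))\<bar> \<le> C"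
    using mangoldt_log_mean_asymp by blast
  let ?g = "euler_mascheroni :: real"
  have g: "0 \<le> ?g" "?g \<le> 1" using euler_mascheroni_gt_19_over_33 euler_mascheroni_less_13_over_22 by auto
  have "\<bar>mangoldt_log_trunc v N - (v\<^sup>2 / 2 - ?g * v)\<bar> \<le> \<bar>C\<bar> + 7" if v: "v \<ge> 0" "v \<le> ln (real N)" "N \<ge> 1" for v N
  proof -
    \<comment> \<open>Passing from v to log K with K the integer part of e^v changes v by at most
      1/K, while the quantities multiplied by this change are O(K).\<close>
    define K where "K = nat \<lfloor>exp v\<rfloor>"
    have K: "K \<ge> 1" "real K \<le> exp v" "exp v < real K + 1" using v(1) one_le_exp_iff[of v] unfolding K_def by linarith+
    have "exp v \<le> real N" using v by (metis exp_le_cancel_iff exp_ln of_nat_0_less_iff less_le_trans zero_less_one)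
    hence KN: "K \<le> N" using K(2) by linarith
    define l where "l = ln (real K)"
    have l: "l \<le> v" "v \<le> l + 1 / real K" "l \<ge> 0"
    proof -
      show "l \<le> v" unfolding l_def using K by (metis exp_le_cancel_iff exp_ln less_le_trans of_nat_0_less_iff zero_less_one)
      have "v = ln (exp v)" by simp
      also have "\<dots> \<le> ln (real K + 1)" using K by (subst ln_le_cancel_iff) auto
      also have "\<dots> = l + ln (1 + 1 / real K)"
        using K ln_div[of "real K + 1" "real K"] by (simp add: add_divide_distrib add.commute l_def)
      also have "ln (1 + 1 / real K) \<le> 1 / real K" using K by (intro ln_add_one_self_le_self) auto
      finally show "v \<le> l + 1 / real K" by simp
      show "l \<ge> 0" using K by (simp add: l_def)
    qed
    have "mangoldt_log_trunc v N = (\<Sum>d=1..K. mangoldt d / real d * max 0 (v - ln (real d)))"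
      unfolding mangoldt_log_trunc_def
    proof (rule sum.mono_neutral_right)
      show "\<forall>d\<in>{1..N} - {1..K}. mangoldt d / real d * max 0 (v - ln (real d)) = 0"
      proof
        fix d assume "d \<in> {1..N} - {1..K}"
        hence "real d \<ge> exp v" "d > 0" using K(3) by auto
        hence "ln (real d) \<ge> v" by (subst ln_ge_iff) auto
        thus "mangoldt d / real d * max 0 (v - ln (real d)) = 0" by simp
      qed
    qed (use KN in auto)
    also have "\<dots> = (\<Sum>d=1..K. mangoldt d / real d * ((l - ln (real d)) + (v - l)))"
    proof (rule sum.cong)
      fix d assume d: "d \<in> {1..K}"
      hence "ln (real d) \<le> l" unfolding l_def by (subst ln_le_cancel_iff) auto
      thus "mangoldt d / real d * max 0 (v - ln (real d)) = mangoldt d / real d * ((l - ln (real d)) + (v - l))"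
        using l(1) by simp
    qed simp
    also have "\<dots> = mangoldt_log_mean K + (v - l) * mangoldt_mean K"
      unfolding mangoldt_log_mean_def mangoldt_mean_def l_def sum_distrib_left sum.distrib[symmetric]
      by (rule sum.cong) (simp_all only: distrib_left mult.commute)
    finally have 1: "mangoldt_log_trunc v N = mangoldt_log_mean K + (v - l) * mangoldt_mean K" .
    have lK: "l \<le> real K" using K ln_le_minus_one[of "real K"] unfolding l_def by auto
    have m: "0 \<le> mangoldt_mean K" "mangoldt_mean K \<le> l + 3"
      using mangoldt_mean_bounds(2)[of K] K by (auto simp: l_def mangoldt_mean_def mangoldt_nonneg' intro!: sum_nonneg)
    have "(v - l) * mangoldt_mean K \<le> (1 / real K) * (real K + 3 * real K)"
      using m l lK K by (intro mult_mono) auto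
    also have "\<dots> = 4" using K by (simp add: field_simps)
    finally have 2: "\<bar>(v - l) * mangoldt_mean K\<bar> \<le> 4" using m l by simp
    have "(v - l) * (v + l) \<le> (1 / real K) * (3 * real K)"
    proof (intro mult_mono)
      have "1 / real K \<le> 1" using K by simp
      thus "v + l \<le> 3 * real K" using l lK K by linarith
    qed (use l K in auto)
    also have "\<dots> = 3" using K by simp
    finally have "(v - l) * (v + l) \<le> 3" .
    moreover have "(v - l) * (v + l) \<ge> 0" using l by (intro mult_nonneg_nonneg) auto
    moreover have "v\<^sup>2 / 2 - l\<^sup>2 / 2 = (v - l) * (v + l) / 2" by (simp add: power2_eq_square algebra_simps)
    ultimately have 3: "\<bar>v\<^sup>2 / 2 - l\<^sup>2 / 2\<bar> \<le> 3 / 2" by linarith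
    have "?g * (v - l) \<le> 1 * (1 / real K)" using g l by (intro mult_mono) auto
    also have "\<dots> \<le> 1" using K by simp
    finally have "?g * (v - l) \<le> 1" .
    moreover have "?g * (v - l) \<ge> 0" using g l by simp
    ultimately have 4: "\<bar>?g * v - ?g * l\<bar> \<le> 1" by (simp add: right_diff_distrib)
    have "\<bar>mangoldt_log_mean K - (l\<^sup>2 / 2 - ?g * l)\<bar> \<le> \<bar>C\<bar>" using C[OF K(1)] by (simp add: l_def)
    thus ?thesis using 1 2 3 4 by linarith
  qed
  thus ?thesis by (intro exI[of _ "\<bar>C\<bar> + 7"]) auto
qed



section \<open>Unsmoothing: second-order asymptotics of the sum of Lambda(n) / (n log n)\<close>

lemma has_real_derivative_max_sq:
  "((\<lambda>x::real. (max 0 x)\<^sup>2) has_real_derivative 2 * max 0 x) (at x)"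
proof (cases "x = 0")
  case False
  show ?thesis
  proof (cases "x > 0")
    case True
    have "((\<lambda>x::real. x\<^sup>2) has_real_derivative 2 * max 0 x) (at x)"
      using True by (auto intro!: derivative_eq_intros)
    moreover have "eventually (\<lambda>y. y > 0) (nhds x)" using True by (intro eventually_nhds_in_open[of "{0<..}", simplified]) auto
    ultimately show ?thesis
      by (subst DERIV_cong_ev[where g = "\<lambda>x. x\<^sup>2"]) (auto elim!: eventually_mono)
  next
    case False
    with \<open>x \<noteq> 0\<close> have x: "x < 0" by simp
    have "((\<lambda>x::real. 0) has_real_derivative 2 * max 0 x) (at x)"
      using x by (auto intro!: derivative_eq_intros)
    moreover have "eventually (\<lambda>y. y < 0) (nhds x)" using x by (intro eventually_nhds_in_open[of "{..<0}", simplified]) auto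
    ultimately show ?thesis
      by (subst DERIV_cong_ev[where g = "\<lambda>x. 0"]) (auto elim!: eventually_mono)
  qed
next
  case True
  have "((\<lambda>h::real. (max 0 h)\<^sup>2 / h) \<longlongrightarrow> 0) (at 0)"
  proof (rule tendsto_sandwich[of "\<lambda>h. - \<bar>h\<bar>" _ _ "\<lambda>h. \<bar>h\<bar>"])
    show "\<forall>\<^sub>F h in at (0::real). - \<bar>h\<bar> \<le> (max 0 h)\<^sup>2 / h"
      by (rule always_eventually) (auto simp: max_def power2_eq_square)
    show "\<forall>\<^sub>F h in at (0::real). (max 0 h)\<^sup>2 / h \<le> \<bar>h\<bar>"
      by (rule always_eventually) (auto simp: max_def power2_eq_square)
    show "((\<lambda>h. - \<bar>h\<bar>) \<longlongrightarrow> 0) (at (0::real))" by (auto intro!: tendsto_eq_intros)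
    show "((\<lambda>h. \<bar>h\<bar>) \<longlongrightarrow> 0) (at (0::real))" by (auto intro!: tendsto_eq_intros)
  qed
  thus ?thesis using True by (simp add: DERIV_def)
qed

text \<open>
  The smoothed sum \<open>\<Sum> \<Lambda>(n) (1 - log n / v)\<^sup>2 / (n log n)\<close> is a \<open>C\<^sup>1\<close> function of \<open>v\<close> whose derivative
  is governed by the averaged Mertens sum, which is known up to \<open>O(1)\<close>; unsmoothing gives the
  second-order term below, whose size matters (and not only its order) in the lower bound.
\<close>
lemma mangoldt_log_sum_asymp:
  "\<exists>c C. C > 0 \<and> (\<forall>N\<ge>2. \<bar>mangoldt_log_sum N - ln (ln (real N)) - c 
      - (mangoldt_mean N - ln (real N) + euler_mascheroni) / ln (real N)\<bar> \<le> C / (ln (real N))\<^sup>2)"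
proof -
  obtain C where C: "C > 0" "\<And>v N. v \<ge> 0 \<Longrightarrow> v \<le> ln (real N) \<Longrightarrow> N \<ge> 1 \<Longrightarrow>
     \<bar>mangoldt_log_trunc v N - (v\<^sup>2 / 2 - euler_mascheroni * v)\<bar> \<le> C"
    using mangoldt_log_trunc_asymp by blast
  let ?\<gamma> = "euler_mascheroni :: real"
  define H where "H N v = (\<Sum>n=1..N. mangoldt n / (real n * ln (real n)) * (max 0 (1 - ln (real n) / v))\<^sup>2)" for N :: nat and v :: real
  \<comment> \<open>The derivative of \<open>H N\<close> is 2 / v^3 times the truncated average,
    hence 1/v - 2 gamma / v^2 up to O(1 / v^3). Subtracting log v + 2 gamma / v removes this main
    part.\<close>
  define g where "g N v = H N v - ln v - 2 * ?\<gamma> / v" for N v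
  have dH: "(H N has_real_derivative 2 * mangoldt_log_trunc v N / v ^ 3) (at v)" if v: "v > 0" for N v
  proof -
    have "(H N has_real_derivative (\<Sum>n=1..N. mangoldt n / (real n * ln (real n)) * 
            (2 * max 0 (1 - ln (real n) / v) * (ln (real n) / v\<^sup>2)))) (at v)"
      unfolding H_def
    proof (intro DERIV_sum DERIV_cmult)
      fix n :: nat
      have "((\<lambda>v. 1 - ln (real n) / v) has_real_derivative ln (real n) / v\<^sup>2) (at v)"
        using v by (auto intro!: derivative_eq_intros simp: power2_eq_square)
      from DERIV_chain2[OF has_real_derivative_max_sq this]
      show "((\<lambda>v. (max 0 (1 - ln (real n) / v))\<^sup>2) has_real_derivative 
         2 * max 0 (1 - ln (real n) / v) * (ln (real n) / v\<^sup>2)) (at v)" .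
    qed
    also have "(\<Sum>n=1..N. mangoldt n / (real n * ln (real n)) * 
            (2 * max 0 (1 - ln (real n) / v) * (ln (real n) / v\<^sup>2)))
       = (\<Sum>n=1..N. 2 * (mangoldt n / real n * max 0 (v - ln (real n))) / v ^ 3)"
    proof (rule sum.cong)
      fix n assume n: "n \<in> {1..N}"
      have m: "max 0 (v - ln (real n)) = v * max 0 (1 - ln (real n) / v)"
        using v by (simp add: max_mult_distrib_left right_diff_distrib)
      show "mangoldt n / (real n * ln (real n)) * (2 * max 0 (1 - ln (real n) / v) * (ln (real n) / v\<^sup>2))
        = 2 * (mangoldt n / real n * max 0 (v - ln (real n))) / v ^ 3"
      proof (cases "n = 1")
        case False
        hence "ln (real n) \<noteq> 0" using n by auto
        thus ?thesis unfolding m using v n by (simp add: divide_simps power2_eq_square power3_eq_cube)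
      qed simp
    qed simp
    also have "\<dots> = 2 * mangoldt_log_trunc v N / v ^ 3"
      by (simp add: mangoldt_log_trunc_def sum_distrib_left sum_divide_distrib)
    finally show ?thesis .
  qed
  have dg: "(g N has_real_derivative 2 * mangoldt_log_trunc v N / v ^ 3 - 1 / v + 2 * ?\<gamma> / v\<^sup>2) (at v)"
    if v: "v > 0" for N v
    unfolding g_def using v
    by (auto intro!: derivative_eq_intros dH simp: power2_eq_square)
  have bd: "\<bar>2 * mangoldt_log_trunc v N / v ^ 3 - 1 / v + 2 * ?\<gamma> / v\<^sup>2\<bar> \<le> 2 * C / v ^ 3"
    if v: "v > 0" "v \<le> ln (real N)" "N \<ge> 1" for v N
  proof -
    have "2 * mangoldt_log_trunc v N / v ^ 3 - 1 / v + 2 * ?\<gamma> / v\<^sup>2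
        = 2 * (mangoldt_log_trunc v N - (v\<^sup>2 / 2 - ?\<gamma> * v)) / v ^ 3"
      using v(1) by (simp add: divide_simps power2_eq_square power3_eq_cube)
    also have "\<bar>\<dots>\<bar> = 2 * \<bar>mangoldt_log_trunc v N - (v\<^sup>2 / 2 - ?\<gamma> * v)\<bar> / v ^ 3"
      unfolding abs_divide abs_mult using v(1) by simp
    also have "\<dots> \<le> 2 * C / v ^ 3"
      using v C(2)[of v N] by (intro divide_right_mono mult_left_mono) auto
    finally show ?thesis .
  qed
  have dC: "((\<lambda>x. C / x\<^sup>2) has_real_derivative - (2 * C / x ^ 3)) (at x)" if "x > 0" for x
    using that by (auto intro!: derivative_eq_intros simp: divide_simps power2_eq_square power3_eq_cube)
  \<comment> \<open>Since the derivative of \<open>g N\<close> is at most 2 C / x^3 in size, adding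
    C / x^2 makes \<open>g N\<close> decreasing and subtracting it makes \<open>g N\<close>
    increasing.\<close>
  have cau: "\<bar>g N w - g N v\<bar> \<le> C / v\<^sup>2" if vw: "0 < v" "v \<le> w" "w \<le> ln (real N)" "N \<ge> 1" for v w N
  proof -
    have 1: "g N w + C / w\<^sup>2 \<le> g N v + C / v\<^sup>2"
    proof (rule DERIV_nonpos_imp_nonincreasing[OF vw(2)])
      fix x assume x: "v \<le> x" "x \<le> w"
      hence x0: "x > 0" using vw by linarith
      have "((\<lambda>x. g N x + C / x\<^sup>2) has_real_derivative
          (2 * mangoldt_log_trunc x N / x ^ 3 - 1 / x + 2 * ?\<gamma> / x\<^sup>2) - 2 * C / x ^ 3) (at x)"
        using DERIV_add[OF dg[OF x0] dC[OF x0]] by simp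
      moreover have "(2 * mangoldt_log_trunc x N / x ^ 3 - 1 / x + 2 * ?\<gamma> / x\<^sup>2) - 2 * C / x ^ 3 \<le> 0"
        using bd[of x N] x x0 vw by linarith
      ultimately show "\<exists>D. ((\<lambda>x. g N x + C / x\<^sup>2) has_real_derivative D) (at x) \<and> D \<le> 0" by blast
    qed
    have 2: "g N v - C / v\<^sup>2 \<le> g N w - C / w\<^sup>2"
    proof (rule DERIV_nonneg_imp_nondecreasing[OF vw(2)])
      fix x assume x: "v \<le> x" "x \<le> w"
      hence x0: "x > 0" using vw by linarith
      have "((\<lambda>x. g N x - C / x\<^sup>2) has_real_derivative
          (2 * mangoldt_log_trunc x N / x ^ 3 - 1 / x + 2 * ?\<gamma> / x\<^sup>2) + 2 * C / x ^ 3) (at x)"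
        using DERIV_diff[OF dg[OF x0] dC[OF x0]] by simp
      moreover have "(2 * mangoldt_log_trunc x N / x ^ 3 - 1 / x + 2 * ?\<gamma> / x\<^sup>2) + 2 * C / x ^ 3 \<ge> 0"
        using bd[of x N] x x0 vw by linarith
      ultimately show "\<exists>D. ((\<lambda>x. g N x - C / x\<^sup>2) has_real_derivative D) (at x) \<and> D \<ge> 0" by blast
    qed
    have "C / w\<^sup>2 \<ge> 0" using C by simp
    thus ?thesis using 1 2 by linarith
  qed
  define a where "a N = g N (ln (real N))" for N :: nat
  \<comment> \<open>At v = log N the weights of all n > N vanish, so enlarging the cutoff does not
    change the value. This lets \<open>a N\<close> and \<open>a M\<close> be compared inside the
    single function \<open>g M\<close>.\<close>
  have HM: "H M (ln (real N)) = H N (ln (real N))" if "2 \<le> N" "N \<le> M" for N M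
    unfolding H_def
  proof (rule sum.mono_neutral_right)
    show "\<forall>n\<in>{1..M} - {1..N}. mangoldt n / (real n * ln (real n)) * (max 0 (1 - ln (real n) / ln (real N)))\<^sup>2 = 0"
      using that by (auto simp: max_def field_simps)
  qed (use that in auto)
  have ca: "\<bar>a M - a N\<bar> \<le> C / (ln (real N))\<^sup>2" if "2 \<le> N" "N \<le> M" for N M
  proof -
    have "\<bar>g M (ln (real M)) - g M (ln (real N))\<bar> \<le> C / (ln (real N))\<^sup>2"
      using that by (intro cau) auto
    thus ?thesis unfolding a_def using HM[OF that] by (simp add: g_def)
  qed
  have "Cauchy a"
  proof (rule metric_CauchyI)
    fix e :: real assume e: "e > 0"
    have "((\<lambda>N::nat. C / (ln (real N))\<^sup>2) \<longlongrightarrow> 0) sequentially" by real_asymp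
    hence "eventually (\<lambda>N. C / (ln (real N))\<^sup>2 < e / 2) sequentially"
      by (rule order_tendstoD(2)) (use e in simp)
    then obtain N0 where N0: "\<And>N. N \<ge> N0 \<Longrightarrow> C / (ln (real N))\<^sup>2 < e / 2"
      by (auto simp: eventually_at_top_linorder)
    define N where "N = max N0 2"
    have "dist (a m) (a n) < e" if "m \<ge> N" "n \<ge> N" for m n
      using ca[of N m] ca[of N n] N0[of N] that unfolding N_def dist_real_def by linarith
    thus "\<exists>M. \<forall>m\<ge>M. \<forall>n\<ge>M. dist (a m) (a n) < e" by blast
  qed
  then obtain c' where c': "a \<longlonglongrightarrow> c'" using convergent_eq_Cauchy convergent_def by blast
  have ac: "\<bar>a N - c'\<bar> \<le> C / (ln (real N))\<^sup>2" if N: "2 \<le> N" for N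
  proof -
    have "(\<lambda>M. \<bar>a M - a N\<bar>) \<longlonglongrightarrow> \<bar>c' - a N\<bar>" by (intro tendsto_intros c')
    moreover have "\<forall>\<^sub>F M in sequentially. \<bar>a M - a N\<bar> \<le> C / (ln (real N))\<^sup>2"
      using eventually_ge_at_top[of N] by eventually_elim (use ca N in auto)
    ultimately have "\<bar>c' - a N\<bar> \<le> C / (ln (real N))\<^sup>2" by (rule tendsto_upperbound) simp
    thus ?thesis by simp
  qed
  \<comment> \<open>With v = log N the square opens to \<open>H N v\<close> = G - mean / v - logmean
    / v^2, where logmean = v^2 / 2 - gamma v + r. Solving for G leaves a constant 1/2, and writing
    mean / v as 1 + (mean - v) / v adds 1; hence the 3/2.\<close>
  have "\<bar>mangoldt_log_sum N - ln (ln (real N)) - (c' + 3 / 2) 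
      - (mangoldt_mean N - ln (real N) + ?\<gamma>) / ln (real N)\<bar> \<le> (2 * C) / (ln (real N))\<^sup>2" if N: "N \<ge> 2" for N
  proof -
    define v where "v = ln (real N)"
    have v: "v > 0" using N by (simp add: v_def)
    define S where "S = (\<Sum>n=1..N. mangoldt n / real n * ln (real n))"
    have Bf: "mangoldt_log_mean N = v * mangoldt_mean N - S"
      unfolding mangoldt_log_mean_def mangoldt_mean_def S_def v_def
      by (simp add: sum_distrib_left sum_subtractf[symmetric] algebra_simps)
    have "H N v = (\<Sum>n=1..N. mangoldt n / (real n * ln (real n)) - 2 / v * (mangoldt n / real n) + (mangoldt n / real n * ln (real n)) / v\<^sup>2)"
      unfolding H_def
    proof (rule sum.cong)
      fix n assume n: "n \<in> {1..N}"
      show "mangoldt n / (real n * ln (real n)) * (max 0 (1 - ln (real n) / v))\<^sup>2 =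
         mangoldt n / (real n * ln (real n)) - 2 / v * (mangoldt n / real n) + (mangoldt n / real n * ln (real n)) / v\<^sup>2"
      proof (cases "n = 1")
        case False
        hence l: "ln (real n) > 0" using n by auto
        have "ln (real n) \<le> v" using n unfolding v_def by (subst ln_le_cancel_iff) auto
        hence mx: "max 0 (1 - ln (real n) / v) = 1 - ln (real n) / v" using v by simp
        show ?thesis unfolding mx using l v n by (simp add: divide_simps power2_eq_square) (simp add: algebra_simps)
      qed simp
    qed simp
    also have "\<dots> = mangoldt_log_sum N - 2 / v * mangoldt_mean N + S / v\<^sup>2"
      unfolding mangoldt_log_sum_def mangoldt_mean_def S_def
      by (simp add: sum.distrib sum_subtractf sum_distrib_left sum_divide_distrib)
    finally have Hv: "H N v = mangoldt_log_sum N - 2 / v * mangoldt_mean N + S / v\<^sup>2" .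
    have tr: "mangoldt_log_trunc v N = mangoldt_log_mean N"
      unfolding mangoldt_log_trunc_def mangoldt_log_mean_def v_def
    proof (rule sum.cong)
      fix d assume d: "d \<in> {1..N}"
      hence "ln (real d) \<le> ln (real N)" by (subst ln_le_cancel_iff) auto
      thus "mangoldt d / real d * max 0 (ln (real N) - ln (real d)) = mangoldt d / real d * (ln (real N) - ln (real d))"
        by simp
    qed simp
    define r where "r = mangoldt_log_mean N - (v\<^sup>2 / 2 - ?\<gamma> * v)"
    have r: "\<bar>r\<bar> \<le> C" unfolding r_def using C(2)[of v N] v N tr by (simp add: v_def)
    have aN: "a N = H N v - ln v - 2 * ?\<gamma> / v" by (simp add: a_def g_def v_def)
    have S: "S = v * mangoldt_mean N - (r + (v\<^sup>2 / 2 - ?\<gamma> * v))" unfolding r_def Bf by simp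
    have G: "mangoldt_log_sum N = a N + ln v + 2 * ?\<gamma> / v + 2 / v * mangoldt_mean N - S / v\<^sup>2"
      unfolding aN Hv by simp
    have "mangoldt_log_sum N - ln v - (c' + 3 / 2) - (mangoldt_mean N - v + ?\<gamma>) / v
        = (a N - c') + r / v\<^sup>2"
      unfolding G S using v by (simp add: divide_simps power2_eq_square) (simp add: algebra_simps)
    also have "\<bar>\<dots>\<bar> \<le> C / v\<^sup>2 + C / v\<^sup>2"
    proof (rule order_trans[OF abs_triangle_ineq add_mono])
      show "\<bar>a N - c'\<bar> \<le> C / v\<^sup>2" using ac[OF N] by (simp add: v_def)
      show "\<bar>r / v\<^sup>2\<bar> \<le> C / v\<^sup>2" using r by (simp add: divide_right_mono)
    qed
    finally show ?thesis by (simp add: v_def)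
  qed
  thus ?thesis using C(1) by (intro exI[of _ "c' + 3 / 2"] exI[of _ "2 * C"]) auto
qed



section \<open>Identification of the constant in Mertens' theorem\<close>

text \<open>The weights (1 - x) x^k have total mass 1, and the mass of any fixed initial segment
  tends to 0 as x tends to 1. Finitely many terms far from the limit therefore cost at most (1 - x)
  W.\<close>

lemma abel_mean:
  fixes u :: "nat \<Rightarrow> real"
  assumes u: "u \<longlonglongrightarrow> l"
  shows "((\<lambda>x. (1 - x) * (\<Sum>k. u k * x ^ k)) \<longlongrightarrow> l) (at_left 1)"
    and "\<And>x. 0 < x \<Longrightarrow> x < 1 \<Longrightarrow> summable (\<lambda>k. u k * x ^ k)"
proof -
  have "Bseq u" using u convergent_def convergent_imp_Bseq by blast
  then obtain B where B: "B > 0" "\<And>n. \<bar>u n\<bar> \<le> B" by (auto elim!: BseqE)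
  show sm: "summable (\<lambda>k. u k * x ^ k)" if "0 < x" "x < 1" for x
  proof (rule summable_comparison_test'[of "\<lambda>k. B * x ^ k" 0])
    show "summable (\<lambda>k. B * x ^ k)" using that by (intro summable_mult summable_geometric) auto
    show "norm (u k * x ^ k) \<le> B * x ^ k" for k
      using B(2)[of k] that by (simp add: abs_mult mult_right_mono)
  qed
  show "((\<lambda>x. (1 - x) * (\<Sum>k. u k * x ^ k)) \<longlongrightarrow> l) (at_left 1)"
  proof (rule tendstoI)
    fix e :: real assume e: "e > 0"
    obtain K where K: "\<And>k. k \<ge> K \<Longrightarrow> \<bar>u k - l\<bar> < e / 2"
      using LIMSEQ_D[OF u, of "e / 2"] e by auto
    define W where "W = (\<Sum>k<K. \<bar>u k - l\<bar>)"
    have W: "W \<ge> 0" unfolding W_def by (rule sum_nonneg) simp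
    have "((\<lambda>x. (1 - x) * W) \<longlongrightarrow> 0) (at_left 1)" by (auto intro!: tendsto_eq_intros)
    hence "\<forall>\<^sub>F x in at_left 1. (1 - x) * W < e / 2" by (rule order_tendstoD(2)) (use e in simp)
    moreover have "\<forall>\<^sub>F x in at_left (1::real). x \<in> {0<..<1}" by (rule eventually_at_left_real) simp
    ultimately show "\<forall>\<^sub>F x in at_left 1. dist ((1 - x) * (\<Sum>k. u k * x ^ k)) l < e"
    proof eventually_elim
      case (elim x)
      hence x: "0 < x" "x < 1" by auto
      have g: "(\<lambda>k. x ^ k) sums (1 / (1 - x))" using x by (intro geometric_sums) auto
      have s1: "(\<lambda>k. (u k - l) * x ^ k) sums ((\<Sum>k. u k * x ^ k) - l * (1 / (1 - x)))"
        unfolding left_diff_distrib by (intro sums_diff sums_mult g summable_sums sm x)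
      have s2: "(\<lambda>k. (if k \<in> {..<K} then \<bar>u k - l\<bar> else 0) + e / 2 * x ^ k) sums (W + e / 2 * (1 / (1 - x)))"
        unfolding W_def by (intro sums_add sums_If_finite_set sums_mult g) auto
      have b: "\<bar>(u k - l) * x ^ k\<bar> \<le> (if k \<in> {..<K} then \<bar>u k - l\<bar> else 0) + e / 2 * x ^ k" for k
      proof (cases "k < K")
        case True
        have "\<bar>u k - l\<bar> * x ^ k \<le> \<bar>u k - l\<bar> * 1" using x by (intro mult_left_mono power_le_one) auto
        moreover have "e / 2 * x ^ k \<ge> 0" using e x by simp
        ultimately show ?thesis using True x unfolding abs_mult by simp
      next
        case False
        hence "\<bar>u k - l\<bar> * x ^ k \<le> e / 2 * x ^ k" using K[of k] x by (intro mult_right_mono) auto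
        thus ?thesis using False x by (simp add: abs_mult)
      qed
      have "(\<Sum>k. u k * x ^ k) - l * (1 / (1 - x)) \<le> W + e / 2 * (1 / (1 - x))"
        by (rule sums_le[OF _ s1 s2]) (use b in \<open>force simp: abs_le_iff\<close>)
      moreover have "- ((\<Sum>k. u k * x ^ k) - l * (1 / (1 - x))) \<le> W + e / 2 * (1 / (1 - x))"
        by (rule sums_le[OF _ sums_minus[OF s1] s2]) (use b in \<open>force simp: abs_le_iff\<close>)
      ultimately have "\<bar>(\<Sum>k. u k * x ^ k) - l * (1 / (1 - x))\<bar> \<le> W + e / 2 * (1 / (1 - x))" by linarith
      hence "(1 - x) * \<bar>(\<Sum>k. u k * x ^ k) - l * (1 / (1 - x))\<bar> \<le> (1 - x) * (W + e / 2 * (1 / (1 - x)))"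
        using x by (intro mult_left_mono) auto
      moreover have "(1 - x) * \<bar>(\<Sum>k. u k * x ^ k) - l * (1 / (1 - x))\<bar> = \<bar>(1 - x) * (\<Sum>k. u k * x ^ k) - l\<bar>"
        using x by (simp add: abs_mult_pos' right_diff_distrib)
      moreover have "(1 - x) * (W + e / 2 * (1 / (1 - x))) = (1 - x) * W + e / 2"
      proof -
        have "(1 - x) * (1 / (1 - x)) = 1" using x by simp
        thus ?thesis by (simp only: distrib_left mult.left_commute[of "1 - x"])
      qed
      ultimately show ?case using elim(1) unfolding dist_real_def by linarith
    qed
  qed
qed

text \<open>Abel summation for power series. It turns the Abel mean of a summatory function back
  into a series weighted over its increments, that is, over the primes themselves.\<close>

lemma power_series_diff:
  fixes f :: "nat \<Rightarrow> real"
  assumes "f 0 = 0" "summable (\<lambda>k. f k * x ^ k)"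
  shows "(\<lambda>k. (f (Suc k) - f k) * x ^ Suc k) sums ((1 - x) * (\<Sum>k. f k * x ^ k))"
proof -
  have s: "(\<lambda>k. f k * x ^ k) sums (\<Sum>k. f k * x ^ k)" using assms(2) by (rule summable_sums)
  hence "(\<lambda>k. f (Suc k) * x ^ Suc k) sums (\<Sum>k. f k * x ^ k)"
    using assms(1) by (subst sums_Suc_iff) simp
  from sums_diff[OF this sums_mult[OF s, of x]] show ?thesis
    by (simp add: algebra_simps)
qed

text \<open>Sieving by one prime at a time: the integers divisible by p and by no earlier prime are
  p times the current set, so removing them multiplies the sum by 1 - p^(-s).\<close>

lemma has_sum_coprime_primes:
  fixes s :: real
  assumes "finite P" "\<And>p. p \<in> P \<Longrightarrow> prime p" and F: "((\<lambda>n. real n powr (-s)) has_sum F) {0<..}"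
  shows "((\<lambda>n. real n powr (-s)) has_sum (F * (\<Prod>p\<in>P. 1 - real p powr (-s)))) {n. n > 0 \<and> (\<forall>p\<in>P. \<not> p dvd n)}"
  using assms(1,2)
proof (induction P rule: finite_induct)
  case empty
  thus ?case using F by (simp add: greaterThan_def)
next
  case (insert p P)
  let ?f = "\<lambda>n. real n powr (-s)" and ?C = "{n. n > 0 \<and> (\<forall>p\<in>P. \<not> p dvd n)}"
  let ?S = "F * (\<Prod>p\<in>P. 1 - real p powr (-s))"
  have p: "prime p" "p > 0" using insert prime_gt_0_nat by auto
  have IH: "(?f has_sum ?S) ?C" using insert by auto
  have "((\<lambda>n. real p powr (-s) * ?f n) has_sum (real p powr (-s) * ?S)) ?C"
    by (rule has_sum_cmult_right[OF IH])
  hence "((?f \<circ> (\<lambda>n. p * n)) has_sum (real p powr (-s) * ?S)) ?C"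
    by (simp add: o_def powr_mult)
  hence "(?f has_sum (real p powr (-s) * ?S)) ((\<lambda>n. p * n) ` ?C)"
    using p by (subst has_sum_reindex) (auto simp: inj_on_def)
  hence "(?f has_sum (?S - real p powr (-s) * ?S)) (?C - (\<lambda>n. p * n) ` ?C)"
  proof (rule has_sum_Diff[OF IH])
    show "(\<lambda>n. p * n) ` ?C \<subseteq> ?C"
    proof safe
      fix n q assume "0 < n" "\<forall>q\<in>P. \<not> q dvd n"
      thus "0 < p * n" using p by simp
      assume "q \<in> P" "q dvd p * n"
      moreover have "prime q" "q \<noteq> p" using insert \<open>q \<in> P\<close> by auto
      ultimately have "q dvd n" using p by (metis primes_dvd_imp_eq prime_dvd_mult_iff)
      thus False using \<open>q \<in> P\<close> \<open>\<forall>q\<in>P. \<not> q dvd n\<close> by blast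
    qed
  qed
  moreover have "?C - (\<lambda>n. p * n) ` ?C = {n. n > 0 \<and> (\<forall>q\<in>insert p P. \<not> q dvd n)}"
  proof (intro equalityI subsetI)
    fix n assume n: "n \<in> ?C - (\<lambda>n. p * n) ` ?C"
    have "\<not> p dvd n"
    proof
      assume "p dvd n"
      then obtain m where "n = p * m" by (elim dvdE)
      moreover have "m \<in> ?C" using n \<open>n = p * m\<close> by (auto intro: dvd_mult)
      ultimately show False using n by blast
    qed
    thus "n \<in> {n. n > 0 \<and> (\<forall>q\<in>insert p P. \<not> q dvd n)}" using n by auto
  qed auto
  moreover have "?S - real p powr (-s) * ?S = F * (\<Prod>q\<in>insert p P. 1 - real q powr (-s))"
    using insert by (simp add: algebra_simps)
  ultimately show ?case by simp
qed

lemma prime_powr_le_half: "prime p \<Longrightarrow> s \<ge> 1 \<Longrightarrow> real p powr (-s) \<le> 1 / 2"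
proof -
  assume p: "prime p" and s: "s \<ge> (1::real)"
  have p2: "real p \<ge> 2" using prime_ge_2_nat[OF p] by simp
  have "real p powr (-s) \<le> real p powr (-1)" using p2 s by (intro powr_mono) auto
  also have "\<dots> = 1 / real p" using p2 by (simp add: powr_minus_divide)
  also have "\<dots> \<le> 1 / 2" using p2 by (intro divide_left_mono) auto
  finally show ?thesis .
qed

text \<open>\<open>F\<close> is zeta(1 + delta); the index n = 0 does no harm because
  \<open>0 powr _\<close> is 0. The sum over integers free of primes up to N lies between its first
  term 1 and 1 plus a tail of the series, which yields the Euler product; the size of
  \<open>F\<close> comes from comparison with an integral.\<close>

lemma zeta_prime_sums:
  fixes \<delta> :: real
  assumes d: "\<delta> > 0"
  defines "F \<equiv> (\<Sum>n. real n powr (-(1 + \<delta>)))"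
  shows "(\<Sum>p | prime p \<and> p \<le> N. - ln (1 - real p powr (-(1 + \<delta>)))) \<le> ln F"
    and "(\<lambda>N. \<Sum>p | prime p \<and> p \<le> N. - ln (1 - real p powr (-(1 + \<delta>)))) \<longlonglongrightarrow> ln F"
    and "F \<ge> 1 / \<delta>" and "F \<le> 1 + 1 / \<delta>"
proof -
  define s where "s = 1 + \<delta>"
  define f where "f = (\<lambda>n. real n powr (-s))"
  have f0: "f n \<ge> 0" for n by (simp add: f_def)
  have sm: "summable f" unfolding f_def using d by (subst summable_real_powr_iff) (auto simp: s_def)
  have sF: "f sums F" using sm unfolding F_def f_def s_def by (rule summable_sums)
  have hU: "(f has_sum F) UNIV" using sm sF f0 by (intro norm_summable_imp_has_sum) auto
  have hF: "(f has_sum F) {0<..}"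
    by (rule iffD1[OF has_sum_cong_neutral hU]) (auto simp: f_def)
  define Pr where "Pr N = (\<Prod>p | prime p \<and> p \<le> N. 1 - real p powr (-s))" for N :: nat
  have fac: "1 - real p powr (-s) \<ge> 1 / 2" if "prime p" for p :: nat
    using prime_powr_le_half[OF that, of s] d by (simp add: s_def)
  have hC: "(f has_sum (F * Pr N)) {n. n > 0 \<and> (\<forall>p\<in>{p. prime p \<and> p \<le> N}. \<not> p dvd n)}" for N
    unfolding Pr_def f_def
    by (rule has_sum_coprime_primes) (use hF in \<open>auto simp: f_def\<close>)
  have facpos: "0 < 1 - real p powr (-s)" if "prime p" for p :: nat
    using fac[OF that] by linarith
  have Pr0: "Pr N > 0" for N unfolding Pr_def
    by (rule prod_pos) (use facpos in blast)
  have lnPr: "(\<Sum>p | prime p \<and> p \<le> N. - ln (1 - real p powr (-s))) = - ln (Pr N)" for N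
  proof -
    have "ln (Pr N) = (\<Sum>p | prime p \<and> p \<le> N. ln (1 - real p powr (-s)))"
      unfolding Pr_def by (rule ln_prod, simp) (metis (no_types, lifting) facpos less_irrefl mem_Collect_eq)
    thus ?thesis by (simp only: sum_negf)
  qed
  have lo: "1 \<le> F * Pr N" for N
  proof -
    have h1: "(f has_sum (sum f {1})) {1}" by (rule has_sum_finite) simp
    have "sum f {1} \<le> F * Pr N"
    proof (rule has_sum_mono2[OF h1 hC[of N]])
      show "{1} \<subseteq> {n. 0 < n \<and> (\<forall>p\<in>{p. prime p \<and> p \<le> N}. \<not> p dvd n)}" by auto
    qed (rule f0)
    thus ?thesis by (simp add: f_def)
  qed
  have F0: "F > 0"
  proof -
    have "0 < F * Pr 0" using lo[of 0] by linarith
    thus ?thesis using Pr0[of 0] by (simp add: zero_less_mult_iff)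
  qed
  \<comment> \<open>An integer n > 1 without prime factors up to N exceeds N, so apart from n = 1
    only the tail beyond N can contribute.\<close>
  have up: "F * Pr N \<le> 1 + (F - (\<Sum>n<Suc N. f n))" for N
  proof -
    have "(f has_sum (F - sum f {1..N})) ({0<..} - {1..N})"
      by (rule has_sum_Diff[OF hF]) auto
    moreover have "(f has_sum (sum f {1})) {1}" by (rule has_sum_finite) simp
    ultimately have "(f has_sum (sum f {1} + (F - sum f {1..N}))) ({1} \<union> ({0<..} - {1..N}))" if "N \<ge> 1"
      using that by (intro has_sum_Un_disjoint) auto
    hence *: "(f has_sum (1 + (F - sum f {1..N}))) ({1} \<union> ({0<..} - {1..N}))" if "N \<ge> 1"
      using that by (simp add: f_def)
    have **: "F * Pr N \<le> 1 + (F - sum f {1..N})"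
    proof (cases "N = 0")
      case True
      have "Pr 0 = 1" unfolding Pr_def using prime_gt_0_nat by (intro prod.neutral) auto
      thus ?thesis using True by simp
    next
      case False
      hence N: "N \<ge> 1" by simp
      show ?thesis
      proof (rule has_sum_mono2[OF hC[of N] *[OF N]])
        show "{n. 0 < n \<and> (\<forall>p\<in>{p. prime p \<and> p \<le> N}. \<not> p dvd n)} \<subseteq> {1} \<union> ({0<..} - {1..N})"
        proof safe
          fix n :: nat assume n: "0 < n" "\<forall>p\<in>{p. prime p \<and> p \<le> N}. \<not> p dvd n" "n \<in> {1..N}" "n \<noteq> 1"
          obtain p where p: "prime p" "p dvd n" using prime_factor_nat[OF n(4)] by blast
          hence "p \<le> n" using n(1) by (auto dest: dvd_imp_le)
          thus False using n p by auto
        qed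
      qed (use f0 in auto)
    qed
    have "sum f {1..N} = (\<Sum>n<Suc N. f n)"
      by (rule sum.mono_neutral_left) (auto simp: f_def)
    thus ?thesis using ** by simp
  qed
  show "(\<Sum>p | prime p \<and> p \<le> N. - ln (1 - real p powr (-(1 + \<delta>)))) \<le> ln F"
  proof -
    have "0 \<le> ln (F * Pr N)" using lo[of N] by (rule ln_ge_zero)
    thus ?thesis using lnPr[of N] F0 Pr0[of N] by (simp add: ln_mult s_def)
  qed
  show "(\<lambda>N. \<Sum>p | prime p \<and> p \<le> N. - ln (1 - real p powr (-(1 + \<delta>)))) \<longlonglongrightarrow> ln F"
  proof -
    have "(\<lambda>N. 1 + (F - (\<Sum>n<Suc N. f n))) \<longlonglongrightarrow> 1 + (F - F)"
      using sF[unfolded sums_def] by (intro tendsto_intros LIMSEQ_Suc)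
    hence lim: "(\<lambda>N. 1 + (F - (\<Sum>n<Suc N. f n))) \<longlonglongrightarrow> 1" by simp
    have "(\<lambda>N. F * Pr N) \<longlonglongrightarrow> 1"
    proof (rule tendsto_sandwich[OF _ _ tendsto_const lim])
      show "\<forall>\<^sub>F N in sequentially. 1 \<le> F * Pr N" using lo by simp
      show "\<forall>\<^sub>F N in sequentially. F * Pr N \<le> 1 + (F - (\<Sum>n<Suc N. f n))" using up by simp
    qed
    hence "(\<lambda>N. ln F - ln (F * Pr N)) \<longlonglongrightarrow> ln F - ln 1" by (intro tendsto_intros) auto
    moreover have "ln F - ln (F * Pr N) = - ln (Pr N)" for N using F0 Pr0[of N] by (simp add: ln_mult)
    ultimately show ?thesis using lnPr by (simp add: s_def)
  qed
  have ms: "-s = -\<delta> - 1" by (simp add: s_def)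
  have cmp: "f (Suc n) \<le> (real n powr (-\<delta>) - real (Suc n) powr (-\<delta>)) / \<delta> \<and>
      (real n powr (-\<delta>) - real (Suc n) powr (-\<delta>)) / \<delta> \<le> f n" if n: "n \<ge> 1" for n
  proof -
    have "\<exists>z>real n. z < real (Suc n) \<and> - (real (Suc n) powr (-\<delta>)) / \<delta> - (- (real n powr (-\<delta>)) / \<delta>) = (real (Suc n) - real n) * (z powr (-s))"
    proof (rule MVT2[of "real n" "real (Suc n)" "\<lambda>z. - (z powr (-\<delta>)) / \<delta>" "\<lambda>z. z powr (-s)"])
      fix z assume "real n \<le> z"
      hence "z > 0" using n by linarith
      thus "((\<lambda>z. - (z powr (-\<delta>)) / \<delta>) has_real_derivative z powr (-s)) (at z)"
        using DERIV_cdivide[OF DERIV_minus[OF has_real_derivative_powr[of z "-\<delta>"]], of \<delta>] d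
        unfolding ms by simp
    qed simp
    then obtain z where z1: "real n < z" "z < real (Suc n)"
      and z2: "- (real (Suc n) powr (-\<delta>)) / \<delta> - (- (real n powr (-\<delta>)) / \<delta>) = (real (Suc n) - real n) * (z powr (-s))"
      by blast
    have "(real n powr (-\<delta>) - real (Suc n) powr (-\<delta>)) / \<delta>
        = - (real (Suc n) powr (-\<delta>)) / \<delta> - (- (real n powr (-\<delta>)) / \<delta>)"
      unfolding diff_divide_distrib minus_divide_left[symmetric] by linarith
    also have "\<dots> = z powr (-s)" unfolding z2 by simp
    finally have "(real n powr (-\<delta>) - real (Suc n) powr (-\<delta>)) / \<delta> = z powr (-s)" .
    note z = z1 this
    have "f (Suc n) \<le> z powr (-s)" "z powr (-s) \<le> f n"
      unfolding f_def using z n d by (auto intro!: powr_mono2' simp: s_def simp del: of_nat_Suc)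
    thus ?thesis using z by simp
  qed
  have p1: "(\<Sum>n=1..N. f n) \<ge> (1 - real (Suc N) powr (-\<delta>)) / \<delta>" for N
  proof (induction N)
    case (Suc N)
    have "(1 - real (Suc (Suc N)) powr (-\<delta>)) / \<delta> = (1 - real (Suc N) powr (-\<delta>)) / \<delta> + (real (Suc N) powr (-\<delta>) - real (Suc (Suc N)) powr (-\<delta>)) / \<delta>"
      by (simp add: diff_divide_distrib)
    moreover have "(\<Sum>n=1..Suc N. f n) = (\<Sum>n=1..N. f n) + f (Suc N)" "(\<Sum>n=1..Suc (Suc N). f n) = (\<Sum>n=1..Suc N. f n) + f (Suc (Suc N))"
      by simp_all
    ultimately show ?case using Suc cmp[of "Suc N"] by linarith
  qed simp
  have p2: "(\<Sum>n=1..Suc N. f n) \<le> 1 + (1 - real (Suc N) powr (-\<delta>)) / \<delta>" for N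
  proof (induction N)
    case (Suc N)
    have "(1 - real (Suc (Suc N)) powr (-\<delta>)) / \<delta> = (1 - real (Suc N) powr (-\<delta>)) / \<delta> + (real (Suc N) powr (-\<delta>) - real (Suc (Suc N)) powr (-\<delta>)) / \<delta>"
      by (simp add: diff_divide_distrib)
    moreover have "(\<Sum>n=1..Suc N. f n) = (\<Sum>n=1..N. f n) + f (Suc N)" "(\<Sum>n=1..Suc (Suc N). f n) = (\<Sum>n=1..Suc N. f n) + f (Suc (Suc N))"
      by simp_all
    ultimately show ?case using Suc cmp[of "Suc N"] by linarith
  qed (simp add: f_def)
  have eqs: "(\<Sum>n<Suc N. f n) = (\<Sum>n=1..N. f n)" for N
    by (rule sum.mono_neutral_right) (auto simp: f_def)
  have l1: "(\<lambda>N. \<Sum>n=1..N. f n) \<longlonglongrightarrow> F"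
    using LIMSEQ_Suc[OF sF[unfolded sums_def]] unfolding eqs .
  show "F \<ge> 1 / \<delta>"
  proof (rule LIMSEQ_le[OF _ l1])
    have l0: "(\<lambda>N. real (Suc N) powr (-\<delta>)) \<longlonglongrightarrow> 0" using d by real_asymp
    from tendsto_divide[OF tendsto_diff[OF tendsto_const l0] tendsto_const, of \<delta> 1] d
    show "(\<lambda>N. (1 - real (Suc N) powr (-\<delta>)) / \<delta>) \<longlonglongrightarrow> 1 / \<delta>" by simp
    show "\<exists>M. \<forall>N\<ge>M. (1 - real (Suc N) powr (-\<delta>)) / \<delta> \<le> (\<Sum>n=1..N. f n)" using p1 by blast
  qed
  show "F \<le> 1 + 1 / \<delta>"
  proof (rule LIMSEQ_le_const2[OF LIMSEQ_Suc[OF l1]])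
    have "(\<Sum>n=1..Suc N. f n) \<le> 1 + 1 / \<delta>" for N
    proof -
      have "(1 - real (Suc N) powr (-\<delta>)) / \<delta> \<le> 1 / \<delta>" using d by (intro divide_right_mono) auto
      thus ?thesis using p2[of N] by linarith
    qed
    thus "\<exists>N. \<forall>n\<ge>N. (\<Sum>n=1..Suc n. f n) \<le> 1 + 1 / \<delta>" by blast
  qed
qed

text \<open>Used with q = 1/p and r = p^(-delta), to exchange the weighted Mertens term for the
  logarithm of the Euler factor of zeta(1 + delta). One direction is convexity of exp. The other
  applies the mean value theorem in r; its error carries 1 - r and so disappears as delta tends to
  0.\<close>

lemma mertens_weight_bounds:
  fixes q r :: real
  assumes q: "0 < q" "q \<le> 1 / 2" and r: "0 < r" "r \<le> 1"
  shows "- ln (1 - q * r) \<le> - ln (1 - q) * r"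
    and "- ln (1 - q) * r \<le> - ln (1 - q * r) + 2 * q\<^sup>2 * (1 - r)"
proof -
  have qr: "q * r \<le> 1 / 2" using q r mult_mono[of q "1/2" r 1] by simp
  have "exp ((1 - r) * 0 + r * ln (1 - q)) \<le> (1 - r) * exp 0 + r * exp (ln (1 - q))"
    using convex_onD[OF exp_convex, of r 0 "ln (1 - q)"] r by simp
  also have "\<dots> = 1 - q * r" using q by (simp add: algebra_simps)
  finally have "exp (r * ln (1 - q)) \<le> 1 - q * r" by simp
  hence "r * ln (1 - q) \<le> ln (1 - q * r)" using qr by (subst ln_ge_iff) auto
  thus "- ln (1 - q * r) \<le> - ln (1 - q) * r" by (simp add: mult.commute)
  show "- ln (1 - q) * r \<le> - ln (1 - q * r) + 2 * q\<^sup>2 * (1 - r)"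
  proof (cases "r = 1")
    case False
    hence r1: "r < 1" using r by simp
    have "\<exists>z>r. z < 1 \<and> (- 1 * ln (1 - q) + ln (1 - q * 1)) - (- r * ln (1 - q) + ln (1 - q * r)) = (1 - r) * (- ln (1 - q) - q / (1 - q * z))"
    proof (rule MVT2[OF r1, of "\<lambda>z. - z * ln (1 - q) + ln (1 - q * z)" "\<lambda>z. - ln (1 - q) - q / (1 - q * z)"])
      fix z assume "r \<le> z" "z \<le> 1"
      hence "q * z \<le> (1/2) * 1" using q r by (intro mult_mono) auto
      thus "((\<lambda>z. - z * ln (1 - q) + ln (1 - q * z)) has_real_derivative - ln (1 - q) - q / (1 - q * z)) (at z)"
        by (auto intro!: derivative_eq_intros simp: field_simps)
    qed
    then obtain z where z: "r < z" "z < 1" "- r * ln (1 - q) + ln (1 - q * r) = (1 - r) * (ln (1 - q) + q / (1 - q * z))"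
      by (auto simp: algebra_simps)
    have "q * z \<le> (1 / 2) * 1" using q r z by (intro mult_mono) auto
    hence "q / (1 - q * z) \<le> q / (1 - q)"
      using q z mult_left_mono[of z 1 q] by (intro divide_left_mono mult_pos_pos) auto
    moreover have "ln (1 - q) \<le> - q" using ln_le_minus_one[of "1 - q"] q by simp
    moreover have "q / (1 - q) - q = q\<^sup>2 / (1 - q)" using q by (simp add: field_simps power2_eq_square)
    moreover have "q\<^sup>2 / (1 - q) \<le> q\<^sup>2 / (1 / 2)" using q by (intro divide_left_mono) auto
    ultimately have "ln (1 - q) + q / (1 - q * z) \<le> 2 * q\<^sup>2" by simp
    hence "(1 - r) * (ln (1 - q) + q / (1 - q * z)) \<le> (1 - r) * (2 * q\<^sup>2)"
      using r by (intro mult_left_mono) auto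
    thus ?thesis using z(3) by (simp add: algebra_simps)
  qed simp
qed

text \<open>For primes with e^k < p <= e^(k+1) the weight p^(-delta) lies between x^(k+1) and x^k.
  Freezing it on each such block costs at most a factor x, which tends to 1 with delta tending to
  0.\<close>

lemma mertens_sum_step_bounds:
  fixes \<delta> :: real
  assumes d: "\<delta> > 0"
  defines "x \<equiv> exp (- \<delta>)" and "Q \<equiv> (\<lambda>k. mertens_sum (nat \<lfloor>exp (real k)\<rfloor>))"
  defines "T \<equiv> (\<lambda>N. \<Sum>p | prime p \<and> p \<le> N. - ln (1 - 1 / real p) * real p powr (-\<delta>))"
  shows "(\<Sum>k<K. (Q (Suc k) - Q k) * x ^ Suc k) \<le> T (nat \<lfloor>exp (real K)\<rfloor>)"
    and "x * T (nat \<lfloor>exp (real K)\<rfloor>) \<le> (\<Sum>k<K. (Q (Suc k) - Q k) * x ^ Suc k)"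
proof -
  define N where "N k = nat \<lfloor>exp (real k)\<rfloor>" for k
  have mono: "N k \<le> N (Suc k)" for k unfolding N_def by (intro nat_mono floor_mono) simp
  define A where "A k = {p. prime p \<and> N k < p \<and> p \<le> N (Suc k)}" for k
  have split: "{p. prime p \<and> p \<le> N (Suc k)} = {p. prime p \<and> p \<le> N k} \<union> A k" for k
    using mono[of k] by (auto simp: A_def)
  have fin: "finite (A k)" for k unfolding A_def by simp
  have Un: "(\<Sum>p | prime p \<and> p \<le> N (Suc k). g p) = (\<Sum>p | prime p \<and> p \<le> N k. g p) + (\<Sum>p\<in>A k. g p)" for g :: "nat \<Rightarrow> real" and k
    unfolding split by (rule sum.union_disjoint) (auto simp: fin, auto simp: A_def)
  have Qd: "Q (Suc k) - Q k = (\<Sum>p\<in>A k. - ln (1 - 1 / real p))" for k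
    unfolding Q_def mertens_sum_def N_def[symmetric] Un by simp
  have Td: "T (N (Suc k)) = T (N k) + (\<Sum>p\<in>A k. - ln (1 - 1 / real p) * real p powr (-\<delta>))" for k
    unfolding T_def Un ..
  have w: "- ln (1 - 1 / real p) \<ge> 0" if "p \<in> A k" for p k
  proof -
    have "p > 1" using that prime_gt_1_nat[of p] by (auto simp: A_def)
    thus ?thesis by (simp add: ln_le_zero_iff)
  qed
  have xk: "x ^ k = exp (real k) powr (-\<delta>)" for k
    by (simp add: x_def powr_def exp_of_nat_mult[symmetric] mult_ac)
  have b: "x ^ Suc k \<le> real p powr (-\<delta>) \<and> x * real p powr (-\<delta>) \<le> x ^ Suc k" if "p \<in> A k" for p k
  proof -
    have p: "p > 0" "N k < p" "p \<le> N (Suc k)" using that prime_gt_0_nat by (auto simp: A_def)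
    have "real p \<le> exp (real (Suc k))" using p unfolding N_def by linarith
    hence 1: "x ^ Suc k \<le> real p powr (-\<delta>)" unfolding xk using d p by (intro powr_mono2') auto
    have "exp (real k) \<le> real p" using p unfolding N_def by linarith
    hence "real p powr (-\<delta>) \<le> x ^ k" unfolding xk using d p by (intro powr_mono2') auto
    hence "x * real p powr (-\<delta>) \<le> x ^ Suc k" by (simp add: x_def)
    with 1 show ?thesis by simp
  qed
  have N0: "N 0 = 1" by (simp add: N_def)
  have no: "{p::nat. prime p \<and> p \<le> 1} = {}" by (auto dest!: prime_gt_1_nat)
  have T0: "T (N 0) = 0" unfolding T_def N0 no by simp
  have "(\<Sum>k<K. (Q (Suc k) - Q k) * x ^ Suc k) \<le> T (N K) \<and> x * T (N K) \<le> (\<Sum>k<K. (Q (Suc k) - Q k) * x ^ Suc k)"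
  proof (induction K)
    case (Suc K)
    have "(Q (Suc K) - Q K) * x ^ Suc K \<le> (\<Sum>p\<in>A K. - ln (1 - 1 / real p) * real p powr (-\<delta>))"
      unfolding Qd sum_distrib_right by (intro sum_mono mult_left_mono w) (use b in blast)+
    moreover have "x * (\<Sum>p\<in>A K. - ln (1 - 1 / real p) * real p powr (-\<delta>)) \<le> (Q (Suc K) - Q K) * x ^ Suc K"
    proof -
      have "x * (\<Sum>p\<in>A K. - ln (1 - 1 / real p) * real p powr (-\<delta>)) = (\<Sum>p\<in>A K. - ln (1 - 1 / real p) * (x * real p powr (-\<delta>)))"
        unfolding sum_distrib_left by (rule sum.cong) auto
      also have "\<dots> \<le> (Q (Suc K) - Q K) * x ^ Suc K"
        unfolding Qd sum_distrib_right by (intro sum_mono mult_left_mono w) (use b in blast)+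
      finally show ?thesis .
    qed
    ultimately show ?case using Suc unfolding Td distrib_left sum.lessThan_Suc by linarith
  qed (simp add: T0)
  thus "(\<Sum>k<K. (Q (Suc k) - Q k) * x ^ Suc k) \<le> T (nat \<lfloor>exp (real K)\<rfloor>)"
    "x * T (nat \<lfloor>exp (real K)\<rfloor>) \<le> (\<Sum>k<K. (Q (Suc k) - Q k) * x ^ Suc k)"
    unfolding N_def by auto
qed



text \<open>Sampling at e^k turns log log N into log k up to o(1), that is, into the k-th harmonic
  number minus gamma. The harmonic numbers are preferred because their generating function is
  explicit.\<close>

lemma mangoldt_log_sum_harm_limit:
  assumes c: "\<And>N. N \<ge> 2 \<Longrightarrow> \<bar>mertens_sum N - ln (ln (real N)) - c\<bar> \<le> C / ln (real N)"
  shows "(\<lambda>k. mertens_sum (nat \<lfloor>exp (real k)\<rfloor>) - harm k) \<longlonglongrightarrow> c - euler_mascheroni"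
proof -
  define N where "N k = nat \<lfloor>exp (real k)\<rfloor>" for k
  have N: "real (N k) \<le> exp (real k)" "exp (real k) - 1 \<le> real (N k)" for k
  proof -
    have "exp (real k) > 0" by simp
    thus "real (N k) \<le> exp (real k)" "exp (real k) - 1 \<le> real (N k)" unfolding N_def by linarith+
  qed
  have top: "filterlim N at_top sequentially"
    unfolding N_def by (rule filterlim_compose[OF filterlim_nat_sequentially],
        rule filterlim_compose[OF filterlim_floor_sequentially]) real_asymp
  have 1: "(\<lambda>n. mertens_sum n - ln (ln (real n)) - c) \<longlonglongrightarrow> 0"
  proof (rule Lim_null_comparison)
    show "\<forall>\<^sub>F n in sequentially. norm (mertens_sum n - ln (ln (real n)) - c) \<le> C / ln (real n)"
      using eventually_ge_at_top[of 2] by eventually_elim (use c in auto)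
    show "(\<lambda>n. C / ln (real n)) \<longlonglongrightarrow> 0" by real_asymp
  qed
  have 2: "(\<lambda>k. mertens_sum (N k) - ln (ln (real (N k))) - c) \<longlonglongrightarrow> 0"
    by (rule filterlim_compose[OF 1 top])
  have 3: "(\<lambda>k. ln (ln (real (N k))) - ln (real k)) \<longlonglongrightarrow> 0"
  proof (rule tendsto_sandwich[of "\<lambda>k. ln (ln (exp (real k) - 1)) - ln (real k)" _ _ "\<lambda>k. 0"])
    have "\<forall>\<^sub>F k in sequentially. exp (real k) - 1 > exp 0" by real_asymp
    moreover have "\<forall>\<^sub>F k in sequentially. k > (0::nat)" by real_asymp
    ultimately have ev: "\<forall>\<^sub>F k in sequentially. ln (ln (exp (real k) - 1)) \<le> ln (ln (real (N k))) \<and> ln (ln (real (N k))) \<le> ln (real k)"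
    proof eventually_elim
      case (elim k)
      have e: "ln (exp (real k) - 1) > 0" using elim by (intro ln_gt_zero) simp
      have le: "ln (exp (real k) - 1) \<le> ln (real (N k))" using N(2)[of k] elim by (subst ln_le_cancel_iff) auto
      have N0: "real (N k) > 0" using N(2)[of k] elim by simp
      have "ln (real (N k)) \<le> ln (exp (real k))" using N(1)[of k] N0 by (subst ln_le_cancel_iff) auto
      hence le2: "ln (real (N k)) \<le> real k" by simp
      show ?case
        by (intro conjI; subst ln_le_cancel_iff) (use e le le2 elim in \<open>linarith | simp\<close>)+
    qed
    show "\<forall>\<^sub>F k in sequentially. ln (ln (exp (real k) - 1)) - ln (real k) \<le> ln (ln (real (N k))) - ln (real k)"
      using ev by eventually_elim auto
    show "\<forall>\<^sub>F k in sequentially. ln (ln (real (N k))) - ln (real k) \<le> 0"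
      using ev by eventually_elim auto
    show "(\<lambda>k. ln (ln (exp (real k) - 1)) - ln (real k)) \<longlonglongrightarrow> 0" by real_asymp
  qed simp
  have 4: "(\<lambda>k. harm k - ln (real k)) \<longlonglongrightarrow> (euler_mascheroni :: real)" by (rule euler_mascheroni_LIMSEQ)
  have "(\<lambda>k. (mertens_sum (N k) - ln (ln (real (N k))) - c) + (ln (ln (real (N k))) - ln (real k)) - (harm k - ln (real k)) + c)
     \<longlonglongrightarrow> 0 + 0 - euler_mascheroni + c"
    by (intro tendsto_intros 2 3 4)
  thus ?thesis unfolding N_def by (simp add: algebra_simps)
qed

text \<open>Summing the weight exchange over primes, with 1 - p^(-delta) <= delta log p. The
  constant is 18 = 2 * 9, with 9 the bound for the sum of Lambda(n) / n^2 from n = 2 on.\<close>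

lemma mertens_prime_sum_powr_bounds:
  fixes \<delta> :: real and N :: nat
  assumes d: "\<delta> > 0"
  defines "T \<equiv> (\<Sum>p | prime p \<and> p \<le> N. - ln (1 - 1 / real p) * real p powr (-\<delta>))"
    and "U \<equiv> (\<Sum>p | prime p \<and> p \<le> N. - ln (1 - real p powr (-(1 + \<delta>))))"
  shows "U \<le> T" "T \<le> U + 18 * \<delta>"
proof -
  have pw: "real p powr (-(1 + \<delta>)) = (1 / real p) * real p powr (-\<delta>)" if "prime p" for p
    using prime_gt_0_nat[OF that] by (simp add: powr_diff powr_minus_divide powr_add field_simps)
  have pb: "0 < 1 / real p \<and> 1 / real p \<le> 1 / 2 \<and> 0 < real p powr (-\<delta>) \<and> real p powr (-\<delta>) \<le> 1" if "prime p" for p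
  proof -
    have "real p \<ge> 2" using prime_ge_2_nat[OF that] by simp
    moreover from this have "real p powr (-\<delta>) \<le> real p powr 0" using d by (intro powr_mono) auto
    ultimately show ?thesis by (auto simp: field_simps)
  qed
  show "U \<le> T" unfolding U_def T_def
  proof (rule sum_mono, clarify)
    fix p :: nat assume p: "prime p"
    show "- ln (1 - real p powr (-(1 + \<delta>))) \<le> - ln (1 - 1 / real p) * real p powr (-\<delta>)"
      unfolding pw[OF p] using pb[OF p] by (intro mertens_weight_bounds) auto
  qed
  have "T \<le> (\<Sum>p | prime p \<and> p \<le> N. - ln (1 - real p powr (-(1 + \<delta>))) + 2 * \<delta> * (mangoldt p / (real p)\<^sup>2))"
    unfolding T_def
  proof (rule sum_mono, clarify)
    fix p :: nat assume p: "prime p"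
    have "- ln (1 - 1 / real p) * real p powr (-\<delta>) \<le> - ln (1 - real p powr (-(1 + \<delta>))) + 2 * (1 / real p)\<^sup>2 * (1 - real p powr (-\<delta>))"
      unfolding pw[OF p] using pb[OF p] by (intro mertens_weight_bounds) auto
    also have "1 - real p powr (-\<delta>) \<le> \<delta> * ln (real p)"
      using exp_ge_add_one_self[of "- \<delta> * ln (real p)"] prime_gt_0_nat[OF p] by (simp add: powr_def)
    hence "2 * (1 / real p)\<^sup>2 * (1 - real p powr (-\<delta>)) \<le> 2 * (1 / real p)\<^sup>2 * (\<delta> * ln (real p))"
      by (intro mult_left_mono) auto
    also have "2 * (1 / real p)\<^sup>2 * (\<delta> * ln (real p)) = 2 * \<delta> * (mangoldt p / (real p)\<^sup>2)"
      using p by (simp add: mangoldt_def power_divide)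
    finally show "- ln (1 - 1 / real p) * real p powr (-\<delta>) \<le> - ln (1 - real p powr (-(1 + \<delta>))) + 2 * \<delta> * (mangoldt p / (real p)\<^sup>2)"
      by simp
  qed
  also have "\<dots> = U + 2 * \<delta> * (\<Sum>p | prime p \<and> p \<le> N. mangoldt p / (real p)\<^sup>2)"
    unfolding U_def by (simp only: sum.distrib sum_distrib_left)
  also have "(\<Sum>p | prime p \<and> p \<le> N. mangoldt p / (real p)\<^sup>2) \<le> (\<Sum>n=1+1..N. mangoldt n / (real n)\<^sup>2)"
    by (intro sum_mono2) (auto simp: mangoldt_nonneg' dest: prime_ge_2_nat)
  also have "\<dots> \<le> 9 / real 1" by (rule mangoldt_sq_tail) simp
  finally show "T \<le> U + 18 * \<delta>" using d by (simp add: mult_left_mono)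
qed

text \<open>
  The constant in Mertens' theorem is \<open>\<gamma>\<close>: with \<open>x = exp (- \<delta>)\<close>, the Abel means of the prime sum over \<open>p \<le> e\<^sup>k\<close>
  approximate \<open>log \<zeta>(1 + \<delta>)\<close>, those of the harmonic numbers are \<open>- log (1 - x)\<close>, and the two are asymptotic to the same \<open>log (1 / \<delta>)\<close>.
\<close>
lemma mertens_constant:
  assumes c: "\<And>N. N \<ge> 2 \<Longrightarrow> \<bar>mertens_sum N - ln (ln (real N)) - c\<bar> \<le> C / ln (real N)"
  shows "c = euler_mascheroni"
proof -
  define Q where "Q = (\<lambda>k. mertens_sum (nat \<lfloor>exp (real k)\<rfloor>))"
  define u where "u = (\<lambda>k. Q k - harm k)"
  have u: "u \<longlonglongrightarrow> c - euler_mascheroni"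
    unfolding u_def Q_def by (rule mangoldt_log_sum_harm_limit[OF c])
  define S where "S x = (1 - x) * (\<Sum>k. Q k * x ^ k)" for x
  have smh: "summable (\<lambda>k. harm k * x ^ k)" if x: "0 < x" "x < 1" for x :: real
  proof (rule summable_comparison_test'[of "\<lambda>k. real (Suc k) * x ^ k" 0])
    show "summable (\<lambda>k. real (Suc k) * x ^ k)" using geometric_deriv_sums[of x] x by (auto simp: sums_iff)
    fix k :: nat
    have "harm k \<le> real (Suc k)" 
    proof (induction k)
      case (Suc k)
      have "inverse (real (Suc k)) \<le> 1" by (simp add: field_simps)
      thus ?case using Suc by (simp add: harm_Suc)
    qed (simp add: harm_def)
    thus "norm (harm k * x ^ k) \<le> real (Suc k) * x ^ k"
      using x harm_nonneg[of k, where 'a=real] by (simp add: abs_mult mult_right_mono)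
  qed
  have smQ: "summable (\<lambda>k. Q k * x ^ k)" if x: "0 < x" "x < 1" for x
    using summable_add[OF abel_mean(2)[OF u x] smh[OF x]] by (simp add: u_def algebra_simps)
  \<comment> \<open>The harmonic numbers have generating function -log (1 - x) / (1 - x), so their
    Abel mean is exactly -log (1 - x).\<close>
  have Shu: "S x + ln (1 - x) = (1 - x) * (\<Sum>k. u k * x ^ k)" if x: "0 < x" "x < 1" for x
  proof -
    have "(\<lambda>k. (harm (Suc k) - harm k) * x ^ Suc k) sums ((1 - x) * (\<Sum>k. harm k * x ^ k))"
      by (rule power_series_diff) (use smh x in \<open>auto simp: harm_def\<close>)
    moreover have "(\<lambda>k. (harm (Suc k) - harm k) * x ^ Suc k) = (\<lambda>k. x ^ Suc k / real (Suc k))"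
      by (simp add: harm_Suc inverse_eq_divide)
    ultimately have "(1 - x) * (\<Sum>k. harm k * x ^ k) = - ln (1 - x)"
      using minus_ln_one_minus_sums[of x] x by (simp add: sums_iff)
    moreover have "(\<Sum>k. u k * x ^ k) = (\<Sum>k. Q k * x ^ k) - (\<Sum>k. harm k * x ^ k)"
      unfolding u_def by (simp add: left_diff_distrib suminf_diff smQ smh x)
    ultimately show ?thesis by (simp add: S_def right_diff_distrib)
  qed
  have bounds: "exp (-\<delta>) * ln (1 / \<delta>) \<le> S (exp (-\<delta>))" "S (exp (-\<delta>)) \<le> ln (1 + 1 / \<delta>) + 18 * \<delta>" if d: "\<delta> > 0" for \<delta>
  proof -
    define x where "x = exp (-\<delta>)"
    have x: "0 < x" "x < 1" using d by (auto simp: x_def)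
    let ?N = "\<lambda>k. nat \<lfloor>exp (real k)\<rfloor>"
    define T where "T = (\<lambda>N. \<Sum>p | prime p \<and> p \<le> N. - ln (1 - 1 / real p) * real p powr (-\<delta>))"
    define U where "U = (\<lambda>N. \<Sum>p | prime p \<and> p \<le> N. - ln (1 - real p powr (-(1 + \<delta>))))"
    define F where "F = (\<Sum>n. real n powr (-(1 + \<delta>)))"
    note z = zeta_prime_sums[OF d, folded F_def]
    have "Q 0 = 0" 
    proof -
      have "{p::nat. prime p \<and> p \<le> 1} = {}" by (auto dest!: prime_gt_1_nat)
      hence "mertens_sum 1 = 0" unfolding mertens_sum_def by (simp only: sum.empty)
      thus ?thesis by (simp add: Q_def)
    qed
    hence "(\<lambda>k. (Q (Suc k) - Q k) * x ^ Suc k) sums S x"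
      unfolding S_def by (intro power_series_diff smQ x)
    hence l: "(\<lambda>K. \<Sum>k<K. (Q (Suc k) - Q k) * x ^ Suc k) \<longlonglongrightarrow> S x" by (simp add: sums_def)
    have st: "(\<Sum>k<K. (Q (Suc k) - Q k) * x ^ Suc k) \<le> T (?N K)" "x * T (?N K) \<le> (\<Sum>k<K. (Q (Suc k) - Q k) * x ^ Suc k)" for K
      using mertens_sum_step_bounds[OF d, of K] unfolding x_def Q_def T_def by auto
    have TU: "U n \<le> T n" "T n \<le> U n + 18 * \<delta>" for n
      unfolding U_def T_def using mertens_prime_sum_powr_bounds[OF d] by auto
    have "S x \<le> ln F + 18 * \<delta>"
    proof (rule LIMSEQ_le_const2[OF l])
      have "(\<Sum>k<K. (Q (Suc k) - Q k) * x ^ Suc k) \<le> ln F + 18 * \<delta>" for K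
        using st(1)[of K] TU(2)[of "?N K"] z(1)[of "?N K"] unfolding U_def by linarith
      thus "\<exists>M. \<forall>K\<ge>M. (\<Sum>k<K. (Q (Suc k) - Q k) * x ^ Suc k) \<le> ln F + 18 * \<delta>" by blast
    qed
    moreover have "ln F \<le> ln (1 + 1 / \<delta>)" using z(3,4) d by (subst ln_le_cancel_iff) (auto intro: less_le_trans[of 0 "1/\<delta>"] add_pos_pos)
    ultimately show "S (exp (-\<delta>)) \<le> ln (1 + 1 / \<delta>) + 18 * \<delta>" unfolding x_def by linarith
    have top: "filterlim ?N at_top sequentially"
    proof (rule filterlim_compose[OF filterlim_nat_sequentially])
      show "filterlim (\<lambda>k. \<lfloor>exp (real k)\<rfloor>) at_top sequentially"
        by (rule filterlim_compose[OF filterlim_floor_sequentially]) real_asymp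
    qed
    have "(\<lambda>K. x * U (?N K)) \<longlonglongrightarrow> x * ln F"
      unfolding U_def by (intro tendsto_mult tendsto_const filterlim_compose[OF z(2) top])
    hence "x * ln F \<le> S x"
    proof (rule LIMSEQ_le[OF _ l])
      have "x * U (?N K) \<le> (\<Sum>k<K. (Q (Suc k) - Q k) * x ^ Suc k)" for K
        using st(2)[of K] mult_left_mono[OF TU(1)[of "?N K"], of x] x by linarith
      thus "\<exists>M. \<forall>K\<ge>M. x * U (?N K) \<le> (\<Sum>k<K. (Q (Suc k) - Q k) * x ^ Suc k)" by blast
    qed
    moreover have "ln (1 / \<delta>) \<le> ln F" using z(3) d by (subst ln_le_cancel_iff) (auto intro: less_le_trans[of 0 "1/\<delta>"])
    hence "x * ln (1 / \<delta>) \<le> x * ln F" using x by (intro mult_left_mono) auto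
    ultimately show "exp (-\<delta>) * ln (1 / \<delta>) \<le> S (exp (-\<delta>))" unfolding x_def by linarith
  qed
  have pos: "\<forall>\<^sub>F \<delta> in at_right (0::real). \<delta> > 0" by (simp add: eventually_at_right_less)
  \<comment> \<open>Since 1 - e^(-delta) is asymptotic to delta, both bounds for \<open>S\<close>
    cancel against log (1 - x). The same expression is an Abel mean with limit c - gamma, so that
    difference vanishes.\<close>
  have "((\<lambda>\<delta>. S (exp (-\<delta>)) + ln (1 - exp (-\<delta>))) \<longlongrightarrow> 0) (at_right 0)"
  proof (rule tendsto_sandwich)
    show "\<forall>\<^sub>F \<delta> in at_right 0. exp (-\<delta>) * ln (1 / \<delta>) + ln (1 - exp (-\<delta>)) \<le> S (exp (-\<delta>)) + ln (1 - exp (-\<delta>))"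
      using pos by eventually_elim (use bounds in auto)
    show "\<forall>\<^sub>F \<delta> in at_right 0. S (exp (-\<delta>)) + ln (1 - exp (-\<delta>)) \<le> ln (1 + 1 / \<delta>) + 18 * \<delta> + ln (1 - exp (-\<delta>))"
      using pos by eventually_elim (use bounds in auto)
    show "((\<lambda>\<delta>. exp (-\<delta>) * ln (1 / \<delta>) + ln (1 - exp (-\<delta>))) \<longlongrightarrow> (0::real)) (at_right 0)" by real_asymp
    show "((\<lambda>\<delta>. ln (1 + 1 / \<delta>) + 18 * \<delta> + ln (1 - exp (-\<delta>))) \<longlongrightarrow> (0::real)) (at_right 0)" by real_asymp
  qed
  moreover have "((\<lambda>\<delta>. S (exp (-\<delta>)) + ln (1 - exp (-\<delta>))) \<longlongrightarrow> c - euler_mascheroni) (at_right 0)"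
  proof (rule Lim_transform_eventually)
    have "filterlim (\<lambda>\<delta>::real. exp (-\<delta>)) (at_left 1) (at_right 0)" by real_asymp
    from filterlim_compose[OF abel_mean(1)[OF u] this]
    show "((\<lambda>\<delta>. (1 - exp (-\<delta>)) * (\<Sum>k. u k * exp (-\<delta>) ^ k)) \<longlongrightarrow> c - euler_mascheroni) (at_right 0)" .
    show "\<forall>\<^sub>F \<delta> in at_right 0. (1 - exp (-\<delta>)) * (\<Sum>k. u k * exp (-\<delta>) ^ k) = S (exp (-\<delta>)) + ln (1 - exp (-\<delta>))"
      using pos by eventually_elim (use Shu in auto)
  qed
  ultimately have "c - euler_mascheroni = 0"
    by (intro tendsto_unique[OF trivial_limit_at_right_real]) auto
  thus ?thesis by simp
qed

section \<open>Mertens' theorem in the forms needed for the saddle point\<close>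

text \<open>Only the lower bound keeps an explicit 1 / log N term. Its coefficient 14/33 is 1 -
  19/33: the constant -1 below \<open>mangoldt_mean\<close> plus gamma > 19/33. The step from
  \<open>mangoldt_log_sum\<close> to \<open>mertens_sum\<close> costs nothing in this
  direction.\<close>

lemma mertens_sum_asymp:
  "\<exists>C>0. \<forall>N\<ge>2. mertens_sum N \<le> ln (ln (real N)) + euler_mascheroni + C / ln (real N) \<and>
     mertens_sum N \<ge> ln (ln (real N)) + euler_mascheroni - 14 / 33 / ln (real N) - C / (ln (real N))\<^sup>2"
proof -
  obtain c C where C: "C > 0" and G: "\<And>N. N \<ge> 2 \<Longrightarrow> \<bar>mangoldt_log_sum N - ln (ln (real N)) - c 
      - (mangoldt_mean N - ln (real N) + euler_mascheroni) / ln (real N)\<bar> \<le> C / (ln (real N))\<^sup>2"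
    using mangoldt_log_sum_asymp by blast
  let ?\<gamma> = "euler_mascheroni :: real"
  have g: "19 / 33 < ?\<gamma>" "?\<gamma> < 1" using euler_mascheroni_gt_19_over_33 euler_mascheroni_less_13_over_22 by auto
  have main: "mertens_sum N \<le> ln (ln (real N)) + c + (22 + 2 * C) / ln (real N) \<and>
      mertens_sum N \<ge> ln (ln (real N)) + c - 14 / 33 / ln (real N) - C / (ln (real N))\<^sup>2" if N: "N \<ge> 2" for N
  proof -
    define v where "v = ln (real N)"
    have "ln 2 \<le> v" unfolding v_def using N by (subst ln_le_cancel_iff) auto
    hence v: "v > 0" "v \<ge> 1 / 2" using ln2_ge_two_thirds by linarith+
    have "C / v\<^sup>2 = C * (1 / v) / v" by (simp add: power2_eq_square)
    also have "\<dots> \<le> C * 2 / v" using v C by (intro divide_right_mono mult_left_mono) (auto simp: field_simps)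
    finally have Cv: "C / v\<^sup>2 \<le> 2 * C / v" by (simp add: mult.commute)
    have m: "mangoldt_mean N - v + ?\<gamma> \<le> 4" "- 14 / 33 \<le> mangoldt_mean N - v + ?\<gamma>"
      using mangoldt_mean_bounds[of N] N g unfolding v_def by auto
    have m2: "(mangoldt_mean N - v + ?\<gamma>) / v \<le> 4 / v" "(- 14 / 33) / v \<le> (mangoldt_mean N - v + ?\<gamma>) / v"
      using m v by (intro divide_right_mono; simp)+
    have b: "mangoldt_log_sum N \<le> mertens_sum N" "mertens_sum N \<le> mangoldt_log_sum N + 18 / v"
      using mertens_sum_bounds[OF N] by (auto simp: v_def)
    have G': "\<bar>mangoldt_log_sum N - ln v - c - (mangoldt_mean N - v + ?\<gamma>) / v\<bar> \<le> C / v\<^sup>2"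
      using G[OF N] by (simp add: v_def)
    have e: "(22 + 2 * C) / v = 18 / v + 4 / v + 2 * C / v" by (simp add: add_divide_distrib[symmetric])
    have e': "(- 14 / 33) / v = - (14 / 33 / v)" by simp
    show ?thesis unfolding v_def[symmetric] e using m2 b G' Cv unfolding e' by linarith
  qed
  \<comment> \<open>A crude two-sided error O(1 / log N) is enough to identify c; the explicit lower
    bound is kept in \<open>main\<close> until then.\<close>
  have "\<bar>mertens_sum N - ln (ln (real N)) - c\<bar> \<le> (22 + 2 * C + 1) / ln (real N)" if N: "N \<ge> 2" for N
  proof -
    define v where "v = ln (real N)"
    have "ln 2 \<le> v" unfolding v_def using N by (subst ln_le_cancel_iff) auto
    hence v: "v > 0" "v \<ge> 1 / 2" using ln2_ge_two_thirds by linarith+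
    have "C / v\<^sup>2 = C * (1 / v) / v" by (simp add: power2_eq_square)
    also have "\<dots> \<le> C * 2 / v" using v C by (intro divide_right_mono mult_left_mono) (auto simp: field_simps)
    finally have Cv: "C / v\<^sup>2 \<le> 2 * C / v" by (simp add: mult.commute)
    have e: "(22 + 2 * C + 1) / v = 22 / v + 2 * C / v + 1 / v" by (simp add: add_divide_distrib[symmetric])
    have e2: "(22 + 2 * C) / v = 22 / v + 2 * C / v" by (simp add: add_divide_distrib[symmetric])
    have "14 / 33 / v \<le> 1 / v" "22 / v \<ge> 0" "1 / v \<ge> 0" using v by (auto simp: field_simps)
    thus ?thesis using main[OF N, folded v_def] Cv unfolding v_def[symmetric] e e2 by linarith
  qed
  hence c: "c = ?\<gamma>" by (rule mertens_constant)
  have "mertens_sum N \<le> ln (ln (real N)) + ?\<gamma> + (22 + 2 * C) / ln (real N) \<and>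
     mertens_sum N \<ge> ln (ln (real N)) + ?\<gamma> - 14 / 33 / ln (real N) - (22 + 2 * C) / (ln (real N))\<^sup>2" if N: "N \<ge> 2" for N
  proof -
    have "C / (ln (real N))\<^sup>2 \<le> (22 + 2 * C) / (ln (real N))\<^sup>2" using C by (intro divide_right_mono) auto
    thus ?thesis using main[OF N] unfolding c by linarith
  qed
  thus ?thesis using C by (intro exI[of _ "22 + 2 * C"]) auto
qed

lemma mertens_upper:
  "\<exists>C>0. \<forall>x\<ge>2. (\<Sum>p | prime p \<and> real p \<le> x. - ln (1 - 1 / real p)) \<le> ln (ln x) + euler_mascheroni + C / ln x"
proof -
  obtain C where C: "C > 0" "\<And>N. N \<ge> 2 \<Longrightarrow> mertens_sum N \<le> ln (ln (real N)) + euler_mascheroni + C / ln (real N)"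
    using mertens_sum_asymp by blast
  have "(\<Sum>p | prime p \<and> real p \<le> x. - ln (1 - 1 / real p)) \<le> ln (ln x) + euler_mascheroni + 2 * C / ln x" if x: "x \<ge> 2" for x
  proof -
    define N where "N = nat \<lfloor>x\<rfloor>"
    have N: "N \<ge> 2" "real N \<le> x" "x \<le> real N * real N"
    proof -
      show N: "N \<ge> 2" "real N \<le> x" using x unfolding N_def by linarith+
      have "x \<le> real N + 1" unfolding N_def by linarith
      also have "\<dots> \<le> real N * 2" using N by simp
      also have "\<dots> \<le> real N * real N" using N by (intro mult_left_mono) auto
      finally show "x \<le> real N * real N" .
    qed
    have l: "ln (real N) > 0" using N by simp
    have "ln x \<le> ln (real N * real N)" using x N by (subst ln_le_cancel_iff) auto
    hence l2: "ln x \<le> 2 * ln (real N)" using N by (simp add: ln_mult)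
    have "C / ln (real N) \<le> 2 * C / ln x"
      using l2 l C x mult_left_mono[OF l2, of C] by (simp add: field_simps)
    moreover have "ln (ln (real N)) \<le> ln (ln x)" using l N x by simp
    ultimately show ?thesis
      using C(2)[OF N(1)] unfolding mertens_sum_def N_def primes_le_nat by linarith
  qed
  thus ?thesis using C(1) by (intro exI[of _ "2 * C"]) auto
qed

text \<open>Removing log 2 from log x lowers log log x by at least about (2/3) / log x, which beats
  the loss (14/33) / log N. The shift by log 2 is exactly what y >= 2 e^t provides.\<close>

lemma mertens_lower:
  "\<exists>x0. \<forall>x\<ge>x0. (\<Sum>p | prime p \<and> real p \<le> x. - ln (1 - 1 / real p)) > ln (ln x - ln 2) + euler_mascheroni"
proof -
  obtain C where C: "C > 0" "\<And>N. N \<ge> 2 \<Longrightarrow> mertens_sum N \<ge> ln (ln (real N)) + euler_mascheroni - 14 / 33 / ln (real N) - C / (ln (real N))\<^sup>2"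
    using mertens_sum_asymp by blast
  have "\<forall>\<^sub>F N in sequentially. ln (ln (real N + 1) - 2 / 3) < ln (ln (real N)) - 14 / 33 / ln (real N) - C / (ln (real N))\<^sup>2"
    by real_asymp
  then obtain N0 where N0: "\<And>N. N \<ge> N0 \<Longrightarrow> ln (ln (real N + 1) - 2 / 3) < ln (ln (real N)) - 14 / 33 / ln (real N) - C / (ln (real N))\<^sup>2"
    by (auto simp: eventually_at_top_linorder)
  have "(\<Sum>p | prime p \<and> real p \<le> x. - ln (1 - 1 / real p)) > ln (ln x - ln 2) + euler_mascheroni"
    if x: "x \<ge> real (max N0 3)" for x
  proof -
    define N where "N = nat \<lfloor>x\<rfloor>"
    have N: "N \<ge> 3" "N \<ge> N0" "x \<le> real N + 1" 
    proof -
      have "real 3 \<le> x" "real N0 \<le> x" using x by auto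
      thus "N \<ge> 3" "N \<ge> N0" unfolding N_def using le_nat_floor by blast+
      show "x \<le> real N + 1" unfolding N_def by linarith
    qed
    have "ln 2 < ln x" using x by (subst ln_less_cancel_iff) auto
    moreover have "ln x \<le> ln (real N + 1)" using x N by (subst ln_le_cancel_iff) auto
    ultimately have "ln (ln x - ln 2) \<le> ln (ln (real N + 1) - 2 / 3)"
      using ln2_ge_two_thirds by (subst ln_le_cancel_iff) auto
    thus ?thesis using N0[OF N(2)] C(2)[of N] N unfolding mertens_sum_def N_def primes_le_nat by simp
  qed
  thus ?thesis by blast
qed



section \<open>A Fourier formula for the expectation of e^(-Z) on Z >= 0\<close>

lemma integrable_inverse_one_plus_sq: "integrable lborel (\<lambda>t::real. 1 / (1 + t\<^sup>2))"
  and integral_inverse_one_plus_sq: "(\<integral>t. 1 / (1 + t\<^sup>2) \<partial>lborel) = pi"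
  using integrable_inverse_1_plus_square LBINT_inverse_1_plus_square
  by (simp_all add: set_integrable_def interval_lebesgue_integral_def set_lebesgue_integral_def inverse_eq_divide)

lemma integrable_exp_sq: "integrable lborel (\<lambda>x::real. exp (- a * x\<^sup>2))"
  and integral_exp_sq: "(\<integral>x. exp (- a * x\<^sup>2) \<partial>lborel) = sqrt (pi / a)" if "a > 0" for a
proof -
  define \<sigma> where "\<sigma> = sqrt (1 / (2 * a))"
  have s: "\<sigma> > 0" "\<sigma>\<^sup>2 = 1 / (2 * a)" using that by (auto simp: \<sigma>_def)
  have e: "exp (- a * x\<^sup>2) = sqrt (2 * pi * \<sigma>\<^sup>2) * normal_density 0 \<sigma> x" for x
    using s that unfolding normal_density_def s(2) by (simp add: field_simps)
  show "integrable lborel (\<lambda>x::real. exp (- a * x\<^sup>2))" unfolding e using s by simp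
  show "(\<integral>x. exp (- a * x\<^sup>2) \<partial>lborel) = sqrt (pi / a)" unfolding e using s that by simp
qed

abbreviation std_exponential :: "real measure" where
  "std_exponential \<equiv> density lborel (\<lambda>x. ennreal (exponential_density 1 x))"

lemma prob_space_std_exponential: "prob_space std_exponential"
  using prob_space_exponential_density[of 1] by simp

lemma distributed_std_exponential: "distributed std_exponential lborel (\<lambda>x. x) (exponential_density 1)"
  by (auto simp: distributed_def distr_id2 exponential_density_nonneg)

lemma integrable_std_exponential: "integrable std_exponential (\<lambda>x. x)"
  and expectation_std_exponential: "(\<integral>x. x \<partial>std_exponential) = 1"
  using prob_space.erlang_ith_moment_integrable[OF prob_space_std_exponential _ distributed_std_exponential, of 1]
    prob_space.exponential_distributed_expectation[OF prob_space_std_exponential _ distributed_std_exponential]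
  by simp_all

lemma prob_std_exponential_gt:
  assumes "a \<ge> 0"
  shows "measure std_exponential {b. a < b} = exp (- a)"
  using prob_space.exponential_distributedD_gt[OF prob_space_std_exponential distributed_std_exponential assms]
  by simp

text \<open>The density supplies e^(-b), so the integrand is e^(-z b) on the half line. The exponent
  is written as 1 - z because z = 1 + i t is the case needed.\<close>

lemma integral_complex_exp:
  fixes z :: complex
  assumes z: "Re z > 0"
  shows "(\<integral>b. exponential_density 1 b *\<^sub>R exp ((1 - z) * of_real b) \<partial>lborel) = 1 / z"
proof -
  have z0: "z \<noteq> 0" using z by auto
  define f where "f b = indicator {0..} b *\<^sub>R exp (- z * of_real b)" for b :: real
  have ff: "exponential_density 1 b *\<^sub>R exp ((1 - z) * of_real b) = f b" for b
    unfolding f_def exponential_density_def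
    by (auto simp: exp_of_real[symmetric] scaleR_conv_of_real mult_exp_exp algebra_simps)
  have F: "(\<integral>b. indicator {0..real n} b *\<^sub>R exp (- z * of_real b) \<partial>lborel) = (1 - exp (- z * of_real (real n))) / z" for n
  proof -
    have "(\<integral>b. indicator {0..real n} b *\<^sub>R exp (- z * of_real b) \<partial>lborel)
      = (- exp (- z * of_real (real n)) / z) - (- exp (- z * of_real 0) / z)"
    proof (rule integral_FTC_Icc)
      fix x assume "0 \<le> x" "x \<le> real n"
      have "((\<lambda>w. - exp (- z * w) / z) has_field_derivative exp (- z * of_real x)) (at (of_real x))"
        using z0 by (auto intro!: derivative_eq_intros)
      thus "((\<lambda>x. - exp (- z * complex_of_real x) / z) has_vector_derivative exp (- z * complex_of_real x)) (at x within {0..real n})"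
        by (rule has_vector_derivative_real_field)
    qed (auto intro!: continuous_intros)
    thus ?thesis by (simp add: diff_divide_distrib)
  qed
  have intf: "integrable lborel (\<lambda>b::real. indicator {0..} b *\<^sub>R exp (- Re z * b))"
    using integrable_density[of "\<lambda>_. 1" lborel "exponential_density (Re z)"] 
  proof -
    interpret P: prob_space "density lborel (\<lambda>x. ennreal (exponential_density (Re z) x))"
      using prob_space_exponential_density[OF z] by simp
    have "integrable (density lborel (\<lambda>x. ennreal (exponential_density (Re z) x))) (\<lambda>_. 1::real)" by simp
    hence "integrable lborel (\<lambda>b. exponential_density (Re z) b *\<^sub>R (1::real))"
      using z by (subst (asm) integrable_density) (auto simp: exponential_density_nonneg)
    hence "integrable lborel (\<lambda>b. (1 / Re z) * exponential_density (Re z) b)" by simp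
    also have "(\<lambda>b. (1 / Re z) * exponential_density (Re z) b) = (\<lambda>b. indicator {0..} b *\<^sub>R exp (- Re z * b))"
      using z by (auto simp: exponential_density_def fun_eq_iff mult.commute)
    finally show ?thesis .
  qed
  have "(\<lambda>n. \<integral>b. indicator {0..real n} b *\<^sub>R exp (- z * of_real b) \<partial>lborel) \<longlonglongrightarrow> (\<integral>b. f b \<partial>lborel)"
  proof (rule integral_dominated_convergence[OF _ _ intf])
    show "AE b in lborel. (\<lambda>n. indicator {0..real n} b *\<^sub>R exp (- z * of_real b)) \<longlonglongrightarrow> f b"
    proof (rule AE_I2, rule tendsto_eventually)
      fix b :: real
      obtain N :: nat where "real N \<ge> b" using real_arch_simple by blast
      thus "\<forall>\<^sub>F n in sequentially. indicator {0..real n} b *\<^sub>R exp (- z * of_real b) = f b"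
        unfolding f_def eventually_at_top_linorder by (intro exI[of _ N]) (auto simp: indicator_def)
    qed
    show "AE b in lborel. norm (indicator {0..real n} b *\<^sub>R exp (- z * complex_of_real b)) \<le> indicator {0..} b *\<^sub>R exp (- Re z * b)" for n
      by (rule AE_I2) (auto simp: indicator_def)
  qed (auto simp: f_def)
  moreover have "(\<lambda>n. (1 - exp (- z * of_real (real n))) / z) \<longlonglongrightarrow> (1 - 0) / z"
  proof (intro tendsto_intros z0)
    show "(\<lambda>n. exp (- z * of_real (real n))) \<longlonglongrightarrow> 0"
      by (subst tendsto_norm_zero_iff[symmetric]) (use z in \<open>simp, real_asymp\<close>)
  qed
  ultimately have "(\<integral>b. f b \<partial>lborel) = 1 / z" unfolding F using LIMSEQ_unique by force
  thus ?thesis unfolding ff .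
qed

lemma char_std_exponential: "(\<integral>b. exp (- (\<i> * of_real (t * b))) \<partial>std_exponential) = 1 / (1 + \<i> * of_real t)"
proof -
  have "(\<integral>b. exp (- (\<i> * of_real (t * b))) \<partial>std_exponential)
      = (\<integral>b. exponential_density 1 b *\<^sub>R exp (- (\<i> * of_real (t * b))) \<partial>lborel)"
    by (rule integral_density) (auto simp: exponential_density_nonneg)
  also have "\<dots> = (\<integral>b. exponential_density 1 b *\<^sub>R exp ((1 - (1 + \<i> * of_real t)) * of_real b) \<partial>lborel)"
    by (simp add: mult.assoc)
  also have "\<dots> = 1 / (1 + \<i> * of_real t)" by (rule integral_complex_exp) simp
  finally show ?thesis .
qed

text \<open>
  Averaging Levy's inversion formula for \<open>(0, b]\<close> over an exponentially distributed \<open>b\<close> turns the kernel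
  \<open>(1 - exp (- i t b)) / (i t)\<close> into \<open>1 / (1 + i t)\<close>.
\<close>
lemma (in real_distribution) fourier_exp:
  assumes atom: "\<And>x. measure M {x} = 0" and C: "C \<ge> 0" "\<And>t. t \<noteq> 0 \<Longrightarrow> norm (char M t) \<le> C / \<bar>t\<bar>"
  shows "complex_of_real (\<integral>x. exp (- x) * indicator {0..} x \<partial>M) = 
      1 / (2 * pi) * (\<integral>t. char M t / (1 + \<i> * of_real t) \<partial>lborel)"
    and "integrable lborel (\<lambda>t. char M t / (1 + \<i> * of_real t))"
proof -
  interpret X: prob_space std_exponential by (rule prob_space_std_exponential)
  interpret P: pair_prob_space M std_exponential ..
  interpret Q: pair_sigma_finite lborel std_exponential ..
  let ?g = "\<lambda>t b. (1 - exp (- (\<i> * of_real (t * b)))) / (\<i> * of_real t)"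
  let ?\<phi> = "char M"
  \<comment> \<open>The domination grows only linearly in b, which the exponential law integrates.
    For |t| <= 1 the kernel is at most b; for |t| > 1 the assumed decay of the characteristic
    function gives 2 C / t^2.\<close>
  have gb: "norm (?g t b * ?\<phi> t) \<le> (2 * b + 4 * C) * (1 / (1 + t\<^sup>2))" if b: "b \<ge> 0" for t b :: real
  proof (cases "\<bar>t\<bar> \<le> 1")
    case True
    have "norm (?g t b) \<le> b"
    proof (cases "t = 0")
      case False
      have "?g t b = (iexp (t * 0) - iexp (t * (-b))) / (\<i> * t)" by simp
      also have "norm \<dots> \<le> 0 - (-b)" by (rule Levy_Inversion_aux2) (use b False in auto)
      finally show ?thesis by simp
    qed (use b in simp)
    hence "norm (?g t b * ?\<phi> t) \<le> b * 1" unfolding norm_mult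
      using cmod_char_le_1[of t] b by (intro mult_mono) auto
    also have "\<dots> \<le> (2 * b + 4 * C) * (1 / 2)" using C(1) by simp
    also have "\<dots> \<le> (2 * b + 4 * C) * (1 / (1 + t\<^sup>2))"
    proof -
      have "t\<^sup>2 \<le> 1" using True by (simp add: abs_square_le_1)
      hence "1 / 2 \<le> 1 / (1 + t\<^sup>2)" by (intro divide_left_mono) (auto intro!: mult_pos_pos add_pos_nonneg)
      thus ?thesis using b C(1) by (intro mult_left_mono) auto
    qed
    finally show ?thesis .
  next
    case False
    hence t0: "t \<noteq> 0" by auto
    have "norm (?g t b) \<le> 2 / \<bar>t\<bar>"
    proof -
      have "norm (1 - exp (- (\<i> * of_real (t * b)))) \<le> 1 + 1"
        by (rule order_trans[OF norm_triangle_ineq4]) simp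
      thus ?thesis by (simp add: norm_divide norm_mult divide_right_mono)
    qed
    hence "norm (?g t b * ?\<phi> t) \<le> (2 / \<bar>t\<bar>) * (C / \<bar>t\<bar>)" unfolding norm_mult
      using C(2)[OF t0] by (intro mult_mono) auto
    also have "\<dots> = 2 * C / t\<^sup>2" by (simp add: power2_eq_square abs_mult[symmetric])
    also have "\<dots> \<le> 4 * C * (1 / (1 + t\<^sup>2))"
    proof -
      have "1 \<le> t\<^sup>2" using False abs_square_le_1[of t] by (simp add: not_le)
      hence "1 + t\<^sup>2 \<le> 2 * t\<^sup>2" by simp
      hence "2 * C * (1 + t\<^sup>2) \<le> 2 * C * (2 * t\<^sup>2)" using C by (intro mult_left_mono) auto
      thus ?thesis using t0 by (simp add: field_simps add_pos_nonneg)
    qed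
    also have "\<dots> \<le> (2 * b + 4 * C) * (1 / (1 + t\<^sup>2))" using b by (intro mult_right_mono) auto
    finally show ?thesis .
  qed
  have AEb: "AE b in std_exponential. b \<ge> 0"
    by (subst AE_density) (auto simp: exponential_density_def)
  have intb: "integrable lborel (\<lambda>t. ?g t b * ?\<phi> t)" if "b \<ge> 0" for b
  proof (rule Bochner_Integration.integrable_bound)
    show "integrable lborel (\<lambda>t. (2 * b + 4 * C) * (1 / (1 + t\<^sup>2)))"
      by (intro integrable_mult_right integrable_inverse_one_plus_sq)
    show "AE t in lborel. norm (?g t b * ?\<phi> t) \<le> norm ((2 * b + 4 * C) * (1 / (1 + t\<^sup>2)))"
      using gb[OF that] by (intro AE_I2) (metis abs_ge_self order_trans real_norm_def)
  qed measurable
  have inv: "complex_of_real (measure M {0<..b}) = 1 / (2 * pi) * (\<integral>t. ?g t b * ?\<phi> t \<partial>lborel)" if b: "b \<ge> 0" for b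
  proof (rule LIMSEQ_unique)
    have "(\<lambda>T::nat. 1 / (2 * pi) * (CLBINT t=-T..T. (iexp (-(t * 0)) - iexp (-(t * b))) / (\<i> * t) * ?\<phi> t))
       \<longlonglongrightarrow> complex_of_real (measure M {0<..b})"
      by (rule Levy_Inversion) (use b atom in auto)
    moreover have "(CLBINT t=-real T..real T. (iexp (-(t * 0)) - iexp (-(t * b))) / (\<i> * t) * ?\<phi> t)
        = (\<integral>t. indicator {-real T<..<real T} t *\<^sub>R (?g t b * ?\<phi> t) \<partial>lborel)" for T :: nat
      unfolding interval_lebesgue_integral_def set_lebesgue_integral_def by (simp add: einterval_eq)
    ultimately show "(\<lambda>T::nat. 1 / (2 * pi) * (\<integral>t. indicator {-real T<..<real T} t *\<^sub>R (?g t b * ?\<phi> t) \<partial>lborel))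
       \<longlonglongrightarrow> complex_of_real (measure M {0<..b})" by simp
    have "(\<lambda>T::nat. \<integral>t. indicator {-real T<..<real T} t *\<^sub>R (?g t b * ?\<phi> t) \<partial>lborel) \<longlonglongrightarrow> (\<integral>t. ?g t b * ?\<phi> t \<partial>lborel)"
    proof (rule integral_dominated_convergence[where w = "\<lambda>t. norm (?g t b * ?\<phi> t)"])
      show "integrable lborel (\<lambda>t. norm (?g t b * ?\<phi> t))" using intb[OF b] by (rule integrable_norm)
      show "AE t in lborel. (\<lambda>T::nat. indicator {-real T<..<real T} t *\<^sub>R (?g t b * ?\<phi> t)) \<longlonglongrightarrow> ?g t b * ?\<phi> t"
      proof (rule AE_I2, rule tendsto_eventually)
        fix t :: real
        obtain N :: nat where "real N > \<bar>t\<bar>" using reals_Archimedean2 by blast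
        thus "\<forall>\<^sub>F T in sequentially. indicator {-real T<..<real T} t *\<^sub>R (?g t b * ?\<phi> t) = ?g t b * ?\<phi> t"
          unfolding eventually_at_top_linorder by (intro exI[of _ N]) (auto simp: indicator_def)
      qed
    qed (auto simp: indicator_def)
    thus "(\<lambda>T::nat. 1 / (2 * pi) * (\<integral>t. indicator {-real T<..<real T} t *\<^sub>R (?g t b * ?\<phi> t) \<partial>lborel))
       \<longlonglongrightarrow> 1 / (2 * pi) * (\<integral>t. ?g t b * ?\<phi> t \<partial>lborel)"
      by (intro tendsto_mult tendsto_const)
  qed
  have K: "integrable (lborel \<Otimes>\<^sub>M std_exponential) (\<lambda>(t, b). ?g t b * ?\<phi> t)"
  proof (rule Q.Fubini_integrable)
    show "AE t in lborel. integrable std_exponential (\<lambda>b. case (t, b) of (t, b) \<Rightarrow> ?g t b * ?\<phi> t)"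
    proof (rule AE_I2, simp only: prod.case)
      fix t :: real
      show "integrable std_exponential (\<lambda>b. ?g t b * ?\<phi> t)"
      proof (rule X.integrable_const_bound[where B = "norm (2 / (\<i> * of_real t) * ?\<phi> t)"])
        have "norm (1 - exp (- (\<i> * of_real (t * b)))) \<le> 2" for b
          by (rule order_trans[OF norm_triangle_ineq4]) simp
        thus "AE b in std_exponential. norm (?g t b * ?\<phi> t) \<le> norm (2 / (\<i> * of_real t) * ?\<phi> t)"
          by (intro AE_I2) (simp add: norm_mult norm_divide mult_right_mono divide_right_mono)
      qed simp
    qed
    show "integrable lborel (\<lambda>t. \<integral>b. norm (case (t, b) of (t, b) \<Rightarrow> ?g t b * ?\<phi> t) \<partial>std_exponential)"
    proof (rule Bochner_Integration.integrable_bound)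
      show "integrable lborel (\<lambda>t. (2 * 1 + 4 * C) * (1 / (1 + t\<^sup>2)))"
        by (intro integrable_mult_right integrable_inverse_one_plus_sq)
      show "(\<lambda>t. \<integral>b. norm (case (t, b) of (t, b) \<Rightarrow> ?g t b * ?\<phi> t) \<partial>std_exponential) \<in> borel_measurable lborel"
        by measurable
      show "AE t in lborel. norm (\<integral>b. norm (case (t, b) of (t, b) \<Rightarrow> ?g t b * ?\<phi> t) \<partial>std_exponential)
              \<le> norm ((2 * 1 + 4 * C) * (1 / (1 + t\<^sup>2)))"
      proof (rule AE_I2)
        fix t :: real
        have i: "integrable std_exponential (\<lambda>b. (2 * b + 4 * C) * (1 / (1 + t\<^sup>2)))"
          by (intro integrable_mult_left Bochner_Integration.integrable_add integrable_mult_right integrable_std_exponential) auto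
        have "(\<integral>b. norm (?g t b * ?\<phi> t) \<partial>std_exponential) \<le> (\<integral>b. (2 * b + 4 * C) * (1 / (1 + t\<^sup>2)) \<partial>std_exponential)"
        proof (rule integral_mono_AE'[OF i])
          show "AE b in std_exponential. norm (?g t b * ?\<phi> t) \<le> (2 * b + 4 * C) * (1 / (1 + t\<^sup>2))"
            using AEb by eventually_elim (rule gb)
          show "AE b in std_exponential. 0 \<le> (2 * b + 4 * C) * (1 / (1 + t\<^sup>2))"
            using AEb by eventually_elim (use C(1) in auto)
        qed
        also have "\<dots> = (2 * 1 + 4 * C) * (1 / (1 + t\<^sup>2))"
          using integrable_std_exponential expectation_std_exponential X.prob_space
          by (subst integral_mult_left_zero) (subst Bochner_Integration.integral_add, auto)
        finally show "norm (\<integral>b. norm (case (t, b) of (t, b) \<Rightarrow> ?g t b * ?\<phi> t) \<partial>std_exponential)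
              \<le> norm ((2 * 1 + 4 * C) * (1 / (1 + t\<^sup>2)))"
          using C(1) by (simp add: Bochner_Integration.integral_nonneg)
      qed
    qed
  qed measurable
  have inner: "(\<integral>b. ?g t b * ?\<phi> t \<partial>std_exponential) = ?\<phi> t / (1 + \<i> * of_real t)" if t: "t \<noteq> 0" for t
  proof -
    have i: "integrable std_exponential (\<lambda>b. exp (- (\<i> * of_real (t * b))))"
      by (rule X.integrable_const_bound[where B = 1]) auto
    have "(\<integral>b. ?g t b * ?\<phi> t \<partial>std_exponential) = (\<integral>b. (1 - exp (- (\<i> * of_real (t * b)))) \<partial>std_exponential) * (?\<phi> t / (\<i> * of_real t))"
      by (subst integral_mult_left_zero[symmetric]) (simp add: field_simps)
    also have "(\<integral>b. (1 - exp (- (\<i> * of_real (t * b)))) \<partial>std_exponential) = 1 - 1 / (1 + \<i> * of_real t)"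
      using i char_std_exponential[of t] X.prob_space
      by (subst Bochner_Integration.integral_diff) auto
    also have "1 + \<i> * complex_of_real t \<noteq> 0" by (simp add: complex_eq_iff)
    hence "(1 - 1 / (1 + \<i> * complex_of_real t)) * (?\<phi> t / (\<i> * of_real t)) = ?\<phi> t / (1 + \<i> * of_real t)"
      using t by (simp add: field_simps)
    finally show ?thesis .
  qed
  have AEt: "AE t in lborel. (t::real) \<noteq> 0" by (rule AE_lborel_singleton)
  have int2: "integrable lborel (\<lambda>t. \<integral>b. ?g t b * ?\<phi> t \<partial>std_exponential)"
    using Q.integrable_fst'[OF K] by simp
  show "integrable lborel (\<lambda>t. ?\<phi> t / (1 + \<i> * of_real t))"
    by (rule integrable_cong_AE_imp[OF int2]) (use AEt inner in \<open>auto elim!: eventually_mono\<close>)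
  \<comment> \<open>Levy's formula speaks of the half-open interval (0, b], so the point 0 is
    dropped first; it has no mass.\<close>
  have "(\<integral>x. exp (- x) * indicator {0..} x \<partial>M) = (\<integral>x. exp (- x) * indicator {0<..} x \<partial>M)"
  proof (rule integral_cong_AE)
    have "AE x in M. x \<noteq> 0" using atom[of 0] by (intro AE_I[of _ _ "{0}"]) (auto simp: emeasure_eq_measure)
    thus "AE x in M. exp (- x) * indicator {0..} x = exp (- x) * indicator {0<..} x"
      by eventually_elim (auto simp: indicator_def)
  qed auto
  \<comment> \<open>For x > 0, e^(-x) is the probability that the exponential variable b is at least
    x, which puts the integrand into Levy's form.\<close>
  also have "\<dots> = (\<integral>x. (\<integral>b. indicator {0<..b} x \<partial>std_exponential) \<partial>M)"
  proof (rule Bochner_Integration.integral_cong[OF refl])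
    fix x :: real
    show "exp (- x) * indicator {0<..} x = (\<integral>b. indicator {0<..b} x \<partial>std_exponential)"
    proof (cases "x > 0")
      case True
      have "AE b in std_exponential. b \<noteq> x"
        using AE_lborel_singleton[of x] by (subst AE_density) (auto elim!: eventually_mono)
      hence "(\<integral>b. indicator {0<..b} x \<partial>std_exponential) = (\<integral>b. indicator {b. x < b} b \<partial>std_exponential)"
        using True by (intro integral_cong_AE) (auto simp: indicator_def elim!: eventually_mono)
      also have "\<dots> = measure std_exponential {b. x < b}" by simp
      also have "\<dots> = exp (- x)" using True by (intro prob_std_exponential_gt) simp
      finally show ?thesis using True by simp
    qed (simp add: indicator_def)
  qed
  also have "\<dots> = (\<integral>b. (\<integral>x. indicator {0<..b} x \<partial>M) \<partial>std_exponential)"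
  proof (rule P.Fubini_integral[symmetric])
    have "{z \<in> space (M \<Otimes>\<^sub>M std_exponential). 0 < fst z \<and> fst z \<le> snd z} \<in> sets (M \<Otimes>\<^sub>M std_exponential)" by measurable
    moreover have "indicator {0<..b} x = (indicator {z \<in> space (M \<Otimes>\<^sub>M std_exponential). 0 < fst z \<and> fst z \<le> snd z} (x, b) :: real)" for x b
      by (auto simp: indicator_def space_pair_measure)
    ultimately have "(\<lambda>(x, b). indicator {0<..b} x :: real) \<in> borel_measurable (M \<Otimes>\<^sub>M std_exponential)"
      by (simp add: case_prod_unfold borel_measurable_indicator)
    thus "integrable (M \<Otimes>\<^sub>M std_exponential) (\<lambda>(x, b). indicator {0<..b} x :: real)"
      by (intro P.integrable_const_bound[where B = 1]) auto
  qed
  also have "\<dots> = (\<integral>b. measure M {0<..b} \<partial>std_exponential)" by simp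
  finally have e1: "(\<integral>x. exp (- x) * indicator {0..} x \<partial>M) = (\<integral>b. measure M {0<..b} \<partial>std_exponential)" .
  have "complex_of_real (\<integral>x. exp (- x) * indicator {0..} x \<partial>M) = (\<integral>b. complex_of_real (measure M {0<..b}) \<partial>std_exponential)"
    unfolding e1 by simp
  also have "\<dots> = (\<integral>b. 1 / (2 * pi) * (\<integral>t. ?g t b * ?\<phi> t \<partial>lborel) \<partial>std_exponential)"
  proof (rule integral_cong_AE)
    have m1: "(\<lambda>b. \<integral>t. ?g t b * ?\<phi> t \<partial>lborel) \<in> borel_measurable std_exponential" by measurable
    thus m2: "(\<lambda>b. 1 / (2 * pi) * (\<integral>t. ?g t b * ?\<phi> t \<partial>lborel)) \<in> borel_measurable std_exponential" by measurable
    have "mono (\<lambda>b. measure M {0<..b})" by (intro monoI finite_measure_mono) auto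
    hence "(\<lambda>b. measure M {0<..b}) \<in> borel_measurable borel" by (rule borel_measurable_mono)
    thus "(\<lambda>b. complex_of_real (measure M {0<..b})) \<in> borel_measurable std_exponential" by simp
    show "AE b in std_exponential. complex_of_real (measure M {0<..b}) = 1 / (2 * pi) * (\<integral>t. ?g t b * ?\<phi> t \<partial>lborel)"
      using AEb by eventually_elim (rule inv)
  qed
  also have "\<dots> = 1 / (2 * pi) * (\<integral>b. (\<integral>t. ?g t b * ?\<phi> t \<partial>lborel) \<partial>std_exponential)" by simp
  also have "(\<integral>b. (\<integral>t. ?g t b * ?\<phi> t \<partial>lborel) \<partial>std_exponential) = (\<integral>t. (\<integral>b. ?g t b * ?\<phi> t \<partial>std_exponential) \<partial>lborel)"
    by (rule Q.Fubini_integral[OF K])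
  also have "\<dots> = (\<integral>t. ?\<phi> t / (1 + \<i> * of_real t) \<partial>lborel)"
    by (rule integral_cong_AE) (use AEt inner in \<open>auto elim!: eventually_mono\<close>)
  finally show "complex_of_real (\<integral>x. exp (- x) * indicator {0..} x \<partial>M) = 
      1 / (2 * pi) * (\<integral>t. ?\<phi> t / (1 + \<i> * of_real t) \<partial>lborel)" .
qed



section \<open>A local limit theorem with relative error O(1 / n)\<close>

lemma norm_prod_le_power:
  fixes w :: "'i \<Rightarrow> 'a::{real_normed_field}"
  assumes I: "finite I" "S \<subseteq> I" and w: "\<And>i. i \<in> I \<Longrightarrow> norm (w i) \<le> 1" "\<And>i. i \<in> S \<Longrightarrow> norm (w i) \<le> q"
  shows "norm (\<Prod>i\<in>I. w i) \<le> q ^ card S"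
proof -
  have "norm (\<Prod>i\<in>I. w i) = (\<Prod>i\<in>I. norm (w i))" by (rule prod_norm[symmetric])
  also have "\<dots> = (\<Prod>i\<in>I - S. norm (w i)) * (\<Prod>i\<in>S. norm (w i))"
    by (rule prod.subset_diff[OF I(2,1)])
  also have "\<dots> \<le> 1 * (\<Prod>i\<in>S. q)"
    using w by (intro mult_mono prod_mono prod_le_1 prod_nonneg) (auto intro: order_trans)
  finally show ?thesis by simp
qed

text \<open>Telescoping one factor at a time. Each difference is multiplied by all other factors,
  among which at least \<open>card S - 1\<close> have norm at most q.\<close>

lemma norm_prod_diff_decay:
  fixes z w :: "'i \<Rightarrow> 'a::{real_normed_field}"
  assumes "finite I" "S \<subseteq> I" "0 \<le> q" "q \<le> 1"
    and "\<And>i. i \<in> I \<Longrightarrow> norm (z i) \<le> 1" "\<And>i. i \<in> S \<Longrightarrow> norm (z i) \<le> q"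
    and "\<And>i. i \<in> I \<Longrightarrow> norm (w i) \<le> 1" "\<And>i. i \<in> S \<Longrightarrow> norm (w i) \<le> q"
  shows "norm ((\<Prod>i\<in>I. z i) - (\<Prod>i\<in>I. w i)) \<le> (\<Sum>i\<in>I. norm (z i - w i)) * q ^ (card S - 1)"
  using assms(1,2,5-)
proof (induction I arbitrary: S rule: finite_induct)
  case (insert x I)
  define S' where "S' = S - {x}"
  have S': "S' \<subseteq> I" "finite S'" using insert by (auto simp: S'_def finite_subset)
  have IH: "norm ((\<Prod>i\<in>I. z i) - (\<Prod>i\<in>I. w i)) \<le> (\<Sum>i\<in>I. norm (z i - w i)) * q ^ (card S' - 1)"
    using insert.prems S' by (intro insert.IH) (auto simp: S'_def)
  have wI: "norm (\<Prod>i\<in>I. w i) \<le> q ^ card S'"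
    using insert.prems insert.hyps S' by (intro norm_prod_le_power) (auto simp: S'_def)
  have s0: "(\<Sum>i\<in>I. norm (z i - w i)) \<ge> 0" by (simp add: sum_nonneg)
  have "(\<Prod>i\<in>insert x I. z i) - (\<Prod>i\<in>insert x I. w i)
      = (z x - w x) * (\<Prod>i\<in>I. w i) + z x * ((\<Prod>i\<in>I. z i) - (\<Prod>i\<in>I. w i))"
    using insert by (simp add: algebra_simps)
  also have "norm \<dots> \<le> norm (z x - w x) * norm (\<Prod>i\<in>I. w i) + norm (z x) * norm ((\<Prod>i\<in>I. z i) - (\<Prod>i\<in>I. w i))"
    by (rule order_trans[OF norm_triangle_ineq]) (simp add: norm_mult)
  also have "\<dots> \<le> norm (z x - w x) * q ^ (card S - 1) + (\<Sum>i\<in>I. norm (z i - w i)) * q ^ (card S - 1)"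
  proof (rule add_mono)
    have "q ^ card S' \<le> q ^ (card S - 1)"
    proof (intro power_decreasing assms)
      show "card S - 1 \<le> card S'" unfolding S'_def by (cases "x \<in> S") (auto simp: card_Diff_singleton_if)
    qed
    thus "norm (z x - w x) * norm (\<Prod>i\<in>I. w i) \<le> norm (z x - w x) * q ^ (card S - 1)"
      using wI by (intro mult_left_mono) auto
    have "norm (z x) * norm ((\<Prod>i\<in>I. z i) - (\<Prod>i\<in>I. w i)) \<le> norm (z x) * ((\<Sum>i\<in>I. norm (z i - w i)) * q ^ (card S' - 1))"
      using IH by (intro mult_left_mono) auto
    also have "\<dots> = (\<Sum>i\<in>I. norm (z i - w i)) * (norm (z x) * q ^ (card S' - 1))" by simp
    also have "\<dots> \<le> (\<Sum>i\<in>I. norm (z i - w i)) * q ^ (card S - 1)"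
    proof (intro mult_left_mono s0)
      show "norm (z x) * q ^ (card S' - 1) \<le> q ^ (card S - 1)"
      proof (cases "x \<in> S \<and> card S \<ge> 2")
        case True
        hence "card S - 1 = Suc (card S' - 1)" using S' by (auto simp: S'_def card_Diff_singleton_if)
        moreover have "norm (z x) * q ^ (card S' - 1) \<le> q * q ^ (card S' - 1)"
          using True insert.prems assms by (intro mult_right_mono) auto
        ultimately show ?thesis by simp
      next
        case False
        have "card S - 1 \<le> card S' - 1"
        proof (cases "x \<in> S")
          case True
          thus ?thesis using False by auto
        qed (simp add: S'_def)
        hence "q ^ (card S' - 1) \<le> q ^ (card S - 1)" using assms by (intro power_decreasing) auto
        moreover have "norm (z x) * q ^ (card S' - 1) \<le> 1 * q ^ (card S' - 1)"
          using insert.prems assms by (intro mult_right_mono) auto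
        ultimately show ?thesis by simp
      qed
    qed
    finally show "norm (z x) * norm ((\<Prod>i\<in>I. z i) - (\<Prod>i\<in>I. w i)) \<le> (\<Sum>i\<in>I. norm (z i - w i)) * q ^ (card S - 1)" .
  qed
  also have "\<dots> = (\<Sum>i\<in>insert x I. norm (z i - w i)) * q ^ (card S - 1)"
    using insert by (simp add: distrib_right)
  finally show ?case .
qed simp

lemma power_le_fact_exp: "x \<ge> 0 \<Longrightarrow> (x::real) ^ j \<le> fact j * exp x"
proof -
  assume x: "x \<ge> 0"
  have s: "(\<lambda>n. x ^ n /\<^sub>R fact n) sums exp x" by (rule exp_converges)
  have "(\<Sum>n\<in>{j}. x ^ n /\<^sub>R fact n) \<le> (\<Sum>n. x ^ n /\<^sub>R fact n)"
    using x s by (intro sum_le_suminf) (auto simp: sums_iff)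
  thus ?thesis using s by (simp add: sums_iff field_simps)
qed

lemma power_mult_exp_le:
  fixes c w :: real
  assumes "c > 0" "w \<ge> 0"
  shows "w ^ j * exp (- c * w) \<le> fact j * (2 / c) ^ j * exp (- c * w / 2)"
proof -
  have "(c * w / 2) ^ j \<le> fact j * exp (c * w / 2)" using assms by (intro power_le_fact_exp) auto
  hence "(2 / c) ^ j * (c * w / 2) ^ j * exp (- c * w) \<le> (2 / c) ^ j * (fact j * exp (c * w / 2)) * exp (- c * w)"
    using assms by (intro mult_right_mono mult_left_mono) auto
  also have "(2 / c) ^ j * (c * w / 2) ^ j = w ^ j" using assms by (simp add: power_mult_distrib[symmetric])
  also have "(2 / c) ^ j * (fact j * exp (c * w / 2)) * exp (- c * w) = fact j * (2 / c) ^ j * exp (- c * w / 2)"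
    by (simp add: mult.assoc mult_exp_exp)
  finally show ?thesis .
qed

text \<open>The bracket collects the Gaussian comparison: the powers 1, 2, 3 of 2/c absorb the
  corresponding powers of n t^2, and 2 / (c delta^2) bounds the Gaussian beyond delta. The last
  summand is the part of the characteristic function with |t| > delta.\<close>

definition saddle_const :: "real \<Rightarrow> real \<Rightarrow> real \<Rightarrow> real \<Rightarrow> real \<Rightarrow> real" where
  "saddle_const c \<delta> B C R =
     (2 / c + 2 * (B + B * exp c) * (2 / c)\<^sup>2 + 6 * B\<^sup>2 * (2 / c) ^ 3 + 2 / (c * \<delta>\<^sup>2)) * sqrt (B / c)
      + sqrt (2 * pi * B) / 2 * C * (1 + 1 / \<delta>\<^sup>2) * R"

text \<open>The real part of e^(-i a) / (1 + i t) is (cos a - t sin a) / (1 + t^2), in which t and a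
  occur only to second order.\<close>

lemma Re_gaussian_quotient:
  fixes V U t :: real
  defines "a \<equiv> U * t ^ 3 / 6"
  shows "\<bar>Re (exp (Complex (- V * t\<^sup>2 / 2) (- U * t ^ 3 / 6)) / (1 + \<i> * of_real t)) - exp (- V * t\<^sup>2 / 2)\<bar>
     \<le> exp (- V * t\<^sup>2 / 2) * (t\<^sup>2 + a\<^sup>2 / 2 + \<bar>t * a\<bar>)"
proof -
  have t1: "1 + t\<^sup>2 > 0" by (simp add: add_pos_nonneg)
  have "Re (exp (Complex (- V * t\<^sup>2 / 2) (- U * t ^ 3 / 6)) / (1 + \<i> * of_real t))
      = exp (- V * t\<^sup>2 / 2) * ((cos a - t * sin a) / (1 + t\<^sup>2))"
    unfolding a_def by (simp add: Re_divide Re_exp Im_exp power2_eq_square algebra_simps)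
  hence "Re (exp (Complex (- V * t\<^sup>2 / 2) (- U * t ^ 3 / 6)) / (1 + \<i> * of_real t)) - exp (- V * t\<^sup>2 / 2)
      = exp (- V * t\<^sup>2 / 2) * ((cos a - 1 - t * sin a - t\<^sup>2) / (1 + t\<^sup>2))"
    using t1 by (simp add: field_simps)
  also have "\<bar>\<dots>\<bar> = exp (- V * t\<^sup>2 / 2) * (\<bar>cos a - 1 - t * sin a - t\<^sup>2\<bar> / (1 + t\<^sup>2))"
    using t1 by (simp add: abs_mult)
  also have "\<dots> \<le> exp (- V * t\<^sup>2 / 2) * (t\<^sup>2 + a\<^sup>2 / 2 + \<bar>t * a\<bar>)"
  proof (intro mult_left_mono)
    have "\<bar>cos a - 1 - t * sin a - t\<^sup>2\<bar> / (1 + t\<^sup>2) \<le> \<bar>cos a - 1 - t * sin a - t\<^sup>2\<bar> / 1"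
      using t1 by (intro divide_left_mono) auto
    also have "\<dots> \<le> t\<^sup>2 + a\<^sup>2 / 2 + \<bar>t * a\<bar>"
    proof -
      have "(sin (a / 2))\<^sup>2 \<le> (a / 2)\<^sup>2"
        using power_mono[OF abs_sin_x_le_abs_x[of "a / 2"], of 2] by (simp add: power_divide)
      hence "1 - cos a \<le> a\<^sup>2 / 2" using cos_double_sin[of "a / 2"] by (simp add: power_divide)
      moreover have "cos a \<le> 1" by simp
      moreover have "\<bar>t * sin a\<bar> \<le> \<bar>t * a\<bar>" unfolding abs_mult using abs_sin_x_le_abs_x by (intro mult_left_mono) auto
      moreover have "t\<^sup>2 \<ge> 0" "a\<^sup>2 \<ge> 0" by auto
      ultimately show ?thesis unfolding div_by_1 by linarith
    qed
    finally show "\<bar>cos a - 1 - t * sin a - t\<^sup>2\<bar> / (1 + t\<^sup>2) \<le> t\<^sup>2 + a\<^sup>2 / 2 + \<bar>t * a\<bar>" .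
  qed simp
  finally show ?thesis .
qed

text \<open>
  For a law that is a convolution of \<open>n\<close> comparable factors, \<open>E (exp (- Z); Z \<ge> 0)\<close> is \<open>(2 \<pi> V)\<^sup>-\<^sup>1\<^sup>/\<^sup>2\<close> up to
  a relative error \<open>O(1 / n)\<close>: the term of order \<open>n\<^sup>-\<^sup>1\<^sup>/\<^sup>2\<close> coming from the third cumulants is odd in \<open>t\<close> and
  hence disappears from the real part.
\<close>
lemma local_limit_exp:
  fixes M :: "real measure" and f :: "'i \<Rightarrow> real \<Rightarrow> complex" and v \<mu> b :: "'i \<Rightarrow> real"
  assumes M: "real_distribution M" and atom: "\<And>x. measure M {x} = 0"
    and I: "finite I" "S \<subseteq> I" "i0 \<in> S"
    and char: "\<And>t. char M t = (\<Prod>i\<in>I. f i t)"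
    and f1: "\<And>i t. i \<in> I \<Longrightarrow> norm (f i t) \<le> 1"
    and fg: "\<And>i t. i \<in> I \<Longrightarrow> \<bar>t\<bar> \<le> \<delta> \<Longrightarrow> norm (f i t - exp (Complex (- v i * t\<^sup>2 / 2) (- \<mu> i * t ^ 3 / 6))) \<le> b i * t ^ 4"
    and fs: "\<And>i t. i \<in> S \<Longrightarrow> \<bar>t\<bar> \<le> \<delta> \<Longrightarrow> norm (f i t) \<le> exp (- c * t\<^sup>2)"
    and v: "\<And>i. i \<in> S \<Longrightarrow> v i \<ge> 2 * c" "\<And>i. i \<in> I \<Longrightarrow> v i \<ge> 0"
    and c: "0 < c" and \<delta>: "0 < \<delta>" "\<delta> \<le> 1"
    and sums: "(\<Sum>i\<in>I. b i) \<le> B * real (card S)" "\<bar>\<Sum>i\<in>I. \<mu> i\<bar> \<le> B * real (card S)" "(\<Sum>i\<in>I. v i) \<le> B * real (card S)"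
    and far: "\<And>i t. i \<in> S - {i0} \<Longrightarrow> \<bar>t\<bar> \<ge> \<delta> \<Longrightarrow> norm (f i t) \<le> \<rho>" and \<rho>: "0 \<le> \<rho>" "\<rho> \<le> 1"
    and C: "C \<ge> 0" "\<And>t. t \<noteq> 0 \<Longrightarrow> norm (f i0 t) \<le> C / \<bar>t\<bar>"
    and R: "\<And>m::nat. real m * sqrt (real m) * \<rho> ^ (m - 1) \<le> R"
  shows "\<bar>sqrt (2 * pi * (\<Sum>i\<in>I. v i)) * (\<integral>x. exp (- x) * indicator {0..} x \<partial>M) - 1\<bar> \<le> saddle_const c \<delta> B C R / real (card S)"
proof -
  interpret real_distribution M by (rule M)
  define n where "n = real (card S)"
  define V where "V = (\<Sum>i\<in>I. v i)"
  define U where "U = (\<Sum>i\<in>I. \<mu> i)"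
  have fin: "finite S" using I finite_subset by blast
  have n1: "card S \<ge> 1" using I fin by (metis One_nat_def Suc_leI card_gt_0_iff empty_iff)
  hence n: "n \<ge> 1" "n > 0" by (auto simp: n_def)
  have Vlo: "V \<ge> 2 * c * n"
  proof -
    have "2 * c * n = (\<Sum>i\<in>S. 2 * c)" by (simp add: n_def)
    also have "\<dots> \<le> (\<Sum>i\<in>S. v i)" by (intro sum_mono v)
    also have "\<dots> \<le> V" unfolding V_def using I v by (intro sum_mono2) auto
    finally show ?thesis .
  qed
  have V0: "V > 0" using Vlo c n by (meson less_le_trans mult_pos_pos zero_less_numeral)
  have Bn: "V \<le> B * n" using sums by (simp add: V_def n_def)
  have B0: "B > 0" using V0 Bn n by (smt (verit) mult_nonpos_nonneg)
  let ?\<psi> = "char M"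
  have decay: "norm (?\<psi> t) \<le> C / \<bar>t\<bar>" if "t \<noteq> 0" for t
  proof -
    have "norm (?\<psi> t) = norm (f i0 t) * norm (\<Prod>i\<in>I - {i0}. f i t)"
      unfolding char using I by (subst prod.remove[of _ i0]) (auto simp: norm_mult)
    also have "\<dots> \<le> (C / \<bar>t\<bar>) * 1"
      using C(2)[OF that] f1 C(1) unfolding prod_norm[symmetric]
      by (intro mult_mono prod_le_1 prod_nonneg) auto
    finally show ?thesis by simp
  qed
  note F = fourier_exp[OF atom C(1) decay]
  define e where "e = (\<integral>x. exp (- x) * indicator {0..} x \<partial>M)"
  define h where "h t = Re (?\<psi> t / (1 + \<i> * of_real t))" for t
  have inth: "integrable lborel h" unfolding h_def using F(2) by (rule integrable_Re)
  have eh: "2 * pi * e = (\<integral>t. h t \<partial>lborel)"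
  proof -
    have "complex_of_real e = of_real (1 / (2 * pi)) * (\<integral>t. ?\<psi> t / (1 + \<i> * of_real t) \<partial>lborel)"
      using F(1) by (simp add: e_def)
    note this
    from arg_cong[OF this, of Re] have "e = 1 / (2 * pi) * Re (\<integral>t. ?\<psi> t / (1 + \<i> * of_real t) \<partial>lborel)"
      by (simp only: Re_complex_of_real times_complex.sel Im_complex_of_real)
    also have "Re (\<integral>t. ?\<psi> t / (1 + \<i> * of_real t) \<partial>lborel) = (\<integral>t. h t \<partial>lborel)"
      unfolding h_def using F(2) by (rule integral_Re[symmetric])
    finally show ?thesis by simp
  qed
  define K1 where "K1 = 2 / c + 2 * (B + B * exp c) * (2 / c)\<^sup>2 + 6 * B\<^sup>2 * (2 / c) ^ 3"
  define K2 where "K2 = K1 + 2 / (c * \<delta>\<^sup>2)"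
  have K1: "K1 \<ge> 0" unfolding K1_def using c B0 by auto
  have K12: "K1 \<le> K2" unfolding K2_def using c \<delta> by simp
  \<comment> \<open>Half of the exponent c n t^2 is given up, so that powers of n t^2 can be
    absorbed with constants independent of n.\<close>
  define E where "E t = exp (- (c * n / 2) * t\<^sup>2)" for t
  have gE: "exp (- V * t\<^sup>2 / 2) \<le> exp (- c * (n * t\<^sup>2))" for t
    using mult_right_mono[OF Vlo, of "t\<^sup>2"] by (simp add: algebra_simps)
  have wE: "(n * t\<^sup>2) ^ j * exp (- c * (n * t\<^sup>2)) \<le> fact j * (2 / c) ^ j * E t" for t j
    using power_mult_exp_le[OF c, of "n * t\<^sup>2" j] n by (simp add: E_def algebra_simps)
  have c0: "1 + \<i> * complex_of_real t \<noteq> 0" for t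
  proof
    assume "1 + \<i> * complex_of_real t = 0"
    hence "Re (1 + \<i> * complex_of_real t) = Re 0" by (rule arg_cong)
    thus False by simp
  qed
  have near: "\<bar>h t - exp (- V * t\<^sup>2 / 2)\<bar> \<le> K1 / n * E t" if t: "\<bar>t\<bar> \<le> \<delta>" for t
  proof -
    define w where "w = n * t\<^sup>2"
    have w0: "w \<ge> 0" using n by (simp add: w_def)
    have tw: "t\<^sup>2 = w / n" using n by (simp add: w_def)
    define G where "G = exp (Complex (- V * t\<^sup>2 / 2) (- U * t ^ 3 / 6))"
    let ?g = "\<lambda>i. exp (Complex (- v i * t\<^sup>2 / 2) (- \<mu> i * t ^ 3 / 6))"
    have G: "G = (\<Prod>i\<in>I. ?g i)"
    proof -
      have "(\<Prod>i\<in>I. ?g i) = exp (\<Sum>i\<in>I. Complex (- v i * t\<^sup>2 / 2) (- \<mu> i * t ^ 3 / 6))"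
        using I by (simp add: exp_sum)
      also have "(\<Sum>i\<in>I. Complex (- v i * t\<^sup>2 / 2) (- \<mu> i * t ^ 3 / 6)) = Complex (- V * t\<^sup>2 / 2) (- U * t ^ 3 / 6)"
        by (simp add: complex_eq_iff V_def U_def sum_distrib_right sum_divide_distrib sum_negf)
      finally show ?thesis by (simp add: G_def)
    qed
    have t2: "t\<^sup>2 \<le> 1" using t \<delta> by (simp add: abs_square_le_1)
    have "norm (?\<psi> t - G) \<le> (\<Sum>i\<in>I. norm (f i t - ?g i)) * exp (- c * t\<^sup>2) ^ (card S - 1)"
      unfolding char G
    proof (rule norm_prod_diff_decay[OF I(1,2)])
      fix i assume "i \<in> I"
      thus "norm (?g i) \<le> 1" using v(2) by (simp add: norm_exp_eq_Re)
    next
      fix i assume "i \<in> S"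
      hence "2 * c * t\<^sup>2 \<le> v i * t\<^sup>2" using v(1) by (intro mult_right_mono) auto
      thus "norm (?g i) \<le> exp (- c * t\<^sup>2)" by (simp add: norm_exp_eq_Re)
    qed (use f1 fs t c in auto)
    also have "\<dots> \<le> (B * n * t ^ 4) * (exp c * exp (- c * w))"
    proof (rule mult_mono)
      have "(\<Sum>i\<in>I. norm (f i t - ?g i)) \<le> (\<Sum>i\<in>I. b i * t ^ 4)" by (intro sum_mono fg t)
      also have "\<dots> = (\<Sum>i\<in>I. b i) * t ^ 4" by (rule sum_distrib_right[symmetric])
      also have "\<dots> \<le> B * n * t ^ 4" using sums(1) by (intro mult_right_mono) (auto simp: n_def)
      finally show "(\<Sum>i\<in>I. norm (f i t - ?g i)) \<le> B * n * t ^ 4" .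
      \<comment> \<open>The one factor missing from the full power costs e^(c t^2), at most e^c
        since |t| <= delta <= 1.\<close>
      have "exp (- c * t\<^sup>2) ^ (card S - 1) = exp (c * t\<^sup>2) * exp (- c * w)"
        using n1 by (simp add: exp_of_nat_mult[symmetric] mult_exp_exp w_def n_def of_nat_diff algebra_simps)
      also have "\<dots> \<le> exp c * exp (- c * w)" using t2 c by (intro mult_right_mono) (auto simp: mult_left_le)
      finally show "exp (- c * t\<^sup>2) ^ (card S - 1) \<le> exp c * exp (- c * w)" .
    qed (use B0 n in auto)
    also have "\<dots> = B * exp c / n * (w ^ 2 * exp (- c * w))"
      using n by (simp add: w_def power2_eq_square power4_eq_xxxx field_simps)
    finally have d1: "norm (?\<psi> t - G) \<le> B * exp c / n * (w ^ 2 * exp (- c * w))" .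
    have d2: "\<bar>h t - Re (G / (1 + \<i> * of_real t))\<bar> \<le> norm (?\<psi> t - G)"
    proof -
      have "h t - Re (G / (1 + \<i> * of_real t)) = Re ((?\<psi> t - G) / (1 + \<i> * of_real t))"
        by (simp add: h_def diff_divide_distrib)
      also have "\<bar>\<dots>\<bar> \<le> norm ((?\<psi> t - G) / (1 + \<i> * of_real t))" by (rule abs_Re_le_cmod)
      also have "\<dots> = norm (?\<psi> t - G) / norm (1 + \<i> * of_real t)" by (rule norm_divide)
      also have "\<dots> \<le> norm (?\<psi> t - G) / 1"
      proof (intro divide_left_mono)
        show "1 \<le> norm (1 + \<i> * complex_of_real t)"
          using complex_Re_le_cmod[of "1 + \<i> * complex_of_real t"] by simp
      qed (use c0 in auto)
      finally show ?thesis by simp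
    qed
    define a where "a = U * t ^ 3 / 6"
    have aa: "\<bar>a\<bar> \<le> B * n * \<bar>t\<bar> ^ 3 / 6"
      unfolding a_def using sums(2) by (simp add: abs_mult power_abs U_def n_def mult_right_mono)
    have d3: "\<bar>Re (G / (1 + \<i> * of_real t)) - exp (- V * t\<^sup>2 / 2)\<bar> \<le> exp (- c * w) * (w / n + B\<^sup>2 * w ^ 3 / n + B * w\<^sup>2 / n)"
    proof -
      have "\<bar>Re (G / (1 + \<i> * of_real t)) - exp (- V * t\<^sup>2 / 2)\<bar> \<le> exp (- V * t\<^sup>2 / 2) * (t\<^sup>2 + a\<^sup>2 / 2 + \<bar>t * a\<bar>)"
        unfolding G_def a_def by (rule Re_gaussian_quotient)
      also have "\<dots> \<le> exp (- c * w) * (w / n + B\<^sup>2 * w ^ 3 / n + B * w\<^sup>2 / n)"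
      proof (intro mult_mono add_mono)
        show "exp (- V * t\<^sup>2 / 2) \<le> exp (- c * w)" using gE unfolding w_def .
        show "t\<^sup>2 \<le> w / n" using tw by simp
        have "a\<^sup>2 \<le> (B * n * \<bar>t\<bar> ^ 3 / 6)\<^sup>2" using power_mono[OF aa, of 2] by simp
        also have "\<dots> = B\<^sup>2 * w ^ 3 / n / 36"
          using n by (simp add: w_def field_simps power2_eq_square power3_eq_cube; simp add: abs_mult[symmetric])
        also have "\<dots> \<le> B\<^sup>2 * w ^ 3 / n" using w0 n by (simp add: field_simps)
        finally have "a\<^sup>2 \<le> B\<^sup>2 * w ^ 3 / n" .
        moreover have "a\<^sup>2 \<ge> 0" by simp
        ultimately show "a\<^sup>2 / 2 \<le> B\<^sup>2 * w ^ 3 / n" by linarith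
        have "\<bar>t * a\<bar> \<le> \<bar>t\<bar> * (B * n * \<bar>t\<bar> ^ 3 / 6)" unfolding abs_mult using aa by (intro mult_left_mono) auto
        also have "\<dots> = B * w\<^sup>2 / n / 6"
          using n by (simp add: w_def field_simps power2_eq_square power3_eq_cube; simp add: abs_mult[symmetric])
        also have "\<dots> \<le> B * w\<^sup>2 / n" using B0 n by (simp add: field_simps)
        finally show "\<bar>t * a\<bar> \<le> B * w\<^sup>2 / n" .
      qed auto
      finally show ?thesis .
    qed
    have "\<bar>h t - exp (- V * t\<^sup>2 / 2)\<bar> \<le> B * exp c / n * (w ^ 2 * exp (- c * w)) + exp (- c * w) * (w / n + B\<^sup>2 * w ^ 3 / n + B * w\<^sup>2 / n)"
      using d1 d2 d3 by linarith
    also have "\<dots> = 1 / n * (w ^ 1 * exp (- c * w)) + (B + B * exp c) / n * (w ^ 2 * exp (- c * w)) + B\<^sup>2 / n * (w ^ 3 * exp (- c * w))"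
      by (simp add: algebra_simps add_divide_distrib)
    also have "\<dots> \<le> 1 / n * (fact 1 * (2 / c) ^ 1 * E t) + (B + B * exp c) / n * (fact 2 * (2 / c) ^ 2 * E t) + B\<^sup>2 / n * (fact 3 * (2 / c) ^ 3 * E t)"
      unfolding w_def using n B0 by (intro add_mono mult_left_mono wE) auto
    also have "\<dots> = K1 / n * E t"
      unfolding K1_def by (simp add: fact_numeral add_divide_distrib algebra_simps)
    finally show ?thesis .
  qed
  \<comment> \<open>Away from 0 the factor \<open>i0\<close> supplies a decay 1/|t|, the denominator
    1 + i t another one, and the remaining \<open>card S - 1\<close> factors are at most
    \<open>\<rho>\<close> each. The last factor converts 1 / t^2 into 1 / (1 + t^2) for |t| >
    delta.\<close>
  define r where "r = C * \<rho> ^ (card S - 1) * (1 + 1 / \<delta>\<^sup>2)"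
  have r0: "r \<ge> 0" using C \<rho> \<delta> by (auto simp: r_def)
  have far': "\<bar>h t - exp (- V * t\<^sup>2 / 2)\<bar> \<le> r * (1 / (1 + t\<^sup>2)) + 2 / (c * \<delta>\<^sup>2) / n * E t" if t: "\<bar>t\<bar> > \<delta>" for t
  proof -
    have t0: "t \<noteq> 0" using t \<delta> by auto
    have td: "\<delta>\<^sup>2 \<le> t\<^sup>2" using t \<delta> power_mono[of \<delta> "\<bar>t\<bar>" 2] by simp
    have "\<bar>h t\<bar> \<le> norm (?\<psi> t / (1 + \<i> * of_real t))" unfolding h_def by (rule abs_Re_le_cmod)
    also have "\<dots> = norm (?\<psi> t) / norm (1 + \<i> * of_real t)" by (rule norm_divide)
    also have "\<dots> \<le> norm (?\<psi> t) / \<bar>t\<bar>"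
    proof (intro divide_left_mono)
      show "\<bar>t\<bar> \<le> norm (1 + \<i> * complex_of_real t)"
        using abs_Im_le_cmod[of "1 + \<i> * complex_of_real t"] by simp
    qed (use t0 c0 in auto)
    also have "norm (?\<psi> t) \<le> C / \<bar>t\<bar> * \<rho> ^ (card S - 1)"
    proof -
      have "norm (?\<psi> t) = norm (f i0 t) * norm (\<Prod>i\<in>I - {i0}. f i t)"
        unfolding char using I by (subst prod.remove[of _ i0]) (auto simp: norm_mult)
      also have "\<dots> \<le> (C / \<bar>t\<bar>) * \<rho> ^ card (S - {i0})"
        using C(2)[OF t0] C(1) I f1 far t by (intro mult_mono norm_prod_le_power) auto
      also have "card (S - {i0}) = card S - 1" using I fin by simp
      finally show ?thesis .
    qed
    hence "norm (?\<psi> t) / \<bar>t\<bar> \<le> C / \<bar>t\<bar> * \<rho> ^ (card S - 1) / \<bar>t\<bar>" by (intro divide_right_mono) auto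
    also have "\<dots> = C * \<rho> ^ (card S - 1) * (1 / t\<^sup>2)"
      by (simp add: power2_eq_square abs_mult[symmetric])
    also have "\<dots> \<le> C * \<rho> ^ (card S - 1) * ((1 + 1 / \<delta>\<^sup>2) * (1 / (1 + t\<^sup>2)))"
    proof (intro mult_left_mono)
      have "1 + t\<^sup>2 \<le> (1 + 1 / \<delta>\<^sup>2) * t\<^sup>2" using td \<delta> by (simp add: field_simps)
      thus "1 / t\<^sup>2 \<le> (1 + 1 / \<delta>\<^sup>2) * (1 / (1 + t\<^sup>2))" using t0 by (simp add: divide_simps add_pos_nonneg)
    qed (use C \<rho> in auto)
    finally have 1: "\<bar>h t\<bar> \<le> r * (1 / (1 + t\<^sup>2))" by (simp add: r_def mult.assoc)
    have "exp (- V * t\<^sup>2 / 2) \<le> 1 * exp (- c * (n * t\<^sup>2))" using gE by simp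
    also have "\<dots> \<le> (n * t\<^sup>2 / (n * \<delta>\<^sup>2)) * exp (- c * (n * t\<^sup>2))"
      using td n \<delta> by (intro mult_right_mono) (auto simp: field_simps)
    also have "\<dots> = 1 / (n * \<delta>\<^sup>2) * ((n * t\<^sup>2) ^ 1 * exp (- c * (n * t\<^sup>2)))" by simp
    also have "\<dots> \<le> 1 / (n * \<delta>\<^sup>2) * (fact 1 * (2 / c) ^ 1 * E t)" using n by (intro mult_left_mono wE) auto
    also have "\<dots> = 2 / (c * \<delta>\<^sup>2) / n * E t" by simp
    finally have "exp (- V * t\<^sup>2 / 2) \<le> 2 / (c * \<delta>\<^sup>2) / n * E t" .
    moreover have "exp (- V * t\<^sup>2 / 2) > 0" by simp
    ultimately show ?thesis using 1 by linarith
  qed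
  have all: "\<bar>h t - exp (- V * t\<^sup>2 / 2)\<bar> \<le> K2 / n * E t + r * (1 / (1 + t\<^sup>2))" for t
  proof (cases "\<bar>t\<bar> \<le> \<delta>")
    case True
    have "K1 / n * E t \<le> K2 / n * E t" using K12 n by (intro mult_right_mono divide_right_mono) (auto simp: E_def)
    moreover have "r * (1 / (1 + t\<^sup>2)) \<ge> 0" using r0 by simp
    ultimately show ?thesis using near[OF True] by linarith
  next
    case False
    have "2 / (c * \<delta>\<^sup>2) / n * E t \<le> K2 / n * E t" unfolding K2_def using K1 n by (intro mult_right_mono divide_right_mono) (auto simp: E_def)
    thus ?thesis using far'[of t] False by linarith
  qed
  have intE: "integrable lborel E" and IE: "(\<integral>t. E t \<partial>lborel) = sqrt (2 * pi / (c * n))"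
    unfolding E_def using integrable_exp_sq[of "c * n / 2"] integral_exp_sq[of "c * n / 2"] c n
    by (simp_all add: mult.commute)
  have eV: "exp (- V * t\<^sup>2 / 2) = exp (- (V / 2) * t\<^sup>2)" for t by simp
  have intV: "integrable lborel (\<lambda>t. exp (- V * t\<^sup>2 / 2))" and IV: "(\<integral>t. exp (- V * t\<^sup>2 / 2) \<partial>lborel) = sqrt (2 * pi / V)"
    unfolding eV using integrable_exp_sq[of "V / 2"] integral_exp_sq[of "V / 2"] V0 by (simp_all add: mult.commute)
  have "\<bar>2 * pi * e - sqrt (2 * pi / V)\<bar> = \<bar>\<integral>t. h t - exp (- V * t\<^sup>2 / 2) \<partial>lborel\<bar>"
    unfolding eh IV[symmetric] using inth intV by simp
  also have "\<dots> \<le> (\<integral>t. \<bar>h t - exp (- V * t\<^sup>2 / 2)\<bar> \<partial>lborel)" by (rule integral_abs_bound)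
  also have "\<dots> \<le> (\<integral>t. K2 / n * E t + r * (1 / (1 + t\<^sup>2)) \<partial>lborel)"
  proof (rule integral_mono)
    show "integrable lborel (\<lambda>t. \<bar>h t - exp (- V * t\<^sup>2 / 2)\<bar>)"
      by (intro integrable_abs Bochner_Integration.integrable_diff inth intV)
    show "integrable lborel (\<lambda>t. K2 / n * E t + r * (1 / (1 + t\<^sup>2)))"
      by (intro Bochner_Integration.integrable_add integrable_mult_right intE integrable_inverse_one_plus_sq)
  qed (rule all)
  also have "\<dots> = K2 / n * sqrt (2 * pi / (c * n)) + r * pi"
    using intE integrable_inverse_one_plus_sq
    by (simp only: Bochner_Integration.integral_add integrable_mult_right integral_mult_right_zero IE integral_inverse_one_plus_sq)
  finally have main: "\<bar>2 * pi * e - sqrt (2 * pi / V)\<bar> \<le> K2 / n * sqrt (2 * pi / (c * n)) + r * pi" .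
  \<comment> \<open>Multiplication by s turns the Gaussian integral sqrt (2 pi / V) into 1. As s is
    O(sqrt n), it just compensates the n^(-1/2) of the integrated Gaussian error.\<close>
  define s where "s = sqrt (2 * pi * V) / (2 * pi)"
  have s0: "s \<ge> 0" using V0 by (simp add: s_def)
  have ss: "s * sqrt (2 * pi / V) = 1" unfolding s_def using V0
    by (simp add: real_sqrt_mult real_sqrt_divide field_simps)
  have sB: "s \<le> sqrt (2 * pi * B) * sqrt n / (2 * pi)"
    unfolding s_def real_sqrt_mult[symmetric] using Bn by (intro divide_right_mono real_sqrt_le_mono) auto
  have "\<bar>sqrt (2 * pi * V) * e - 1\<bar> = s * \<bar>2 * pi * e - sqrt (2 * pi / V)\<bar>"
  proof -
    have "sqrt (2 * pi * V) * e - 1 = s * (2 * pi * e - sqrt (2 * pi / V))"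
      unfolding right_diff_distrib ss by (simp add: s_def)
    thus ?thesis using s0 by (simp add: abs_mult)
  qed
  also have "\<dots> \<le> (sqrt (2 * pi * B) * sqrt n / (2 * pi)) * (K2 / n * sqrt (2 * pi / (c * n)) + r * pi)"
    using main sB s0 by (intro mult_mono) (auto simp: B0 n less_imp_le)
  also have "\<dots> = K2 * sqrt (B / c) / n + sqrt (2 * pi * B) / 2 * (sqrt n * r)"
  proof -
    have "sqrt (2 * pi * B) * sqrt n / (2 * pi) * (K2 / n * sqrt (2 * pi / (c * n))) = K2 * sqrt (B / c) / n"
      using n c B0 by (simp add: real_sqrt_mult real_sqrt_divide field_simps)
    moreover have "sqrt (2 * pi * B) * sqrt n / (2 * pi) * (r * pi) = sqrt (2 * pi * B) / 2 * (sqrt n * r)"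
      by simp
    ultimately show ?thesis by (simp add: distrib_left)
  qed
  also have "sqrt n * r \<le> C * (1 + 1 / \<delta>\<^sup>2) * R / n"
  proof -
    have "n * sqrt n * \<rho> ^ (card S - 1) \<le> R" using R[of "card S"] by (simp add: n_def)
    hence "C * (1 + 1 / \<delta>\<^sup>2) * (n * sqrt n * \<rho> ^ (card S - 1)) \<le> C * (1 + 1 / \<delta>\<^sup>2) * R"
      using C by (intro mult_left_mono) auto
    thus ?thesis using n by (simp add: r_def field_simps)
  qed
  hence "K2 * sqrt (B / c) / n + sqrt (2 * pi * B) / 2 * (sqrt n * r) \<le> K2 * sqrt (B / c) / n + sqrt (2 * pi * B) / 2 * (C * (1 + 1 / \<delta>\<^sup>2) * R / n)"
    using B0 by (intro add_left_mono mult_left_mono) auto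
  also have "\<dots> = saddle_const c \<delta> B C R / n"
    unfolding saddle_const_def K2_def K1_def by (simp add: add_divide_distrib)
  finally show ?thesis unfolding V_def e_def n_def .
qed



section \<open>Exponential tilting of bounded random variables\<close>

lemma norm_exp_minus_one_minus_le:
  fixes z :: complex
  shows "norm (exp z - 1 - z) \<le> exp \<bar>Re z\<bar> * (norm z)\<^sup>2"
proof -
  have "norm (exp z - (\<Sum>i\<le>1. z ^ i / fact i)) \<le> exp \<bar>Re z\<bar> * norm z ^ Suc 1 / fact 1"
    by (rule Taylor_exp)
  thus ?thesis by (simp add: power2_eq_square algebra_simps)
qed

lemma norm_Complex_quadratic_cubic:
  "(norm (Complex (- a * t\<^sup>2 / 2) (- b * t ^ 3 / 6)))\<^sup>2 = a\<^sup>2 * t ^ 4 / 4 + b\<^sup>2 * (t\<^sup>2 * t ^ 4) / 36"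
  by (simp add: cmod_power2 power_divide power_mult_distrib power_mult[symmetric] power_add[symmetric])

text \<open>Instantiated twice: for the contribution of one prime under the Sato-Tate law and for
  the whole sum log L. Boundedness makes all exponential moments finite and the moment generating
  function entire.\<close>

locale bounded_rv = prob_space M for M :: "'a measure" +
  fixes X :: "'a \<Rightarrow> real" and B :: real
  assumes X_meas [measurable]: "X \<in> borel_measurable M"
    and X_bound: "\<And>x. x \<in> space M \<Longrightarrow> \<bar>X x\<bar> \<le> B"
begin

definition emom :: "nat \<Rightarrow> complex \<Rightarrow> complex" where
  "emom j s = (\<integral>x. of_real (X x) ^ j * exp (s * of_real (X x)) \<partial>M)"

definition rmom :: "nat \<Rightarrow> real \<Rightarrow> real" where
  "rmom j k = (\<integral>x. X x ^ j * exp (k * X x) \<partial>M)"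

definition tmean :: "real \<Rightarrow> real" where "tmean k = rmom 1 k / rmom 0 k"
definition tvar :: "real \<Rightarrow> real" where "tvar k = rmom 2 k / rmom 0 k - (tmean k)\<^sup>2"

definition tilt :: "real \<Rightarrow> 'a measure" where
  "tilt k = density M (\<lambda>x. ennreal (exp (k * X x) / rmom 0 k))"

lemma B_nonneg: "B \<ge> 0"
  using X_bound not_empty by force

lemma norm_integrand_le:
  assumes "x \<in> space M"
  shows "norm (of_real (X x) ^ j * exp (s * of_real (X x)) :: complex) \<le> B ^ j * exp (norm s * B)"
  unfolding norm_mult
proof (rule mult_mono)
  show "norm (of_real (X x) ^ j :: complex) \<le> B ^ j"
    using X_bound[OF assms] by (simp add: norm_power power_mono)
  have "Re s * X x \<le> \<bar>Re s\<bar> * \<bar>X x\<bar>" by (metis abs_ge_self abs_mult)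
  also have "\<dots> \<le> norm s * B" using X_bound[OF assms] abs_Re_le_cmod by (intro mult_mono) auto
  finally show "norm (exp (s * of_real (X x))) \<le> exp (norm s * B)" by (simp add: norm_exp_eq_Re)
qed (use B_nonneg in auto)

lemma integrable_emom: "integrable M (\<lambda>x. of_real (X x) ^ j * exp (s * of_real (X x)) :: complex)"
  by (rule integrable_const_bound[where B = "B ^ j * exp (norm s * B)"])
     (auto intro!: AE_I2 norm_integrand_le)

text \<open>Because X is bounded, the remainder e^(hX) - 1 - hX is O(|h|^2) uniformly on the space,
  so the error of the difference quotient can be integrated directly.\<close>

lemma emom_deriv: "(emom j has_field_derivative emom (Suc j) s) (at s)"
proof -
  define K where "K = B ^ j * exp (norm s * B) * exp B * B\<^sup>2"
  have bd: "norm ((emom j (s + h) - emom j s) / h - emom (Suc j) s) \<le> K * norm h" if h: "h \<noteq> 0" "norm h \<le> 1" for h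
  proof -
    let ?w = "\<lambda>x. of_real (X x) ^ j * exp (s * of_real (X x)) * (exp (h * of_real (X x)) - 1 - h * of_real (X x)) :: complex"
    let ?a = "\<lambda>j s x. of_real (X x) ^ j * exp (s * of_real (X x)) :: complex"
    have w: "?w x = ?a j (s + h) x - ?a j s x - h * ?a (Suc j) s x" for x
      by (simp add: distrib_right exp_add algebra_simps)
    have "(\<integral>x. ?w x \<partial>M) = (\<integral>x. ?a j (s + h) x - ?a j s x \<partial>M) - (\<integral>x. h * ?a (Suc j) s x \<partial>M)"
      unfolding w by (intro Bochner_Integration.integral_diff Bochner_Integration.integrable_diff integrable_mult_right integrable_emom)
    also have "(\<integral>x. ?a j (s + h) x - ?a j s x \<partial>M) = emom j (s + h) - emom j s"
      unfolding emom_def by (intro Bochner_Integration.integral_diff integrable_emom)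
    also have "(\<integral>x. h * ?a (Suc j) s x \<partial>M) = h * emom (Suc j) s"
      unfolding emom_def by (rule integral_mult_right_zero)
    finally have e: "emom j (s + h) - emom j s - h * emom (Suc j) s = (\<integral>x. ?w x \<partial>M)" by simp
    have "norm (\<integral>x. ?w x \<partial>M) \<le> (\<integral>x. K * (norm h)\<^sup>2 \<partial>M)"
    proof (rule order_trans[OF integral_norm_bound integral_mono])
      show "integrable M (\<lambda>x. norm (?w x))"
        unfolding w by (intro integrable_norm integrable_emom Bochner_Integration.integrable_diff integrable_mult_right)
      fix x assume x: "x \<in> space M"
      have hX: "norm (h * of_real (X x)) \<le> norm h * B" using X_bound[OF x] by (simp add: norm_mult mult_left_mono)
      also have "\<dots> \<le> 1 * B" using h B_nonneg by (intro mult_right_mono) auto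
      finally have hB: "norm (h * of_real (X x)) \<le> B" by simp
      have "norm (exp (h * of_real (X x)) - 1 - h * of_real (X x)) \<le> exp \<bar>Re (h * of_real (X x))\<bar> * (norm (h * of_real (X x)))\<^sup>2"
        by (rule norm_exp_minus_one_minus_le)
      also have "\<dots> \<le> exp B * (norm h * B)\<^sup>2"
        using hX hB abs_Re_le_cmod[of "h * of_real (X x)"] by (intro mult_mono power_mono) auto
      finally have 1: "norm (exp (h * of_real (X x)) - 1 - h * of_real (X x)) \<le> exp B * (norm h * B)\<^sup>2" .
      have "norm (?w x) \<le> (B ^ j * exp (norm s * B)) * (exp B * (norm h * B)\<^sup>2)"
        unfolding norm_mult[of "of_real (X x) ^ j * exp (s * of_real (X x))"]
        using norm_integrand_le[OF x, of j s] 1 B_nonneg by (intro mult_mono) auto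
      thus "norm (?w x) \<le> K * (norm h)\<^sup>2" by (simp add: K_def power_mult_distrib mult_ac)
    qed simp
    hence "norm (emom j (s + h) - emom j s - h * emom (Suc j) s) \<le> K * (norm h)\<^sup>2" unfolding e by (simp add: prob_space)
    moreover have "(emom j (s + h) - emom j s) / h - emom (Suc j) s = (emom j (s + h) - emom j s - h * emom (Suc j) s) / h"
      using h by (simp add: field_simps)
    ultimately show ?thesis using h by (simp add: norm_divide field_simps power2_eq_square)
  qed
  have "((\<lambda>h. (emom j (s + h) - emom j s) / h - emom (Suc j) s) \<longlongrightarrow> 0) (at 0)"
  proof (rule Lim_null_comparison)
    have "\<forall>\<^sub>F h in at (0::complex). h \<noteq> 0 \<and> norm h \<le> 1"
      unfolding eventually_at by (intro exI[of _ 1]) auto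
    thus "\<forall>\<^sub>F h in at 0. norm ((emom j (s + h) - emom j s) / h - emom (Suc j) s) \<le> K * norm h"
      by eventually_elim (use bd in auto)
    show "((\<lambda>h. K * norm h) \<longlongrightarrow> 0) (at (0::complex))" by (auto intro!: tendsto_eq_intros)
  qed
  hence "((\<lambda>h. (emom j (s + h) - emom j s) / h) \<longlongrightarrow> emom (Suc j) s) (at 0)" by (rule LIM_zero_cancel)
  thus ?thesis by (simp add: DERIV_def)
qed

lemma emom_of_real: "emom j (of_real k) = of_real (rmom j k)"
proof -
  have "emom j (of_real k) = (\<integral>x. complex_of_real (X x ^ j * exp (k * X x)) \<partial>M)"
    unfolding emom_def by (intro Bochner_Integration.integral_cong refl)
      (simp only: exp_of_real of_real_mult[symmetric] of_real_power[symmetric])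
  thus ?thesis by (simp only: rmom_def integral_complex_of_real)
qed

lemma integrable_rmom: "integrable M (\<lambda>x. X x ^ j * exp (k * X x))"
proof -
  have "integrable M (\<lambda>x. Re (of_real (X x) ^ j * exp (of_real k * of_real (X x)) :: complex))"
    by (rule integrable_Re[OF integrable_emom])
  moreover have "Re (of_real (X x) ^ j * exp (of_real k * of_real (X x)) :: complex) = X x ^ j * exp (k * X x)" for x
    by (metis Re_complex_of_real exp_of_real of_real_mult of_real_power)
  ultimately show ?thesis by (simp only:)
qed

lemma rmom_deriv: "(rmom j has_real_derivative rmom (Suc j) k) (at k)"
proof -
  have "((\<lambda>x. emom j (of_real x)) has_vector_derivative emom (Suc j) (of_real k)) (at k)"
    using emom_deriv by (rule has_vector_derivative_real_field)
  hence "((\<lambda>x. Re (emom j (of_real x))) has_vector_derivative Re (emom (Suc j) (of_real k))) (at k)"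
    by (rule bounded_linear.has_vector_derivative[OF bounded_linear_Re])
  thus ?thesis by (simp add: emom_of_real has_real_derivative_iff_has_vector_derivative)
qed

lemma rmom_0_pos: "rmom 0 k > 0"
proof -
  have "rmom 0 k \<ge> (\<integral>x. exp (- \<bar>k\<bar> * B) \<partial>M)"
    unfolding rmom_def
  proof (rule integral_mono)
    fix x assume x: "x \<in> space M"
    have "\<bar>k * X x\<bar> \<le> \<bar>k\<bar> * B" unfolding abs_mult using X_bound[OF x] by (intro mult_left_mono) auto
    thus "exp (- \<bar>k\<bar> * B) \<le> X x ^ 0 * exp (k * X x)" by simp
  qed (use integrable_rmom[of 0] in auto)
  moreover have "(\<integral>x. exp (- \<bar>k\<bar> * B) \<partial>M) = exp (- \<bar>k\<bar> * B)" by (simp add: prob_space)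
  ultimately show ?thesis by (smt (verit) exp_gt_zero)
qed

lemma ln_rmom_deriv: "((\<lambda>k. ln (rmom 0 k)) has_real_derivative tmean k) (at k)"
  using rmom_0_pos[of k] unfolding tmean_def
  by (auto intro!: derivative_eq_intros rmom_deriv)

lemma tmean_deriv: "(tmean has_real_derivative tvar k) (at k)"
proof -
  have 1: "(rmom 1 has_real_derivative rmom 2 k) (at k)" using rmom_deriv[of 1 k] by (simp add: numeral_2_eq_2)
  have 0: "(rmom 0 has_real_derivative rmom 1 k) (at k)" using rmom_deriv[of 0 k] by simp
  have n0: "rmom 0 k \<noteq> 0" using rmom_0_pos[of k] by simp
  have "((\<lambda>k. rmom 1 k / rmom 0 k) has_real_derivative (rmom 2 k * rmom 0 k - rmom 1 k * rmom 1 k) / (rmom 0 k * rmom 0 k)) (at k)"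
    by (rule DERIV_divide[OF 1 0 n0])
  also have "(rmom 2 k * rmom 0 k - rmom 1 k * rmom 1 k) / (rmom 0 k * rmom 0 k) = tvar k"
    using n0 by (simp add: tvar_def tmean_def field_simps power2_eq_square)
  finally show ?thesis unfolding tmean_def[abs_def] .
qed

lemma prob_space_tilt: "prob_space (tilt k)"
proof
  have "emeasure (tilt k) (space (tilt k)) = (\<integral>\<^sup>+x. ennreal (exp (k * X x) / rmom 0 k) \<partial>M)"
    unfolding tilt_def by (subst emeasure_density) (auto intro!: nn_integral_cong)
  also have "\<dots> = ennreal (\<integral>x. exp (k * X x) / rmom 0 k \<partial>M)"
    using rmom_0_pos[of k] integrable_rmom[of 0 k]
    by (intro nn_integral_eq_integral) auto
  also have "(\<integral>x. exp (k * X x) / rmom 0 k \<partial>M) = 1"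
    using rmom_0_pos[of k] by (simp add: rmom_def)
  finally show "emeasure (tilt k) (space (tilt k)) = 1" by simp
qed

lemma space_tilt [simp]: "space (tilt k) = space M" and sets_tilt [simp]: "sets (tilt k) = sets M"
  by (simp_all add: tilt_def)

lemma measurable_tilt [simp]: "measurable (tilt k) N = measurable M N"
  by (rule measurable_cong_sets) auto

lemma integral_tilt:
  fixes f :: "'a \<Rightarrow> 'b::{banach, second_countable_topology}"
  assumes "f \<in> borel_measurable M"
  shows "(\<integral>x. f x \<partial>tilt k) = (\<integral>x. (exp (k * X x) / rmom 0 k) *\<^sub>R f x \<partial>M)"
  unfolding tilt_def using assms rmom_0_pos[of k]
  by (intro integral_density) (auto intro!: AE_I2 divide_nonneg_pos)

lemma integrable_tilt_bounded:
  fixes f :: "'a \<Rightarrow> 'b::{banach, second_countable_topology}"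
  assumes "f \<in> borel_measurable M" "\<And>x. x \<in> space M \<Longrightarrow> norm (f x) \<le> C"
  shows "integrable (tilt k) f"
proof -
  interpret T: prob_space "tilt k" by (rule prob_space_tilt)
  show ?thesis by (rule T.integrable_const_bound[where B = C]) (use assms in auto)
qed

lemma integrable_tilt_power: "integrable (tilt k) (\<lambda>x. X x ^ j)"
proof (rule integrable_tilt_bounded[where C = "B ^ j"])
  fix x assume "x \<in> space M"
  from power_mono[OF X_bound[OF this], of j] show "norm (X x ^ j) \<le> B ^ j" by (simp add: power_abs)
qed simp

lemma integral_tilt_power: "(\<integral>x. X x ^ j \<partial>tilt k) = rmom j k / rmom 0 k"
  unfolding rmom_def[of j] by (subst integral_tilt) (simp_all add: mult.commute)

lemma tmean_eq: "tmean k = (\<integral>x. X x \<partial>tilt k)"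
  using integral_tilt_power[where j = 1] by (simp add: tmean_def)

lemma tvar_eq: "tvar k = (\<integral>x. (X x - tmean k)\<^sup>2 \<partial>tilt k)"
proof -
  interpret T: prob_space "tilt k" by (rule prob_space_tilt)
  have i: "integrable (tilt k) (\<lambda>x. (X x)\<^sup>2)" "integrable (tilt k) X"
    using integrable_tilt_power[of k 2] integrable_tilt_power[of k 1] by simp_all
  have "(\<integral>x. (X x - tmean k)\<^sup>2 \<partial>tilt k) = (\<integral>x. (X x)\<^sup>2 - 2 * tmean k * X x + (tmean k)\<^sup>2 \<partial>tilt k)"
    by (rule Bochner_Integration.integral_cong) (auto simp: power2_diff algebra_simps)
  also have "\<dots> = (\<integral>x. (X x)\<^sup>2 \<partial>tilt k) - 2 * tmean k * (\<integral>x. X x \<partial>tilt k) + (tmean k)\<^sup>2"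
    using i T.prob_space by simp
  also have "\<dots> = tvar k"
    unfolding tmean_eq[symmetric] integral_tilt_power tvar_def by (simp add: power2_eq_square)
  finally show ?thesis ..
qed

lemma tvar_nonneg: "tvar k \<ge> 0"
  unfolding tvar_eq by (rule Bochner_Integration.integral_nonneg) auto

text \<open>The characteristic function of \<open>tlaw k\<close>, written through
  \<open>emom\<close> at k + i k t. In this form it factors over independent summands at
  once.\<close>

definition tchar :: "real \<Rightarrow> real \<Rightarrow> complex" where
  "tchar k t = emom 0 (Complex k (k * t)) / of_real (rmom 0 k) * exp (- (\<i> * of_real (k * t * tmean k)))"

text \<open>The centred variable is multiplied by k, so that undoing the tilt produces exactly
  e^(-Z) and each prime p <= k contributes on a scale of order 1.\<close>

definition tlaw :: "real \<Rightarrow> real measure" where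
  "tlaw k = distr (tilt k) borel (\<lambda>x. k * (X x - tmean k))"

lemma real_distribution_tlaw: "real_distribution (tlaw k)"
proof -
  interpret T: prob_space "tilt k" by (rule prob_space_tilt)
  show ?thesis unfolding tlaw_def by (rule T.real_distribution_distr) simp
qed

lemma char_tlaw: "char (tlaw k) t = tchar k t"
proof -
  have "char (tlaw k) t = (\<integral>x. exp (\<i> * of_real (t * (k * (X x - tmean k)))) \<partial>tilt k)"
    unfolding char_def tlaw_def by (subst integral_distr) auto
  also have "\<dots> = (\<integral>x. (exp (k * X x) / rmom 0 k) *\<^sub>R exp (\<i> * of_real (t * (k * (X x - tmean k)))) \<partial>M)"
    by (rule integral_tilt) measurable
  also have "\<dots> = (\<integral>x. (of_real (X x) ^ 0 * exp (Complex k (k * t) * of_real (X x))) * (exp (- (\<i> * of_real (k * t * tmean k))) / of_real (rmom 0 k)) \<partial>M)"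
  proof (rule Bochner_Integration.integral_cong[OF refl])
    fix x
    have "complex_of_real (exp (k * X x)) * exp (\<i> * of_real (t * (k * (X x - tmean k))))
        = exp (Complex k (k * t) * of_real (X x)) * exp (- (\<i> * of_real (k * t * tmean k)))"
      unfolding exp_of_real[symmetric] mult_exp_exp
      by (rule arg_cong[of _ _ exp]) (simp add: complex_eq_iff algebra_simps)
    thus "(exp (k * X x) / rmom 0 k) *\<^sub>R exp (\<i> * of_real (t * (k * (X x - tmean k))))
        = (of_real (X x) ^ 0 * exp (Complex k (k * t) * of_real (X x))) * (exp (- (\<i> * of_real (k * t * tmean k))) / of_real (rmom 0 k))"
      by (simp add: scaleR_conv_of_real)
  qed
  also have "\<dots> = tchar k t" unfolding tchar_def emom_def by simp
  finally show ?thesis .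
qed

lemma norm_tchar_le_1: "norm (tchar k t) \<le> 1"
  using real_distribution.cmod_char_le_1[OF real_distribution_tlaw] by (simp add: char_tlaw)

text \<open>The density of M with respect to the tilted measure is a constant times e^(-kX), and
  e^(-kX) = e^(-k tmean) e^(-Z). This is an identity, with no approximation.\<close>

lemma tail_prob_eq:
  assumes k: "k > 0"
  shows "measure M {x \<in> space M. X x \<ge> tmean k} 
      = rmom 0 k * exp (- k * tmean k) * (\<integral>x. exp (- x) * indicator {0..} x \<partial>tlaw k)"
proof -
  have "(\<integral>x. exp (- x) * indicator {0..} x \<partial>tlaw k) = (\<integral>x. exp (- (k * (X x - tmean k))) * indicator {0..} (k * (X x - tmean k)) \<partial>tilt k)"
    unfolding tlaw_def by (subst integral_distr) auto
  also have "\<dots> = (\<integral>x. (exp (k * X x) / rmom 0 k) *\<^sub>R (exp (- (k * (X x - tmean k))) * indicator {0..} (k * (X x - tmean k))) \<partial>M)"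
    by (rule integral_tilt) measurable
  also have "\<dots> = (\<integral>x. (exp (k * tmean k) / rmom 0 k) * indicator {x \<in> space M. X x \<ge> tmean k} x \<partial>M)"
  proof (rule Bochner_Integration.integral_cong[OF refl])
    fix x assume "x \<in> space M"
    thus "(exp (k * X x) / rmom 0 k) *\<^sub>R (exp (- (k * (X x - tmean k))) * indicator {0..} (k * (X x - tmean k)))
        = (exp (k * tmean k) / rmom 0 k) * indicator {x \<in> space M. X x \<ge> tmean k} x"
      using k by (auto simp: indicator_def zero_le_mult_iff mult_exp_exp right_diff_distrib)
  qed
  also have "\<dots> = (exp (k * tmean k) / rmom 0 k) * measure M {x \<in> space M. X x \<ge> tmean k}"
    by simp
  finally have eq: "(\<integral>x. exp (- x) * indicator {0..} x \<partial>tlaw k) = exp (k * tmean k) / rmom 0 k * measure M {x \<in> space M. X x \<ge> tmean k}" .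
  show ?thesis unfolding eq using rmom_0_pos[of k] by (simp add: exp_minus field_simps)
qed

lemma emom_not_nonpos_Reals: "emom 0 (of_real k) \<notin> \<real>\<^sub>\<le>\<^sub>0"
  using rmom_0_pos[of k] by (simp add: emom_of_real complex_nonpos_Reals_iff)

text \<open>\<open>emom 0\<close> avoids the branch cut on an open set containing the real axis. The
  formula for the first derivative must hold on a neighbourhood before it can be differentiated
  again, hence the set \<open>U\<close>.\<close>

lemma deriv_Ln_emom:
  "deriv (\<lambda>z. Ln (emom 0 z)) (of_real k) = of_real (tmean k)"
  "(deriv ^^ 2) (\<lambda>z. Ln (emom 0 z)) (of_real k) = of_real (tvar k)"
proof -
  define U where "U = {z. emom 0 z \<notin> \<real>\<^sub>\<le>\<^sub>0}"
  have cont: "continuous_on UNIV (emom 0)"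
    by (rule DERIV_continuous_on) (rule DERIV_subset[OF emom_deriv], simp)
  have "open (emom 0 -` (- \<real>\<^sub>\<le>\<^sub>0))"
    by (rule open_vimage[OF _ cont]) (simp add: open_Compl)
  moreover have "emom 0 -` (- \<real>\<^sub>\<le>\<^sub>0) = U" by (auto simp: U_def)
  ultimately have U: "open U" by simp
  have d1: "((\<lambda>z. Ln (emom 0 z)) has_field_derivative emom 1 z / emom 0 z) (at z)" if "z \<in> U" for z
    using that emom_deriv[of 0 z] unfolding U_def
    by (auto intro!: derivative_eq_intros simp: field_simps)
  have kU: "of_real k \<in> U" using emom_not_nonpos_Reals by (simp add: U_def)
  have e1: "deriv (\<lambda>z. Ln (emom 0 z)) z = emom 1 z / emom 0 z" if "z \<in> U" for z
    by (rule DERIV_imp_deriv[OF d1[OF that]])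
  show "deriv (\<lambda>z. Ln (emom 0 z)) (of_real k) = of_real (tmean k)"
    unfolding e1[OF kU] by (simp add: emom_of_real tmean_def)
  have n0: "emom 0 (of_real k) \<noteq> 0" using rmom_0_pos[of k] by (simp add: emom_of_real)
  have d2: "((\<lambda>z. emom 1 z / emom 0 z) has_field_derivative of_real (tvar k)) (at (of_real k))"
  proof -
    have "((\<lambda>z. emom 1 z / emom 0 z) has_field_derivative 
       (emom 2 (of_real k) * emom 0 (of_real k) - emom 1 (of_real k) * emom 1 (of_real k)) / (emom 0 (of_real k) * emom 0 (of_real k))) (at (of_real k))"
      using DERIV_divide[OF emom_deriv[of 1] emom_deriv[of 0] n0] by (simp add: numeral_2_eq_2)
    also have "(emom 2 (of_real k) * emom 0 (of_real k) - emom 1 (of_real k) * emom 1 (of_real k)) / (emom 0 (of_real k) * emom 0 (of_real k))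
        = complex_of_real ((rmom 2 k * rmom 0 k - rmom 1 k * rmom 1 k) / (rmom 0 k * rmom 0 k))"
      by (simp add: emom_of_real)
    also have "(rmom 2 k * rmom 0 k - rmom 1 k * rmom 1 k) / (rmom 0 k * rmom 0 k) = tvar k"
      using rmom_0_pos[of k] by (simp add: tvar_def tmean_def field_simps power2_eq_square)
    finally show ?thesis .
  qed
  have "\<forall>\<^sub>F z in nhds (of_real k). deriv (\<lambda>z. Ln (emom 0 z)) z = emom 1 z / emom 0 z"
    using eventually_nhds_in_open[OF U kU] by eventually_elim (rule e1)
  hence "deriv (deriv (\<lambda>z. Ln (emom 0 z))) (of_real k) = deriv (\<lambda>z. emom 1 z / emom 0 z) (of_real k)"
    by (rule deriv_cong_ev) simp
  also have "\<dots> = of_real (tvar k)" by (rule DERIV_imp_deriv[OF d2])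
  finally show "(deriv ^^ 2) (\<lambda>z. Ln (emom 0 z)) (of_real k) = of_real (tvar k)" by (simp add: numeral_2_eq_2)
qed

definition tmom4 :: "real \<Rightarrow> real" where
  "tmom4 k = (\<integral>x. (k * (X x - tmean k)) ^ 4 \<partial>tilt k)"
definition tmom3 :: "real \<Rightarrow> real" where
  "tmom3 k = (\<integral>x. (k * (X x - tmean k)) ^ 3 \<partial>tilt k)"

lemma integrable_tilt_centered: "integrable (tilt k) (\<lambda>x. (k * (X x - tmean k)) ^ j)"
proof (rule integrable_tilt_bounded[where C = "(\<bar>k\<bar> * (B + \<bar>tmean k\<bar>)) ^ j"])
  fix x assume "x \<in> space M"
  hence "\<bar>X x - tmean k\<bar> \<le> B + \<bar>tmean k\<bar>" using X_bound by (smt (verit))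
  thus "norm ((k * (X x - tmean k)) ^ j) \<le> (\<bar>k\<bar> * (B + \<bar>tmean k\<bar>)) ^ j"
    unfolding norm_power by (intro power_mono) (auto simp: abs_mult intro!: mult_left_mono)
qed simp

text \<open>With Y the centred variable scaled by k, the third claim is nonnegativity of the
  variance of Y^2, and the fourth integrates 2 |y|^3 <= y^2 + y^4.\<close>

lemma tilt_moments:
  shows "(\<integral>x. k * (X x - tmean k) \<partial>tilt k) = 0" and "(\<integral>x. (k * (X x - tmean k))\<^sup>2 \<partial>tilt k) = k\<^sup>2 * tvar k"
    and "(k\<^sup>2 * tvar k)\<^sup>2 \<le> tmom4 k" and "\<bar>tmom3 k\<bar> \<le> (k\<^sup>2 * tvar k + tmom4 k) / 2"
proof -
  interpret T: prob_space "tilt k" by (rule prob_space_tilt)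
  let ?Y = "\<lambda>x. k * (X x - tmean k)"
  have i: "integrable (tilt k) X" using integrable_tilt_power[of k 1] by simp
  show "(\<integral>x. ?Y x \<partial>tilt k) = 0" using i T.prob_space by (simp add: tmean_eq[symmetric])
  show v: "(\<integral>x. (?Y x)\<^sup>2 \<partial>tilt k) = k\<^sup>2 * tvar k"
    unfolding tvar_eq by (simp add: power_mult_distrib)
  let ?v = "k\<^sup>2 * tvar k"
  have i2: "integrable (tilt k) (\<lambda>x. (?Y x)\<^sup>2)" "integrable (tilt k) (\<lambda>x. (?Y x) ^ 4)" "integrable (tilt k) (\<lambda>x. (?Y x) ^ 3)"
    using integrable_tilt_centered by blast+
  have "0 \<le> (\<integral>x. ((?Y x)\<^sup>2 - ?v)\<^sup>2 \<partial>tilt k)" by (rule Bochner_Integration.integral_nonneg) auto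
  also have "\<dots> = (\<integral>x. (?Y x) ^ 4 - 2 * ?v * (?Y x)\<^sup>2 + ?v\<^sup>2 \<partial>tilt k)"
  proof (rule Bochner_Integration.integral_cong[OF refl])
    fix x
    have "(y\<^sup>2 - w)\<^sup>2 = y ^ 4 - 2 * w * y\<^sup>2 + w\<^sup>2" for y w :: real by (simp add: power2_eq_square power4_eq_xxxx algebra_simps)
    thus "((?Y x)\<^sup>2 - ?v)\<^sup>2 = (?Y x) ^ 4 - 2 * ?v * (?Y x)\<^sup>2 + ?v\<^sup>2" .
  qed
  also have "\<dots> = (\<integral>x. (?Y x) ^ 4 - 2 * ?v * (?Y x)\<^sup>2 \<partial>tilt k) + (\<integral>x. ?v\<^sup>2 \<partial>tilt k)"
    by (intro Bochner_Integration.integral_add Bochner_Integration.integrable_diff integrable_mult_right i2) auto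
  also have "(\<integral>x. (?Y x) ^ 4 - 2 * ?v * (?Y x)\<^sup>2 \<partial>tilt k) = (\<integral>x. (?Y x) ^ 4 \<partial>tilt k) - (\<integral>x. 2 * ?v * (?Y x)\<^sup>2 \<partial>tilt k)"
    by (intro Bochner_Integration.integral_diff integrable_mult_right i2)
  also have "(\<integral>x. 2 * ?v * (?Y x)\<^sup>2 \<partial>tilt k) = 2 * ?v * ?v"
    using v by (subst integral_mult_right_zero) simp
  also have "(\<integral>x. ?v\<^sup>2 \<partial>tilt k) = ?v\<^sup>2" using T.prob_space by simp
  also have "2 * ?v * ?v = 2 * ?v\<^sup>2" by (simp only: power2_eq_square mult.assoc)
  finally show "?v\<^sup>2 \<le> tmom4 k" unfolding tmom4_def by linarith
  have "\<bar>tmom3 k\<bar> \<le> (\<integral>x. \<bar>(?Y x) ^ 3\<bar> \<partial>tilt k)" unfolding tmom3_def by (rule integral_abs_bound)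
  also have "\<dots> \<le> (\<integral>x. ((?Y x)\<^sup>2 + (?Y x) ^ 4) / 2 \<partial>tilt k)"
  proof (rule integral_mono)
    fix x
    have "\<bar>y ^ 3\<bar> \<le> (y\<^sup>2 + y ^ 4) / 2" for y :: real
    proof -
      have "0 \<le> (\<bar>y\<bar> - y\<^sup>2)\<^sup>2" by simp
      also have "\<dots> = y\<^sup>2 + y ^ 4 - 2 * \<bar>y ^ 3\<bar>"
        by (cases "y \<ge> 0") (auto simp: power2_eq_square power4_eq_xxxx power3_eq_cube algebra_simps abs_mult)
      finally show ?thesis by simp
    qed
    thus "\<bar>(?Y x) ^ 3\<bar> \<le> ((?Y x)\<^sup>2 + (?Y x) ^ 4) / 2" .
  qed (use i2 in auto)
  also have "\<dots> = (\<integral>x. ((?Y x)\<^sup>2 + (?Y x) ^ 4) \<partial>tilt k) / 2" by simp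
  also have "(\<integral>x. ((?Y x)\<^sup>2 + (?Y x) ^ 4) \<partial>tilt k) = ?v + tmom4 k"
    unfolding tmom4_def v[symmetric] by (intro Bochner_Integration.integral_add i2)
  finally show "\<bar>tmom3 k\<bar> \<le> (?v + tmom4 k) / 2" .
qed

definition gauss_const :: "real \<Rightarrow> real" where "gauss_const Q = 1 + (1 + Q) * exp (1 + Q)"

text \<open>Both functions are compared with 1 + z, where z holds the second and third moments. The
  error is kept proportional to \<open>tmom4 k\<close>, and not merely bounded through Q, so that it
  can be summed over the primes above k.\<close>

lemma tchar_gauss_approx:
  assumes Q: "tmom4 k \<le> Q" and t: "\<bar>t\<bar> \<le> 1"
  shows "norm (tchar k t - exp (Complex (- (k\<^sup>2 * tvar k) * t\<^sup>2 / 2) (- tmom3 k * t ^ 3 / 6))) \<le> gauss_const Q * tmom4 k * t ^ 4"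
proof -
  let ?Y = "\<lambda>x. k * (X x - tmean k)"
  let ?v = "k\<^sup>2 * tvar k"
  define m where "m = tmom4 k"
  interpret R: real_distribution "tlaw k" by (rule real_distribution_tlaw)
  have Y: "?Y \<in> measurable (tilt k) borel" by simp
  have mom: "R.expectation (\<lambda>x. x ^ j) = (\<integral>x. ?Y x ^ j \<partial>tilt k)" for j
    unfolding tlaw_def by (subst integral_distr[OF Y]) auto
  have im: "integrable (tlaw k) (\<lambda>x. x ^ j)" for j
    unfolding tlaw_def by (subst integrable_distr_eq[OF Y]) (auto intro: integrable_tilt_centered)
  have m0: "m \<ge> 0" unfolding m_def tmom4_def by (rule Bochner_Integration.integral_nonneg) auto
  define z where "z = Complex (- ?v * t\<^sup>2 / 2) (- tmom3 k * t ^ 3 / 6)"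
  have v0: "?v \<ge> 0" using tvar_nonneg by simp
  have v2: "?v\<^sup>2 \<le> m" unfolding m_def by (rule tilt_moments)
  have t2: "t\<^sup>2 \<le> 1" using t by (simp add: abs_square_le_1)
  have "(\<Sum>j\<le>3. ((\<i> * t) ^ j / fact j) * R.expectation (\<lambda>x. x ^ j)) = 1 + z"
  proof -
    have "R.expectation (\<lambda>x. x ^ 0) = 1" "R.expectation (\<lambda>x. x ^ 1) = 0" "R.expectation (\<lambda>x. x ^ 2) = ?v" "R.expectation (\<lambda>x. x ^ 3) = tmom3 k"
      using R.prob_space unfolding mom tmom3_def using tilt_moments(1,2)[of k] prob_space.prob_space[OF prob_space_tilt] by simp_all
    moreover have "{..3::nat} = {0,1,2,3}" by auto
    ultimately show ?thesis
      by (simp add: z_def complex_eq_iff fact_numeral power2_eq_square power3_eq_cube)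
  qed
  hence "norm (char (tlaw k) t - (1 + z)) \<le> \<bar>t\<bar> ^ 3 / fact (Suc 3) * R.expectation (\<lambda>x. min (2 * \<bar>x\<bar> ^ 3 * Suc 3) (\<bar>t\<bar> * \<bar>x\<bar> ^ Suc 3))"
    using R.char_approx2[of 3 t] im by simp
  also have "\<dots> \<le> \<bar>t\<bar> ^ 3 / fact (Suc 3) * (\<bar>t\<bar> * m)"
  proof (intro mult_left_mono)
    have "R.expectation (\<lambda>x. min (2 * \<bar>x\<bar> ^ 3 * Suc 3) (\<bar>t\<bar> * \<bar>x\<bar> ^ Suc 3)) \<le> R.expectation (\<lambda>x. \<bar>t\<bar> * x ^ 4)"
    proof (rule integral_mono)
      show "integrable (tlaw k) (\<lambda>x. \<bar>t\<bar> * x ^ 4)" using im by simp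
      thus "integrable (tlaw k) (\<lambda>x. min (2 * \<bar>x\<bar> ^ 3 * Suc 3) (\<bar>t\<bar> * \<bar>x\<bar> ^ Suc 3))"
        by (rule Bochner_Integration.integrable_bound) (auto simp: tlaw_def abs_mult min_def power_abs numeral_eq_Suc)
    qed (auto simp: power_abs numeral_eq_Suc)
    also have "\<dots> = \<bar>t\<bar> * m" unfolding m_def tmom4_def using mom[of 4] by simp
    finally show "R.expectation (\<lambda>x. min (2 * \<bar>x\<bar> ^ 3 * Suc 3) (\<bar>t\<bar> * \<bar>x\<bar> ^ Suc 3)) \<le> \<bar>t\<bar> * m" .
  qed simp
  also have "\<dots> = (\<bar>t\<bar> ^ 3 * \<bar>t\<bar>) * m / 24" by (simp add: fact_numeral)
  also have "\<bar>t\<bar> ^ 3 * \<bar>t\<bar> = t ^ 4" by (simp add: power3_eq_cube power4_eq_xxxx abs_mult[symmetric])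
  finally have 1: "norm (char (tlaw k) t - (1 + z)) \<le> t ^ 4 * m / 24" .
  have "norm (exp z - 1 - z) \<le> exp \<bar>Re z\<bar> * (norm z)\<^sup>2" by (rule norm_exp_minus_one_minus_le)
  also have "\<dots> \<le> exp (1 + Q) * ((1 + Q) * m * t ^ 4)"
  proof (intro mult_mono)
    have "?v \<le> (1 + ?v\<^sup>2) / 2" using sum_squares_bound[of 1 ?v] by simp
    hence v1: "?v \<le> 1 + Q" using v2 Q m0 by (simp add: m_def)
    have "\<bar>Re z\<bar> = ?v * t\<^sup>2 / 2" using v0 by (simp add: z_def)
    also have "\<dots> \<le> ?v * 1 / 2" using v0 t2 by (intro divide_right_mono mult_left_mono) auto
    finally show "exp \<bar>Re z\<bar> \<le> exp (1 + Q)" using v1 v0 by simp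
    have "(tmom3 k)\<^sup>2 \<le> ((?v + m) / 2)\<^sup>2" using power_mono[OF tilt_moments(4)[of k], of 2] by (simp add: m_def)
    also have "\<dots> \<le> (?v\<^sup>2 + m\<^sup>2) / 2" using sum_squares_bound[of ?v m] by (simp add: power2_eq_square algebra_simps)
    also have "m\<^sup>2 \<le> Q * m" using Q m0 by (simp add: power2_eq_square m_def mult_right_mono)
    finally have \<mu>: "(tmom3 k)\<^sup>2 \<le> (1 + Q) * m" using v2 m0 Q
      by (simp add: algebra_simps m_def) (smt (verit) mult_nonneg_nonneg)
    have "(norm z)\<^sup>2 = ?v\<^sup>2 * t ^ 4 / 4 + (tmom3 k)\<^sup>2 * (t\<^sup>2 * t ^ 4) / 36"
      unfolding z_def by (rule norm_Complex_quadratic_cubic)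
    also have "\<dots> \<le> m * t ^ 4 / 4 + ((1 + Q) * m) * (1 * t ^ 4) / 36"
      using v2 \<mu> t2 m0 order_trans[OF zero_le_power2 \<mu>] by (intro add_mono divide_right_mono mult_mono) auto
    also have "\<dots> \<le> (1 + Q) * m * t ^ 4"
    proof -
      have "m * t ^ 4 \<le> (1 + Q) * m * t ^ 4" using m0 Q by (intro mult_right_mono) (auto simp: m_def algebra_simps)
      moreover have "0 \<le> m * t ^ 4" using m0 by simp
      ultimately show ?thesis by simp
    qed
    finally show "(norm z)\<^sup>2 \<le> (1 + Q) * m * t ^ 4" .
  qed auto
  finally have 2: "norm (exp z - 1 - z) \<le> exp (1 + Q) * ((1 + Q) * m * t ^ 4)" .
  have "norm (tchar k t - exp z) \<le> norm (char (tlaw k) t - (1 + z)) + norm (exp z - 1 - z)"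
    unfolding char_tlaw using norm_triangle_ineq4[of "tchar k t - (1 + z)" "exp z - 1 - z"] by (simp add: algebra_simps)
  also have "\<dots> \<le> t ^ 4 * m / 24 + exp (1 + Q) * ((1 + Q) * m * t ^ 4)" using 1 2 by linarith
  also have "\<dots> \<le> gauss_const Q * m * t ^ 4"
  proof -
    have "0 \<le> t ^ 4 * m" using m0 by simp
    thus ?thesis unfolding gauss_const_def by (simp add: algebra_simps)
  qed
  finally show ?thesis unfolding z_def m_def .
qed

end



section \<open>The contribution of one prime: tilted law of the angle and its moments\<close>

lemma exp_minus_mult_le: "x \<ge> 0 \<Longrightarrow> x * exp (- x) \<le> 2 * exp (- x / 2)" for x :: real
  using power_mult_exp_le[of 1 x 1] by simp

text \<open>From sin 3y = sin y (3 - 4 sin^2 y). Up to pi/6 the sine is at most 1/2, which keeps the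
  bracket at least 2.\<close>

lemma sin_sq_triple: "\<bar>sin (3 * y)\<bar> \<le> 3 * \<bar>sin y\<bar>" "0 \<le> y \<Longrightarrow> y \<le> pi / 6 \<Longrightarrow> 4 * (sin y)\<^sup>2 \<le> (sin (3 * y))\<^sup>2 \<and> (sin y)\<^sup>2 \<le> 1 / 4" for y :: real
proof -
  have t: "sin (3 * y) = sin y * (3 - 4 * (sin y)\<^sup>2)" for y :: real
  proof -
    have "sin (3 * y) = sin (2 * y + y)" by (simp add: algebra_simps)
    also have "\<dots> = 2 * sin y * (cos y)\<^sup>2 + (1 - 2 * (sin y)\<^sup>2) * sin y"
      unfolding sin_add sin_double cos_double_sin by (simp add: power2_eq_square)
    also have "\<dots> = sin y * (3 - 4 * (sin y)\<^sup>2)" unfolding cos_squared_eq by (simp add: algebra_simps)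
    finally show ?thesis .
  qed
  have s1: "(sin y)\<^sup>2 \<le> 1" for y :: real by (simp add: abs_square_le_1)
  have "\<bar>3 - 4 * (sin y)\<^sup>2\<bar> \<le> 3" using s1[of y] zero_le_power2[of "sin y"] by linarith
  thus "\<bar>sin (3 * y)\<bar> \<le> 3 * \<bar>sin y\<bar>"
    unfolding t abs_mult using mult_left_mono[of "\<bar>3 - 4 * (sin y)\<^sup>2\<bar>" 3 "\<bar>sin y\<bar>"] by (simp add: mult.commute)
  assume y: "0 \<le> y" "y \<le> pi / 6"
  have "sin y \<le> sin (pi / 6)" using y pi_gt_zero by (intro sin_monotone_2pi_le) auto
  moreover have "sin y \<ge> 0" using y by (intro sin_ge_zero) auto
  ultimately have q: "(sin y)\<^sup>2 \<le> (1 / 2)\<^sup>2" by (intro power_mono) (auto simp: sin_30)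
  hence q': "(sin y)\<^sup>2 \<le> 1 / 4" by (simp add: power2_eq_square)
  hence "2\<^sup>2 \<le> (3 - 4 * (sin y)\<^sup>2)\<^sup>2" by (intro power_mono) auto
  hence "(sin y)\<^sup>2 * 4 \<le> (sin y)\<^sup>2 * (3 - 4 * (sin y)\<^sup>2)\<^sup>2" by (intro mult_left_mono) auto
  thus "4 * (sin y)\<^sup>2 \<le> (sin (3 * y))\<^sup>2 \<and> (sin y)\<^sup>2 \<le> 1 / 4" using q'
    unfolding t power_mult_distrib by linarith
qed

text \<open>Jordan's inequality, from concavity of the sine.\<close>

lemma sin_ge_two_pi: "0 \<le> x \<Longrightarrow> x \<le> pi / 2 \<Longrightarrow> sin x \<ge> 2 / pi * x"
proof -
  assume x: "0 \<le> x" "x \<le> pi / 2"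
  have "convex_on {0..pi/2} (\<lambda>x. - sin x)"
  proof (rule f''_ge0_imp_convex)
    show "((\<lambda>x. - sin x) has_real_derivative - cos x) (at x)" for x by (auto intro!: derivative_eq_intros)
    show "((\<lambda>x. - cos x) has_real_derivative sin x) (at x)" for x by (auto intro!: derivative_eq_intros)
    show "sin x \<ge> 0" if "x \<in> {0..pi/2}" for x using that by (intro sin_ge_zero) auto
  qed simp
  from convex_onD[OF this, of "2 / pi * x" 0 "pi / 2"] x
  show ?thesis by (auto simp: field_simps)
qed

lemma one_minus_sinc:
  fixes y :: real
  assumes "y \<noteq> 0"
  shows "\<bar>y\<bar> \<le> 2 \<Longrightarrow> \<bar>sin y\<bar> / \<bar>y\<bar> \<le> 1 - y\<^sup>2 / 8" and "\<bar>y\<bar> \<ge> 2 \<Longrightarrow> \<bar>sin y\<bar> / \<bar>y\<bar> \<le> 1 / 2"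
proof -
  assume y2: "\<bar>y\<bar> \<le> 2"
  have "\<bar>sin y - (y - y ^ 3 / 6)\<bar> \<le> \<bar>y\<bar> ^ 5 / 120"
  proof -
    have "(\<Sum>m<5. sin_coeff m * y ^ m) = y - y ^ 3 / 6"
      by (simp add: lessThan_nat_numeral sin_coeff_def fact_numeral)
    hence "\<bar>sin y - (y - y ^ 3 / 6)\<bar> \<le> inverse (fact 5) * \<bar>y\<bar> ^ 5"
      using Maclaurin_sin_bound[of y 5] by (simp only:)
    thus ?thesis by (simp add: fact_numeral)
  qed
  moreover have "\<bar>y - y ^ 3 / 6\<bar> = \<bar>y\<bar> - \<bar>y\<bar> ^ 3 / 6"
  proof -
    have "y\<^sup>2 \<le> 2\<^sup>2" using power_mono[OF y2, of 2] by simp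
    hence "\<bar>y * (1 - y\<^sup>2 / 6)\<bar> = \<bar>y\<bar> * (1 - \<bar>y\<bar>\<^sup>2 / 6)" unfolding abs_mult by simp
    thus ?thesis by (simp add: algebra_simps power2_eq_square power3_eq_cube abs_mult)
  qed
  ultimately have "\<bar>sin y\<bar> \<le> \<bar>y\<bar> - \<bar>y\<bar> ^ 3 / 6 + \<bar>y\<bar> ^ 5 / 120" by linarith
  also have "\<dots> = \<bar>y\<bar> * (1 - \<bar>y\<bar>\<^sup>2 / 6 + \<bar>y\<bar>\<^sup>2 * \<bar>y\<bar>\<^sup>2 / 120)"
    by (simp add: algebra_simps eval_nat_numeral)
  \<comment> \<open>For |y| <= 2 the quartic term is at most y^2 / 30, and 1/6 - 1/30 > 1/8.\<close>
  also have "\<dots> \<le> \<bar>y\<bar> * (1 - \<bar>y\<bar>\<^sup>2 / 8)"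
  proof (intro mult_left_mono)
    have "\<bar>y\<bar>\<^sup>2 \<le> 4" using power_mono[OF y2, of 2] by simp
    hence "\<bar>y\<bar>\<^sup>2 * \<bar>y\<bar>\<^sup>2 \<le> \<bar>y\<bar>\<^sup>2 * 4" by (intro mult_left_mono) auto
    thus "1 - \<bar>y\<bar>\<^sup>2 / 6 + \<bar>y\<bar>\<^sup>2 * \<bar>y\<bar>\<^sup>2 / 120 \<le> 1 - \<bar>y\<bar>\<^sup>2 / 8" using zero_le_power2[of "\<bar>y\<bar>"] by linarith
  qed simp
  finally show "\<bar>sin y\<bar> / \<bar>y\<bar> \<le> 1 - y\<^sup>2 / 8" using assms by (simp add: field_simps)
next
  assume "\<bar>y\<bar> \<ge> 2"
  hence "\<bar>sin y\<bar> / \<bar>y\<bar> \<le> 1 / 2" by (intro frac_le) auto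
  thus "\<bar>sin y\<bar> / \<bar>y\<bar> \<le> 1 / 2" .
qed

abbreviation st_measure :: "real measure" where
  "st_measure \<equiv> density lborel (\<lambda>x. ennreal (sato_tate_density x))"

lemma sato_tate_density_measurable [measurable]: "sato_tate_density \<in> borel_measurable borel"
  unfolding sato_tate_density_def[abs_def] by measurable

lemma integrable_indicator_bounded:
  fixes f :: "real \<Rightarrow> 'b::{banach, second_countable_topology}"
  assumes "f \<in> borel_measurable borel" "\<And>x. x \<in> {a..b} \<Longrightarrow> norm (f x) \<le> C"
  shows "integrable lborel (\<lambda>x. indicator {a..b} x *\<^sub>R f x)"
  by (rule integrableI_bounded_set_indicator[where B = C]) (use assms in \<open>auto simp: emeasure_lborel_Icc_eq\<close>)

lemma prob_space_st_measure: "prob_space st_measure"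
proof
  have "(\<integral>x. indicator {0..pi} x *\<^sub>R (sin x)\<^sup>2 \<partial>lborel) = (pi - sin pi * cos pi) / 2 - (0 - sin 0 * cos 0) / 2"
  proof (rule integral_FTC_Icc)
    fix x :: real
    have "((\<lambda>x. (x - sin x * cos x) / 2) has_real_derivative (1 - (cos x * cos x - sin x * sin x)) / 2) (at x)"
      by (auto intro!: derivative_eq_intros)
    also have "(1 - (cos x * cos x - sin x * sin x)) / 2 = (sin x)\<^sup>2"
      using sin_squared_eq[of x] by (simp add: power2_eq_square)
    finally have d: "((\<lambda>x. (x - sin x * cos x) / 2) has_real_derivative (sin x)\<^sup>2) (at x)" .
    show "((\<lambda>x. (x - sin x * cos x) / 2) has_vector_derivative (sin x)\<^sup>2) (at x within {0..pi})"
      by (rule has_vector_derivative_at_within[OF d[unfolded has_real_derivative_iff_has_vector_derivative]])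
  qed (auto intro!: continuous_intros)
  hence i: "(\<integral>x. indicator {0..pi} x *\<^sub>R (sin x)\<^sup>2 \<partial>lborel) = pi / 2" by simp
  have "emeasure st_measure (space st_measure) = (\<integral>\<^sup>+x. ennreal (sato_tate_density x) \<partial>lborel)"
    by (subst emeasure_density) (auto intro!: nn_integral_cong)
  also have "\<dots> = (\<integral>\<^sup>+x. ennreal (2 / pi * (indicator {0..pi} x *\<^sub>R (sin x)\<^sup>2)) \<partial>lborel)"
    by (rule nn_integral_cong) (simp add: sato_tate_density_def mult_ac)
  also have "\<dots> = ennreal (\<integral>x. 2 / pi * (indicator {0..pi} x *\<^sub>R (sin x)\<^sup>2) \<partial>lborel)"
  proof (rule nn_integral_eq_integral)
    show "integrable lborel (\<lambda>x. 2 / pi * (indicator {0..pi} x *\<^sub>R (sin x)\<^sup>2))"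
      by (intro integrable_mult_right integrable_indicator_bounded[where C = 1]) (auto simp: abs_square_le_1)
  qed (auto simp: indicator_def)
  also have "(\<integral>x. 2 / pi * (indicator {0..pi} x *\<^sub>R (sin x)\<^sup>2) \<partial>lborel) = 1"
    unfolding integral_mult_right_zero i by simp
  finally show "emeasure st_measure (space st_measure) = 1" by simp
qed

lemma integral_st_measure:
  fixes f :: "real \<Rightarrow> 'b::{banach, second_countable_topology}"
  assumes "f \<in> borel_measurable borel"
  shows "(\<integral>x. f x \<partial>st_measure) = (\<integral>x. (2 / pi) *\<^sub>R (indicator {0..pi} x *\<^sub>R ((sin x)\<^sup>2 *\<^sub>R f x)) \<partial>lborel)"
  using assms by (subst integral_density) (auto simp: sato_tate_density_def mult_ac)

locale prime_angle =
  fixes p :: nat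
  assumes p2: "p \<ge> 2"
begin

text \<open>From 1 - 2 cos(theta)/p + 1/p^2 = (1 - 1/p)^2 (1 + a sin^2(theta/2)). Thus
  \<open>x0\<close> is the maximum of log D, attained at angle 0, and \<open>W\<close> is the
  nonnegative amount by which log D falls short of it. The tilt favours small
  \<open>W\<close>.\<close>

definition a :: real where "a = (4 / real p) / (1 - 1 / real p)\<^sup>2"
definition x0 :: real where "x0 = - 2 * ln (1 - 1 / real p)"
definition W :: "real \<Rightarrow> real" where "W \<theta> = ln (1 + a * (sin (\<theta> / 2))\<^sup>2)"

lemma p_inv: "0 < 1 / real p" "1 / real p \<le> 1 / 2" "real p > 0"
  using p2 by (auto simp: field_simps)

lemma a_bounds: "a > 0" "a \<le> 8" "a \<le> 16 / real p" "a \<ge> 4 / real p"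
proof -
  have s: "(1 / 2)\<^sup>2 \<le> (1 - 1 / real p)\<^sup>2" using p_inv by (intro power_mono) auto
  have s1: "(1 - 1 / real p)\<^sup>2 \<le> 1" using p_inv by (intro power_le_one) auto
  have s0: "(1 - 1 / real p)\<^sup>2 > 0" using p_inv by simp
  show "a > 0" unfolding a_def using p_inv s0 by simp
  have "a \<le> (4 / real p) / (1 / 2)\<^sup>2" unfolding a_def using s s0 by (intro divide_left_mono) auto
  thus a16: "a \<le> 16 / real p" by (simp add: power2_eq_square)
  have "16 / real p = 16 * (1 / real p)" by simp
  also have "\<dots> \<le> 16 * (1 / 2)" using p_inv by (intro mult_left_mono) auto
  finally show "a \<le> 8" using a16 by simp
  have "(4 / real p) / 1 \<le> a" unfolding a_def using s1 s0 by (intro divide_left_mono) auto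
  thus "a \<ge> 4 / real p" by simp
qed

lemma one_plus_pos: "1 + a * (sin (\<theta> / 2))\<^sup>2 \<ge> 1"
  using a_bounds(1) by simp

lemma W_nonneg: "W \<theta> \<ge> 0" unfolding W_def by (intro ln_ge_zero one_plus_pos)

lemma exp_W: "exp (W \<theta>) = 1 + a * (sin (\<theta> / 2))\<^sup>2"
  unfolding W_def using one_plus_pos[of \<theta>] by (subst exp_ln) auto

lemma W_le: "W \<theta> \<le> a * (sin (\<theta> / 2))\<^sup>2" "W \<theta> \<le> a"
proof -
  show 1: "W \<theta> \<le> a * (sin (\<theta> / 2))\<^sup>2"
    unfolding W_def using a_bounds by (intro ln_add_one_self_le_self) auto
  also have "\<dots> \<le> a * 1" using a_bounds by (intro mult_left_mono) (auto simp: abs_square_le_1)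
  finally show "W \<theta> \<le> a" by simp
qed

lemma W_measurable [measurable]: "W \<in> borel_measurable borel"
  unfolding W_def[abs_def] by measurable

lemma D_eq: "D p \<theta> = exp (x0 - W \<theta>)" and ln_D: "ln (D p \<theta>) = x0 - W \<theta>"
proof -
  have d0: "1 - 1 / real p > 0" using p_inv by simp
  have c: "cos \<theta> = 1 - 2 * (sin (\<theta> / 2))\<^sup>2" using cos_double_sin[of "\<theta> / 2"] by simp
  have "1 - 2 * cos \<theta> / real p + 1 / (real p)\<^sup>2 = (1 - 1 / real p)\<^sup>2 + 4 / real p * (sin (\<theta> / 2))\<^sup>2"
    unfolding c by (simp add: power2_eq_square diff_divide_distrib algebra_simps)
  also have "\<dots> = (1 - 1 / real p)\<^sup>2 * (1 + a * (sin (\<theta> / 2))\<^sup>2)"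
  proof -
    have "(1 - 1 / real p)\<^sup>2 \<noteq> 0" using zero_less_power[OF d0, of 2] by linarith
    moreover have "r \<noteq> 0 \<Longrightarrow> r * (4 / real p / r) = 4 / real p" for r :: real by simp
    ultimately have "(1 - 1 / real p)\<^sup>2 * a = 4 / real p" unfolding a_def by blast
    thus ?thesis by (simp only: distrib_left mult_1_right mult.assoc[symmetric])
  qed
  also have "(1 - 1 / real p)\<^sup>2 = exp (- x0)"
    using d0 by (simp add: x0_def exp_double[of "ln (1 - 1 / real p)"])
  also have "exp (- x0) * (1 + a * (sin (\<theta> / 2))\<^sup>2) = exp (- (x0 - W \<theta>))"
    unfolding exp_W[symmetric] by (simp add: mult_exp_exp)
  finally show "D p \<theta> = exp (x0 - W \<theta>)" unfolding D_def by (simp only: exp_minus inverse_inverse_eq)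
  thus "ln (D p \<theta>) = x0 - W \<theta>" by simp
qed

sublocale bounded_rv st_measure "\<lambda>\<theta>. (x0 - W \<theta>)" "\<bar>x0\<bar> + 8"
proof -
  interpret prob_space st_measure by (rule prob_space_st_measure)
  show "bounded_rv st_measure (\<lambda>\<theta>. (x0 - W \<theta>)) (\<bar>x0\<bar> + 8)"
  proof
    show "(\<lambda>\<theta>. (x0 - W \<theta>)) \<in> borel_measurable st_measure" by simp
    fix \<theta>
    have "0 \<le> W \<theta>" "W \<theta> \<le> 8" using W_nonneg W_le(2)[of \<theta>] a_bounds(2) by auto
    thus "\<bar>(x0 - W \<theta>)\<bar> \<le> \<bar>x0\<bar> + 8" by linarith
  qed
qed

definition h :: "real \<Rightarrow> real" where
  "h s = (\<integral>\<theta>. indicator {0..pi} \<theta> *\<^sub>R (exp (- s * W \<theta>) * (sin \<theta>)\<^sup>2) \<partial>lborel)"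

definition dens :: "real \<Rightarrow> real \<Rightarrow> real" where
  "dens s \<theta> = indicator {0..pi} \<theta> * (exp (- s * W \<theta>) * (sin \<theta>)\<^sup>2) / h s"

lemma integrable_h: "integrable lborel (\<lambda>\<theta>. indicator {0..pi} \<theta> *\<^sub>R (exp (- s * W \<theta>) * (sin \<theta>)\<^sup>2))"
proof (rule integrable_indicator_bounded[where C = "exp (\<bar>s\<bar> * 8) * 1"])
  fix \<theta> :: real
  have W8: "W \<theta> \<le> 8" using W_le(2)[of \<theta>] a_bounds(2) by linarith
  have "- s * W \<theta> \<le> \<bar>s\<bar> * W \<theta>" using W_nonneg by (intro mult_right_mono) auto
  also have "\<dots> \<le> \<bar>s\<bar> * 8" using W8 by (intro mult_left_mono) auto
  finally have "exp (- s * W \<theta>) \<le> exp (\<bar>s\<bar> * 8)" by simp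
  thus "norm (exp (- s * W \<theta>) * (sin \<theta>)\<^sup>2) \<le> exp (\<bar>s\<bar> * 8) * 1"
    unfolding norm_mult by (intro mult_mono) (auto simp: abs_square_le_1)
qed measurable

lemma rmom_0_eq: "rmom 0 s = exp (s * x0) * (2 / pi) * h s"
proof -
  have "rmom 0 s = (\<integral>\<theta>. exp (s * (x0 - W \<theta>)) \<partial>st_measure)" unfolding rmom_def by simp
  also have "\<dots> = (\<integral>\<theta>. (exp (s * x0) * (2 / pi)) * (indicator {0..pi} \<theta> *\<^sub>R (exp (- s * W \<theta>) * (sin \<theta>)\<^sup>2)) \<partial>lborel)"
    by (subst integral_st_measure)
       (auto intro!: Bochner_Integration.integral_cong simp: right_diff_distrib exp_diff exp_minus field_simps)
  also have "\<dots> = exp (s * x0) * (2 / pi) * h s" unfolding h_def by (rule integral_mult_right_zero)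
  finally show ?thesis .
qed

lemma h_pos: "h s > 0"
proof -
  have "exp (s * x0) * (2 / pi) > 0" by simp
  thus ?thesis using rmom_0_pos[of s] unfolding rmom_0_eq by (rule zero_less_mult_pos[rotated])
qed

lemma dens_nonneg: "dens s \<theta> \<ge> 0"
  unfolding dens_def using h_pos[of s] by (intro divide_nonneg_pos mult_nonneg_nonneg) auto

lemma dens_measurable [measurable]: "dens s \<in> borel_measurable borel"
  unfolding dens_def[abs_def] by measurable

lemma integral_tilt_dens:
  fixes f :: "real \<Rightarrow> 'b::{banach, second_countable_topology}"
  assumes f: "f \<in> borel_measurable borel"
  shows "(\<integral>\<theta>. f \<theta> \<partial>tilt k) = (\<integral>\<theta>. dens k \<theta> *\<^sub>R f \<theta> \<partial>lborel)"
proof -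
  have fm: "f \<in> borel_measurable st_measure" using f by simp
  have "(\<integral>\<theta>. f \<theta> \<partial>tilt k) = (\<integral>\<theta>. (exp (k * (x0 - W \<theta>)) / rmom 0 k) *\<^sub>R f \<theta> \<partial>st_measure)"
    using integral_tilt[OF fm, of k] .
  also have "\<dots> = (\<integral>\<theta>. (2 / pi) *\<^sub>R (indicator {0..pi} \<theta> *\<^sub>R ((sin \<theta>)\<^sup>2 *\<^sub>R ((exp (k * (x0 - W \<theta>)) / rmom 0 k) *\<^sub>R f \<theta>))) \<partial>lborel)"
    using f by (intro integral_st_measure) measurable
  also have "\<dots> = (\<integral>\<theta>. dens k \<theta> *\<^sub>R f \<theta> \<partial>lborel)"
  proof (rule Bochner_Integration.integral_cong[OF refl])
    fix \<theta>
    have "2 / pi * (indicator {0..pi} \<theta> * ((sin \<theta>)\<^sup>2 * (exp (k * (x0 - W \<theta>)) / rmom 0 k))) = dens k \<theta>"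
      unfolding dens_def rmom_0_eq using h_pos[of k] by (simp add: right_diff_distrib exp_diff exp_minus field_simps)
    thus "(2 / pi) *\<^sub>R (indicator {0..pi} \<theta> *\<^sub>R ((sin \<theta>)\<^sup>2 *\<^sub>R ((exp (k * (x0 - W \<theta>)) / rmom 0 k) *\<^sub>R f \<theta>))) = dens k \<theta> *\<^sub>R f \<theta>"
      by (simp add: mult_ac)
  qed
  finally show ?thesis .
qed

text \<open>
  Comparing \<open>\<theta>\<close> with \<open>\<theta> / 3\<close>: as \<open>a \<le> 8\<close>, \<open>(1 + a sin\<^sup>2(\<theta>/6))\<^sup>2 \<le> 1 + a sin\<^sup>2(\<theta>/2)\<close>, so halving the exponent costs a constant factor,
  uniformly in \<open>s\<close> and \<open>p\<close>.
\<close>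
lemma h_half: assumes s: "s \<ge> 0" shows "h (s / 2) \<le> 27 * h s"
proof -
  have W3: "2 * W (\<theta> / 3) \<le> W \<theta>" if "\<theta> \<in> {0..pi}" for \<theta>
  proof -
    define y where "y = \<theta> / 6"
    have y: "0 \<le> y" "y \<le> pi / 6" "3 * y = \<theta> / 2" "\<theta> / 3 / 2 = y" using that by (auto simp: y_def)
    have sq: "4 * (sin y)\<^sup>2 \<le> (sin (\<theta> / 2))\<^sup>2" "(sin y)\<^sup>2 \<le> 1 / 4" using sin_sq_triple(2)[OF y(1,2)] unfolding y(3) by auto
    have ay: "a * (sin y)\<^sup>2 \<le> 8 * (1 / 4)" using a_bounds sq by (intro mult_mono) auto
    have "(1 + a * (sin y)\<^sup>2)\<^sup>2 = 1 + 2 * (a * (sin y)\<^sup>2) + (a * (sin y)\<^sup>2) * (a * (sin y)\<^sup>2)"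
      by (simp add: power2_eq_square algebra_simps)
    moreover have "(a * (sin y)\<^sup>2) * (a * (sin y)\<^sup>2) \<le> (a * (sin y)\<^sup>2) * 2"
      using ay a_bounds by (intro mult_left_mono) auto
    moreover have "a * (4 * (sin y)\<^sup>2) \<le> a * (sin (\<theta> / 2))\<^sup>2" using sq a_bounds by (intro mult_left_mono) auto
    ultimately have le: "(1 + a * (sin y)\<^sup>2)\<^sup>2 \<le> 1 + a * (sin (\<theta> / 2))\<^sup>2" by linarith
    have "0 < 1 + a * (sin y)\<^sup>2" using a_bounds(1) by (intro add_pos_nonneg) auto
    hence "0 < (1 + a * (sin y)\<^sup>2)\<^sup>2" by (rule zero_less_power)
    with le have "ln ((1 + a * (sin y)\<^sup>2)\<^sup>2) \<le> ln (1 + a * (sin (\<theta> / 2))\<^sup>2)"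
      by (rule ln_mono)
    moreover have "ln ((1 + a * (sin y)\<^sup>2)\<^sup>2) = 2 * ln (1 + a * (sin y)\<^sup>2)"
      using one_plus_pos[of "\<theta>/3"] by (subst ln_realpow) (auto simp: y(4))
    ultimately show ?thesis unfolding W_def y(4) by simp
  qed
  have "h (s / 2) \<le> (\<integral>\<theta>. indicator {0..pi} \<theta> *\<^sub>R (exp (- s * W (\<theta> / 3)) * (sin \<theta>)\<^sup>2) \<partial>lborel)"
    unfolding h_def
  proof (rule integral_mono[OF integrable_h])
    show "integrable lborel (\<lambda>\<theta>. indicator {0..pi} \<theta> *\<^sub>R (exp (- s * W (\<theta> / 3)) * (sin \<theta>)\<^sup>2))"
    proof (rule integrable_indicator_bounded[where C = "1 * 1"])
      fix \<theta> show "norm (exp (- s * W (\<theta> / 3)) * (sin \<theta>)\<^sup>2) \<le> 1 * 1"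
        unfolding norm_mult using s W_nonneg[of "\<theta>/3"] by (intro mult_mono) (auto simp: abs_square_le_1)
    qed measurable
    fix \<theta> :: real
    show "indicator {0..pi} \<theta> *\<^sub>R (exp (- (s / 2) * W \<theta>) * (sin \<theta>)\<^sup>2) \<le> indicator {0..pi} \<theta> *\<^sub>R (exp (- s * W (\<theta> / 3)) * (sin \<theta>)\<^sup>2)"
    proof (cases "\<theta> \<in> {0..pi}")
      case True
      have "s / 2 * (2 * W (\<theta> / 3)) \<le> s / 2 * W \<theta>" using W3[OF True] s by (intro mult_left_mono) auto
      thus ?thesis using True by (simp add: mult_right_mono)
    qed simp
  qed
  \<comment> \<open>Substitution theta = 3 phi. The Jacobian 3 and sin^2(3 phi) <= 9 sin^2(phi) give
    the constant 27.\<close>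
  also have "\<dots> = 3 * (\<integral>\<phi>. indicator {0..pi} (3 * \<phi>) *\<^sub>R (exp (- s * W \<phi>) * (sin (3 * \<phi>))\<^sup>2) \<partial>lborel)"
    by (subst lborel_integral_real_affine[where c = 3 and t = 0]) simp_all
  also have "(\<integral>\<phi>. indicator {0..pi} (3 * \<phi>) *\<^sub>R (exp (- s * W \<phi>) * (sin (3 * \<phi>))\<^sup>2) \<partial>lborel)
      \<le> (\<integral>\<phi>. 9 * (indicator {0..pi} \<phi> *\<^sub>R (exp (- s * W \<phi>) * (sin \<phi>)\<^sup>2)) \<partial>lborel)"
  proof (rule integral_mono_AE')
    show "integrable lborel (\<lambda>\<phi>. 9 * (indicator {0..pi} \<phi> *\<^sub>R (exp (- s * W \<phi>) * (sin \<phi>)\<^sup>2)))"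
      by (intro integrable_mult_right integrable_h)
    have "indicator {0..pi} (3 * \<phi>) *\<^sub>R (exp (- s * W \<phi>) * (sin (3 * \<phi>))\<^sup>2) \<le> 9 * (indicator {0..pi} \<phi> *\<^sub>R (exp (- s * W \<phi>) * (sin \<phi>)\<^sup>2))" for \<phi>
    proof -
      have s9: "(sin (3 * \<phi>))\<^sup>2 \<le> 9 * (sin \<phi>)\<^sup>2"
        using power_mono[OF sin_sq_triple(1)[of \<phi>], of 2] by (simp add: power_mult_distrib)
      have i: "indicator {0..pi} (3 * \<phi>) \<le> (indicator {0..pi} \<phi> :: real)" using pi_gt_zero by (auto simp: indicator_def)
      have "indicator {0..pi} (3 * \<phi>) * (exp (- s * W \<phi>) * (sin (3 * \<phi>))\<^sup>2) \<le> indicator {0..pi} \<phi> * (exp (- s * W \<phi>) * (9 * (sin \<phi>)\<^sup>2))"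
        using i s9 by (intro mult_mono) auto
      thus ?thesis by (simp add: mult_ac)
    qed
    thus "AE \<phi> in lborel. indicator {0..pi} (3 * \<phi>) *\<^sub>R (exp (- s * W \<phi>) * (sin (3 * \<phi>))\<^sup>2) \<le> 9 * (indicator {0..pi} \<phi> *\<^sub>R (exp (- s * W \<phi>) * (sin \<phi>)\<^sup>2))"
      by simp
  qed (auto simp: indicator_def)
  also have "\<dots> = 9 * h s" unfolding h_def by (rule integral_mult_right_zero)
  finally show ?thesis by simp
qed

lemma integrable_dens: "integrable lborel (dens k)"
  using integrable_h[of k] unfolding dens_def[abs_def] by simp

lemma integral_dens: "(\<integral>\<theta>. dens k \<theta> \<partial>lborel) = 1"
  using h_pos[of k] unfolding dens_def[abs_def] h_def by (simp add: h_def)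

text \<open>This expectation is h(k/2) / h(k). It bounds all moments of k W uniformly in k and p,
  whatever the scale of the tilted density.\<close>

lemma expectation_exp_W:
  assumes k: "k \<ge> 0"
  shows "(\<integral>\<theta>. exp (k * W \<theta> / 2) \<partial>tilt k) \<le> 27"
proof -
  have "(\<integral>\<theta>. exp (k * W \<theta> / 2) \<partial>tilt k) = (\<integral>\<theta>. dens k \<theta> *\<^sub>R exp (k * W \<theta> / 2) \<partial>lborel)"
    by (rule integral_tilt_dens) measurable
  also have "\<dots> = (\<integral>\<theta>. (1 / h k) * (indicator {0..pi} \<theta> *\<^sub>R (exp (- (k / 2) * W \<theta>) * (sin \<theta>)\<^sup>2)) \<partial>lborel)"
  proof (rule Bochner_Integration.integral_cong[OF refl])
    fix \<theta>
    have "exp (- k * W \<theta>) * exp (k * W \<theta> / 2) = exp (- (k / 2) * W \<theta>)" by (simp add: mult_exp_exp)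
    thus "dens k \<theta> *\<^sub>R exp (k * W \<theta> / 2) = (1 / h k) * (indicator {0..pi} \<theta> *\<^sub>R (exp (- (k / 2) * W \<theta>) * (sin \<theta>)\<^sup>2))"
      unfolding dens_def by (simp add: mult_ac)
  qed
  also have "\<dots> = (1 / h k) * h (k / 2)" unfolding h_def by (rule integral_mult_right_zero)
  also have "\<dots> \<le> 27" using h_half[OF k] h_pos[of k] by (simp add: field_simps)
  finally show ?thesis .
qed

lemma tmean_eq_W: "tmean k = x0 - (\<integral>\<theta>. W \<theta> \<partial>tilt k)" and EW_bounds: "0 \<le> (\<integral>\<theta>. W \<theta> \<partial>tilt k)" "(\<integral>\<theta>. W \<theta> \<partial>tilt k) \<le> a"
proof -
  interpret T: prob_space "tilt k" by (rule prob_space_tilt)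
  have i: "integrable (tilt k) W"
    by (rule integrable_tilt_bounded[where C = a]) (use W_nonneg W_le in auto)
  show "tmean k = x0 - (\<integral>\<theta>. W \<theta> \<partial>tilt k)"
    unfolding tmean_eq using i T.prob_space by simp
  show "0 \<le> (\<integral>\<theta>. W \<theta> \<partial>tilt k)" by (rule Bochner_Integration.integral_nonneg) (rule W_nonneg)
  have "(\<integral>\<theta>. W \<theta> \<partial>tilt k) \<le> (\<integral>\<theta>. a \<partial>tilt k)" by (rule integral_mono[OF i]) (use W_le in auto)
  thus "(\<integral>\<theta>. W \<theta> \<partial>tilt k) \<le> a" using T.prob_space by simp
qed

lemma tmean_le: "tmean k \<le> x0" using tmean_eq_W EW_bounds(1) by simp

lemma centered_bound: "\<bar>x0 - W \<theta> - tmean k\<bar> \<le> 16 / real p"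
  unfolding tmean_eq_W using EW_bounds[of k] W_nonneg[of \<theta>] W_le(2)[of \<theta>] a_bounds(3) by linarith

lemma scaled_centered_bound: assumes "k \<ge> 0" shows "\<bar>k * (x0 - W \<theta> - tmean k)\<bar> \<le> 16 * k / real p"
proof -
  have "k * \<bar>x0 - W \<theta> - tmean k\<bar> \<le> k * (16 / real p)" using centered_bound assms by (rule mult_left_mono)
  thus ?thesis unfolding abs_mult using assms by (simp add: mult.commute)
qed

text \<open>The trivial bound, from the range of \<open>W\<close>; it is the useful one for p > k.
  For p <= k it is replaced by the uniform bound \<open>Q4\<close>.\<close>

lemma tmom4_small: assumes "k \<ge> 0" shows "tmom4 k \<le> (16 * k / real p) ^ 4"
proof -
  interpret T: prob_space "tilt k" by (rule prob_space_tilt)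
  have "tmom4 k \<le> (\<integral>\<theta>. (16 * k / real p) ^ 4 \<partial>tilt k)"
    unfolding tmom4_def
  proof (rule integral_mono[OF integrable_tilt_centered])
    fix \<theta>
    show "(k * ((x0 - W \<theta>) - tmean k)) ^ 4 \<le> (16 * k / real p) ^ 4"
      using power_mono[OF scaled_centered_bound[OF assms, of \<theta>], of 4] by simp
  qed simp
  thus ?thesis using T.prob_space by simp
qed

lemma tvar_small: "tvar k \<le> (16 / real p)\<^sup>2"
proof -
  interpret T: prob_space "tilt k" by (rule prob_space_tilt)
  have "tvar k \<le> (\<integral>\<theta>. (16 / real p)\<^sup>2 \<partial>tilt k)"
    unfolding tvar_eq
  proof (rule integral_mono)
    have sq: "(x0 - W \<theta> - tmean k)\<^sup>2 \<le> (16 / real p)\<^sup>2" for \<theta>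
      using power_mono[OF centered_bound[of \<theta> k], of 2] by simp
    thus "integrable (tilt k) (\<lambda>\<theta>. (x0 - W \<theta> - tmean k)\<^sup>2)"
      by (intro integrable_tilt_bounded[where C = "(16 / real p)\<^sup>2"]) auto
    show "(x0 - W \<theta> - tmean k)\<^sup>2 \<le> (16 / real p)\<^sup>2" for \<theta> by (rule sq)
  qed simp
  thus ?thesis using T.prob_space by simp
qed

text \<open>From (m - w)^4 <= 8 (m^4 + w^4) with w = k W and m its mean: w^4 <= 2^4 4! e^(w/2) = 384
  e^(w/2), whose exponential has expectation at most 27, and m <= 2 * 27 = 54.\<close>

definition Q4 :: real where "Q4 = 8 * (384 * 27 + 54 ^ 4)"

lemma tmom4_le: assumes k: "k \<ge> 0" shows "tmom4 k \<le> Q4"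
proof -
  interpret T: prob_space "tilt k" by (rule prob_space_tilt)
  define m where "m = k * (\<integral>\<theta>. W \<theta> \<partial>tilt k)"
  have ie: "integrable (tilt k) (\<lambda>\<theta>. exp (k * W \<theta> / 2))"
  proof (rule integrable_tilt_bounded[where C = "exp (k * a / 2)"])
    fix \<theta> show "norm (exp (k * W \<theta> / 2)) \<le> exp (k * a / 2)" using W_le(2)[of \<theta>] k by (simp add: mult_left_mono)
  qed simp
  have "m = (\<integral>\<theta>. k * W \<theta> \<partial>tilt k)" by (simp add: m_def)
  also have "\<dots> \<le> (\<integral>\<theta>. 2 * exp (k * W \<theta> / 2) \<partial>tilt k)"
  proof (rule integral_mono)
    show "integrable (tilt k) (\<lambda>\<theta>. k * W \<theta>)"
      by (rule integrable_tilt_bounded[where C = "k * a"]) (use W_nonneg W_le(2) k in \<open>auto simp: abs_mult intro: mult_left_mono\<close>)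
    fix \<theta> show "k * W \<theta> \<le> 2 * exp (k * W \<theta> / 2)" using exp_ge_add_one_self[of "k * W \<theta> / 2"] by linarith
  qed (use ie in simp)
  also have "\<dots> \<le> 54" using expectation_exp_W[OF k] by simp
  finally have m54: "m \<le> 54" .
  have m0: "m \<ge> 0" using k EW_bounds(1) by (simp add: m_def)
  have "tmom4 k \<le> (\<integral>\<theta>. 8 * (384 * exp (k * W \<theta> / 2) + 54 ^ 4) \<partial>tilt k)"
    unfolding tmom4_def
  proof (rule integral_mono[OF integrable_tilt_centered])
    fix \<theta>
    define w where "w = k * W \<theta>"
    have w0: "w \<ge> 0" using k W_nonneg by (simp add: w_def)
    have four: "(y - z) ^ 4 \<le> 8 * (y ^ 4 + z ^ 4)" for y z :: real
    proof -
      have "(y - z)\<^sup>2 \<le> 2 * (y\<^sup>2 + z\<^sup>2)" using zero_le_power2[of "y + z"] by (simp add: power2_eq_square algebra_simps)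
      hence "((y - z)\<^sup>2)\<^sup>2 \<le> (2 * (y\<^sup>2 + z\<^sup>2))\<^sup>2" by (intro power_mono) auto
      also have "\<dots> \<le> 8 * ((y\<^sup>2)\<^sup>2 + (z\<^sup>2)\<^sup>2)" using zero_le_power2[of "y\<^sup>2 - z\<^sup>2"] by (simp add: power2_eq_square algebra_simps)
      finally show ?thesis by (simp add: power_mult[symmetric])
    qed
    have "(k * ((x0 - W \<theta>) - tmean k)) ^ 4 = (m - w) ^ 4"
      by (simp add: tmean_eq_W m_def w_def algebra_simps)
    also have "\<dots> \<le> 8 * (m ^ 4 + w ^ 4)" by (rule four)
    also have "m ^ 4 \<le> 54 ^ 4" using m0 m54 by (rule power_mono[rotated])
    also have "w ^ 4 \<le> 384 * exp (w / 2)"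
    proof -
      have "(w / 2) ^ 4 \<le> fact 4 * exp (w / 2)" using w0 by (intro power_le_fact_exp) simp
      thus ?thesis by (simp add: fact_numeral power_divide)
    qed
    finally show "(k * ((x0 - W \<theta>) - tmean k)) ^ 4 \<le> 8 * (384 * exp (k * W \<theta> / 2) + 54 ^ 4)" by (simp add: w_def)
  qed (use ie in simp)
  also have "\<dots> = 8 * (384 * (\<integral>\<theta>. exp (k * W \<theta> / 2) \<partial>tilt k) + 54 ^ 4)" using ie T.prob_space by simp
  also have "\<dots> \<le> Q4" unfolding Q4_def using expectation_exp_W[OF k] by simp
  finally show ?thesis .
qed

lemma var_le: assumes k: "k \<ge> 0" shows "k\<^sup>2 * tvar k \<le> Q4"
proof (rule power2_le_imp_le)
  have "(k\<^sup>2 * tvar k)\<^sup>2 \<le> Q4" using tilt_moments(3)[of k] tmom4_le[OF k] by linarith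
  also have "\<dots> \<le> Q4\<^sup>2" by (simp add: Q4_def)
  finally show "(k\<^sup>2 * tvar k)\<^sup>2 \<le> Q4\<^sup>2" .
qed (simp add: Q4_def)

end



section \<open>Minorization by a uniform law, and decay of the characteristic function at one
  prime\<close>

context prime_angle
begin

text \<open>\<open>Ch\<close> is what the Gaussian majorant of \<open>h\<close> gives at scale
  \<open>eta\<close>. \<open>cmin\<close> combines e^(-1), from k W <= 1, the factor 4 / pi^2 of
  Jordan's inequality squared, and division by \<open>Ch\<close>.\<close>

definition Ch :: real where "Ch = 18 * pi\<^sup>2 * sqrt (18 * pi ^ 3)"
definition cmin :: real where "cmin = exp (- 1) * (4 / pi\<^sup>2) / Ch"

lemma Ch_pos: "Ch > 0" and cmin_pos: "cmin > 0"
  by (simp_all add: Ch_def cmin_def)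

text \<open>The width of the tilted density of the angle: k W is of order a k theta^2 near 0, which
  is 1 at this scale. For p <= k one has a k >= 4, so \<open>eta k\<close> is at most 1/2.\<close>

definition eta :: "real \<Rightarrow> real" where "eta k = 1 / sqrt (a * k)"

lemma eta: assumes k: "k \<ge> 1" "real p \<le> k"
  shows "eta k > 0" "eta k \<le> 1 / 2" "a * k * (eta k)\<^sup>2 = 1"
proof -
  have "4 / real p * k \<le> a * k" using a_bounds(4) k by (intro mult_right_mono) auto
  moreover have "4 / real p * k \<ge> 4" using k p_inv by (simp add: field_simps)
  ultimately have ak: "a * k \<ge> 4" by linarith
  hence "sqrt (a * k) \<ge> sqrt 4" by (rule real_sqrt_le_mono)
  hence s: "sqrt (a * k) \<ge> 2" by simp
  hence sp: "sqrt (a * k) > 0" by linarith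
  show "eta k > 0" unfolding eta_def by (rule divide_pos_pos[OF zero_less_one sp])
  show "eta k \<le> 1 / 2" unfolding eta_def by (rule frac_le) (use s in simp_all)
  have gen: "q \<ge> 4 \<Longrightarrow> q * (1 / sqrt q)\<^sup>2 = 1" for q :: real by (simp add: power_divide)
  show "a * k * (eta k)\<^sup>2 = 1" unfolding eta_def by (rule gen[OF ak])
qed

text \<open>With z = a sin^2(theta/2) <= 8, log(1 + z) >= z / (1 + z) >= z/9, and Jordan's
  inequality gives z >= a (theta/pi)^2. Hence k W >= beta theta^2 with the beta below, and a
  Gaussian integral remains.\<close>

lemma h_le: assumes k: "k \<ge> 1" "real p \<le> k" shows "h k \<le> Ch * (eta k) ^ 3"
proof -
  define \<beta> where "\<beta> = k * a / (9 * pi\<^sup>2)"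
  have \<beta>: "\<beta> > 0" using k a_bounds by (simp add: \<beta>_def)
  have pt: "indicator {0..pi} \<theta> *\<^sub>R (exp (- k * W \<theta>) * (sin \<theta>)\<^sup>2) \<le> 2 / \<beta> * exp (- (\<beta> / 2) * \<theta>\<^sup>2)" for \<theta>
  proof (cases "\<theta> \<in> {0..pi}")
    case True
    define z where "z = a * (sin (\<theta> / 2))\<^sup>2"
    have z: "0 \<le> z" "z \<le> 8"
    proof -
      show "0 \<le> z" using a_bounds by (simp add: z_def)
      have "z \<le> a * 1" unfolding z_def using a_bounds by (intro mult_left_mono) (auto simp: abs_square_le_1)
      thus "z \<le> 8" using a_bounds by simp
    qed
    have "sin (\<theta> / 2) \<ge> 2 / pi * (\<theta> / 2)" using True by (intro sin_ge_two_pi) auto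
    hence "(\<theta> / pi)\<^sup>2 \<le> (sin (\<theta> / 2))\<^sup>2" using True by (intro power_mono) auto
    hence "a * (\<theta> / pi)\<^sup>2 \<le> z" unfolding z_def using a_bounds by (intro mult_left_mono) auto
    hence "a * (\<theta> / pi)\<^sup>2 / 9 \<le> z / 9" by simp
    also have "z / 9 \<le> z / (1 + z)" using z by (intro divide_left_mono) auto
    also have "z / (1 + z) \<le> ln (1 + z)"
      using ln_le_minus_one[of "1 / (1 + z)"] z by (simp add: ln_div field_simps)
    also have "ln (1 + z) = W \<theta>" by (simp add: W_def z_def)
    finally have "k * (a * (\<theta> / pi)\<^sup>2 / 9) \<le> k * W \<theta>" using k by (intro mult_left_mono) auto
    hence e: "\<beta> * \<theta>\<^sup>2 \<le> k * W \<theta>" by (simp add: \<beta>_def power_divide mult_ac)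
    have "(sin \<theta>)\<^sup>2 \<le> \<theta>\<^sup>2" using power_mono[OF abs_sin_x_le_abs_x[of \<theta>], of 2] by simp
    hence "exp (- k * W \<theta>) * (sin \<theta>)\<^sup>2 \<le> exp (- (\<beta> * \<theta>\<^sup>2)) * \<theta>\<^sup>2" using e by (intro mult_mono) auto
    also have "\<dots> = 1 / \<beta> * ((\<beta> * \<theta>\<^sup>2) * exp (- (\<beta> * \<theta>\<^sup>2)))" using \<beta> by simp
    also have "\<dots> \<le> 1 / \<beta> * (2 * exp (- (\<beta> * \<theta>\<^sup>2) / 2))"
      using \<beta> by (intro mult_left_mono exp_minus_mult_le) auto
    finally show ?thesis using True by simp
  qed (use \<beta> in simp)
  have "h k \<le> (\<integral>\<theta>. 2 / \<beta> * exp (- (\<beta> / 2) * \<theta>\<^sup>2) \<partial>lborel)"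
    unfolding h_def using \<beta> by (intro integral_mono[OF integrable_h] integrable_mult_right integrable_exp_sq pt) auto
  also have "\<dots> = 2 / \<beta> * sqrt (pi / (\<beta> / 2))"
  proof -
    have half: "\<beta> / 2 > 0" using \<beta> by simp
    show ?thesis by (simp only: integral_mult_right_zero integral_exp_sq[OF half])
  qed
  also have "\<dots> = Ch * (eta k) ^ 3"
  proof -
    have ak: "a * k > 0" using a_bounds k by simp
    have b1: "1 / \<beta> = 9 * pi\<^sup>2 * (eta k)\<^sup>2"
      unfolding \<beta>_def eta_def using ak by (simp add: power_divide mult.commute)
    have "pi / (\<beta> / 2) = 2 * pi * (1 / \<beta>)" by simp
    also have "\<dots> = 18 * pi ^ 3 * (eta k)\<^sup>2" unfolding b1 by (simp add: power2_eq_square power3_eq_cube)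
    finally have "sqrt (pi / (\<beta> / 2)) = sqrt (18 * pi ^ 3) * eta k"
      using eta(1)[OF k] by (simp add: real_sqrt_mult)
    moreover have "2 / \<beta> = 18 * pi\<^sup>2 * (eta k)\<^sup>2" using b1 by simp
    ultimately show ?thesis by (simp only: Ch_def) (simp add: power2_eq_square power3_eq_cube)
  qed
  finally show ?thesis .
qed

definition W' :: "real \<Rightarrow> real" where "W' \<theta> = a * sin \<theta> / (2 * (1 + a * (sin (\<theta> / 2))\<^sup>2))"

lemma W_deriv: "(W has_real_derivative W' \<theta>) (at \<theta>)"
proof -
  have "1 + a * (sin (\<theta> / 2))\<^sup>2 > 0" using one_plus_pos[of \<theta>] by linarith
  hence "(W has_real_derivative (a * (2 * sin (\<theta> / 2) * (cos (\<theta> / 2) * (1 / 2)))) / (1 + a * (sin (\<theta> / 2))\<^sup>2)) (at \<theta>)"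
    unfolding W_def[abs_def] by (auto intro!: derivative_eq_intros simp: divide_simps)
  moreover have "sin \<theta> = 2 * sin (\<theta> / 2) * cos (\<theta> / 2)" using sin_double[of "\<theta> / 2"] by simp
  moreover have "A * (2 * S * (C * (1 / 2))) / d = A * (2 * S * C) / (2 * d)" for A S C d :: real by simp
  ultimately show ?thesis unfolding W'_def by (simp only:)
qed

lemma W_cont: "continuous_on A W"
  by (rule DERIV_continuous_on) (rule DERIV_subset[OF W_deriv], simp)

lemma W'_cont: "continuous_on A W'"
  unfolding W'_def[abs_def]
proof (rule continuous_on_divide)
  show "\<forall>\<theta>\<in>A. 2 * (1 + a * (sin (\<theta> / 2))\<^sup>2) \<noteq> 0"
  proof
    fix \<theta> show "2 * (1 + a * (sin (\<theta> / 2))\<^sup>2) \<noteq> 0"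
      using one_plus_pos[of \<theta>] by (metis less_irrefl linorder_not_less mult_eq_0_iff zero_less_one zero_neq_numeral)
  qed
qed (auto intro!: continuous_intros)

text \<open>The key uniform estimate. Between \<open>eta k\<close> and 2 \<open>eta k\<close> the
  density of the angle is at least \<open>cmin\<close> times the derivative of k W, so the law of k
  W dominates \<open>cmin\<close> times Lebesgue measure on an interval. The lower bound for k W'
  makes that interval long enough.\<close>

lemma minorization:
  assumes k: "k \<ge> 1" "real p \<le> k" and \<theta>: "eta k \<le> \<theta>" "\<theta> \<le> 2 * eta k"
  shows "0 \<le> k * W' \<theta>" "cmin * (k * W' \<theta>) \<le> dens k \<theta>" "1 / (2 * pi * eta k) \<le> k * W' \<theta>" "0 \<le> \<theta>" "\<theta> \<le> 1" "k * W \<theta> \<le> 1"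
proof -
  note e = eta[OF k]
  show t0: "0 \<le> \<theta>" and t1: "\<theta> \<le> 1" using e \<theta> by auto
  have tpi: "\<theta> \<le> pi / 2" using t1 pi_gt3 by linarith
  have tpos: "\<theta> > 0" using e \<theta> by linarith
  have s_up: "sin \<theta> \<le> \<theta>" using t0 by (rule sin_x_le_x)
  have s_lo: "sin \<theta> \<ge> 2 / pi * \<theta>" using t0 tpi by (rule sin_ge_two_pi)
  have s0: "sin \<theta> \<ge> 0" using t0 tpi by (intro sin_ge_zero) auto
  have ak: "a * k > 0" using a_bounds k by simp
  have hs: "0 \<le> sin (\<theta> / 2)" using t0 tpi pi_gt_zero by (intro sin_ge_zero) linarith+
  have hs2: "sin (\<theta> / 2) \<le> \<theta> / 2" using t0 by (intro sin_x_le_x) simp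
  have "(sin (\<theta> / 2))\<^sup>2 \<le> (\<theta> / 2)\<^sup>2" using hs hs2 by (intro power_mono)
  also have "\<dots> \<le> (eta k)\<^sup>2" using \<theta> t0 by (intro power_mono) auto
  finally have u: "(sin (\<theta> / 2))\<^sup>2 \<le> (eta k)\<^sup>2" .
  have aku: "a * k * (sin (\<theta> / 2))\<^sup>2 \<le> 1" using mult_left_mono[OF u, of "a * k"] ak e(3) by simp
  have "k * W \<theta> \<le> k * (a * (sin (\<theta> / 2))\<^sup>2)" using W_le(1) k by (intro mult_left_mono) auto
  thus kW: "k * W \<theta> \<le> 1" using aku by (simp add: mult_ac)
  have "a * (sin (\<theta> / 2))\<^sup>2 * 1 \<le> a * (sin (\<theta> / 2))\<^sup>2 * k" using a_bounds k by (intro mult_left_mono) auto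
  hence au: "a * (sin (\<theta> / 2))\<^sup>2 \<le> 1" using aku by (simp add: mult_ac)
  have den: "2 * (1 + a * (sin (\<theta> / 2))\<^sup>2) \<ge> 2" "2 * (1 + a * (sin (\<theta> / 2))\<^sup>2) \<le> 4" using au one_plus_pos[of \<theta>] by auto
  show "0 \<le> k * W' \<theta>" unfolding W'_def using k a_bounds s0 den by simp
  have "k * W' \<theta> = a * k * sin \<theta> / (2 * (1 + a * (sin (\<theta> / 2))\<^sup>2))" by (simp add: W'_def mult_ac)
  also have "\<dots> \<le> a * k * sin \<theta> / 2" using den ak s0 by (intro divide_left_mono) auto
  also have "\<dots> \<le> a * k * (2 * eta k) / 2" using s_up \<theta> ak by (intro divide_right_mono mult_left_mono) auto
  also have "\<dots> = 1 / eta k" using e by (simp add: field_simps power2_eq_square)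
  finally have w_up: "k * W' \<theta> \<le> 1 / eta k" .
  have "1 / (2 * pi * eta k) = a * k * (2 / pi * eta k) / 4" using e by (simp add: field_simps power2_eq_square)
  also have "\<dots> \<le> a * k * sin \<theta> / 4"
  proof (intro divide_right_mono mult_left_mono)
    have "2 / pi * eta k \<le> 2 / pi * \<theta>" using \<theta> by (intro mult_left_mono) auto
    thus "2 / pi * eta k \<le> sin \<theta>" using s_lo by linarith
  qed (use ak in auto)
  also have "\<dots> \<le> a * k * sin \<theta> / (2 * (1 + a * (sin (\<theta> / 2))\<^sup>2))" using den ak s0 by (intro divide_left_mono) auto
  also have "\<dots> = k * W' \<theta>" by (simp add: W'_def mult_ac)
  finally show "1 / (2 * pi * eta k) \<le> k * W' \<theta>" .
  have "cmin * (k * W' \<theta>) \<le> cmin * (1 / eta k)" using w_up cmin_pos by (intro mult_left_mono) auto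
  also have "\<dots> = exp (- 1) * (2 / pi * eta k)\<^sup>2 / (Ch * (eta k) ^ 3)"
    unfolding cmin_def using e Ch_pos by (simp add: field_simps power2_eq_square power3_eq_cube)
  also have "\<dots> \<le> exp (- k * W \<theta>) * (sin \<theta>)\<^sup>2 / h k"
  proof (rule frac_le)
    have "2 / pi * eta k \<le> 2 / pi * \<theta>" using \<theta> by (intro mult_left_mono) auto
    hence "(2 / pi * eta k)\<^sup>2 \<le> (sin \<theta>)\<^sup>2" using s_lo e by (intro power_mono) auto
    thus "exp (- 1) * (2 / pi * eta k)\<^sup>2 \<le> exp (- k * W \<theta>) * (sin \<theta>)\<^sup>2" using kW by (intro mult_mono) auto
  qed (use h_le[OF k] h_pos in auto)
  also have "\<dots> = dens k \<theta>" unfolding dens_def using t0 tpi by simp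
  finally show "cmin * (k * W' \<theta>) \<le> dens k \<theta>" .
qed

text \<open>The length of that interval, the image of [eta, 2 eta] under k W.\<close>

definition ell :: "real \<Rightarrow> real" where "ell k = k * W (2 * eta k) - k * W (eta k)"

lemma ell_bounds: assumes k: "k \<ge> 1" "real p \<le> k" shows "1 / (2 * pi) \<le> ell k" "ell k \<le> 1"
proof -
  note e = eta[OF k]
  have "\<exists>z>eta k. z < 2 * eta k \<and> k * W (2 * eta k) - k * W (eta k) = (2 * eta k - eta k) * (k * W' z)"
    using e by (intro MVT2) (auto intro!: derivative_eq_intros W_deriv)
  then obtain z where z: "eta k < z" "z < 2 * eta k" "ell k = eta k * (k * W' z)" unfolding ell_def by auto
  have "eta k * (1 / (2 * pi * eta k)) \<le> eta k * (k * W' z)"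
    using minorization(3)[OF k, of z] z e by (intro mult_left_mono) auto
  thus "1 / (2 * pi) \<le> ell k" using z e by simp
  have "k * W (2 * eta k) \<le> 1" using minorization(6)[OF k, of "2 * eta k"] e by simp
  moreover have "k * W (eta k) \<ge> 0" using k W_nonneg by simp
  ultimately show "ell k \<le> 1" unfolding ell_def by simp
qed

abbreviation ind :: "real \<Rightarrow> real \<Rightarrow> real" where "ind k \<equiv> indicator {eta k..2 * eta k}"

lemma minor_le: assumes k: "k \<ge> 1" "real p \<le> k"
  shows "cmin * (ind k \<theta> * (k * W' \<theta>)) \<le> dens k \<theta>" and "0 \<le> ind k \<theta> * (k * W' \<theta>)"
  using minorization(1,2)[OF k, of \<theta>] dens_nonneg[of k \<theta>] by (auto simp: indicator_def)

lemma has_derivative_power_kW: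
  "((\<lambda>\<theta>. F (k * W \<theta>)) has_vector_derivative (k * W' \<theta>) *\<^sub>R f (k * W \<theta>)) (at \<theta> within A)"
  if "\<And>w. (F has_vector_derivative f w) (at w)" for F f :: "real \<Rightarrow> 'b::real_normed_vector"
proof -
  have "((\<lambda>\<theta>. k * W \<theta>) has_vector_derivative k * W' \<theta>) (at \<theta> within A)"
    using DERIV_cmult[OF W_deriv, of k] by (simp add: has_real_derivative_iff_has_vector_derivative has_vector_derivative_at_within)
  from vector_diff_chain_within[OF this has_vector_derivative_at_within[OF that]]
  show ?thesis by (simp add: o_def)
qed

text \<open>Substitution w = k W(theta), phrased with an antiderivative F. It is used with f = 1, a
  square and a complex exponential.\<close>

lemma integral_ind_W':
  fixes F f :: "real \<Rightarrow> 'b::euclidean_space"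
  assumes k: "k \<ge> 1" "real p \<le> k" and F: "\<And>w. (F has_vector_derivative f w) (at w)" and f: "continuous_on UNIV f"
  shows "(\<integral>\<theta>. ind k \<theta> *\<^sub>R ((k * W' \<theta>) *\<^sub>R f (k * W \<theta>)) \<partial>lborel) = F (k * W (2 * eta k)) - F (k * W (eta k))"
    and "integrable lborel (\<lambda>\<theta>. ind k \<theta> *\<^sub>R ((k * W' \<theta>) *\<^sub>R f (k * W \<theta>)))"
proof -
  have c: "continuous_on {eta k..2 * eta k} (\<lambda>\<theta>. (k * W' \<theta>) *\<^sub>R f (k * W \<theta>))"
    by (intro continuous_intros W'_cont continuous_on_compose2[OF f] W_cont) auto
  show "(\<integral>\<theta>. ind k \<theta> *\<^sub>R ((k * W' \<theta>) *\<^sub>R f (k * W \<theta>)) \<partial>lborel) = F (k * W (2 * eta k)) - F (k * W (eta k))"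
    by (rule integral_FTC_Icc) (use eta[OF k] has_derivative_power_kW[OF F] c in auto)
  show "integrable lborel (\<lambda>\<theta>. ind k \<theta> *\<^sub>R ((k * W' \<theta>) *\<^sub>R f (k * W \<theta>)))"
    using borel_integrable_compact[OF _ c] by (simp add: indicator_scaleR_eq_if)
qed

text \<open>Split the density into the minorizing part and a nonnegative rest. The rest contributes
  at most its mass 1 - cmin ell; the uniform part has a sinc as characteristic function.\<close>

lemma tchar_norm_le:
  assumes k: "k \<ge> 1" "real p \<le> k" and t: "t \<noteq> 0"
  shows "norm (tchar k t) \<le> 1 - cmin * ell k * (1 - \<bar>sin (t * ell k / 2)\<bar> / \<bar>t * ell k / 2\<bar>)"
proof -
  let ?e = "\<lambda>w. exp (- (\<i> * of_real (t * w)))"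
  have fm: "(\<lambda>\<theta>. ?e (k * W \<theta>)) \<in> borel_measurable borel" by measurable
  have "norm (tchar k t) = norm (\<integral>\<theta>. exp (\<i> * of_real (t * (k * (x0 - W \<theta> - tmean k)))) \<partial>tilt k)"
    unfolding char_tlaw[symmetric] char_def tlaw_def by (subst integral_distr) auto
  also have "(\<integral>\<theta>. exp (\<i> * of_real (t * (k * (x0 - W \<theta> - tmean k)))) \<partial>tilt k)
      = (\<integral>\<theta>. exp (\<i> * of_real (t * k * (x0 - tmean k))) * ?e (k * W \<theta>) \<partial>tilt k)"
    by (rule Bochner_Integration.integral_cong) (auto simp: mult_exp_exp algebra_simps)
  also have "\<dots> = exp (\<i> * of_real (t * k * (x0 - tmean k))) * (\<integral>\<theta>. ?e (k * W \<theta>) \<partial>tilt k)" by (rule integral_mult_right_zero)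
  also have "norm \<dots> = norm (\<integral>\<theta>. ?e (k * W \<theta>) \<partial>tilt k)" by (simp add: norm_mult)
  also have "(\<integral>\<theta>. ?e (k * W \<theta>) \<partial>tilt k) = (\<integral>\<theta>. dens k \<theta> *\<^sub>R ?e (k * W \<theta>) \<partial>lborel)"
    by (rule integral_tilt_dens[OF fm])
  finally have n1: "norm (tchar k t) = norm (\<integral>\<theta>. dens k \<theta> *\<^sub>R ?e (k * W \<theta>) \<partial>lborel)" .
  let ?F = "\<lambda>w. ?e w / (- (\<i> * of_real t))"
  have F: "(?F has_vector_derivative ?e w) (at w)" for w
  proof -
    have "((\<lambda>z. exp (- (\<i> * of_real t * z)) / (- (\<i> * of_real t))) has_field_derivative exp (- (\<i> * of_real t * of_real w))) (at (of_real w))"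
      using t by (auto intro!: derivative_eq_intros)
    from has_vector_derivative_real_field[OF this, of UNIV] show ?thesis by (simp add: mult.assoc)
  qed
  have ec: "continuous_on UNIV ?e" by (intro continuous_intros)
  note I = integral_ind_W'[OF k F ec]
  note I1 = integral_ind_W'[OF k, where F = "\<lambda>w. w" and f = "\<lambda>_. 1::real"]
  have i1: "(\<integral>\<theta>. ind k \<theta> *\<^sub>R ((k * W' \<theta>) *\<^sub>R 1) \<partial>lborel) = ell k" "integrable lborel (\<lambda>\<theta>. ind k \<theta> *\<^sub>R ((k * W' \<theta>) *\<^sub>R (1::real)))"
    unfolding ell_def by (rule I1; simp add: has_vector_derivative_id)+
  have intd: "integrable lborel (\<lambda>\<theta>. dens k \<theta> *\<^sub>R ?e (k * W \<theta>))"
  proof (rule Bochner_Integration.integrable_bound[OF integrable_dens])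
    show "(\<lambda>\<theta>. dens k \<theta> *\<^sub>R ?e (k * W \<theta>)) \<in> borel_measurable lborel" using fm by measurable
  qed (auto simp: dens_nonneg)
  let ?m = "\<lambda>\<theta>. cmin * (ind k \<theta> * (k * W' \<theta>))"
  have intm: "integrable lborel (\<lambda>\<theta>. ?m \<theta> *\<^sub>R ?e (k * W \<theta>))"
    using integrable_scaleR_right[OF I(2), of cmin] by simp
  have intm1: "integrable lborel ?m" using i1(2) by simp
  have "(\<integral>\<theta>. dens k \<theta> *\<^sub>R ?e (k * W \<theta>) \<partial>lborel) = (\<integral>\<theta>. (dens k \<theta> - ?m \<theta>) *\<^sub>R ?e (k * W \<theta>) + ?m \<theta> *\<^sub>R ?e (k * W \<theta>) \<partial>lborel)"
    by (rule Bochner_Integration.integral_cong) (auto simp: scaleR_diff_left)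
  also have "\<dots> = (\<integral>\<theta>. (dens k \<theta> - ?m \<theta>) *\<^sub>R ?e (k * W \<theta>) \<partial>lborel) + (\<integral>\<theta>. ?m \<theta> *\<^sub>R ?e (k * W \<theta>) \<partial>lborel)"
    using intd intm by (intro Bochner_Integration.integral_add) (auto simp: scaleR_diff_left)
  finally have split: "(\<integral>\<theta>. dens k \<theta> *\<^sub>R ?e (k * W \<theta>) \<partial>lborel) = \<dots>" .
  have "norm (\<integral>\<theta>. (dens k \<theta> - ?m \<theta>) *\<^sub>R ?e (k * W \<theta>) \<partial>lborel) \<le> (\<integral>\<theta>. norm ((dens k \<theta> - ?m \<theta>) *\<^sub>R ?e (k * W \<theta>)) \<partial>lborel)"
    by (rule integral_norm_bound)
  also have "\<dots> = (\<integral>\<theta>. dens k \<theta> - ?m \<theta> \<partial>lborel)"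
    using minor_le(1)[OF k] by (intro Bochner_Integration.integral_cong) auto
  also have "\<dots> = 1 - cmin * ell k"
  proof -
    have "(\<integral>\<theta>. ?m \<theta> \<partial>lborel) = cmin * ell k" using i1(1) by simp
    thus ?thesis using integrable_dens intm1 integral_dens by simp
  qed
  finally have b1: "norm (\<integral>\<theta>. (dens k \<theta> - ?m \<theta>) *\<^sub>R ?e (k * W \<theta>) \<partial>lborel) \<le> 1 - cmin * ell k" .
  have "(\<integral>\<theta>. ?m \<theta> *\<^sub>R ?e (k * W \<theta>) \<partial>lborel) = cmin *\<^sub>R (\<integral>\<theta>. ind k \<theta> *\<^sub>R ((k * W' \<theta>) *\<^sub>R ?e (k * W \<theta>)) \<partial>lborel)"
    by (subst integral_scaleR_right[symmetric]) simp
  also have "\<dots> = cmin *\<^sub>R (?F (k * W (2 * eta k)) - ?F (k * W (eta k)))" by (simp only: I(1))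
  also have "norm \<dots> = cmin * (norm (?e (k * W (2 * eta k)) - ?e (k * W (eta k))) / \<bar>t\<bar>)"
    unfolding diff_divide_distrib[symmetric] using cmin_pos by (simp add: norm_divide norm_mult)
  also have "norm (?e (k * W (2 * eta k)) - ?e (k * W (eta k))) = 2 * \<bar>sin (t * ell k / 2)\<bar>"
  proof -
    define u where "u = k * W (2 * eta k)" 
    define v where "v = k * W (eta k)"
    have "norm (?e u - ?e v) = norm (exp (\<i> * of_real (t * (v - u))) - 1)"
    proof -
      have "?e u - ?e v = ?e v * (exp (\<i> * of_real (t * (v - u))) - 1)"
        by (simp add: right_diff_distrib mult_exp_exp algebra_simps)
      thus ?thesis by (simp add: norm_mult)
    qed
    also have "\<dots> = 2 * \<bar>sin (t * (v - u) / 2)\<bar>"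
      using dist_exp_i_1[of "t * (v - u)"] by simp
    also have "t * (v - u) / 2 = - (t * ell k / 2)"
    proof -
      have "v - u = - ell k" by (simp add: u_def v_def ell_def)
      thus ?thesis by simp
    qed
    finally show ?thesis by (simp add: u_def v_def)
  qed
  also have "cmin * (2 * \<bar>sin (t * ell k / 2)\<bar> / \<bar>t\<bar>) = cmin * ell k * (\<bar>sin (t * ell k / 2)\<bar> / \<bar>t * ell k / 2\<bar>)"
  proof -
    have "ell k > 0" using ell_bounds(1)[OF k] pi_gt_zero by (smt (verit) divide_pos_pos)
    thus ?thesis using t by (simp add: abs_mult field_simps)
  qed
  finally have b2: "norm (\<integral>\<theta>. ?m \<theta> *\<^sub>R ?e (k * W \<theta>) \<partial>lborel) = cmin * ell k * (\<bar>sin (t * ell k / 2)\<bar> / \<bar>t * ell k / 2\<bar>)" .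
  have "norm (tchar k t) \<le> (1 - cmin * ell k) + cmin * ell k * (\<bar>sin (t * ell k / 2)\<bar> / \<bar>t * ell k / 2\<bar>)"
    unfolding n1 split using norm_triangle_ineq[of "\<integral>\<theta>. (dens k \<theta> - ?m \<theta>) *\<^sub>R ?e (k * W \<theta>) \<partial>lborel" "\<integral>\<theta>. ?m \<theta> *\<^sub>R ?e (k * W \<theta>) \<partial>lborel"] b1 b2 by linarith
  thus ?thesis by (simp add: right_diff_distrib)
qed

text \<open>One constant for three purposes: Gaussian decay for |t| <= 1, the gap below 1 for |t| >=
  1, and half the lower bound for the variance. The cube is l^3 at the smallest length l = 1/(2
  pi).\<close>

definition cdec :: real where "cdec = cmin / (32 * (2 * pi) ^ 3)"

lemma cdec_pos: "cdec > 0" using cmin_pos by (simp add: cdec_def)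

lemma tchar_decay:
  assumes k: "k \<ge> 1" "real p \<le> k"
  shows "\<bar>t\<bar> \<le> 1 \<Longrightarrow> norm (tchar k t) \<le> exp (- cdec * t\<^sup>2)"
    and "\<bar>t\<bar> \<ge> 1 \<Longrightarrow> norm (tchar k t) \<le> max 0 (1 - cdec)"
proof -
  define l where "l = ell k"
  have l: "1 / (2 * pi) \<le> l" "l \<le> 1" "l > 0"
  proof -
    show "1 / (2 * pi) \<le> l" "l \<le> 1" using ell_bounds[OF k] by (auto simp: l_def)
    moreover have "1 / (2 * pi) > 0" by simp
    ultimately show "l > 0" by linarith
  qed
  have "(1 / (2 * pi)) ^ 3 \<le> l ^ 3" using l by (intro power_mono) auto
  hence l3: "cmin * (1 / (2 * pi)) ^ 3 \<le> cmin * l ^ 3" using cmin_pos by (intro mult_left_mono) auto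
  have cd: "cdec = cmin * (1 / (2 * pi)) ^ 3 / 32" by (simp add: cdec_def power_divide)
  \<comment> \<open>Here y stands for t l / 2. The auxiliary s is t^2 for small t and 1 for large t,
    where y may be capped at 2.\<close>
  have small: "cmin * l * (y\<^sup>2 / 8) \<ge> cdec * s" if "y\<^sup>2 \<ge> s * l\<^sup>2 / 4" "s \<ge> 0" for y s :: real
  proof -
    have "cdec * s \<le> (cmin * l ^ 3 / 32) * s" unfolding cd using l3 that by (intro mult_right_mono divide_right_mono) auto
    also have "\<dots> = cmin * l * ((s * l\<^sup>2 / 4) / 8)" by (simp add: power2_eq_square power3_eq_cube)
    also have "\<dots> \<le> cmin * l * (y\<^sup>2 / 8)" using that cmin_pos l by (intro mult_left_mono divide_right_mono) auto
    finally show ?thesis .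
  qed
  show "norm (tchar k t) \<le> exp (- cdec * t\<^sup>2)" if t: "\<bar>t\<bar> \<le> 1"
  proof (cases "t = 0")
    case True
    thus ?thesis using norm_tchar_le_1 by simp
  next
    case False
    define y where "y = t * l / 2"
    have y0: "y \<noteq> 0" using False l by (simp add: y_def)
    have "\<bar>t\<bar> * l \<le> 1 * 1" using t l by (intro mult_mono) auto
    hence "\<bar>y\<bar> \<le> 2" using l by (simp add: y_def abs_mult)
    hence "\<bar>sin y\<bar> / \<bar>y\<bar> \<le> 1 - y\<^sup>2 / 8" by (rule one_minus_sinc(1)[OF y0])
    hence "cmin * l * (y\<^sup>2 / 8) \<le> cmin * l * (1 - \<bar>sin y\<bar> / \<bar>y\<bar>)" using cmin_pos l by (intro mult_left_mono) auto
    moreover have "cdec * t\<^sup>2 \<le> cmin * l * (y\<^sup>2 / 8)" by (rule small) (simp_all add: y_def power2_eq_square)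
    ultimately have "norm (tchar k t) \<le> 1 - cdec * t\<^sup>2"
      using tchar_norm_le[OF k False] unfolding l_def[symmetric] y_def[symmetric] by linarith
    also have "\<dots> \<le> exp (- cdec * t\<^sup>2)" using exp_ge_add_one_self[of "- cdec * t\<^sup>2"] by simp
    finally show ?thesis .
  qed
  show "norm (tchar k t) \<le> max 0 (1 - cdec)" if t: "\<bar>t\<bar> \<ge> 1"
  proof -
    have t0: "t \<noteq> 0" using t by auto
    define y where "y = t * l / 2"
    have y0: "y \<noteq> 0" using t0 l by (simp add: y_def)
    have "cdec \<le> cmin * l * (1 - \<bar>sin y\<bar> / \<bar>y\<bar>)"
    proof (cases "\<bar>y\<bar> \<le> 2")
      case True
      have "1 \<le> t\<^sup>2" using t abs_le_square_iff[of 1 t] by simp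
      hence "1 * l\<^sup>2 / 4 \<le> y\<^sup>2" using l by (simp add: y_def power_mult_distrib power_divide)
      from small[OF this] have "cdec \<le> cmin * l * (y\<^sup>2 / 8)" by simp
      also have "\<dots> \<le> cmin * l * (1 - \<bar>sin y\<bar> / \<bar>y\<bar>)"
        using one_minus_sinc(1)[OF y0 True] cmin_pos l by (intro mult_left_mono) auto
      finally show ?thesis .
    next
      case False
      have "l\<^sup>2 \<le> 1" using l by (intro power_le_one) auto
      hence "cdec \<le> cmin * l * (2\<^sup>2 / 8)" using small[of 1 2] by simp
      also have "\<dots> \<le> cmin * l * (1 - \<bar>sin y\<bar> / \<bar>y\<bar>)"
        using one_minus_sinc(2)[OF y0] False cmin_pos l by (intro mult_left_mono) auto
      finally show ?thesis .
    qed
    thus ?thesis using tchar_norm_le[OF k t0] unfolding l_def[symmetric] y_def[symmetric] by linarith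
  qed
qed

text \<open>Only the uniform part of the law is used: its second moment about any point is at least
  \<open>cmin\<close> l^3 / 12, since a uniform variable is least spread about its midpoint.\<close>

lemma var_ge: assumes k: "k \<ge> 1" "real p \<le> k" shows "k\<^sup>2 * tvar k \<ge> 2 * cdec"
proof -
  define m where "m = k * (x0 - tmean k)"
  have "k\<^sup>2 * tvar k = (\<integral>\<theta>. (k * W \<theta> - m)\<^sup>2 \<partial>tilt k)"
    unfolding tilt_moments(2)[symmetric]
    by (rule Bochner_Integration.integral_cong) (auto simp: m_def power2_eq_square algebra_simps)
  also have "\<dots> = (\<integral>\<theta>. dens k \<theta> *\<^sub>R (k * W \<theta> - m)\<^sup>2 \<partial>lborel)"
    by (rule integral_tilt_dens) measurable
  finally have v: "k\<^sup>2 * tvar k = (\<integral>\<theta>. dens k \<theta> *\<^sub>R (k * W \<theta> - m)\<^sup>2 \<partial>lborel)" .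
  have F: "((\<lambda>w. (w - m) ^ 3 / 3) has_vector_derivative (w - m)\<^sup>2) (at w)" for w
    by (auto intro!: derivative_eq_intros simp: has_real_derivative_iff_has_vector_derivative[symmetric])
  have fc: "continuous_on UNIV (\<lambda>w. (w - m)\<^sup>2)" by (intro continuous_intros)
  note I = integral_ind_W'[OF k F fc]
  define u where "u = k * W (2 * eta k) - m" 
  define w where "w = k * W (eta k) - m"
  define l where "l = ell k"
  have uw: "u = w + l" by (simp add: u_def w_def l_def ell_def)
  have l: "1 / (2 * pi) \<le> l" "l > 0"
  proof -
    show "1 / (2 * pi) \<le> l" using ell_bounds[OF k] by (auto simp: l_def)
    moreover have "1 / (2 * pi) > 0" by simp
    ultimately show "l > 0" by linarith
  qed
  have "l ^ 3 / 12 \<le> u ^ 3 / 3 - w ^ 3 / 3"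
  proof -
    \<comment> \<open>The remainder is the squared distance of the midpoint from the centre, times
      the length.\<close>
    have "u ^ 3 / 3 - w ^ 3 / 3 - l ^ 3 / 12 = l * (w + l / 2)\<^sup>2"
      unfolding uw by (simp add: power2_eq_square power3_eq_cube field_simps)
    moreover have "l * (w + l / 2)\<^sup>2 \<ge> 0" using l by simp
    ultimately show ?thesis by linarith
  qed
  hence "cmin * (l ^ 3 / 12) \<le> cmin * (\<integral>\<theta>. ind k \<theta> *\<^sub>R ((k * W' \<theta>) *\<^sub>R (k * W \<theta> - m)\<^sup>2) \<partial>lborel)"
    unfolding I(1) u_def w_def using cmin_pos by (intro mult_left_mono) auto
  also have "\<dots> = (\<integral>\<theta>. cmin * (ind k \<theta> *\<^sub>R ((k * W' \<theta>) *\<^sub>R (k * W \<theta> - m)\<^sup>2)) \<partial>lborel)"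
    by (rule integral_mult_right_zero[symmetric])
  also have "\<dots> \<le> (\<integral>\<theta>. dens k \<theta> *\<^sub>R (k * W \<theta> - m)\<^sup>2 \<partial>lborel)"
  proof (rule integral_mono)
    show "integrable lborel (\<lambda>\<theta>. cmin * (ind k \<theta> *\<^sub>R ((k * W' \<theta>) *\<^sub>R (k * W \<theta> - m)\<^sup>2)))"
      using I(2) by (rule integrable_mult_right)
    show "integrable lborel (\<lambda>\<theta>. dens k \<theta> *\<^sub>R (k * W \<theta> - m)\<^sup>2)"
    proof (rule Bochner_Integration.integrable_bound)
      show "integrable lborel (\<lambda>\<theta>. (k * a + \<bar>m\<bar>)\<^sup>2 * dens k \<theta>)" using integrable_dens by simp
      show "AE \<theta> in lborel. norm (dens k \<theta> *\<^sub>R (k * W \<theta> - m)\<^sup>2) \<le> norm ((k * a + \<bar>m\<bar>)\<^sup>2 * dens k \<theta>)"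
      proof (rule AE_I2)
        fix \<theta> :: real
        have "0 \<le> k * W \<theta>" "k * W \<theta> \<le> k * a" using k W_nonneg W_le(2) by (auto intro: mult_left_mono)
        hence "\<bar>k * W \<theta> - m\<bar> \<le> k * a + \<bar>m\<bar>" by linarith
        hence "(k * W \<theta> - m)\<^sup>2 \<le> (k * a + \<bar>m\<bar>)\<^sup>2" using power_mono[of "\<bar>k * W \<theta> - m\<bar>" "k * a + \<bar>m\<bar>" 2] by simp
        thus "norm (dens k \<theta> *\<^sub>R (k * W \<theta> - m)\<^sup>2) \<le> norm ((k * a + \<bar>m\<bar>)\<^sup>2 * dens k \<theta>)"
          using dens_nonneg[of k \<theta>] by (simp add: abs_mult mult.commute mult_left_mono)
      qed
    qed simp
    fix \<theta>
    have "cmin * (ind k \<theta> * (k * W' \<theta>)) * (k * W \<theta> - m)\<^sup>2 \<le> dens k \<theta> * (k * W \<theta> - m)\<^sup>2"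
      using minor_le(1)[OF k] by (intro mult_right_mono) auto
    thus "cmin * (ind k \<theta> *\<^sub>R ((k * W' \<theta>) *\<^sub>R (k * W \<theta> - m)\<^sup>2)) \<le> dens k \<theta> *\<^sub>R (k * W \<theta> - m)\<^sup>2" by (simp add: mult_ac)
  qed
  also have "\<dots> = k\<^sup>2 * tvar k" by (rule v[symmetric])
  finally have 1: "cmin * (l ^ 3 / 12) \<le> k\<^sup>2 * tvar k" .
  have "(1 / (2 * pi)) ^ 3 \<le> l ^ 3" using l by (intro power_mono) auto
  hence "cmin * (1 / (2 * pi)) ^ 3 \<le> cmin * l ^ 3" using cmin_pos by (intro mult_left_mono) auto
  moreover have "2 * cdec = cmin * (1 / (2 * pi)) ^ 3 / 16" by (simp add: cdec_def power_divide)
  moreover have "cmin * l ^ 3 \<ge> 0" using cmin_pos l by simp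
  ultimately show ?thesis using 1 by simp
qed

text \<open>Integration by parts: \<open>(1 - s) \<integral> e\<^sup>-\<^sup>s\<^sup>W sin\<^sup>2 = - (2 / a) \<integral> e\<^sup>(\<^sup>1\<^sup>-\<^sup>s\<^sup>)\<^sup>W cos\<close>.\<close>
lemma parts:
  fixes s :: complex
  shows "(1 - s) * (\<integral>\<theta>. indicator {0..pi} \<theta> *\<^sub>R (exp (- s * of_real (W \<theta>)) * of_real ((sin \<theta>)\<^sup>2)) \<partial>lborel)
     = - of_real (2 / a) * (\<integral>\<theta>. indicator {0..pi} \<theta> *\<^sub>R (exp ((1 - s) * of_real (W \<theta>)) * of_real (cos \<theta>)) \<partial>lborel)"
proof -
  let ?A = "\<lambda>\<theta>. exp (- s * of_real (W \<theta>)) * of_real ((sin \<theta>)\<^sup>2)"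
  let ?B = "\<lambda>\<theta>. exp ((1 - s) * of_real (W \<theta>)) * of_real (cos \<theta>)"
  have iA: "integrable lborel (\<lambda>\<theta>. indicator {0..pi} \<theta> *\<^sub>R ?A \<theta>)"
    by (rule borel_integrable_compact, simp, intro continuous_intros W_cont)
  have iB: "integrable lborel (\<lambda>\<theta>. indicator {0..pi} \<theta> *\<^sub>R ?B \<theta>)"
    by (rule borel_integrable_compact, simp, intro continuous_intros W_cont)
  let ?F = "\<lambda>\<theta>. exp ((1 - s) * of_real (W \<theta>)) * of_real (sin \<theta>)"
  let ?f = "\<lambda>\<theta>. ?B \<theta> + (1 - s) * of_real (a / 2) * ?A \<theta>"
  have d: "(?F has_vector_derivative ?f \<theta>) (at \<theta> within {0..pi})" for \<theta>
  proof -
    have dW: "((\<lambda>\<theta>. complex_of_real (W \<theta>)) has_vector_derivative of_real (W' \<theta>)) (at \<theta> within {0..pi})"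
      by (rule bounded_linear.has_vector_derivative[OF bounded_linear_of_real
            has_vector_derivative_at_within[OF W_deriv[unfolded has_real_derivative_iff_has_vector_derivative]]])
    have "((\<lambda>z. exp ((1 - s) * z)) has_field_derivative (1 - s) * exp ((1 - s) * of_real (W \<theta>))) (at (of_real (W \<theta>)))"
      by (auto intro!: derivative_eq_intros)
    from field_vector_diff_chain_within[OF dW DERIV_subset[OF this]]
    have d1: "((\<lambda>\<theta>. exp ((1 - s) * of_real (W \<theta>))) has_vector_derivative of_real (W' \<theta>) * ((1 - s) * exp ((1 - s) * of_real (W \<theta>)))) (at \<theta> within {0..pi})"
      by (simp add: o_def)
    have "(sin has_vector_derivative cos \<theta>) (at \<theta> within {0..pi})"
      using DERIV_sin[of \<theta>] by (simp add: has_real_derivative_iff_has_vector_derivative has_vector_derivative_at_within)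
    hence d2: "((\<lambda>\<theta>. complex_of_real (sin \<theta>)) has_vector_derivative of_real (cos \<theta>)) (at \<theta> within {0..pi})"
      by (rule bounded_linear.has_vector_derivative[OF bounded_linear_of_real])
    have "(?F has_vector_derivative (exp ((1 - s) * of_real (W \<theta>)) * of_real (cos \<theta>) + of_real (W' \<theta>) * ((1 - s) * exp ((1 - s) * of_real (W \<theta>))) * of_real (sin \<theta>))) (at \<theta> within {0..pi})"
      by (rule has_vector_derivative_mult[OF d1 d2])
    moreover have key: "of_real (W' \<theta>) * exp ((1 - s) * of_real (W \<theta>)) = of_real (a / 2 * sin \<theta>) * exp (- s * of_real (W \<theta>))"
    proof -
      have "exp ((1 - s) * of_real (W \<theta>)) = of_real (exp (W \<theta>)) * exp (- s * of_real (W \<theta>))"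
        by (simp add: exp_of_real[symmetric] mult_exp_exp algebra_simps)
      moreover have "W' \<theta> * exp (W \<theta>) = a / 2 * sin \<theta>"
        unfolding W'_def exp_W using one_plus_pos[of \<theta>] by (simp add: field_simps)
      ultimately show ?thesis by (metis mult.assoc of_real_mult)
    qed
    moreover have "of_real (W' \<theta>) * ((1 - s) * exp ((1 - s) * of_real (W \<theta>))) * of_real (sin \<theta>)
        = (1 - s) * of_real (a / 2) * ?A \<theta>"
    proof -
      have "of_real (W' \<theta>) * ((1 - s) * exp ((1 - s) * of_real (W \<theta>))) * of_real (sin \<theta>)
          = (1 - s) * (of_real (W' \<theta>) * exp ((1 - s) * of_real (W \<theta>))) * of_real (sin \<theta>)" by (simp only: mult_ac)
      also have "\<dots> = (1 - s) * of_real (a / 2) * ?A \<theta>" unfolding key by (simp add: power2_eq_square mult_ac)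
      finally show ?thesis .
    qed
    ultimately show ?thesis by (simp only:)
  qed
  have "(\<integral>\<theta>. indicator {0..pi} \<theta> *\<^sub>R ?f \<theta> \<partial>lborel) = ?F pi - ?F 0"
  proof (rule integral_FTC_Icc)
    show "continuous_on {0..pi} ?f" by (intro continuous_intros W_cont)
  qed (use d in simp_all)
  hence "(\<integral>\<theta>. indicator {0..pi} \<theta> *\<^sub>R ?f \<theta> \<partial>lborel) = 0" by simp
  also have "(\<integral>\<theta>. indicator {0..pi} \<theta> *\<^sub>R ?f \<theta> \<partial>lborel)
     = (\<integral>\<theta>. indicator {0..pi} \<theta> *\<^sub>R ?B \<theta> + ((1 - s) * of_real (a / 2)) * (indicator {0..pi} \<theta> *\<^sub>R ?A \<theta>) \<partial>lborel)"
    by (rule Bochner_Integration.integral_cong) (auto simp: scaleR_add_right)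
  also have "\<dots> = (\<integral>\<theta>. indicator {0..pi} \<theta> *\<^sub>R ?B \<theta> \<partial>lborel) + ((1 - s) * of_real (a / 2)) * (\<integral>\<theta>. indicator {0..pi} \<theta> *\<^sub>R ?A \<theta> \<partial>lborel)"
    by (subst Bochner_Integration.integral_add[OF iB integrable_mult_right[OF iA]]) (simp only: integral_mult_right_zero)
  finally have "((1 - s) * of_real (a / 2)) * (\<integral>\<theta>. indicator {0..pi} \<theta> *\<^sub>R ?A \<theta> \<partial>lborel) = - (\<integral>\<theta>. indicator {0..pi} \<theta> *\<^sub>R ?B \<theta> \<partial>lborel)"
    by (simp add: eq_neg_iff_add_eq_0 add.commute)
  hence "of_real (2 / a) * (((1 - s) * of_real (a / 2)) * (\<integral>\<theta>. indicator {0..pi} \<theta> *\<^sub>R ?A \<theta> \<partial>lborel)) = of_real (2 / a) * - (\<integral>\<theta>. indicator {0..pi} \<theta> *\<^sub>R ?B \<theta> \<partial>lborel)"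
    by simp
  moreover have "complex_of_real (2 / a) * of_real (a / 2) = 1" using a_bounds(1) by simp
  ultimately show ?thesis by (metis (no_types, lifting) minus_mult_commute mult.assoc mult.left_commute mult_1)
qed

text \<open>Decay 1/|t| uniform in k. In the integration by parts |1 - s| >= k |t|, so the other
  integral must be O(k h(k)) in absolute value. At the real point s = k the same identity evaluates
  the signed integral \<open>J\<close> exactly, and \<open>J'\<close> exceeds it only through the
  angles beyond pi/2, which \<open>h k\<close> controls.\<close>

lemma tchar_norm_parts:
  assumes k: "k \<ge> 1" and t: "t \<noteq> 0"
  shows "norm (tchar k t) \<le> 296 / a / \<bar>t\<bar>"
proof -
  let ?i = "\<lambda>\<theta>. indicator {0..pi} \<theta> :: real"
  define J where "J = (\<integral>\<theta>. ?i \<theta> *\<^sub>R (exp ((1 - k) * W \<theta>) * cos \<theta>) \<partial>lborel)"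
  define J' where "J' = (\<integral>\<theta>. ?i \<theta> *\<^sub>R (exp ((1 - k) * W \<theta>) * \<bar>cos \<theta>\<bar>) \<partial>lborel)"
  have iJ: "integrable lborel (\<lambda>\<theta>. ?i \<theta> *\<^sub>R (exp ((1 - k) * W \<theta>) * cos \<theta>))"
       and iJ': "integrable lborel (\<lambda>\<theta>. ?i \<theta> *\<^sub>R (exp ((1 - k) * W \<theta>) * \<bar>cos \<theta>\<bar>))"
  proof -
    have e: "exp ((1 - k) * W \<theta>) \<le> 1" for \<theta> using k W_nonneg[of \<theta>] by (simp add: mult_nonpos_nonneg)
    have "norm (exp ((1 - k) * W \<theta>) * cos \<theta>) \<le> 1 * 1" "norm (exp ((1 - k) * W \<theta>) * \<bar>cos \<theta>\<bar>) \<le> 1 * 1" for \<theta>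
      unfolding norm_mult using e by (intro mult_mono; simp)+
    thus "integrable lborel (\<lambda>\<theta>. ?i \<theta> *\<^sub>R (exp ((1 - k) * W \<theta>) * cos \<theta>))"
       "integrable lborel (\<lambda>\<theta>. ?i \<theta> *\<^sub>R (exp ((1 - k) * W \<theta>) * \<bar>cos \<theta>\<bar>))"
      by (intro integrable_indicator_bounded[where C = "1 * 1"]; simp)+
  qed
  have real: "(1 - k) * h k = - (2 / a) * J"
  proof -
    have "(1 - of_real k) * complex_of_real (h k) = - of_real (2 / a) * complex_of_real J"
    proof -
      have "complex_of_real (h k) = (\<integral>\<theta>. indicator {0..pi} \<theta> *\<^sub>R (exp (- of_real k * of_real (W \<theta>)) * of_real ((sin \<theta>)\<^sup>2)) \<partial>lborel)"
        unfolding h_def integral_complex_of_real[symmetric]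
        by (rule Bochner_Integration.integral_cong) (auto simp: exp_of_real[symmetric] indicator_def)
      moreover have "complex_of_real J = (\<integral>\<theta>. indicator {0..pi} \<theta> *\<^sub>R (exp ((1 - of_real k) * of_real (W \<theta>)) * of_real (cos \<theta>)) \<partial>lborel)"
        unfolding J_def integral_complex_of_real[symmetric]
        by (rule Bochner_Integration.integral_cong) (auto simp: exp_of_real[symmetric] indicator_def)
      ultimately show ?thesis using parts[of "of_real k"] by simp
    qed
    hence "complex_of_real ((1 - k) * h k) = complex_of_real (- (2 / a) * J)" by simp
    thus ?thesis by (simp only: of_real_eq_iff)
  qed
  have Jh: "J = a * (k - 1) / 2 * h k" using real a_bounds(1) by (simp add: field_simps)
  define W2 where "W2 = W (pi / 2)"
  have Wmono: "W x \<le> W y" if "0 \<le> x" "x \<le> y" "y \<le> pi" for x y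
  proof -
    have "sin (x / 2) \<le> sin (y / 2)" using that by (intro sin_monotone_2pi_le) auto
    moreover have "sin (x / 2) \<ge> 0" using that by (intro sin_ge_zero) auto
    ultimately have "(sin (x / 2))\<^sup>2 \<le> (sin (y / 2))\<^sup>2" by (intro power_mono) auto
    hence "1 + a * (sin (x / 2))\<^sup>2 \<le> 1 + a * (sin (y / 2))\<^sup>2" using a_bounds by (intro add_left_mono mult_left_mono) auto
    thus ?thesis unfolding W_def using one_plus_pos[of x] by (intro ln_mono) auto
  qed
  have hlo: "pi / 8 * exp (- k * W2) \<le> h k"
  proof -
    have "pi / 8 * exp (- k * W2) = (\<integral>\<theta>. indicator {pi / 4..pi / 2} \<theta> *\<^sub>R (exp (- k * W2) * (1 / 2)) \<partial>lborel)" by simp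
    also have "\<dots> \<le> h k"
      unfolding h_def
    proof (rule integral_mono[OF _ integrable_h])
      show "integrable lborel (\<lambda>\<theta>. indicator {pi / 4..pi / 2} \<theta> *\<^sub>R (exp (- k * W2) * (1 / 2)))"
        by (rule integrable_indicator_bounded[where C = "exp (- k * W2) * (1 / 2)"]) auto
      fix \<theta> :: real
      show "indicator {pi / 4..pi / 2} \<theta> *\<^sub>R (exp (- k * W2) * (1 / 2)) \<le> ?i \<theta> *\<^sub>R (exp (- k * W \<theta>) * (sin \<theta>)\<^sup>2)"
      proof (cases "\<theta> \<in> {pi / 4..pi / 2}")
        case True
        have "sin (pi / 4) \<le> sin \<theta>" using True by (intro sin_monotone_2pi_le) auto
        hence "(sin (pi / 4))\<^sup>2 \<le> (sin \<theta>)\<^sup>2" by (intro power_mono) (auto simp: sin_45)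
        hence s: "1 / 2 \<le> (sin \<theta>)\<^sup>2" by (simp add: sin_45 power_divide)
        have "k * W \<theta> \<le> k * W2" unfolding W2_def using True k by (intro mult_left_mono Wmono) auto
        hence "exp (- k * W2) * (1 / 2) \<le> exp (- k * W \<theta>) * (sin \<theta>)\<^sup>2" using s by (intro mult_mono) auto
        thus ?thesis using True by simp
      qed simp
    qed
    finally show ?thesis .
  qed
  have "J' - J \<le> (\<integral>\<theta>. ?i \<theta> *\<^sub>R (2 * exp ((1 - k) * W2)) \<partial>lborel)"
    unfolding J_def J'_def Bochner_Integration.integral_diff[OF iJ' iJ, symmetric]
  proof (rule integral_mono)
    show "integrable lborel (\<lambda>\<theta>. ?i \<theta> *\<^sub>R (exp ((1 - k) * W \<theta>) * \<bar>cos \<theta>\<bar>) - ?i \<theta> *\<^sub>R (exp ((1 - k) * W \<theta>) * cos \<theta>))"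
      by (rule Bochner_Integration.integrable_diff[OF iJ' iJ])
    show "integrable lborel (\<lambda>\<theta>. ?i \<theta> *\<^sub>R (2 * exp ((1 - k) * W2)))"
      by (rule integrable_indicator_bounded[where C = "2 * exp ((1 - k) * W2)"]) auto
    fix \<theta> :: real
    show "?i \<theta> *\<^sub>R (exp ((1 - k) * W \<theta>) * \<bar>cos \<theta>\<bar>) - ?i \<theta> *\<^sub>R (exp ((1 - k) * W \<theta>) * cos \<theta>) \<le> ?i \<theta> *\<^sub>R (2 * exp ((1 - k) * W2))"
    proof (cases "\<theta> \<in> {0..pi}")
      case True
      show ?thesis
      proof (cases "\<theta> \<le> pi / 2")
        case T2: True
        hence "cos \<theta> \<ge> 0" using True by (intro cos_ge_zero) auto
        thus ?thesis using True by simp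
      next
        case False
        have "(1 - k) * W \<theta> \<le> (1 - k) * W2"
          unfolding W2_def using False True k by (intro mult_left_mono_neg Wmono) auto
        hence e: "exp ((1 - k) * W \<theta>) \<le> exp ((1 - k) * W2)" by simp
        have "exp ((1 - k) * W \<theta>) * (\<bar>cos \<theta>\<bar> - cos \<theta>) \<le> exp ((1 - k) * W2) * 2"
        proof (rule mult_mono[OF e])
          show "\<bar>cos \<theta>\<bar> - cos \<theta> \<le> 2" "0 \<le> \<bar>cos \<theta>\<bar> - cos \<theta>" using abs_cos_le_one[of \<theta>] by linarith+
        qed simp
        thus ?thesis using True by (simp add: right_diff_distrib)
      qed
    qed simp
  qed
  also have "\<dots> = 2 * pi * exp ((1 - k) * W2)" by simp
  also have "exp ((1 - k) * W2) = exp W2 * exp (- k * W2)" by (simp add: mult_exp_exp algebra_simps)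
  also have "2 * pi * (exp W2 * exp (- k * W2)) = 16 * exp W2 * (pi / 8 * exp (- k * W2))" by simp
  also have "\<dots> \<le> 16 * 9 * h k"
  proof (rule mult_mono[OF _ hlo])
    have "exp W2 \<le> 1 + 8 * 1" unfolding W2_def exp_W using a_bounds by (intro add_left_mono mult_mono) (auto simp: abs_square_le_1)
    thus "16 * exp W2 \<le> 16 * 9" by simp
  qed auto
  \<comment> \<open>The 144 is 16 * 9 with exp(W) <= 1 + a <= 9; with a/2 <= 4 it gives 148 k for k
    >= 1, and 2 * 148 = 296.\<close>
  finally have "J' \<le> (a * (k - 1) / 2 + 144) * h k" unfolding Jh by (simp add: algebra_simps)
  also have "\<dots> \<le> 148 * k * h k"
  proof (intro mult_right_mono)
    have "a * (k - 1) \<le> 8 * (k - 1)" using a_bounds k by (intro mult_right_mono) auto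
    thus "a * (k - 1) / 2 + 144 \<le> 148 * k" using k by simp
  qed (use h_pos[of k] in simp)
  finally have J'b: "J' \<le> 148 * k * h k" .
  define s where "s = Complex k (k * t)"
  let ?A = "\<integral>\<theta>. indicator {0..pi} \<theta> *\<^sub>R (exp (- s * of_real (W \<theta>)) * of_real ((sin \<theta>)\<^sup>2)) \<partial>lborel"
  let ?Bi = "\<integral>\<theta>. indicator {0..pi} \<theta> *\<^sub>R (exp ((1 - s) * of_real (W \<theta>)) * of_real (cos \<theta>)) \<partial>lborel"
  have tc: "norm (tchar k t) = norm ?A / h k"
  proof -
    have "emom 0 s = of_real (2 / pi) * (exp (s * of_real x0) * ?A)"
    proof -
      have "emom 0 s = (\<integral>\<theta>. exp (s * of_real (x0 - W \<theta>)) \<partial>st_measure)" unfolding emom_def by simp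
      also have "\<dots> = (\<integral>\<theta>. (of_real (2 / pi) * exp (s * of_real x0)) * (indicator {0..pi} \<theta> *\<^sub>R (exp (- s * of_real (W \<theta>)) * of_real ((sin \<theta>)\<^sup>2))) \<partial>lborel)"
        by (subst integral_st_measure)
           (auto intro!: Bochner_Integration.integral_cong simp: scaleR_conv_of_real right_diff_distrib exp_diff exp_minus field_simps)
      also have "\<dots> = of_real (2 / pi) * exp (s * of_real x0) * ?A" by (rule integral_mult_right_zero)
      finally show ?thesis by simp
    qed
    note E = this
    have "norm (emom 0 s) = 2 / pi * (exp (k * x0) * norm ?A)"
    proof -
      have "norm (exp (s * of_real x0)) = exp (k * x0)" "norm (complex_of_real (2 / pi)) = 2 / pi"
        by (simp_all add: norm_exp_eq_Re s_def norm_divide)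
      thus ?thesis by (simp only: E norm_mult)
    qed
    moreover have "norm (tchar k t) = norm (emom 0 s) / rmom 0 k"
      unfolding tchar_def s_def using rmom_0_pos[of k] by (simp add: norm_mult norm_divide)
    ultimately show ?thesis unfolding rmom_0_eq by simp
  qed
  have nB: "norm ?Bi \<le> J'"
  proof -
    have "norm ?Bi \<le> (\<integral>\<theta>. norm (indicator {0..pi} \<theta> *\<^sub>R (exp ((1 - s) * of_real (W \<theta>)) * complex_of_real (cos \<theta>))) \<partial>lborel)"
      by (rule integral_norm_bound)
    also have "\<dots> = J'" unfolding J'_def
      by (rule Bochner_Integration.integral_cong) (auto simp: norm_mult norm_exp_eq_Re s_def indicator_def)
    finally show ?thesis .
  qed
  have ns: "norm (1 - s) \<ge> k * \<bar>t\<bar>"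
    using abs_Im_le_cmod[of "1 - s"] k by (simp add: s_def abs_mult)
  have "norm (1 - s) * norm ?A = 2 / a * norm ?Bi"
    using arg_cong[OF parts[of s], of norm] a_bounds(1) by (simp add: norm_mult norm_divide)
  hence "k * \<bar>t\<bar> * norm ?A \<le> 2 / a * J'"
    using mult_right_mono[OF ns, of "norm ?A"] mult_left_mono[OF nB, of "2 / a"] a_bounds(1) by simp
  also have "\<dots> \<le> 2 / a * (148 * k * h k)" using J'b a_bounds(1) by (intro mult_left_mono) auto
  finally have "norm ?A \<le> 296 / a / \<bar>t\<bar> * h k"
    using k t a_bounds(1) by (simp add: field_simps)
  thus ?thesis unfolding tc using h_pos[of k] by (simp add: field_simps)
qed

text \<open>The term of order 1/p has mean zero, because cos has Sato-Tate mean 0. The constant must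
  be explicit: summed over all primes it gives at most (3/2)(3/4) = 9/8, which lies below 2 (log t +
  gamma) for every t >= 1.\<close>

lemma tmean_0_le: "tmean 0 \<le> 3 / 2 / (real p)\<^sup>2"
proof -
  interpret prob_space st_measure by (rule prob_space_st_measure)
  define r where "r = 1 / real p"
  have r: "0 < r" "r \<le> 1 / 2" using p_inv by (auto simp: r_def)
  have pt: "x0 - W \<theta> \<le> 2 * cos \<theta> * r - r\<^sup>2 + 2 * (4 * (cos \<theta>)\<^sup>2 * r\<^sup>2 - 4 * cos \<theta> * r ^ 3 + r ^ 4)" for \<theta>
  proof -
    define x where "x = - 2 * cos \<theta> * r + r\<^sup>2"
    have "1 + x = inverse (D p \<theta>)" by (simp add: D_def x_def r_def power_divide)
    hence lx: "ln (1 + x) = - (x0 - W \<theta>)" using ln_D[of \<theta>] by (simp add: D_eq ln_inverse)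
    have "2 * cos \<theta> * r \<le> 2 * 1 * r" using r by (intro mult_right_mono) auto
    hence "x \<ge> r\<^sup>2 - 2 * r" by (simp add: x_def)
    moreover have "r\<^sup>2 - 2 * r + 3 / 4 = (1 / 2 - r) * (3 / 2 - r)" by (simp add: power2_eq_square field_simps)
    moreover have "(1 / 2 - r) * (3 / 2 - r) \<ge> 0" using r by (intro mult_nonneg_nonneg) auto
    ultimately have x: "x \<ge> - 3 / 4" by linarith
    \<comment> \<open>The inequality -log(1 + x) <= -x + 2 x^2 holds for x >= -3/4, and p >= 2 keeps
      x in this range. The derivative of \<open>g\<close> changes sign only at 0 there.\<close>
    define g where "g y = ln (1 + y) - y + 2 * y\<^sup>2" for y :: real
    have dg: "(g has_real_derivative y * (3 + 4 * y) / (1 + y)) (at y)" if "y \<ge> - 3 / 4" for y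
      unfolding g_def using that by (auto intro!: derivative_eq_intros simp: field_simps power2_eq_square)
    have "g x \<ge> g 0"
    proof (cases "x \<ge> 0")
      case True
      show ?thesis
      proof (rule DERIV_nonneg_imp_nondecreasing[OF True])
        fix y :: real assume y: "0 \<le> y"
        have "y * (3 + 4 * y) / (1 + y) \<ge> 0" using y by simp
        thus "\<exists>d. (g has_real_derivative d) (at y) \<and> 0 \<le> d" using dg[of y] y by auto
      qed
    next
      case False
      hence x0: "x \<le> 0" by simp
      show ?thesis
      proof (rule DERIV_nonpos_imp_nonincreasing[OF x0])
        fix y :: real assume y: "x \<le> y" "y \<le> 0"
        have "y * (3 + 4 * y) \<le> 0" using y x by (intro mult_nonpos_nonneg) auto
        hence "y * (3 + 4 * y) / (1 + y) \<le> 0" using y x by (intro divide_nonpos_pos) auto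
        thus "\<exists>d. (g has_real_derivative d) (at y) \<and> d \<le> 0" using dg[of y] y x by auto
      qed
    qed
    hence "- ln (1 + x) \<le> - x + 2 * x\<^sup>2" by (simp add: g_def)
    moreover have "x\<^sup>2 = 4 * (cos \<theta>)\<^sup>2 * r\<^sup>2 - 4 * cos \<theta> * r ^ 3 + r ^ 4"
      by (simp add: x_def power2_eq_square power3_eq_cube power4_eq_xxxx algebra_simps)
    ultimately show ?thesis unfolding lx by (simp add: x_def)
  qed
  have FTC: "(\<integral>\<theta>. f \<theta> \<partial>st_measure) = 2 / pi * (F pi - F 0)"
    if "\<And>\<theta>. (F has_real_derivative (sin \<theta>)\<^sup>2 * f \<theta>) (at \<theta>)" "continuous_on UNIV f" for F f :: "real \<Rightarrow> real"
  proof -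
    have "(\<integral>\<theta>. indicator {0..pi} \<theta> *\<^sub>R ((sin \<theta>)\<^sup>2 * f \<theta>) \<partial>lborel) = F pi - F 0"
    proof (rule integral_FTC_Icc)
      show "continuous_on {0..pi} (\<lambda>\<theta>. (sin \<theta>)\<^sup>2 * f \<theta>)"
        using that(2) by (intro continuous_intros) (auto intro: continuous_on_subset)
      fix \<theta> show "(F has_vector_derivative (sin \<theta>)\<^sup>2 * f \<theta>) (at \<theta> within {0..pi})"
        by (rule has_vector_derivative_at_within[OF that(1)[unfolded has_real_derivative_iff_has_vector_derivative]])
    qed simp
    thus ?thesis using borel_measurable_continuous_onI[OF that(2)] by (subst integral_st_measure) simp_all
  qed
  have c1: "(\<integral>\<theta>. cos \<theta> \<partial>st_measure) = 0"
    by (subst FTC[of "\<lambda>\<theta>. (sin \<theta>) ^ 3 / 3"]) (auto intro!: derivative_eq_intros continuous_intros)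
  have c2: "(\<integral>\<theta>. (cos \<theta>)\<^sup>2 \<partial>st_measure) = 1 / 4"
  proof (subst FTC[of "\<lambda>\<theta>. \<theta> / 8 - sin (4 * \<theta>) / 32"])
    fix \<theta> :: real
    have "cos (4 * \<theta>) = 1 - 2 * (2 * sin \<theta> * cos \<theta>)\<^sup>2" using cos_double_sin[of "2 * \<theta>"] by (simp add: sin_double)
    hence "cos (4 * \<theta>) = 1 - 8 * ((sin \<theta>)\<^sup>2 * (cos \<theta>)\<^sup>2)" by (simp add: power_mult_distrib)
    hence "1 / 8 - cos (4 * \<theta>) * 4 / 32 = (sin \<theta>)\<^sup>2 * (cos \<theta>)\<^sup>2" by linarith
    moreover have "((\<lambda>\<theta>. \<theta> / 8 - sin (4 * \<theta>) / 32) has_real_derivative 1 / 8 - cos (4 * \<theta>) * 4 / 32) (at \<theta>)"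
      by (auto intro!: derivative_eq_intros)
    ultimately show "((\<lambda>\<theta>. \<theta> / 8 - sin (4 * \<theta>) / 32) has_real_derivative (sin \<theta>)\<^sup>2 * (cos \<theta>)\<^sup>2) (at \<theta>)" by simp
  next
    have "sin (4 * pi) = 0" using sin_npi[of 4] by simp
    thus "2 / pi * (pi / 8 - sin (4 * pi) / 32 - (0 / 8 - sin (4 * 0) / 32)) = 1 / 4" by simp
  qed (intro continuous_intros)
  have i: "integrable st_measure cos" "integrable st_measure (\<lambda>\<theta>. (cos \<theta>)\<^sup>2)"
    by (rule integrable_const_bound[where B = 1]; auto simp: abs_square_le_1)+
  have "tmean 0 = (\<integral>\<theta>. x0 - W \<theta> \<partial>st_measure)"
  proof -
    have "rmom 0 0 = 1" using prob_space by (simp add: rmom_def)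
    hence "tmean 0 = rmom 1 0" unfolding tmean_def by simp
    thus ?thesis unfolding rmom_def by simp
  qed
  also have "\<dots> \<le> (\<integral>\<theta>. 2 * cos \<theta> * r - r\<^sup>2 + 2 * (4 * (cos \<theta>)\<^sup>2 * r\<^sup>2 - 4 * cos \<theta> * r ^ 3 + r ^ 4) \<partial>st_measure)"
  proof (rule integral_mono)
    show "integrable st_measure (\<lambda>\<theta>. x0 - W \<theta>)" using integrable_rmom[of 1 0] by simp
  qed (use i pt in auto)
  also have "\<dots> = - r\<^sup>2 + 2 * (r\<^sup>2 + r ^ 4)"
  proof -
    have "(\<lambda>\<theta>. 2 * cos \<theta> * r - r\<^sup>2 + 2 * (4 * (cos \<theta>)\<^sup>2 * r\<^sup>2 - 4 * cos \<theta> * r ^ 3 + r ^ 4))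
        = (\<lambda>\<theta>. ((2 * r - 8 * r ^ 3) * cos \<theta> + (8 * r\<^sup>2) * (cos \<theta>)\<^sup>2) + (2 * r ^ 4 - r\<^sup>2))"
      by (simp add: fun_eq_iff algebra_simps)
    hence "(\<integral>\<theta>. 2 * cos \<theta> * r - r\<^sup>2 + 2 * (4 * (cos \<theta>)\<^sup>2 * r\<^sup>2 - 4 * cos \<theta> * r ^ 3 + r ^ 4) \<partial>st_measure)
        = (\<integral>\<theta>. ((2 * r - 8 * r ^ 3) * cos \<theta> + (8 * r\<^sup>2) * (cos \<theta>)\<^sup>2) + (2 * r ^ 4 - r\<^sup>2) \<partial>st_measure)" by (simp only:)
    also have "\<dots> = (\<integral>\<theta>. (2 * r - 8 * r ^ 3) * cos \<theta> + (8 * r\<^sup>2) * (cos \<theta>)\<^sup>2 \<partial>st_measure) + (\<integral>\<theta>. 2 * r ^ 4 - r\<^sup>2 \<partial>st_measure)"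
      by (rule Bochner_Integration.integral_add) (use i in \<open>auto intro!: Bochner_Integration.integrable_add integrable_mult_right\<close>)
    also have "(\<integral>\<theta>. (2 * r - 8 * r ^ 3) * cos \<theta> + (8 * r\<^sup>2) * (cos \<theta>)\<^sup>2 \<partial>st_measure)
        = (\<integral>\<theta>. (2 * r - 8 * r ^ 3) * cos \<theta> \<partial>st_measure) + (\<integral>\<theta>. (8 * r\<^sup>2) * (cos \<theta>)\<^sup>2 \<partial>st_measure)"
      by (rule Bochner_Integration.integral_add) (use i in \<open>auto intro!: integrable_mult_right\<close>)
    also have "(\<integral>\<theta>. 2 * r ^ 4 - r\<^sup>2 \<partial>st_measure) = 2 * r ^ 4 - r\<^sup>2" using prob_space by simp
    finally show ?thesis unfolding integral_mult_right_zero c1 c2 by simp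
  qed
  also have "\<dots> \<le> 3 / 2 * r\<^sup>2"
  proof -
    have "r\<^sup>2 \<le> (1 / 2)\<^sup>2" using r by (intro power_mono) auto
    hence "r\<^sup>2 * r\<^sup>2 \<le> r\<^sup>2 * (1 / 4)" by (intro mult_left_mono) (auto simp: power2_eq_square)
    hence "r ^ 4 \<le> r\<^sup>2 / 4" by (simp add: power2_eq_square power4_eq_xxxx)
    moreover have "y \<le> z / 4 \<Longrightarrow> - z + 2 * (z + y) \<le> 3 / 2 * z" for y z :: real by argo
    ultimately show ?thesis by blast
  qed
  finally show ?thesis by (simp add: r_def power_divide)
qed

end



section \<open>Independence: passing from single primes to log L\<close>

lemma sum_inverse_prime_sq_le: "(\<Sum>p | prime p \<and> real p \<le> y. 1 / (real p)\<^sup>2) \<le> 3 / 4"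
proof -
  define N where "N = max 2 (nat \<lfloor>y\<rfloor>)"
  have "(\<Sum>n=2..N. 1 / (real n)\<^sup>2) \<le> 3 / 4 - 1 / real N" if "N \<ge> 2" for N
    using that
  proof (induction N rule: dec_induct)
    case (step N)
    have "1 / (real (Suc N))\<^sup>2 \<le> 1 / real N - 1 / real (Suc N)"
    proof -
      have "1 / real N - 1 / real (Suc N) = 1 / (real N * real (Suc N))" using step by (simp add: field_simps)
      moreover have "1 / (real (Suc N))\<^sup>2 \<le> 1 / (real N * real (Suc N))"
        unfolding power2_eq_square using step by (intro divide_left_mono mult_right_mono) auto
      ultimately show ?thesis by linarith
    qed
    thus ?case using step by simp
  qed simp
  from this[of N] have "(\<Sum>n=2..N. 1 / (real n)\<^sup>2) \<le> 3 / 4 - 1 / real N" by (simp add: N_def)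
  moreover have "1 / real N \<ge> 0" by simp
  ultimately have "(\<Sum>n=2..N. 1 / (real n)\<^sup>2) \<le> 3 / 4" by linarith
  moreover have "(\<Sum>p | prime p \<and> real p \<le> y. 1 / (real p)\<^sup>2) \<le> (\<Sum>n=2..N. 1 / (real n)\<^sup>2)"
  proof (rule sum_mono2)
    show "{p. prime p \<and> real p \<le> y} \<subseteq> {2..N}"
    proof
      fix p assume "p \<in> {p. prime p \<and> real p \<le> y}"
      hence "p \<ge> 2" "p \<le> nat \<lfloor>y\<rfloor>" using prime_ge_2_nat le_nat_floor by auto
      thus "p \<in> {2..N}" by (simp add: N_def)
    qed
  qed auto
  ultimately show ?thesis by linarith
qed

abbreviation prime_log :: "nat \<Rightarrow> real \<Rightarrow> real" where
  "prime_log p \<equiv> (\<lambda>\<theta>. prime_angle.x0 p - prime_angle.W p \<theta>)"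
abbreviation "prime_emom p \<equiv> bounded_rv.emom st_measure (prime_log p) 0"
abbreviation "prime_rmom p \<equiv> bounded_rv.rmom st_measure (prime_log p) 0"
abbreviation "prime_mean p \<equiv> bounded_rv.tmean st_measure (prime_log p)"
abbreviation "prime_var p \<equiv> bounded_rv.tvar st_measure (prime_log p)"
abbreviation "prime_mom3 p \<equiv> bounded_rv.tmom3 st_measure (prime_log p)"
abbreviation "prime_mom4 p \<equiv> bounded_rv.tmom4 st_measure (prime_log p)"
abbreviation "prime_char p \<equiv> bounded_rv.tchar st_measure (prime_log p)"

lemma prime_angleI: "prime p \<Longrightarrow> prime_angle p"
  by unfold_locales (rule prime_ge_2_nat)

lemma prime_bounded_rv:
  assumes "prime p"
  shows "bounded_rv st_measure (prime_log p) (\<bar>prime_angle.x0 p\<bar> + 8)"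
proof -
  interpret prime_angle p by (rule prime_angleI[OF assms])
  show ?thesis by unfold_locales
qed

text \<open>The value of \<open>W\<close> determines sin^2(theta/2), hence cos theta, hence the
  angle in [0, pi]; each level set is at most one point.\<close>

lemma st_measure_no_atom:
  assumes "prime p"
  shows "AE \<theta> in st_measure. prime_log p \<theta> \<noteq> c"
proof -
  interpret prime_angle p by (rule prime_angleI[OF assms])
  define z where "z = arccos (1 - 2 * ((exp (x0 - c) - 1) / a))"
  have r: "\<theta> = z" if "\<theta> \<in> {0..pi}" "x0 - W \<theta> = c" for \<theta>
  proof -
    have "exp (x0 - c) = 1 + a * (sin (\<theta> / 2))\<^sup>2" using exp_W[of \<theta>] that(2) by (simp add: algebra_simps)
    hence "(exp (x0 - c) - 1) / a = (sin (\<theta> / 2))\<^sup>2" using a_bounds(1) by simp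
    hence "1 - 2 * ((exp (x0 - c) - 1) / a) = cos \<theta>" using cos_double_sin[of "\<theta> / 2"] by simp
    thus ?thesis using that(1) by (simp add: z_def arccos_cos)
  qed
  have a1: "AE \<theta> in st_measure. \<theta> \<in> {0..pi}"
    by (subst AE_density) (auto simp: sato_tate_density_def indicator_def)
  have a2: "AE \<theta> in st_measure. \<theta> \<noteq> z"
    using AE_lborel_singleton[of z] by (subst AE_density) auto
  show ?thesis using a1 a2 by eventually_elim (use r in blast)
qed

locale st_model = prob_space M for M :: "'a measure" +
  fixes \<theta> :: "nat \<Rightarrow> 'a \<Rightarrow> real"
  assumes indep: "indep_vars (\<lambda>_. borel) \<theta> {p. prime p}"
    and dist: "\<And>p. prime p \<Longrightarrow> distributed M lborel (\<theta> p) (\<lambda>x. ennreal (sato_tate_density x))"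
begin

abbreviation P :: "real \<Rightarrow> nat set" where "P y \<equiv> {p. prime p \<and> real p \<le> y}"

definition logL :: "real \<Rightarrow> 'a \<Rightarrow> real" where
  "logL y \<omega> = (\<Sum>p\<in>P y. prime_log p (\<theta> p \<omega>))"

lemma theta_measurable [measurable]: "prime p \<Longrightarrow> \<theta> p \<in> borel_measurable M"
  using dist[of p] by (simp add: distributed_def)

lemma prime_log_measurable [measurable]: "prime p \<Longrightarrow> prime_log p \<in> borel_measurable borel"
  using prime_angle.W_measurable[OF prime_angleI, of p] by simp

lemma L_eq: "L \<theta> y \<omega> = exp (logL y \<omega>)"
proof -
  have "L \<theta> y \<omega> = (\<Prod>p\<in>P y. exp (prime_log p (\<theta> p \<omega>)))"
    unfolding L_def by (rule prod.cong) (auto simp: prime_angle.D_eq[OF prime_angleI])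
  thus ?thesis by (simp add: exp_sum logL_def)
qed

definition bnd :: "real \<Rightarrow> real" where "bnd y = (\<Sum>p\<in>P y. \<bar>prime_angle.x0 p\<bar> + 8)"

lemma bounded_rv_logL: "bounded_rv M (logL y) (bnd y)"
proof
  show "logL y \<in> borel_measurable M" unfolding logL_def[abs_def]
  proof (rule borel_measurable_sum)
    fix p assume "p \<in> P y"
    thus "(\<lambda>\<omega>. prime_log p (\<theta> p \<omega>)) \<in> borel_measurable M"
      by (intro measurable_compose[OF theta_measurable prime_log_measurable]) auto
  qed
  fix \<omega>
  have "\<bar>logL y \<omega>\<bar> \<le> (\<Sum>p\<in>P y. \<bar>prime_log p (\<theta> p \<omega>)\<bar>)" unfolding logL_def by (rule sum_abs)
  also have "\<dots> \<le> bnd y" unfolding bnd_def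
  proof (rule sum_mono)
    fix p assume "p \<in> P y"
    hence "prime p" by simp
    thus "\<bar>prime_log p (\<theta> p \<omega>)\<bar> \<le> \<bar>prime_angle.x0 p\<bar> + 8"
      using bounded_rv.X_bound[OF prime_bounded_rv, of p "\<theta> p \<omega>"] by simp
  qed
  finally show "\<bar>logL y \<omega>\<bar> \<le> bnd y" .
qed

end

sublocale st_model \<subseteq> g: bounded_rv M "logL y" "bnd y" for y
  by (rule bounded_rv_logL)

context st_model
begin

lemma integral_theta:
  fixes f :: "real \<Rightarrow> complex"
  assumes "prime p" "f \<in> borel_measurable borel"
  shows "(\<integral>\<omega>. f (\<theta> p \<omega>) \<partial>M) = (\<integral>x. f x \<partial>st_measure)"
proof -
  have "(\<integral>x. f x \<partial>distr M lborel (\<theta> p)) = (\<integral>\<omega>. f (\<theta> p \<omega>) \<partial>M)"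
    using assms by (intro integral_distr) auto
  thus ?thesis using distributed_distr_eq_density[OF dist[OF assms(1)]] by simp
qed

lemma emom_prod: "g.emom y 0 s = (\<Prod>p\<in>P y. prime_emom p s)"
proof -
  let ?f = "\<lambda>p x. exp (s * complex_of_real (prime_log p x))"
  have fm: "?f p \<in> borel_measurable borel" if "prime p" for p
    using prime_log_measurable[OF that] by measurable
  have ind: "indep_vars (\<lambda>_. borel) (\<lambda>p \<omega>. ?f p (\<theta> p \<omega>)) (P y)"
    by (rule indep_vars_compose2[OF indep_vars_subset[OF indep]]) (use fm in auto)
  have "g.emom y 0 s = (\<integral>\<omega>. (\<Prod>p\<in>P y. ?f p (\<theta> p \<omega>)) \<partial>M)"
    unfolding g.emom_def logL_def by (simp add: exp_sum sum_distrib_left)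
  also have "\<dots> = (\<Prod>p\<in>P y. \<integral>\<omega>. ?f p (\<theta> p \<omega>) \<partial>M)"
  proof (rule indep_vars_lebesgue_integral[OF finite_primes_le ind])
    fix p assume "p \<in> P y"
    hence p: "prime p" by simp
    interpret b: bounded_rv st_measure "prime_log p" "\<bar>prime_angle.x0 p\<bar> + 8" by (rule prime_bounded_rv[OF p])
    have bd: "norm (?f p x) \<le> exp (norm s * (\<bar>prime_angle.x0 p\<bar> + 8))" for x
      using b.norm_integrand_le[of x 0 s] by simp
    show "integrable M (\<lambda>\<omega>. ?f p (\<theta> p \<omega>))"
      using fm[OF p] theta_measurable[OF p] bd by (intro integrable_const_bound[where B = "exp (norm s * (\<bar>prime_angle.x0 p\<bar> + 8))"]) auto
  qed
  also have "\<dots> = (\<Prod>p\<in>P y. prime_emom p s)"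
  proof (rule prod.cong[OF refl])
    fix p assume "p \<in> P y"
    hence p: "prime p" by simp
    interpret b: bounded_rv st_measure "prime_log p" "\<bar>prime_angle.x0 p\<bar> + 8" by (rule prime_bounded_rv[OF p])
    show "(\<integral>\<omega>. ?f p (\<theta> p \<omega>) \<partial>M) = prime_emom p s"
      unfolding b.emom_def using integral_theta[OF p fm[OF p]] by simp
  qed
  finally show ?thesis .
qed

lemma rmom_prod: "g.rmom y 0 k = (\<Prod>p\<in>P y. prime_rmom p k)"
proof -
  have "complex_of_real (g.rmom y 0 k) = g.emom y 0 (of_real k)" by (rule g.emom_of_real[symmetric])
  also have "\<dots> = (\<Prod>p\<in>P y. complex_of_real (prime_rmom p k))"
    unfolding emom_prod by (rule prod.cong) (auto simp: bounded_rv.emom_of_real[OF prime_bounded_rv])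
  finally have "complex_of_real (g.rmom y 0 k) = complex_of_real (\<Prod>p\<in>P y. prime_rmom p k)"
    by (simp only: of_real_prod)
  thus ?thesis by (simp only: of_real_eq_iff)
qed

text \<open>Obtained by differentiating the logarithm of the product formula for \<open>rmom\<close>
  and using uniqueness of derivatives; the variance is treated likewise.\<close>

lemma tmean_sum: "g.tmean y k = (\<Sum>p\<in>P y. prime_mean p k)"
proof (rule DERIV_unique[OF g.ln_rmom_deriv])
  have "ln (g.rmom y 0 k) = (\<Sum>p\<in>P y. ln (prime_rmom p k))" for k
    unfolding rmom_prod using bounded_rv.rmom_0_pos[OF prime_bounded_rv, of _ k]
    by (intro ln_prod) (auto simp: less_imp_neq[symmetric])
  hence "(\<lambda>k. ln (g.rmom y 0 k)) = (\<lambda>k. \<Sum>p\<in>P y. ln (prime_rmom p k))" by auto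
  moreover have "((\<lambda>k. \<Sum>p\<in>P y. ln (prime_rmom p k)) has_real_derivative (\<Sum>p\<in>P y. prime_mean p k)) (at k)"
    by (rule DERIV_sum) (auto intro: bounded_rv.ln_rmom_deriv[OF prime_bounded_rv])
  ultimately show "((\<lambda>k. ln (g.rmom y 0 k)) has_real_derivative (\<Sum>p\<in>P y. prime_mean p k)) (at k)" by simp
qed

lemma tvar_sum: "g.tvar y k = (\<Sum>p\<in>P y. prime_var p k)"
proof (rule DERIV_unique[OF g.tmean_deriv])
  have "g.tmean y = (\<lambda>k. \<Sum>p\<in>P y. prime_mean p k)" by (rule ext) (rule tmean_sum)
  moreover have "((\<lambda>k. \<Sum>p\<in>P y. prime_mean p k) has_real_derivative (\<Sum>p\<in>P y. prime_var p k)) (at k)"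
    by (rule DERIV_sum) (auto intro: bounded_rv.tmean_deriv[OF prime_bounded_rv])
  ultimately show "(g.tmean y has_real_derivative (\<Sum>p\<in>P y. prime_var p k)) (at k)" by simp
qed

lemma tchar_prod: "g.tchar y k t = (\<Prod>p\<in>P y. prime_char p k t)"
proof -
  have "(\<Prod>p\<in>P y. prime_char p k t) = (\<Prod>p\<in>P y. prime_emom p (Complex k (k * t)) / of_real (prime_rmom p k) * exp (- (\<i> * of_real (k * t * prime_mean p k))))"
    by (rule prod.cong) (auto simp: bounded_rv.tchar_def[OF prime_bounded_rv])
  also have "\<dots> = g.emom y 0 (Complex k (k * t)) / of_real (g.rmom y 0 k) * exp (\<Sum>p\<in>P y. - (\<i> * of_real (k * t * prime_mean p k)))"
    unfolding emom_prod rmom_prod by (simp add: prod.distrib prod_dividef exp_sum)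
  also have "(\<Sum>p\<in>P y. - (\<i> * of_real (k * t * prime_mean p k))) = - (\<i> * of_real (k * t * g.tmean y k))"
    unfolding tmean_sum by (simp add: sum_negf sum_distrib_left)
  finally show ?thesis by (simp add: g.tchar_def)
qed

text \<open>The prime 2 always occurs because y >= 2. Its contribution has no atom and is
  independent of the rest, and Fubini passes this on to the sum.\<close>

lemma no_atom:
  assumes y: "y \<ge> 2"
  shows "AE \<omega> in M. logL y \<omega> \<noteq> c"
proof -
  let ?X = "\<lambda>p \<omega>. prime_log p (\<theta> p \<omega>)"
  define A where "A = P y - {2}"
  have two: "prime (2::nat)" by (rule two_is_prime_nat)
  have PA: "P y = insert 2 A" "2 \<notin> A" "finite A" using y two by (auto simp: A_def)
  define R where "R \<omega> = (\<Sum>p\<in>A. ?X p \<omega>)" for \<omega>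
  have lR: "logL y \<omega> = ?X 2 \<omega> + R \<omega>" for \<omega>
    unfolding logL_def PA(1) R_def using PA by simp
  have Pp: "prime p" if "p \<in> insert 2 A" for p using that PA(1) by auto
  have "indep_vars (\<lambda>_. borel) ?X (insert 2 A)"
    by (rule indep_vars_compose2[OF indep_vars_subset[OF indep]]) (use Pp prime_log_measurable in auto)
  from indep_vars_sum[OF PA(3,2) this]
  have ind: "indep_var borel (?X 2) borel R" unfolding R_def .
  have mX: "?X 2 \<in> borel_measurable M"
    by (rule measurable_compose[OF theta_measurable[OF two] prime_log_measurable[OF two]])
  have mR: "R \<in> borel_measurable M" using ind by (rule indep_var_rv2)
  interpret D1: prob_space "distr M borel (?X 2)" using mX by (rule prob_space_distr)
  interpret D2: prob_space "distr M borel R" using mR by (rule prob_space_distr)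
  interpret D: pair_prob_space "distr M borel (?X 2)" "distr M borel R" ..
  have single: "emeasure (distr M borel (?X 2)) {x} = 0" for x
  proof -
    have "AE z in distr M lborel (\<theta> 2). prime_log 2 z \<noteq> x"
      unfolding distributed_distr_eq_density[OF dist[OF two]] by (rule st_measure_no_atom[OF two])
    hence "AE \<omega> in M. ?X 2 \<omega> \<noteq> x"
      using theta_measurable[OF two] prime_log_measurable[OF two] by (subst (asm) AE_distr_iff) auto
    hence "emeasure M {\<omega> \<in> space M. ?X 2 \<omega> = x} = 0"
      using mX by (subst (asm) AE_iff_measurable[OF _ refl]) auto
    moreover have "?X 2 -` {x} \<inter> space M = {\<omega> \<in> space M. ?X 2 \<omega> = x}" by auto
    ultimately show ?thesis using mX by (simp add: emeasure_distr)
  qed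
  let ?S = "{z :: real \<times> real. fst z + snd z = c}"
  have S: "?S \<in> sets (borel \<Otimes>\<^sub>M borel)"
  proof -
    have "{z \<in> space (borel \<Otimes>\<^sub>M borel). fst z + snd z = (c::real)} \<in> sets (borel \<Otimes>\<^sub>M borel)" by measurable
    thus ?thesis by (simp add: space_pair_measure)
  qed
  have "emeasure M {\<omega> \<in> space M. logL y \<omega> = c} = emeasure (distr M (borel \<Otimes>\<^sub>M borel) (\<lambda>\<omega>. (?X 2 \<omega>, R \<omega>))) ?S"
    using mX mR S by (subst emeasure_distr) (auto simp: lR intro!: arg_cong[of _ _ "emeasure M"])
  also have "distr M (borel \<Otimes>\<^sub>M borel) (\<lambda>\<omega>. (?X 2 \<omega>, R \<omega>)) = distr M borel (?X 2) \<Otimes>\<^sub>M distr M borel R"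
    using ind by (simp add: indep_var_distribution_eq)
  also have "emeasure (distr M borel (?X 2) \<Otimes>\<^sub>M distr M borel R) ?S
      = (\<integral>\<^sup>+b. emeasure (distr M borel (?X 2)) ((\<lambda>a. (a, b)) -` ?S) \<partial>distr M borel R)"
    using S by (intro D.emeasure_pair_measure_alt2) (simp add: sets_pair_measure_cong[OF sets_distr sets_distr])
  also have "\<dots> = (\<integral>\<^sup>+b. 0 \<partial>distr M borel R)"
  proof (rule nn_integral_cong)
    fix b
    have "(\<lambda>a. (a, b)) -` ?S = {c - b}" by auto
    thus "emeasure (distr M borel (?X 2)) ((\<lambda>a. (a, b)) -` ?S) = 0" using single by simp
  qed
  finally have "emeasure M {\<omega> \<in> space M. logL y \<omega> = c} = 0" by simp
  thus ?thesis by (subst AE_iff_measurable[OF _ refl]) auto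
qed

lemma AE_tilt: "AE \<omega> in M. Q \<omega> \<Longrightarrow> AE \<omega> in g.tilt y k. Q \<omega>"
  unfolding g.tilt_def by (subst AE_density) auto

lemma tlaw_no_atom:
  assumes y: "y \<ge> 2" and k: "k > 0"
  shows "measure (g.tlaw y k) {x} = 0"
proof -
  interpret T: prob_space "g.tilt y k" by (rule g.prob_space_tilt)
  have "AE \<omega> in g.tilt y k. logL y \<omega> \<noteq> x / k + g.tmean y k" by (intro AE_tilt no_atom y)
  hence "AE \<omega> in g.tilt y k. k * (logL y \<omega> - g.tmean y k) \<noteq> x"
    by eventually_elim (use k in \<open>auto simp: field_simps\<close>)
  hence "measure (g.tilt y k) {\<omega> \<in> space M. k * (logL y \<omega> - g.tmean y k) = x} = 0"
    by (subst T.prob_eq_0) auto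
  moreover have "(\<lambda>\<omega>. k * (logL y \<omega> - g.tmean y k)) -` {x} \<inter> space (g.tilt y k) = {\<omega> \<in> space M. k * (logL y \<omega> - g.tmean y k) = x}" by auto
  ultimately show ?thesis unfolding g.tlaw_def by (subst measure_distr) auto
qed

text \<open>A vanishing variance would make log L almost surely equal to its mean, an atom. Strict
  positivity gives the uniqueness of kappa.\<close>

lemma tvar_pos: assumes y: "y \<ge> 2" shows "g.tvar y k > 0"
proof (rule ccontr)
  assume "\<not> g.tvar y k > 0"
  hence z: "g.tvar y k = 0" using g.tvar_nonneg[of y k] by linarith
  interpret T: prob_space "g.tilt y k" by (rule g.prob_space_tilt)
  have i: "integrable (g.tilt y k) (\<lambda>\<omega>. (logL y \<omega> - g.tmean y k)\<^sup>2)"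
  proof (rule g.integrable_tilt_bounded[where C = "(bnd y + \<bar>g.tmean y k\<bar>)\<^sup>2"])
    fix \<omega> assume "\<omega> \<in> space M"
    hence "\<bar>logL y \<omega> - g.tmean y k\<bar> \<le> bnd y + \<bar>g.tmean y k\<bar>" using g.X_bound[of \<omega> y] by linarith
    from power_mono[OF this, of 2] show "norm ((logL y \<omega> - g.tmean y k)\<^sup>2) \<le> (bnd y + \<bar>g.tmean y k\<bar>)\<^sup>2" by simp
  qed simp
  have "AE \<omega> in g.tilt y k. (logL y \<omega> - g.tmean y k)\<^sup>2 = 0"
    using integral_nonneg_eq_0_iff_AE[OF i] z unfolding g.tvar_eq by simp
  moreover have "AE \<omega> in g.tilt y k. logL y \<omega> \<noteq> g.tmean y k" by (intro AE_tilt no_atom y)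
  ultimately have "AE \<omega> in g.tilt y k. False" by eventually_elim simp
  thus False using T.AE_False by simp
qed

lemma tmean_strict: "y \<ge> 2 \<Longrightarrow> k < l \<Longrightarrow> g.tmean y k < g.tmean y l"
  by (rule DERIV_pos_imp_increasing) (use g.tmean_deriv tvar_pos in blast)+

end

section \<open>The local limit theorem applied to the tilted law of log L\<close>

text \<open>Primes above k contribute no more than the primes below k do: k^2 times the square tail
  is O(k / log k), and Chebyshev's bound makes that O of the number of primes up to k. If k >= y
  there is no tail.\<close>

lemma prime_tail_le:
  "\<exists>K>0. \<forall>k\<ge>2. \<forall>y. (\<Sum>p | prime p \<and> real p \<le> y \<and> k < real p. (k / real p)\<^sup>2)
       \<le> K * real (card {p. prime p \<and> real p \<le> min k y})"
proof -
  obtain C where C: "C > 0" and C': "\<forall>s\<ge>2. \<forall>A. finite A \<longrightarrow> A \<subseteq> {p::nat. prime p \<and> real p > s} \<longrightarrow>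
     (\<Sum>p\<in>A. 1 / (real p)\<^sup>2) \<le> C / (s * ln s)" using prime_sq_tail by (elim exE conjE) (rule that)
  obtain c where c: "c > 0" and c': "\<forall>x\<ge>2. real (card {p::nat. prime p \<and> real p \<le> x}) \<ge> c * x / ln x"
    using prime_count_lower by (elim exE conjE) (rule that)
  have "(\<Sum>p | prime p \<and> real p \<le> y \<and> k < real p. (k / real p)\<^sup>2)
       \<le> (C / c) * real (card {p. prime p \<and> real p \<le> min k y})" if k: "k \<ge> 2" for k y
  proof (cases "k < y")
    case True
    let ?A = "{p::nat. prime p \<and> real p \<le> y \<and> k < real p}"
    have fin: "finite ?A" by (rule finite_subset[OF _ finite_primes_le[of y]]) auto
    have "(\<Sum>p\<in>?A. (k / real p)\<^sup>2) = k\<^sup>2 * (\<Sum>p\<in>?A. 1 / (real p)\<^sup>2)"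
      by (simp add: sum_distrib_left power_divide)
    also have "\<dots> \<le> k\<^sup>2 * (C / (k * ln k))" using k fin by (intro mult_left_mono C'[rule_format]) auto
    also have "\<dots> = (C / c) * (c * k / ln k)" using k c by (simp add: power2_eq_square)
    also have "\<dots> \<le> (C / c) * real (card {p::nat. prime p \<and> real p \<le> k})"
      using k C c c'[rule_format, of k] by (intro mult_left_mono) auto
    also have "{p::nat. prime p \<and> real p \<le> k} = {p. prime p \<and> real p \<le> min k y}" using True by auto
    finally show ?thesis .
  next
    case False
    hence E: "{p::nat. prime p \<and> real p \<le> y \<and> k < real p} = {}" by auto
    show ?thesis unfolding E using C c by simp
  qed
  thus ?thesis using C c by (intro exI[of _ "C / c"]) auto
qed

context st_model
begin

lemma saddle_error:
  "\<exists>K>0. \<forall>k\<ge>2. \<forall>y\<ge>2. \<bar>sqrt (2 * pi * (k\<^sup>2 * g.tvar y k)) * (\<integral>x. exp (- x) * indicator {0..} x \<partial>g.tlaw y k) - 1\<bar>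
      \<le> K / real (card {p::nat. prime p \<and> real p \<le> min k y})"
proof -
  obtain K where K: "K > 0" "\<And>k y. k \<ge> 2 \<Longrightarrow> (\<Sum>p | prime p \<and> real p \<le> y \<and> k < real p. (k / real p)\<^sup>2)
       \<le> K * real (card {p::nat. prime p \<and> real p \<le> min k y})" using prime_tail_le by blast
  \<comment> \<open>These constants do not mention the prime, although they come from the locale of
    one prime; this is the uniformity in p. The instance at 2 also supplies the distinguished factor
    \<open>i0\<close>.\<close>
  let ?Q = "prime_angle.Q4" and ?c = "prime_angle.cdec"
  interpret A: prime_angle 2 by unfold_locales simp
  define G where "G = A.gauss_const ?Q"
  define B1 where "B1 = ?Q + 65536 * K"
  define B where "B = G * B1"
  define \<rho> where "\<rho> = max 0 (1 - ?c)"
  have Q1: "?Q \<ge> 1" by (simp add: A.Q4_def)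
  have G1: "G \<ge> 1" unfolding G_def A.gauss_const_def using Q1 by simp
  have B1: "B1 \<ge> 1" using Q1 K(1) by (simp add: B1_def)
  have B1B: "B1 \<le> B" unfolding B_def using G1 B1 mult_right_mono[of 1 G B1] by simp
  have c0: "?c > 0" by (rule A.cdec_pos)
  have \<rho>: "0 \<le> \<rho>" "\<rho> < 1" using c0 by (auto simp: \<rho>_def)
  have "\<exists>R. \<forall>m::nat. real m * sqrt (real m) * \<rho> ^ (m - 1) \<le> R"
  proof (cases "\<rho> = 0")
    case True
    \<comment> \<open>For \<open>\<rho>\<close> = 0 only m = 1 survives, by
      \<open>0 ^ 0 = 1\<close>.\<close>
    have "real m * sqrt (real m) * \<rho> ^ (m - 1) \<le> 1" for m :: nat
    proof (cases "m \<le> 1")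
      case False
      thus ?thesis using True by (simp add: power_0_left)
    qed (use True in \<open>auto simp: le_Suc_eq\<close>)
    thus ?thesis by blast
  next
    case False
    hence r0: "\<rho> > 0" using \<rho> by simp
    have "(\<lambda>m. real (Suc m) * sqrt (real (Suc m)) * \<rho> ^ m) \<longlonglongrightarrow> 0" using r0 \<rho> by real_asymp
    hence "Bseq (\<lambda>m. real (Suc m) * sqrt (real (Suc m)) * \<rho> ^ m)" using convergent_def convergent_imp_Bseq by blast
    then obtain R where R: "R > 0" "\<And>m. norm (real (Suc m) * sqrt (real (Suc m)) * \<rho> ^ m) \<le> R" by (auto elim!: BseqE)
    have "real m * sqrt (real m) * \<rho> ^ (m - 1) \<le> R" for m :: nat
      using R(1) R(2)[of "m - 1"] by (cases m) (auto intro: order_trans[OF abs_ge_self])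
    thus ?thesis by blast
  qed
  then obtain R where R: "\<And>m::nat. real m * sqrt (real m) * \<rho> ^ (m - 1) \<le> R" by blast
  \<comment> \<open>Here delta = 1, and 37 is 296 / a for p = 2, where a = 8.\<close>
  define KK where "KK = saddle_const ?c 1 B 37 R"
  have main: "\<bar>sqrt (2 * pi * (k\<^sup>2 * g.tvar y k)) * (\<integral>x. exp (- x) * indicator {0..} x \<partial>g.tlaw y k) - 1\<bar>
      \<le> KK / real (card {p::nat. prime p \<and> real p \<le> min k y})" if k: "k \<ge> 2" and y: "y \<ge> 2" for k y
  proof -
    let ?S = "{p::nat. prime p \<and> real p \<le> min k y}"
    define n where "n = real (card ?S)"
    have SP: "?S \<subseteq> P y" by auto
    define Tl where "Tl = (\<Sum>p | prime p \<and> real p \<le> y \<and> k < real p. (k / real p)\<^sup>2)"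
    have Tn: "Tl \<le> K * n" unfolding Tl_def n_def by (rule K(2)[OF k])
    have PA: "prime_angle p" if "p \<in> P y" for p using that by (auto intro: prime_angleI)
    have k0: "k \<ge> 0" "k \<ge> 1" using k by auto
    \<comment> \<open>Primes up to k are counted with the uniform bound; larger ones with 65536 =
      16^4 times (k/p)^2, which the tail estimate turns into a multiple of n.\<close>
    have sum_bound: "(\<Sum>p\<in>P y. F p) \<le> B1 * n"
      if F: "\<And>p. p \<in> P y \<Longrightarrow> F p \<le> ?Q" "\<And>p. p \<in> P y \<Longrightarrow> k < real p \<Longrightarrow> F p \<le> 65536 * (k / real p)\<^sup>2" for F :: "nat \<Rightarrow> real"
    proof -
      have "P y = ?S \<union> {p. prime p \<and> real p \<le> y \<and> k < real p}" by auto
      hence "(\<Sum>p\<in>P y. F p) = (\<Sum>p\<in>?S \<union> {p. prime p \<and> real p \<le> y \<and> k < real p}. F p)" by simp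
      also have "\<dots> = (\<Sum>p\<in>?S. F p) + (\<Sum>p | prime p \<and> real p \<le> y \<and> k < real p. F p)"
        by (rule sum.union_disjoint) (auto intro: finite_subset[OF _ finite_primes_le[of y]])
      also have "(\<Sum>p\<in>?S. F p) \<le> (\<Sum>p\<in>?S. ?Q)" using F(1) by (intro sum_mono) auto
      also have "(\<Sum>p\<in>?S. ?Q) = ?Q * n" by (simp add: n_def)
      also have "(\<Sum>p | prime p \<and> real p \<le> y \<and> k < real p. F p) \<le> (\<Sum>p | prime p \<and> real p \<le> y \<and> k < real p. 65536 * (k / real p)\<^sup>2)"
        using F(2) by (intro sum_mono) auto
      also have "\<dots> = 65536 * Tl" unfolding Tl_def by (rule sum_distrib_left[symmetric])
      also have "\<dots> \<le> 65536 * (K * n)" using Tn by simp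
      finally show ?thesis by (simp add: B1_def algebra_simps)
    qed
    have m4: "(\<Sum>p\<in>P y. prime_mom4 p k) \<le> B1 * n"
    proof (rule sum_bound)
      fix p assume p: "p \<in> P y"
      show "prime_mom4 p k \<le> ?Q" by (rule prime_angle.tmom4_le[OF PA[OF p] k0(1)])
      assume kp: "k < real p"
      have q: "0 \<le> k / real p" "k / real p \<le> 1" using kp k by auto
      have "prime_mom4 p k \<le> (16 * k / real p) ^ 4" by (rule prime_angle.tmom4_small[OF PA[OF p] k0(1)])
      also have "\<dots> = 65536 * (k / real p) ^ 4" by (simp add: power_mult_distrib power_divide)
      also have "(k / real p) ^ 4 \<le> (k / real p)\<^sup>2" using q by (intro power_decreasing) auto
      finally show "prime_mom4 p k \<le> 65536 * (k / real p)\<^sup>2" by simp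
    qed
    have v2: "(\<Sum>p\<in>P y. k\<^sup>2 * prime_var p k) \<le> B1 * n"
    proof (rule sum_bound)
      fix p assume p: "p \<in> P y"
      show "k\<^sup>2 * prime_var p k \<le> ?Q" by (rule prime_angle.var_le[OF PA[OF p] k0(1)])
      have "k\<^sup>2 * prime_var p k \<le> k\<^sup>2 * (16 / real p)\<^sup>2" using prime_angle.tvar_small[OF PA[OF p]] by (intro mult_left_mono) auto
      also have "\<dots> = 256 * (k / real p)\<^sup>2" by (simp add: power_divide)
      also have "\<dots> \<le> 65536 * (k / real p)\<^sup>2" by (intro mult_right_mono) auto
      finally show "k\<^sup>2 * prime_var p k \<le> 65536 * (k / real p)\<^sup>2" .
    qed
    have n0: "n \<ge> 0" by (simp add: n_def)
    have BB: "B1 * n \<le> B * n" using B1B n0 by (intro mult_right_mono)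
    have brv: "bounded_rv st_measure (prime_log p) (\<bar>prime_angle.x0 p\<bar> + 8)" if "p \<in> P y" for p
      using that by (auto intro: prime_bounded_rv)
    have "\<bar>sqrt (2 * pi * (\<Sum>p\<in>P y. k\<^sup>2 * prime_var p k)) * (\<integral>x. exp (- x) * indicator {0..} x \<partial>g.tlaw y k) - 1\<bar>
      \<le> saddle_const ?c 1 B 37 R / real (card ?S)"
    proof (rule local_limit_exp[where f = "\<lambda>p. prime_char p k" and ?i0.0 = 2 and b = "\<lambda>p. G * prime_mom4 p k" and \<mu> = "\<lambda>p. prime_mom3 p k" and \<rho> = \<rho>])
      show "real_distribution (g.tlaw y k)" by (rule g.real_distribution_tlaw)
      show "measure (g.tlaw y k) {x} = 0" for x using k y by (intro tlaw_no_atom) auto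
      show "finite (P y)" by simp
      show "?S \<subseteq> P y" by (rule SP)
      show "2 \<in> ?S" using k y by (simp add: two_is_prime_nat)
      show "char (g.tlaw y k) t = (\<Prod>p\<in>P y. prime_char p k t)" for t unfolding g.char_tlaw by (rule tchar_prod)
      show "norm (prime_char p k t) \<le> 1" if "p \<in> P y" for p t by (rule bounded_rv.norm_tchar_le_1[OF brv[OF that]])
      show "norm (prime_char p k t - exp (Complex (- (k\<^sup>2 * prime_var p k) * t\<^sup>2 / 2) (- prime_mom3 p k * t ^ 3 / 6))) \<le> G * prime_mom4 p k * t ^ 4"
        if "p \<in> P y" "\<bar>t\<bar> \<le> 1" for p t
        unfolding G_def by (rule bounded_rv.tchar_gauss_approx[OF brv[OF that(1)] prime_angle.tmom4_le[OF PA[OF that(1)] k0(1)] that(2)])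
      show "norm (prime_char p k t) \<le> exp (- ?c * t\<^sup>2)" if "p \<in> ?S" "\<bar>t\<bar> \<le> 1" for p t
        using that SP by (intro prime_angle.tchar_decay(1)[OF PA k0(2)]) auto
      show "2 * ?c \<le> k\<^sup>2 * prime_var p k" if "p \<in> ?S" for p
        using that SP by (intro prime_angle.var_ge[OF PA k0(2)]) auto
      show "0 \<le> k\<^sup>2 * prime_var p k" if "p \<in> P y" for p using bounded_rv.tvar_nonneg[OF brv[OF that], of k] by simp
      show "norm (prime_char p k t) \<le> \<rho>" if "p \<in> ?S - {2}" "\<bar>t\<bar> \<ge> 1" for p t
        unfolding \<rho>_def using that SP by (intro prime_angle.tchar_decay(2)[OF PA k0(2)]) auto
      show "norm (prime_char 2 k t) \<le> 37 / \<bar>t\<bar>" if "t \<noteq> 0" for t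
        using A.tchar_norm_parts[OF k0(2) that] by (simp add: A.a_def power2_eq_square)
      have "(\<Sum>p\<in>P y. G * prime_mom4 p k) = G * (\<Sum>p\<in>P y. prime_mom4 p k)" by (rule sum_distrib_left[symmetric])
      also have "\<dots> \<le> G * (B1 * n)" using m4 G1 by (intro mult_left_mono) auto
      finally show "(\<Sum>p\<in>P y. G * prime_mom4 p k) \<le> B * real (card ?S)" by (simp add: B_def n_def)
      show "(\<Sum>p\<in>P y. k\<^sup>2 * prime_var p k) \<le> B * real (card ?S)" using v2 BB by (simp add: n_def)
      have "\<bar>\<Sum>p\<in>P y. prime_mom3 p k\<bar> \<le> (\<Sum>p\<in>P y. \<bar>prime_mom3 p k\<bar>)" by (rule sum_abs)
      also have "\<dots> \<le> (\<Sum>p\<in>P y. (k\<^sup>2 * prime_var p k + prime_mom4 p k) / 2)"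
        by (intro sum_mono bounded_rv.tilt_moments(4)[OF brv])
      also have "\<dots> = ((\<Sum>p\<in>P y. k\<^sup>2 * prime_var p k) + (\<Sum>p\<in>P y. prime_mom4 p k)) / 2"
        by (simp add: sum.distrib sum_divide_distrib[symmetric])
      also have "\<dots> \<le> B * n"
      proof -
        have "(a + b) / 2 \<le> d" if "a \<le> e" "b \<le> e" "e \<le> d" for a b d e :: real using that by argo
        from this[OF v2 m4 BB] show ?thesis .
      qed
      finally show "\<bar>\<Sum>p\<in>P y. prime_mom3 p k\<bar> \<le> B * real (card ?S)" by (simp add: n_def)
    qed (use c0 \<rho> R in auto)
    moreover have "(\<Sum>p\<in>P y. k\<^sup>2 * prime_var p k) = k\<^sup>2 * g.tvar y k" unfolding tvar_sum by (rule sum_distrib_left[symmetric])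
    ultimately show ?thesis unfolding KK_def by (simp only:)
  qed
  have "\<bar>sqrt (2 * pi * (k\<^sup>2 * g.tvar y k)) * (\<integral>x. exp (- x) * indicator {0..} x \<partial>g.tlaw y k) - 1\<bar>
      \<le> (\<bar>KK\<bar> + 1) / real (card {p::nat. prime p \<and> real p \<le> min k y})" if "k \<ge> 2" "y \<ge> 2" for k y
    using main[OF that] by (rule order_trans) (auto intro: divide_right_mono)
  thus ?thesis by (intro exI[of _ "\<bar>KK\<bar> + 1"]) auto
qed

lemma tlaw_integral_bounds: "0 \<le> (\<integral>x. exp (- x) * indicator {0..} x \<partial>g.tlaw y k)" "(\<integral>x. exp (- x) * indicator {0..} x \<partial>g.tlaw y k) \<le> 1"
proof -
  interpret R: real_distribution "g.tlaw y k" by (rule g.real_distribution_tlaw)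
  show "0 \<le> (\<integral>x. exp (- x) * indicator {0..} x \<partial>g.tlaw y k)" by (rule Bochner_Integration.integral_nonneg) auto
  have b: "norm (exp (- x) * indicator {0..} x) \<le> 1" for x :: real by (auto simp: indicator_def)
  have "(\<integral>x. exp (- x) * indicator {0..} x \<partial>g.tlaw y k) \<le> (\<integral>x. 1 \<partial>g.tlaw y k)"
  proof (rule integral_mono)
    show "integrable (g.tlaw y k) (\<lambda>x. exp (- x) * indicator {0..} x)"
      by (rule R.integrable_const_bound[where B = 1]) (use b in auto)
    fix x :: real show "exp (- x) * indicator {0..} x \<le> (1::real)" using b[of x] by simp
  qed simp
  thus "(\<integral>x. exp (- x) * indicator {0..} x \<partial>g.tlaw y k) \<le> 1" using R.prob_space by simp
qed

text \<open>For k < 2 no prime need lie below k, and only boundedness is available. This suffices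
  because such k occur only for bounded t. The 768 is 4 * 192, with 192 = 256 * 3/4 a bound for the
  variance.\<close>

lemma saddle_error_small:
  assumes k: "0 < k" "k < 2"
  shows "\<bar>sqrt (2 * pi * (k\<^sup>2 * g.tvar y k)) * (\<integral>x. exp (- x) * indicator {0..} x \<partial>g.tlaw y k) - 1\<bar> \<le> 1 + sqrt (2 * pi * 768)"
proof -
  let ?I = "\<integral>x. exp (- x) * indicator {0..} x \<partial>g.tlaw y k"
  have "g.tvar y k \<le> (\<Sum>p\<in>P y. (16 / real p)\<^sup>2)"
    unfolding tvar_sum by (intro sum_mono prime_angle.tvar_small prime_angleI) auto
  also have "\<dots> = 256 * (\<Sum>p\<in>P y. 1 / (real p)\<^sup>2)" by (simp add: sum_distrib_left power_divide)
  also have "\<dots> \<le> 256 * (3 / 4)" by (intro mult_left_mono sum_inverse_prime_sq_le) auto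
  finally have v: "g.tvar y k \<le> 192" by simp
  have "k\<^sup>2 \<le> 2\<^sup>2" using k by (intro power_mono) auto
  hence "k\<^sup>2 * g.tvar y k \<le> 4 * 192" using v g.tvar_nonneg[of y k] by (intro mult_mono) auto
  hence "sqrt (2 * pi * (k\<^sup>2 * g.tvar y k)) \<le> sqrt (2 * pi * 768)" by (intro real_sqrt_le_mono mult_left_mono) auto
  moreover have "0 \<le> sqrt (2 * pi * (k\<^sup>2 * g.tvar y k))" using g.tvar_nonneg[of y k] by simp
  ultimately have "sqrt (2 * pi * (k\<^sup>2 * g.tvar y k)) * ?I \<le> sqrt (2 * pi * 768) * 1"
    using tlaw_integral_bounds[of y k] by (intro mult_mono) auto
  moreover have "0 \<le> sqrt (2 * pi * (k\<^sup>2 * g.tvar y k)) * ?I"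
    using tlaw_integral_bounds(1)[of y k] g.tvar_nonneg[of y k] by (intro mult_nonneg_nonneg) auto
  ultimately show ?thesis by linarith
qed

end



section \<open>The saddle point: existence, size and the final expansion\<close>

lemma two_ln_add_euler_gt:
  fixes t :: real
  assumes "t \<ge> 1"
  shows "2 * (ln t + euler_mascheroni) > (9 / 8 :: real)"
proof -
  have "2 * (a + b) > 9 / 8" if "a \<ge> 0" "19 / 33 < b" for a b :: real using that by argo
  from this[OF ln_ge_zero[OF assms] euler_mascheroni_gt_19_over_33] show ?thesis .
qed

context prime_angle
begin

text \<open>The derivative of the tilted mean is the tilted variance, at most (16/p)^2. For p > k
  this makes the mean O(k / p^2), much better than the trivial bound \<open>x0\<close>.\<close>

lemma tmean_growth:
  assumes k: "k \<ge> 0"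
  shows "tmean k \<le> tmean 0 + k * (16 / real p)\<^sup>2"
proof -
  have "0 * (16 / real p)\<^sup>2 - tmean 0 \<le> k * (16 / real p)\<^sup>2 - tmean k"
  proof (rule DERIV_nonneg_imp_nondecreasing[OF k])
    fix l
    have "((\<lambda>l. l * (16 / real p)\<^sup>2 - tmean l) has_real_derivative 1 * (16 / real p)\<^sup>2 - tvar l) (at l)"
      by (intro DERIV_diff DERIV_cmult_right DERIV_ident tmean_deriv)
    thus "\<exists>d. ((\<lambda>l. l * (16 / real p)\<^sup>2 - tmean l) has_real_derivative d) (at l) \<and> 0 \<le> d"
      using tvar_small[of l] by (intro exI[of _ "1 * (16 / real p)\<^sup>2 - tvar l"]) simp
  qed
  thus ?thesis by simp
qed

lemma tmean_growth': "k \<ge> 0 \<Longrightarrow> tmean k \<le> (3 / 2 + 256 * k) * (1 / (real p)\<^sup>2)"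
  using tmean_growth[of k] tmean_0_le by (simp add: power_divide algebra_simps)

lemma x0_nonneg: "x0 \<ge> 0"
  using p_inv by (simp add: x0_def)

lemma h_power: "h 1 \<le> 27 ^ j * h (2 ^ j)"
proof (induction j)
  case (Suc j)
  have "h (2 ^ j) \<le> 27 * h (2 ^ Suc j)" using h_half[of "2 ^ Suc j"] by simp
  hence "27 ^ j * h (2 ^ j) \<le> 27 ^ j * (27 * h (2 ^ Suc j))" by (intro mult_left_mono) auto
  from order_trans[OF Suc.IH this] show ?case by (simp only: power_Suc mult_ac)
qed simp

text \<open>Doubling the exponent costs a factor 27 in \<open>h\<close>. Along s = 2^j the loss
  against the extreme value s \<open>x0\<close> is therefore linear in j, that is, logarithmic in
  s.\<close>

lemma ln_rmom_power_ge: "ln (rmom 0 (2 ^ j)) \<ge> 2 ^ j * x0 + (ln (2 / pi) + ln (h 1)) - real j * ln 27"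
proof -
  have "ln (h 1) \<le> ln (27 ^ j * h (2 ^ j))" using h_power[of j] h_pos by (subst ln_le_cancel_iff) auto
  also have "\<dots> = real j * ln 27 + ln (h (2 ^ j))" using h_pos[of "2 ^ j"] by (simp add: ln_mult ln_realpow)
  finally have 1: "ln (h 1) \<le> real j * ln 27 + ln (h (2 ^ j))" .
  have "(0::real) < 2 / pi" by simp
  hence "rmom 0 (2 ^ j) = exp (2 ^ j * x0 + ln (2 / pi) + ln (h (2 ^ j)))"
    unfolding rmom_0_eq by (simp only: exp_add exp_ln[OF h_pos] exp_ln)
  hence "ln (rmom 0 (2 ^ j)) = 2 ^ j * x0 + ln (2 / pi) + ln (h (2 ^ j))" by (simp only: ln_exp)
  thus ?thesis using 1 by linarith
qed

end

context st_model
begin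

lemma E_eq: "E M \<theta> s y = g.emom y 0 s"
proof -
  have "complex_of_real (L \<theta> y \<omega>) powr s = exp (s * of_real (logL y \<omega>))" for \<omega>
    unfolding L_eq powr_def using Ln_of_real[of "exp (logL y \<omega>)"] by simp
  thus ?thesis by (simp add: E_def g.emom_def)
qed

lemma phi_deriv_1: "phi_deriv 1 M \<theta> (of_real \<sigma>) y = of_real (g.tmean y \<sigma>)"
  unfolding phi_deriv_def phi_def E_eq using g.deriv_Ln_emom(1)[of y \<sigma>] by simp

lemma phi_deriv_2: "phi_deriv 2 M \<theta> (of_real \<sigma>) y = of_real (g.tvar y \<sigma>)"
  unfolding phi_deriv_def phi_def E_eq by (rule g.deriv_Ln_emom(2))

lemma kappa_eq:
  assumes y: "y \<ge> 2" and \<sigma>: "\<sigma> > 0" "g.tmean y \<sigma> = 2 * (ln t + euler_mascheroni)"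
  shows "kappa M \<theta> t y = \<sigma>"
  unfolding kappa_def phi_deriv_1 of_real_eq_iff
proof (rule the_equality)
  fix s assume s: "s > 0 \<and> g.tmean y s = 2 * (ln t + euler_mascheroni)"
  thus "s = \<sigma>" using tmean_strict[OF y, of s \<sigma>] tmean_strict[OF y, of \<sigma> s] \<sigma>
    by (cases s \<sigma> rule: linorder_cases) auto
qed (use \<sigma> in simp)

lemma Phi_eq:
  assumes t: "t > 0"
  shows "Phi M \<theta> t y = measure M {\<omega> \<in> space M. logL y \<omega> \<ge> 2 * (ln t + euler_mascheroni)}"
proof -
  have "exp euler_mascheroni * t = exp (ln t + euler_mascheroni)" using t by (simp add: exp_add)
  hence "(exp euler_mascheroni * t)\<^sup>2 = exp (2 * (ln t + euler_mascheroni))" by (simp only: exp_double)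
  thus ?thesis unfolding Phi_def L_eq by simp
qed

abbreviation saddle_int :: "real \<Rightarrow> real \<Rightarrow> real" where
  "saddle_int y k \<equiv> (\<integral>x. exp (- x) * indicator {0..} x \<partial>g.tlaw y k)"
abbreviation saddle_rel :: "real \<Rightarrow> real \<Rightarrow> real" where
  "saddle_rel y k \<equiv> sqrt (2 * pi * (k\<^sup>2 * g.tvar y k)) * saddle_int y k - 1"

text \<open>An exact identity: \<open>saddle_rel\<close> is by definition the relative error, and
  all estimates concern it alone.\<close>

lemma saddle_expansion:
  assumes y: "y \<ge> 2" and k: "k > 0" and t: "t > 0"
    and m: "g.tmean y k = 2 * (ln t + euler_mascheroni)"
  shows "complex_of_real (Phi M \<theta> t y) =
    E M \<theta> (of_real k) y / (of_real k * csqrt (2 * of_real pi * phi_deriv 2 M \<theta> (of_real k) y)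
      * of_real ((exp euler_mascheroni * t) powr (2 * k))) * (1 + of_real (saddle_rel y k))"
proof -
  define v where "v = g.tvar y k"
  define R where "R = g.rmom y 0 k"
  define s where "s = sqrt (2 * pi * v)"
  define I where "I = saddle_int y k"
  have v: "v > 0" unfolding v_def by (rule tvar_pos[OF y])
  have s: "s > 0" unfolding s_def using v by simp
  have cs: "csqrt (2 * of_real pi * phi_deriv 2 M \<theta> (of_real k) y) = of_real s"
  proof -
    have "of_real s = csqrt (of_real (2 * pi * v))" unfolding s_def by (rule of_real_sqrt) (use v in simp)
    thus ?thesis unfolding phi_deriv_2 v_def[symmetric] by (simp only: of_real_mult of_real_numeral)
  qed
  have "2 * pi * (k\<^sup>2 * v) = k\<^sup>2 * (2 * pi * v)" by simp
  hence "sqrt (2 * pi * (k\<^sup>2 * v)) = sqrt (k\<^sup>2 * (2 * pi * v))" by simp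
  also have "\<dots> = sqrt (k\<^sup>2) * s" unfolding s_def by (rule real_sqrt_mult)
  also have "sqrt (k\<^sup>2) = k" using k by simp
  finally have ks: "1 + saddle_rel y k = k * s * I" by (simp add: v_def I_def)
  have pw: "(exp euler_mascheroni * t) powr (2 * k) = exp (k * g.tmean y k)"
    unfolding m using t by (simp add: powr_def ln_mult algebra_simps)
  have "Phi M \<theta> t y = R * exp (- k * g.tmean y k) * I"
    unfolding Phi_eq[OF t] m[symmetric] R_def I_def by (rule g.tail_prob_eq[OF k])
  also have "\<dots> = R / (k * s * exp (k * g.tmean y k)) * (k * s * I)"
    using k s by (simp add: exp_minus field_simps)
  finally have "complex_of_real (Phi M \<theta> t y) = of_real (R / (k * s * exp (k * g.tmean y k)) * (1 + saddle_rel y k))"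
    unfolding ks by (rule arg_cong)
  thus ?thesis unfolding cs pw E_eq g.emom_of_real R_def by (simp only: of_real_mult of_real_divide of_real_add of_real_1)
qed

lemma tmean_le_small:
  assumes k: "k \<ge> 0"
  shows "g.tmean y k \<le> (3 / 2 + 256 * k) * (3 / 4)"
proof -
  have "g.tmean y k \<le> (\<Sum>p\<in>P y. (3 / 2 + 256 * k) * (1 / (real p)\<^sup>2))"
    unfolding tmean_sum by (intro sum_mono prime_angle.tmean_growth'[OF prime_angleI k]) simp
  also have "\<dots> = (3 / 2 + 256 * k) * (\<Sum>p\<in>P y. 1 / (real p)\<^sup>2)" by (rule sum_distrib_left[symmetric])
  also have "\<dots> \<le> (3 / 2 + 256 * k) * (3 / 4)" using k by (intro mult_left_mono sum_inverse_prime_sq_le) auto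
  finally show ?thesis .
qed

text \<open>The mean starts at 0 with a value at most 9/8 < A. If it never equals A it stays at or
  below A by continuity, and integrating it from 0 bounds the logarithm of the moment generating
  function.\<close>

lemma rmom_le_no_saddle:
  assumes A: "A > 9 / 8" and no: "\<not> (\<exists>\<sigma>>0. g.tmean y \<sigma> = A)" and s: "s \<ge> 0"
  shows "ln (g.rmom y 0 s) \<le> A * s"
proof -
  have m0: "g.tmean y 0 \<le> 9 / 8" using tmean_le_small[of 0 y] by simp
  have cont: "continuous_on S (g.tmean y)" for S
    by (rule DERIV_continuous_on[OF DERIV_subset[OF g.tmean_deriv subset_UNIV]])
  have le: "g.tmean y \<sigma> \<le> A" if "\<sigma> \<ge> 0" for \<sigma>
  proof (rule ccontr)
    assume "\<not> g.tmean y \<sigma> \<le> A"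
    hence "\<exists>x\<ge>0. x \<le> \<sigma> \<and> g.tmean y x = A" using m0 A that by (intro IVT' cont) auto
    then obtain x where x: "x \<ge> 0" "g.tmean y x = A" by blast
    hence "x \<noteq> 0" using m0 A by auto
    thus False using x no by auto
  qed
  have "A * 0 - ln (g.rmom y 0 0) \<le> A * s - ln (g.rmom y 0 s)"
  proof (rule DERIV_nonneg_imp_nondecreasing[OF s])
    fix l :: real assume l: "0 \<le> l"
    have "((\<lambda>l. A * l - ln (g.rmom y 0 l)) has_real_derivative A * 1 - g.tmean y l) (at l)"
      by (intro DERIV_diff DERIV_cmult DERIV_ident g.ln_rmom_deriv)
    thus "\<exists>d. ((\<lambda>l. A * l - ln (g.rmom y 0 l)) has_real_derivative d) (at l) \<and> 0 \<le> d"
      using le[OF l] by (intro exI[of _ "A * 1 - g.tmean y l"]) simp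
  qed
  moreover have "g.rmom y 0 0 = 1" by (simp add: g.rmom_def prob_space)
  ultimately show ?thesis by simp
qed

text \<open>Chernoff's bound with exponent s gives e^(-eps s) for the threshold A + eps, and s may
  tend to infinity. This excludes values above A; the value A itself is excluded because log L has
  no atoms.\<close>

lemma no_saddle_Phi:
  assumes y: "y \<ge> 2" and A: "A > 9 / 8" and no: "\<not> (\<exists>\<sigma>>0. g.tmean y \<sigma> = A)"
  shows "measure M {\<omega> \<in> space M. logL y \<omega> \<ge> A} = 0"
proof -
  have tail: "measure M {\<omega> \<in> space M. logL y \<omega> \<ge> A + \<epsilon>} = 0" if \<epsilon>: "\<epsilon> > 0" for \<epsilon>
  proof -
    have bd: "measure M {\<omega> \<in> space M. logL y \<omega> \<ge> A + \<epsilon>} \<le> exp (- (\<epsilon> * s))" if s: "s \<ge> 0" for s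
    proof -
      have i: "integrable M (\<lambda>\<omega>. exp (s * logL y \<omega>))" using g.integrable_rmom[of y 0 s] by simp
      have "measure M {\<omega> \<in> space M. logL y \<omega> \<ge> A + \<epsilon>} = (\<integral>\<omega>. indicator {\<omega> \<in> space M. logL y \<omega> \<ge> A + \<epsilon>} \<omega> \<partial>M)"
        by simp
      also have "\<dots> \<le> (\<integral>\<omega>. exp (s * logL y \<omega>) * exp (- (s * (A + \<epsilon>))) \<partial>M)"
      proof (rule integral_mono)
        show "integrable M (\<lambda>\<omega>. indicator {\<omega> \<in> space M. logL y \<omega> \<ge> A + \<epsilon>} \<omega> :: real)"
          by (rule integrable_real_indicator) (auto simp: emeasure_eq_measure)
        show "integrable M (\<lambda>\<omega>. exp (s * logL y \<omega>) * exp (- (s * (A + \<epsilon>))))" by (rule integrable_mult_left[OF i])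
        fix \<omega> assume "\<omega> \<in> space M"
        have "s * (A + \<epsilon>) \<le> s * logL y \<omega>" if "logL y \<omega> \<ge> A + \<epsilon>" using that s by (rule mult_left_mono)
        thus "indicator {\<omega> \<in> space M. logL y \<omega> \<ge> A + \<epsilon>} \<omega> \<le> exp (s * logL y \<omega>) * exp (- (s * (A + \<epsilon>)))"
          by (simp add: exp_add[symmetric] indicator_def)
      qed
      also have "\<dots> = g.rmom y 0 s * exp (- (s * (A + \<epsilon>)))" by (simp add: g.rmom_def)
      also have "g.rmom y 0 s \<le> exp (A * s)"
      proof -
        have "exp (ln (g.rmom y 0 s)) \<le> exp (A * s)" unfolding exp_le_cancel_iff by (rule rmom_le_no_saddle[OF A no s])
        thus ?thesis using g.rmom_0_pos[of y s] by simp
      qed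
      hence "g.rmom y 0 s * exp (- (s * (A + \<epsilon>))) \<le> exp (A * s) * exp (- (s * (A + \<epsilon>)))" by (rule mult_right_mono) simp
      also have "\<dots> = exp (- (\<epsilon> * s))" by (simp add: exp_add[symmetric] algebra_simps)
      finally show ?thesis .
    qed
    have "((\<lambda>s::real. exp (- (\<epsilon> * s))) \<longlongrightarrow> 0) at_top" using \<epsilon> by real_asymp
    moreover have "eventually (\<lambda>s::real. measure M {\<omega> \<in> space M. logL y \<omega> \<ge> A + \<epsilon>} \<le> exp (- (\<epsilon> * s))) at_top"
      using eventually_ge_at_top[of 0] by eventually_elim (rule bd)
    ultimately have "measure M {\<omega> \<in> space M. logL y \<omega> \<ge> A + \<epsilon>} \<le> 0"
      by (intro tendsto_lowerbound) auto
    thus ?thesis using measure_nonneg[of M "{\<omega> \<in> space M. logL y \<omega> \<ge> A + \<epsilon>}"] by linarith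
  qed
  have "AE \<omega> in M. logL y \<omega> < A + 1 / real (Suc n)" for n
  proof -
    have ev: "{\<omega> \<in> space M. logL y \<omega> \<ge> A + 1 / real (Suc n)} \<in> events" by measurable
    have "(0::real) < 1 / real (Suc n)" by simp
    from tail[OF this] have "AE \<omega> in M. \<omega> \<notin> {\<omega> \<in> space M. logL y \<omega> \<ge> A + 1 / real (Suc n)}"
      by (simp only: prob_eq_0[OF ev])
    with AE_space show ?thesis by eventually_elim (simp add: not_le)
  qed
  hence a1: "AE \<omega> in M. \<forall>n. logL y \<omega> < A + 1 / real (Suc n)" by (simp only: AE_all_countable) blast
  have a2: "AE \<omega> in M. logL y \<omega> \<noteq> A" by (rule no_atom[OF y])
  have r: "\<not> A \<le> x" if x: "\<forall>n. x < A + 1 / real (Suc n)" "x \<noteq> A" for x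
  proof
    assume "A \<le> x"
    hence "x - A > 0" using x(2) by simp
    then obtain n where "inverse (real (Suc n)) < x - A" using reals_Archimedean by blast
    thus False using x(1)[rule_format, of n] by (simp add: inverse_eq_divide)
  qed
  have "AE \<omega> in M. \<not> A \<le> logL y \<omega>" using a1 a2 by eventually_elim (rule r)
  thus ?thesis by (subst prob_eq_0) auto
qed

text \<open>If there were no saddle point, log E(s) <= A s would hold for all s >= 0. Along s = 2^j
  however log E(s) is at least s Q - O(j), where Q is the supremum of log L, and
  \<open>mertens_lower\<close> with y >= 2 e^t makes Q strictly larger than A.\<close>

lemma saddle_exists:
  "\<exists>T. \<forall>t\<ge>T. \<forall>y\<ge>2 * exp t. \<exists>\<sigma>>0. g.tmean y \<sigma> = 2 * (ln t + euler_mascheroni)"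
proof -
  obtain X0 where X0: "\<forall>x\<ge>X0. (\<Sum>p | prime p \<and> real p \<le> x. - ln (1 - 1 / real p)) > ln (ln x - ln 2) + euler_mascheroni"
    using mertens_lower by (elim exE) (rule that)
  have "\<exists>\<sigma>>0. g.tmean y \<sigma> = 2 * (ln t + euler_mascheroni)" if t: "t \<ge> max 1 X0" and y: "y \<ge> 2 * exp t" for t y
  proof (rule ccontr)
    define A where "A = 2 * (ln t + euler_mascheroni)"
    assume "\<not> ?thesis"
    hence no: "\<not> (\<exists>\<sigma>>0. g.tmean y \<sigma> = A)" unfolding A_def .
    have t1: "t \<ge> 1" using t by simp
    have A: "A > 9 / 8" unfolding A_def by (rule two_ln_add_euler_gt[OF t1])
    have y0: "y > 0" using y exp_gt_zero[of t] by linarith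
    have "y \<ge> X0" using t y exp_ge_add_one_self[of t] t1 by linarith
    hence m: "(\<Sum>p\<in>P y. - ln (1 - 1 / real p)) > ln (ln y - ln 2) + euler_mascheroni" using X0 by blast
    have "ln (2 * exp t) \<le> ln y" using y y0 by (subst ln_le_cancel_iff) auto
    hence "t \<le> ln y - ln 2" by (simp add: ln_mult)
    hence lt: "ln t \<le> ln (ln y - ln 2)" using t1 by (subst ln_le_cancel_iff) auto
    define Q where "Q = (\<Sum>p\<in>P y. prime_angle.x0 p)"
    have "Q = (\<Sum>p\<in>P y. 2 * - ln (1 - 1 / real p))" unfolding Q_def
      by (rule sum.cong) (auto simp: prime_angle.x0_def[OF prime_angleI])
    also have "\<dots> = 2 * (\<Sum>p\<in>P y. - ln (1 - 1 / real p))" by (rule sum_distrib_left[symmetric])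
    finally have Q: "Q = 2 * (\<Sum>p\<in>P y. - ln (1 - 1 / real p))" .
    have "q - 2 * (b + c) > 0" if "a + c < S" "b \<le> a" "q = 2 * S" for a b c q S :: real using that by argo
    from this[OF m lt Q] have QA: "Q - A > 0" by (simp only: A_def)
    define c where "c = (\<Sum>p\<in>P y. ln (2 / pi) + ln (prime_angle.h p 1))"
    define n where "n = real (card (P y)) * ln 27"
    have "2 ^ j * (Q - A) - real j * n + c \<le> 0" for j :: nat
    proof -
      have "2 ^ j * Q + c - real j * n = (\<Sum>p\<in>P y. 2 ^ j * prime_angle.x0 p + (ln (2 / pi) + ln (prime_angle.h p 1)) - real j * ln 27)"
        by (simp add: Q_def c_def n_def sum.distrib sum_subtractf sum_distrib_left)
      also have "\<dots> \<le> (\<Sum>p\<in>P y. ln (prime_rmom p (2 ^ j)))"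
        by (intro sum_mono prime_angle.ln_rmom_power_ge prime_angleI) simp
      also have "\<dots> = ln (\<Prod>p\<in>P y. prime_rmom p (2 ^ j))"
        using bounded_rv.rmom_0_pos[OF prime_bounded_rv, of _ "2 ^ j"]
        by (intro ln_prod[symmetric]) (auto simp: less_imp_neq[symmetric])
      also have "\<dots> \<le> A * 2 ^ j" unfolding rmom_prod[symmetric] by (rule rmom_le_no_saddle[OF A no]) simp
      finally show ?thesis by (simp add: algebra_simps)
    qed
    moreover have "filterlim (\<lambda>j::nat. 2 ^ j * (Q - A) - real j * n + c) at_top at_top"
    proof -
      define d where "d = Q - A"
      have "d > 0" using QA by (simp add: d_def)
      hence "filterlim (\<lambda>j::nat. 2 ^ j * d - real j * n + c) at_top at_top" by real_asymp
      thus ?thesis by (simp only: d_def)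
    qed
    hence "eventually (\<lambda>j::nat. 2 ^ j * (Q - A) - real j * n + c > 0) at_top" by (simp add: filterlim_at_top_dense)
    then obtain j :: nat where "2 ^ j * (Q - A) - real j * n + c > 0" by (meson eventually_happens' sequentially_bot)
    ultimately show False by (simp add: not_less[symmetric])
  qed
  thus ?thesis by (intro exI[of _ "max 1 X0"]) blast
qed

text \<open>Bound the mean from above: primes up to k give at most the Mertens sum up to k, and
  primes beyond k give O(1 / log k) by the square tail. Hence log t <= log log k + O(1 / log k),
  which means log k >= t - O(1).\<close>

lemma saddle_large:
  "\<exists>T. \<exists>c\<ge>0. \<forall>t\<ge>T. \<forall>y k. k > 0 \<longrightarrow> g.tmean y k = 2 * (ln t + euler_mascheroni) \<longrightarrow> k \<ge> 2 \<and> ln k \<ge> t - c"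
proof -
  obtain C1 where C1: "C1 > 0" and C1': "\<forall>x\<ge>2. (\<Sum>p | prime p \<and> real p \<le> x. - ln (1 - 1 / real p)) \<le> ln (ln x) + euler_mascheroni + C1 / ln x"
    using mertens_upper by (elim exE conjE) (rule that)
  obtain C2 where C2: "C2 > 0" and C2': "\<forall>s\<ge>2. \<forall>A. finite A \<longrightarrow> A \<subseteq> {p::nat. prime p \<and> real p > s} \<longrightarrow>
     (\<Sum>p\<in>A. 1 / (real p)\<^sup>2) \<le> C2 / (s * ln s)" using prime_sq_tail by (elim exE conjE) (rule that)
  define C3 where "C3 = C1 + 129 * C2"
  define c where "c = C3 * exp (C3 / ln 2)"
  have C3: "C3 > 0" using C1 C2 by (simp add: C3_def)
  \<comment> \<open>The threshold e^193 rules out k < 2, for which the mean is below (3/2 +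
    512)(3/4) < 386, while 2 log t >= 386.\<close>
  have main: "k \<ge> 2 \<and> ln k \<ge> t - c" if t: "t \<ge> exp 193" and k: "k > 0" and m: "g.tmean y k = 2 * (ln t + euler_mascheroni)" for t y k
  proof
    have t0: "t > 0" using t exp_gt_zero[of "193::real"] by linarith
    have lt: "ln t \<ge> 193" using t t0 by (simp add: ln_ge_iff)
    show k2: "k \<ge> 2"
    proof (rule ccontr)
      assume "\<not> k \<ge> 2"
      hence k': "k < 2" by simp
      have "False" if "a \<ge> 193" "19 / 33 < b" "x = 2 * (a + b)" "x \<le> (3 / 2 + 256 * k) * (3 / 4)" for a b x :: real
        using that k' by argo
      from this[OF lt euler_mascheroni_gt_19_over_33 m tmean_le_small] show False using k by simp
    qed
    define u where "u = ln k"
    have u: "u \<ge> ln 2" unfolding u_def using k2 by (subst ln_le_cancel_iff) auto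
    have u0: "u > 0" using u ln_gt_zero[of "2::real"] by linarith
    let ?S = "{p. prime p \<and> real p \<le> y \<and> real p \<le> k}" and ?B = "{p. prime p \<and> real p \<le> y \<and> k < real p}"
    have fin: "finite ?S" "finite ?B" by (rule finite_subset[OF _ finite_primes_le[of y]]; auto)+
    have "g.tmean y k = (\<Sum>p\<in>?S \<union> ?B. prime_mean p k)" unfolding tmean_sum by (rule sum.cong) auto
    also have "\<dots> = (\<Sum>p\<in>?S. prime_mean p k) + (\<Sum>p\<in>?B. prime_mean p k)" by (rule sum.union_disjoint[OF fin]) auto
    finally have split: "g.tmean y k = (\<Sum>p\<in>?S. prime_mean p k) + (\<Sum>p\<in>?B. prime_mean p k)" .
    have "(\<Sum>p\<in>?S. prime_mean p k) \<le> (\<Sum>p\<in>?S. prime_angle.x0 p)"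
      by (intro sum_mono prime_angle.tmean_le prime_angleI) simp
    also have "\<dots> \<le> (\<Sum>p\<in>P k. prime_angle.x0 p)"
      by (intro sum_mono2 finite_primes_le) (auto intro: prime_angle.x0_nonneg prime_angleI)
    also have "\<dots> = (\<Sum>p\<in>P k. 2 * - ln (1 - 1 / real p))"
      by (rule sum.cong) (auto simp: prime_angle.x0_def[OF prime_angleI])
    also have "\<dots> = 2 * (\<Sum>p\<in>P k. - ln (1 - 1 / real p))" by (rule sum_distrib_left[symmetric])
    also have "\<dots> \<le> 2 * (ln u + euler_mascheroni + C1 / u)"
      unfolding u_def using C1'[rule_format, OF k2] by (intro mult_left_mono) auto
    finally have s1: "(\<Sum>p\<in>?S. prime_mean p k) \<le> 2 * (ln u + euler_mascheroni + C1 / u)" .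
    have "(\<Sum>p\<in>?B. prime_mean p k) \<le> (\<Sum>p\<in>?B. (3 / 2 + 256 * k) * (1 / (real p)\<^sup>2))"
      using k by (intro sum_mono prime_angle.tmean_growth' prime_angleI) auto
    also have "\<dots> = (3 / 2 + 256 * k) * (\<Sum>p\<in>?B. 1 / (real p)\<^sup>2)" by (rule sum_distrib_left[symmetric])
    \<comment> \<open>For k >= 2 the constant 3/2 is at most 2 k. Halving 258 gives the 129 in
      \<open>C3\<close>.\<close>
    also have "\<dots> \<le> (258 * k) * (C2 / (k * u))"
      unfolding u_def using k2 fin(2) by (intro mult_mono C2'[rule_format]) (auto intro!: sum_nonneg)
    also have "\<dots> = 258 * (C2 / u)" using k by simp
    finally have s2: "(\<Sum>p\<in>?B. prime_mean p k) \<le> 258 * (C2 / u)" .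
    have e: "C3 / u = C1 / u + 129 * (C2 / u)" by (simp add: C3_def add_divide_distrib)
    have "a \<le> b + f" if "2 * (a + g0) = x + z" "x \<le> 2 * (b + g0 + d)" "z \<le> 258 * e" "f = d + 129 * e"
      for a b d e f g0 x z :: real using that by argo
    from this[OF trans[OF m[symmetric] split] s1 s2 e] have "ln t \<le> ln u + C3 / u" .
    hence "exp (ln t) \<le> exp (ln u + C3 / u)" by simp
    hence tu: "t \<le> u * exp (C3 / u)" using t0 u0 by (simp add: exp_add)
    \<comment> \<open>With x = C3 / u it turns the factor e^(C3/u) into an additive error: u
      e^(C3/u) <= u + C3 e^(C3/u), which is u + O(1).\<close>
    have x: "exp x \<le> 1 + x * exp x" for x :: real
    proof -
      have "(1 - x) * exp x \<le> exp (- x) * exp x" using exp_ge_add_one_self[of "- x"] by (intro mult_right_mono) auto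
      thus ?thesis by (simp add: exp_minus algebra_simps)
    qed
    have "u * exp (C3 / u) \<le> u * (1 + C3 / u * exp (C3 / u))" using u0 x[of "C3 / u"] by (intro mult_left_mono) auto
    also have "\<dots> = u + C3 * exp (C3 / u)" using u0 by (simp add: field_simps)
    also have "C3 / u \<le> C3 / ln 2" using u u0 C3 by (intro divide_left_mono mult_pos_pos) auto
    hence "exp (C3 / u) \<le> exp (C3 / ln 2)" by (simp only: exp_le_cancel_iff)
    hence "u + C3 * exp (C3 / u) \<le> u + c" unfolding c_def using C3 by simp
    finally show "t - c \<le> ln k" using tu unfolding u_def by linarith
  qed
  have "c \<ge> 0" using C3 by (simp add: c_def)
  thus ?thesis by (intro exI[of _ "exp 193"] exI[of _ c] conjI[of "c \<ge> 0"] allI impI main)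
qed

text \<open>For k >= 2 the prime 2 makes the count at least 1. The requirement C >= 1 leaves room
  for the relative error -1 when no saddle point exists.\<close>

lemma saddle_error_bound:
  "\<exists>C\<ge>1. \<forall>k>0. \<forall>y\<ge>2. \<bar>saddle_rel y k\<bar> \<le> C"
proof -
  obtain K where K: "K > 0" and K': "\<forall>k\<ge>2. \<forall>y\<ge>2. \<bar>saddle_rel y k\<bar> \<le> K / real (card {p::nat. prime p \<and> real p \<le> min k y})"
    using saddle_error by (elim exE conjE) (rule that)
  have "\<bar>saddle_rel y k\<bar> \<le> K + (1 + sqrt (2 * pi * 768))" if k: "k > 0" and y: "y \<ge> 2" for k y
  proof (cases "k \<ge> 2")
    case True
    have "2 \<in> {p::nat. prime p \<and> real p \<le> min k y}" using True y by (simp add: two_is_prime_nat)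
    hence "card {p::nat. prime p \<and> real p \<le> min k y} > 0" using finite_primes_le[of "min k y"] by (subst card_gt_0_iff) blast
    hence c: "real (card {p::nat. prime p \<and> real p \<le> min k y}) \<ge> 1" by linarith
    have "\<bar>saddle_rel y k\<bar> \<le> K / real (card {p::nat. prime p \<and> real p \<le> min k y})" using K' True y by blast
    also have "\<dots> \<le> K / 1" using c K by (intro divide_left_mono) auto
    finally show ?thesis by (simp add: add_increasing2)
  next
    case False
    thus ?thesis using saddle_error_small[of k y] k K by simp
  qed
  thus ?thesis using K by (intro exI[of _ "K + (1 + sqrt (2 * pi * 768))"]) auto
qed

text \<open>Both k and y are at least z = e^(t - c), so at least of order z / log z >= z / t primes
  take part; this is where the error t / e^t arises.\<close>

lemma saddle_error_large:
  "\<exists>T. \<exists>C>0. \<forall>t\<ge>T. \<forall>y\<ge>2 * exp t. \<forall>k>0. g.tmean y k = 2 * (ln t + euler_mascheroni) \<longrightarrow> \<bar>saddle_rel y k\<bar> \<le> C * (t / exp t)"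
proof -
  obtain K where K: "K > 0" and K': "\<forall>k\<ge>2. \<forall>y\<ge>2. \<bar>saddle_rel y k\<bar> \<le> K / real (card {p::nat. prime p \<and> real p \<le> min k y})"
    using saddle_error by (elim exE conjE) (rule that)
  obtain T c where c: "c \<ge> 0" and T: "\<forall>t\<ge>T. \<forall>y k. k > 0 \<longrightarrow> g.tmean y k = 2 * (ln t + euler_mascheroni) \<longrightarrow> k \<ge> 2 \<and> ln k \<ge> t - c"
    using saddle_large by (elim exE conjE) (rule that)
  obtain b where b: "b > 0" and b': "\<forall>x\<ge>2. real (card {p::nat. prime p \<and> real p \<le> x}) \<ge> b * x / ln x"
    using prime_count_lower by (elim exE conjE) (rule that)
  have main: "\<bar>saddle_rel y k\<bar> \<le> K * exp c / b * (t / exp t)"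
    if t: "t \<ge> max T (c + 1)" and y: "y \<ge> 2 * exp t" and k: "k > 0" and m: "g.tmean y k = 2 * (ln t + euler_mascheroni)" for t y k
  proof -
    have k2: "k \<ge> 2" and lk: "ln k \<ge> t - c" using T k m t by auto
    define z where "z = exp (t - c)"
    have t1: "t \<ge> c + 1" using t by simp
    have z2: "z \<ge> 2" using exp_ge_add_one_self[of "t - c"] t1 unfolding z_def by linarith
    have y2: "y \<ge> 2" using y exp_ge_add_one_self[of t] t1 c by linarith
    have zk: "z \<le> k" using lk k unfolding z_def by (simp add: ln_ge_iff)
    have "z \<le> exp t" unfolding z_def using c by simp
    hence zy: "z \<le> y" using y exp_gt_zero[of t] by linarith
    have "{p::nat. prime p \<and> real p \<le> z} \<subseteq> {p. prime p \<and> real p \<le> min k y}" using zk zy by auto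
    hence "card {p::nat. prime p \<and> real p \<le> z} \<le> card {p::nat. prime p \<and> real p \<le> min k y}"
      by (rule card_mono[OF finite_primes_le])
    hence "real (card {p::nat. prime p \<and> real p \<le> min k y}) \<ge> b * z / ln z" using b'[rule_format, OF z2] by linarith
    moreover have "b * z / ln z \<ge> b * z / t"
      unfolding z_def ln_exp using t1 c b by (intro divide_left_mono) auto
    moreover have bz: "b * z / t > 0" using t1 c b z2 by simp
    ultimately have card: "real (card {p::nat. prime p \<and> real p \<le> min k y}) \<ge> b * z / t" by linarith
    have "\<bar>saddle_rel y k\<bar> \<le> K / real (card {p::nat. prime p \<and> real p \<le> min k y})" using K' k2 y2 by blast
    also have "\<dots> \<le> K / (b * z / t)" using card bz K by (intro divide_left_mono mult_pos_pos) auto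
    also have "\<dots> = K * exp c / b * (t / exp t)" unfolding z_def using b t1 c by (simp add: exp_diff)
    finally show ?thesis .
  qed
  have "K * exp c / b > 0" using K b by simp
  thus ?thesis by (intro exI[of _ "max T (c + 1)"] exI[of _ "K * exp c / b"] conjI allI impI main)
qed

lemma saddle_point_expansion:
  "\<exists>C>0. \<forall>t\<ge>1. \<forall>y\<ge>2 * exp t. \<exists>\<delta>::real. \<bar>\<delta>\<bar> \<le> C * (t / exp t) \<and>
     complex_of_real (Phi M \<theta> t y) =
       E M \<theta> (complex_of_real (kappa M \<theta> t y)) y /
         (complex_of_real (kappa M \<theta> t y) * csqrt (2 * complex_of_real pi * phi_deriv 2 M \<theta> (complex_of_real (kappa M \<theta> t y)) y)
           * complex_of_real ((exp euler_mascheroni * t) powr (2 * kappa M \<theta> t y)))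
       * (1 + complex_of_real \<delta>)"
proof -
  obtain C0 where C0: "C0 \<ge> 1" and C0': "\<forall>k>0. \<forall>y\<ge>2. \<bar>saddle_rel y k\<bar> \<le> C0"
    using saddle_error_bound by (elim exE conjE) (rule that)
  obtain T1 C1 where C1: "C1 > 0" and C1': "\<forall>t\<ge>T1. \<forall>y\<ge>2 * exp t. \<forall>k>0. g.tmean y k = 2 * (ln t + euler_mascheroni) \<longrightarrow> \<bar>saddle_rel y k\<bar> \<le> C1 * (t / exp t)"
    using saddle_error_large by (elim exE conjE) (rule that)
  obtain T2 where T2: "\<forall>t\<ge>T2. \<forall>y\<ge>2 * exp t. \<exists>\<sigma>>0. g.tmean y \<sigma> = 2 * (ln t + euler_mascheroni)"
    using saddle_exists by (elim exE) (rule that)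
  define T where "T = max T1 T2"
  \<comment> \<open>For 1 <= t < T one has t / e^t >= e^(-T), so the second summand turns a bounded
    error into an admissible one.\<close>
  define C where "C = C1 + C0 * exp T"
  have C: "C > 0" using C1 C0 by (simp add: C_def add_pos_pos)
  show ?thesis
  proof (rule exI[of _ C], intro conjI C allI impI)
    fix t y :: real assume t: "1 \<le> t" and y: "2 * exp t \<le> y"
    have t0: "t > 0" using t by simp
    have y2: "y \<ge> 2" using y exp_ge_add_one_self[of t] t by linarith
    have q: "t / exp t > 0" using t0 by simp
    have le1: "C1 * (t / exp t) \<le> C * (t / exp t)" unfolding C_def using q C0 by (intro mult_right_mono) auto
    have small: "C0 \<le> C * (t / exp t)" if "t < T"
    proof -
      have "1 \<le> exp T * (t / exp t)"
      proof -
        have "exp t * 1 \<le> exp T * t" using that t by (intro mult_mono) auto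
        thus ?thesis by (simp add: field_simps)
      qed
      hence "C0 * 1 \<le> C0 * (exp T * (t / exp t))" using C0 by (intro mult_left_mono) auto
      also have "\<dots> \<le> C * (t / exp t)" 
      proof -
        have "C * (t / exp t) = C1 * (t / exp t) + C0 * (exp T * (t / exp t))" by (simp add: C_def algebra_simps add_divide_distrib)
        moreover have "C1 * (t / exp t) \<ge> 0" by (rule mult_nonneg_nonneg[OF less_imp_le[OF C1] less_imp_le[OF q]])
        ultimately show ?thesis by linarith
      qed
      finally show ?thesis by simp
    qed
    have A: "2 * (ln t + euler_mascheroni) > (9 / 8 :: real)" by (rule two_ln_add_euler_gt[OF t])
    show "\<exists>\<delta>::real. \<bar>\<delta>\<bar> \<le> C * (t / exp t) \<and>
     complex_of_real (Phi M \<theta> t y) =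
       E M \<theta> (complex_of_real (kappa M \<theta> t y)) y /
         (complex_of_real (kappa M \<theta> t y) * csqrt (2 * complex_of_real pi * phi_deriv 2 M \<theta> (complex_of_real (kappa M \<theta> t y)) y)
           * complex_of_real ((exp euler_mascheroni * t) powr (2 * kappa M \<theta> t y)))
       * (1 + complex_of_real \<delta>)"
    proof (cases "\<exists>k>0. g.tmean y k = 2 * (ln t + euler_mascheroni)")
      case True
      then obtain k where k: "k > 0" "g.tmean y k = 2 * (ln t + euler_mascheroni)" by blast
      have "\<bar>saddle_rel y k\<bar> \<le> C * (t / exp t)"
      proof (cases "t < T")
        case True
        have "\<bar>saddle_rel y k\<bar> \<le> C0" using C0' k(1) y2 by blast
        thus ?thesis using small[OF True] by linarith
      next
        case False
        hence "t \<ge> T1" by (simp add: T_def)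
        hence "\<bar>saddle_rel y k\<bar> \<le> C1 * (t / exp t)" using C1' y k by blast
        thus ?thesis using le1 by linarith
      qed
      thus ?thesis unfolding kappa_eq[OF y2 k] using saddle_expansion[OF y2 k(1) t0 k(2)] by blast
    next
      case False
      have "\<not> t \<ge> T2" using T2 y False by blast
      hence "t < T" by (simp add: T_def)
      from order_trans[OF C0 small[OF this]] have "\<bar>- 1 :: real\<bar> \<le> C * (t / exp t)" by simp
      moreover have "Phi M \<theta> t y = 0" unfolding Phi_eq[OF t0] by (rule no_saddle_Phi[OF y2 A False])
      \<comment> \<open>Here \<open>kappa\<close> is a description without a referent, so nothing is
        known about the quotient; the factor 1 + (-1) = 0 makes the right side vanish
        regardless.\<close>
      ultimately show ?thesis by (intro exI[of _ "-1"]) simp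
    qed
  qed
qed

end

theorem theorem3:
  fixes M :: "'a measure" and \<theta> :: "nat \<Rightarrow> 'a \<Rightarrow> real"
  assumes "prob_space M"
    and "prob_space.indep_vars M (\<lambda>_. borel) \<theta> {p. prime p}"
    and "\<And>p. prime p \<Longrightarrow> distributed M lborel (\<theta> p) (\<lambda>x. ennreal (sato_tate_density x))"
  shows "\<exists>C>0. \<forall>t\<ge>1. \<forall>y\<ge>2 * exp t.
           let \<kappa> = kappa M \<theta> t y;
               \<sigma>\<^sub>2 = phi_deriv 2 M \<theta> (complex_of_real \<kappa>) y
           in \<exists>\<delta>::real. \<bar>\<delta>\<bar> \<le> C * (t / exp t) \<and>
                complex_of_real (Phi M \<theta> t y) =
                  E M \<theta> (complex_of_real \<kappa>) y /
                    (complex_of_real \<kappa> * csqrt (2 * complex_of_real pi * \<sigma>\<^sub>2)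
                      * complex_of_real ((exp euler_mascheroni * t) powr (2 * \<kappa>)))
                  * (1 + complex_of_real \<delta>)"
proof -
  interpret prob_space M by fact
  interpret st_model M \<theta> by unfold_locales fact+
  show ?thesis unfolding Let_def by (rule saddle_point_expansion)
qed


end
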